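(* Let $\alpha\in(0,1)$, $T>0$, $\rho>0$, and let $\Omega\subset\mathbb{R}^2$ be a bounded domain. For given $f\in V'$ and $u_0\in H$, there exists a unique weak solution $u$ to the fractional Stokes problem $$\left\{\begin{array}{ll} cD^\alpha_{0,t}u(x,t)-\rho\Delta u(x,t)+\nabla p(x)=f(x), & \text{in }\Omega\times(0,T),\\ \operatorname{div}u(x,t)=0, & \text{in }\Omega\times(0,T),\\ u(x,t)=0, & \text{on }\partial\Omega\times[0,T],\\ u(x,0)=u_0, & \text{in }\Omega. \end{array}\right.$$ Moreover, $u\in C([0,T];H)$.
   Context: $H:=\{u\in[L^2(\Omega)]^2:\operatorname{div}u=0\text{ in }\Omega\text{ and }u\cdot\nu=0\text{ on }\partial\Omega\}$ ($\nu$ the normal to $\partial\Omega$), a Hilbert space with the topology induced by $[L^2(\Omega)]^2$. $V:=\{u\in[H_0^1(\Omega)]^2:\operatorname{div}u=0\text{ in }\Omega\}$, a Hilbert space with inner product $(v_1,v_2)_V=(\nabla v_1,\nabla v_2)$ (the $L^2$ inner product of the gradients). $H$ is identified with its dual, giving dense continuous inclusions $V\subset H\equiv H'\subset V'$; $\langle\cdot,\cdot\rangle_{V',V}$ is the duality pairing. Fractional derivatives: for $\alpha\in(0,1)$, the Riemann-Liouville derivative at $0$ is $D_{0,t}^\alpha w(t)=\frac{d}{dt}\left\{\frac{1}{\Gamma(1-\alpha)}\int_0^t(t-s)^{-\alpha}w(s)\,ds\right\}$ (weak derivative), and the Caputo derivative is $cD_t^\alpha w(t)=cD_{0,t}^\alpha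 w(t)=D_{0,t}^\alpha[w(t)-w(0)]$, for a.e. $t$. Weak solution: for $f\in V'$ and $u_0\in H$, a weak solution of the problem is a function $u\in L^2(0,T;V)$ such that $cD_t^\alpha u\in L^2(0,T;V')$, $u(0)=u_0$, and, for every $v\in V$, $$cD_t^\alpha(u(t),v)_H+\rho(u(t),v)_V=\langle f,v\rangle_{V',V},\quad\text{for almost every }t\in[0,T].$$ *)

theory Defs
  imports "HOL-Analysis.Analysis"
begin

type_synonym pt = "real ^ 2"
type_synonym field = "pt \<Rightarrow> pt"

(* Elements of function spaces are represented by genuine functions; equality in the space is
   equality almost everywhere on the domain, and all norms below are seminorms on
   representatives. *)


subsection \<open>Test functions\<close>

primrec C_k :: "nat \<Rightarrow> ('a::euclidean_space \<Rightarrow> real) \<Rightarrow> bool" where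
  "C_k 0 f \<longleftrightarrow> continuous_on UNIV f"
| "C_k (Suc k) f \<longleftrightarrow>
     (\<forall>x. f differentiable (at x)) \<and> (\<forall>b\<in>Basis. C_k k (\<lambda>x. frechet_derivative f (at x) b))"

definition test_functions :: "'a::euclidean_space set \<Rightarrow> ('a \<Rightarrow> real) set" where
  "test_functions U =
     {\<phi>. (\<forall>k. C_k k \<phi>) \<and> compact (closure {x. \<phi> x \<noteq> 0}) \<and> closure {x. \<phi> x \<noteq> 0} \<subseteq> U}"

definition grad :: "(pt \<Rightarrow> real) \<Rightarrow> field" where
  "grad \<phi> x = (\<chi> i. frechet_derivative \<phi> (at x) (axis i 1))"


subsection \<open>Lebesgue and Sobolev spaces on a planar domain\<close>

definition L2 :: "pt set \<Rightarrow> (pt \<Rightarrow> 'b::euclidean_space) set" where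
  "L2 \<Omega> = {u. u \<in> borel_measurable (lebesgue_on \<Omega>) \<and>
              integrable (lebesgue_on \<Omega>) (\<lambda>x. (norm (u x))\<^sup>2)}"

definition L2_inner :: "pt set \<Rightarrow> (pt \<Rightarrow> 'b::euclidean_space) \<Rightarrow> (pt \<Rightarrow> 'b) \<Rightarrow> real" where
  "L2_inner \<Omega> u v = (\<integral>x. u x \<bullet> v x \<partial>lebesgue_on \<Omega>)"

definition L2_norm :: "pt set \<Rightarrow> (pt \<Rightarrow> 'b::euclidean_space) \<Rightarrow> real" where
  "L2_norm \<Omega> u = sqrt (L2_inner \<Omega> u u)"

definition is_weak_grad :: "pt set \<Rightarrow> (pt \<Rightarrow> real) \<Rightarrow> field \<Rightarrow> bool" where
  "is_weak_grad \<Omega> w g \<longleftrightarrow>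
     (\<forall>\<phi>\<in>test_functions \<Omega>. \<forall>i.
        (\<integral>x. w x * grad \<phi> x $ i \<partial>lebesgue_on \<Omega>) = - (\<integral>x. g x $ i * \<phi> x \<partial>lebesgue_on \<Omega>))"

definition H1 :: "pt set \<Rightarrow> (pt \<Rightarrow> real) set" where
  "H1 \<Omega> = {w \<in> L2 \<Omega>. \<exists>g \<in> L2 \<Omega>. is_weak_grad \<Omega> w g}"

(* Only meaningful on H1, where it is determined up to a null set. *)
definition weak_grad :: "pt set \<Rightarrow> (pt \<Rightarrow> real) \<Rightarrow> field" where
  "weak_grad \<Omega> w = (SOME g. g \<in> L2 \<Omega> \<and> is_weak_grad \<Omega> w g)"

(* Closure of the test functions in the norm of H1. *)
definition H1_0 :: "pt set \<Rightarrow> (pt \<Rightarrow> real) set" where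
  "H1_0 \<Omega> = {w \<in> H1 \<Omega>. \<exists>\<phi>. (\<forall>n. \<phi> n \<in> test_functions \<Omega>) \<and>
      (\<lambda>n::nat. L2_norm \<Omega> (\<lambda>x. \<phi> n x - w x)) \<longlonglongrightarrow> 0 \<and>
      (\<lambda>n. L2_norm \<Omega> (\<lambda>x. grad (\<phi> n) x - weak_grad \<Omega> w x)) \<longlonglongrightarrow> 0}"

definition has_weak_div :: "pt set \<Rightarrow> field \<Rightarrow> (pt \<Rightarrow> real) \<Rightarrow> bool" where
  "has_weak_div \<Omega> u d \<longleftrightarrow>
     (\<forall>\<phi>\<in>test_functions \<Omega>.
        (\<integral>x. u x \<bullet> grad \<phi> x \<partial>lebesgue_on \<Omega>) = - (\<integral>x. d x * \<phi> x \<partial>lebesgue_on \<Omega>))"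

(* The boundary of a general bounded domain carries no pointwise normal.  For u and div u in L2
   the normal trace is the functional
     w |-> integral over Omega of (u . grad w + (div u) w),  w in H1(Omega),
   which by Green's formula is the boundary integral of (u . nu) w in the smooth case. *)
definition zero_normal_trace :: "pt set \<Rightarrow> field \<Rightarrow> bool" where
  "zero_normal_trace \<Omega> u \<longleftrightarrow>
     (\<exists>d \<in> L2 \<Omega>. has_weak_div \<Omega> u d \<and>
        (\<forall>w \<in> H1 \<Omega>. (\<integral>x. u x \<bullet> weak_grad \<Omega> w x + d x * w x \<partial>lebesgue_on \<Omega>) = 0))"


subsection \<open>The spaces H, V and the dual of V\<close>

definition H_space :: "pt set \<Rightarrow> field set" where
  "H_space \<Omega> = {u \<in> L2 \<Omega>. has_weak_div \<Omega> u (\<lambda>x. 0) \<and> zero_normal_trace \<Omega> u}"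

definition V_space :: "pt set \<Rightarrow> field set" where
  "V_space \<Omega> = {u. (\<forall>i. (\<lambda>x. u x $ i) \<in> H1_0 \<Omega>) \<and> has_weak_div \<Omega> u (\<lambda>x. 0)}"

definition V_inner :: "pt set \<Rightarrow> field \<Rightarrow> field \<Rightarrow> real" where
  "V_inner \<Omega> u v =
     (\<Sum>i\<in>UNIV. L2_inner \<Omega> (weak_grad \<Omega> (\<lambda>x. u x $ i)) (weak_grad \<Omega> (\<lambda>x. v x $ i)))"

definition V_norm :: "pt set \<Rightarrow> field \<Rightarrow> real" where
  "V_norm \<Omega> u = sqrt (V_inner \<Omega> u u)"

(* The duality pairing of F with v is F v; only the values of F on V matter. *)
definition V_dual :: "pt set \<Rightarrow> (field \<Rightarrow> real) set" where
  "V_dual \<Omega> = {F.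
     (\<forall>v\<in>V_space \<Omega>. \<forall>w\<in>V_space \<Omega>. F (\<lambda>x. v x + w x) = F v + F w) \<and>
     (\<forall>v\<in>V_space \<Omega>. \<forall>c. F (\<lambda>x. c *\<^sub>R v x) = c * F v) \<and>
     (\<exists>C. \<forall>v\<in>V_space \<Omega>. \<bar>F v\<bar> \<le> C * V_norm \<Omega> v)}"

definition V_dual_norm :: "pt set \<Rightarrow> (field \<Rightarrow> real) \<Rightarrow> real" where
  "V_dual_norm \<Omega> F = (SUP v\<in>{v \<in> V_space \<Omega>. V_norm \<Omega> v \<le> 1}. \<bar>F v\<bar>)"

(* The inclusion of H in the dual of V, through the identification of H with its own dual, is
   L2_inner Omega :: field => (field => real). *)


subsection \<open>Functions of time with values in a seminormed space\<close>

(* A space is given by a carrier S and a seminorm N.  Membership is strong (Bochner)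
   measurability, i.e. almost everywhere approximation by simple functions, together with square
   integrability of the seminorm. *)
definition L2_time :: "real \<Rightarrow> 'b::minus set \<Rightarrow> ('b \<Rightarrow> real) \<Rightarrow> (real \<Rightarrow> 'b) set" where
  "L2_time T S N = {u.
     (AE t in lebesgue_on {0<..<T}. u t \<in> S) \<and>
     (\<exists>s. (\<forall>n::nat. simple_function (lebesgue_on {0<..<T}) (s n) \<and> (\<forall>t\<in>{0<..<T}. s n t \<in> S)) \<and>
          (AE t in lebesgue_on {0<..<T}. (\<lambda>n. N (s n t - u t)) \<longlonglongrightarrow> 0)) \<and>
     integrable (lebesgue_on {0<..<T}) (\<lambda>t. (N (u t))\<^sup>2)}"

definition C_time :: "real \<Rightarrow> 'b::minus set \<Rightarrow> ('b \<Rightarrow> real) \<Rightarrow> (real \<Rightarrow> 'b) set" where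
  "C_time T S N = {u. \<forall>t\<in>{0..T}. u t \<in> S \<and> ((\<lambda>s. N (u s - u t)) \<longlongrightarrow> 0) (at t within {0..T})}"

(* "w(0) = w0" for a class w of functions modulo null sets: some representative tends to w0. *)
definition has_initial_value ::
    "real \<Rightarrow> ('b::minus \<Rightarrow> real) \<Rightarrow> (real \<Rightarrow> 'b) \<Rightarrow> 'b \<Rightarrow> bool" where
  "has_initial_value T N w w0 \<longleftrightarrow>
     (\<exists>w'. (AE t in lebesgue_on {0<..<T}. w' t = w t) \<and>
           ((\<lambda>t. N (w' t - w0)) \<longlongrightarrow> 0) (at_right 0))"


subsection \<open>Fractional derivatives\<close>

definition has_weak_deriv :: "real \<Rightarrow> (real \<Rightarrow> real) \<Rightarrow> (real \<Rightarrow> real) \<Rightarrow> bool" where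
  "has_weak_deriv T h g \<longleftrightarrow>
     (\<forall>a b. 0 < a \<and> b < T \<longrightarrow>
        set_integrable lebesgue {a..b} h \<and> set_integrable lebesgue {a..b} g) \<and>
     (\<forall>\<phi>\<in>test_functions {0<..<T}.
        (LINT t:{0<..<T}|lebesgue. h t * deriv \<phi> t) = - (LINT t:{0<..<T}|lebesgue. g t * \<phi> t))"

definition has_RL_deriv :: "real \<Rightarrow> real \<Rightarrow> (real \<Rightarrow> real) \<Rightarrow> (real \<Rightarrow> real) \<Rightarrow> bool" where
  "has_RL_deriv \<alpha> T w g \<longleftrightarrow>
     set_integrable lebesgue {0<..<T} w \<and>
     has_weak_deriv T
       (\<lambda>t. 1 / Gamma (1 - \<alpha>) * (LINT s:{0<..<t}|lebesgue. (t - s) powr (- \<alpha>) * w s)) g"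

(* w0 is the initial value w(0). *)
definition has_Caputo_deriv ::
    "real \<Rightarrow> real \<Rightarrow> (real \<Rightarrow> real) \<Rightarrow> real \<Rightarrow> (real \<Rightarrow> real) \<Rightarrow> bool" where
  "has_Caputo_deriv \<alpha> T w w0 g \<longleftrightarrow>
     has_initial_value T abs w w0 \<and> has_RL_deriv \<alpha> T (\<lambda>t. w t - w0) g"

(* The Caputo derivative in the dual of V.  Integrals of V'-valued functions are determined by
   their values on the elements of V, since evaluation at v commutes with the Bochner integral. *)
definition has_Caputo_deriv_dual ::
    "pt set \<Rightarrow> real \<Rightarrow> real \<Rightarrow> (real \<Rightarrow> field \<Rightarrow> real) \<Rightarrow> (field \<Rightarrow> real) \<Rightarrow> (real \<Rightarrow> field \<Rightarrow> real) \<Rightarrow> bool"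
  where
  "has_Caputo_deriv_dual \<Omega> \<alpha> T W W0 G \<longleftrightarrow>
     has_initial_value T (V_dual_norm \<Omega>) W W0 \<and>
     (\<forall>v\<in>V_space \<Omega>. has_RL_deriv \<alpha> T (\<lambda>t. W t v - W0 v) (\<lambda>t. G t v))"


subsection \<open>Weak solutions of the fractional Stokes problem\<close>

(* A weak solution lies only in L2(0,T;V), so its initial value is taken in the sense of
   has_initial_value in the dual of V. *)
definition weak_solution ::
    "pt set \<Rightarrow> real \<Rightarrow> real \<Rightarrow> real \<Rightarrow> (field \<Rightarrow> real) \<Rightarrow> field \<Rightarrow> (real \<Rightarrow> field) \<Rightarrow> bool" where
  "weak_solution \<Omega> \<alpha> T \<rho> f u0 u \<longleftrightarrow>
     u \<in> L2_time T (V_space \<Omega>) (V_norm \<Omega>) \<and>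
     has_initial_value T (V_dual_norm \<Omega>) (\<lambda>t. L2_inner \<Omega> (u t)) (L2_inner \<Omega> u0) \<and>
     (\<exists>G \<in> L2_time T (V_dual \<Omega>) (V_dual_norm \<Omega>).
        has_Caputo_deriv_dual \<Omega> \<alpha> T (\<lambda>t. L2_inner \<Omega> (u t)) (L2_inner \<Omega> u0) G) \<and>
     (\<forall>v\<in>V_space \<Omega>. \<exists>g.
        has_Caputo_deriv \<alpha> T (\<lambda>t. L2_inner \<Omega> (u t) v) (L2_inner \<Omega> u0 v) g \<and>
        (AE t in lebesgue_on {0<..<T}. g t + \<rho> * V_inner \<Omega> (u t) v = f v))"

end

theory Submission
  imports Defs
begin

text \<open>Poincare's inequality makes \<open>V\<close>, with the inner product of the gradients, a Hilbert space embedded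
  in \<open>L\<^sup>2\<close>. The adjoint of the embedding defines a bounded positive operator \<open>B\<close>, formally the inverse
  of the Stokes operator, and everything is expressed through the functional calculus of \<open>B\<close>, for which
  Bernstein polynomials suffice; no compactness or eigenfunction expansion enters. By Riesz's theorem
  there is a stationary solution, and subtracting it reduces existence to \<open>f = 0\<close>. There
  the solution is the Mittag-Leffler function \<open>E\<^sub>\<alpha>(-\<rho> t\<^sup>\<alpha> / b)\<close> at \<open>b = B\<close>, applied to the projection
  of the initial value on the closure of \<open>V\<close>; positivity and decay of this function give the estimates.
  For uniqueness, the integrated equation for a difference of two solutions is tested with elements on which
  \<open>B\<close> is invertible: iterating it gives the bound \<open>c\<^sup>m t\<^sup>\<alpha>\<^sup>m / \<Gamma>(\<alpha> m + 1)\<close> for every \<open>m\<close>.\<close>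

subsection \<open>Classes of square integrable functions\<close>

text \<open>The equation is tested with elements of \<open>V\<close> only and sees \<open>u0\<close>
  only through its pairings with them; these are the pairings of the projection of \<open>u0\<close>
  on the closure of \<open>V\<close>, which is the initial value that a function of \<open>B\<close>
  can reach. At a spectral value \<open>b\<close> of \<open>B\<close> the Stokes operator acts as
  \<open>1 / b\<close>, unbounded near \<open>b = 0\<close>. Three scalar bounds on the relaxation
  function absorb this. It lies between 0 and 1, which controls the \<open>L\<^sup>2\<close> norm.
  It is at most a constant times \<open>b\<close> times \<open>t\<close> to the power
  \<open>-\<alpha>\<close>, so the square of the \<open>V\<close> norm is of that order in
  \<open>t\<close>, integrable because \<open>\<alpha> < 1\<close>. And \<open>b\<close> times its
  distance to 1 is of order \<open>t\<close> to the power \<open>\<alpha>\<close>, which yields the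
  initial value on the range of \<open>B\<close>. In uniqueness a solution is only square integrable
  in time with values in \<open>V\<close>. Its equation is therefore integrated first: the initial
  condition bounds the scalar functions near time 0, which fixes the constant of integration, and
  Abel inversion then turns the equation into a Volterra equation that can be iterated.\<close>

definition l2fun :: "(pt \<Rightarrow> 'b::euclidean_space) \<Rightarrow> bool" where
  "l2fun u \<longleftrightarrow> u \<in> borel_measurable lebesgue \<and> integrable lebesgue (\<lambda>x. (norm (u x))\<^sup>2)"

lemma l2fun_integrable_inner:
  assumes "l2fun u" "l2fun v"
  shows "integrable lebesgue (\<lambda>x. u x \<bullet> v x)"
proof (rule Bochner_Integration.integrable_bound[of _ "\<lambda>x. (norm (u x))\<^sup>2 + (norm (v x))\<^sup>2"])
  have "\<bar>u x \<bullet> v x\<bar> \<le> (norm (u x))\<^sup>2 + (norm (v x))\<^sup>2" for x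
  proof -
    have "\<bar>u x \<bullet> v x\<bar> \<le> norm (u x) * norm (v x)" by (rule Cauchy_Schwarz_ineq2)
    also have "\<dots> \<le> (norm (u x))\<^sup>2 + (norm (v x))\<^sup>2"
      using sum_squares_bound[of "norm (u x)" "norm (v x)"] mult_nonneg_nonneg[OF norm_ge_zero norm_ge_zero, of "u x" "v x"]
      by linarith
    finally show ?thesis .
  qed
  then show "AE x in lebesgue. norm (u x \<bullet> v x) \<le> norm ((norm (u x))\<^sup>2 + (norm (v x))\<^sup>2)" by simp
qed (use assms in \<open>auto simp: l2fun_def\<close>)

lemma l2fun_add:
  assumes "l2fun u" "l2fun v" shows "l2fun (\<lambda>x. u x + v x)"
proof -
  have "(norm (u x + v x))\<^sup>2 = (norm (u x))\<^sup>2 + (norm (v x))\<^sup>2 + 2 * (u x \<bullet> v x)" for x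
    by (simp add: power2_norm_eq_inner inner_simps inner_commute)
  then show ?thesis using assms l2fun_integrable_inner[OF assms] by (auto simp: l2fun_def)
qed

lemma l2fun_scaleR: "l2fun u \<Longrightarrow> l2fun (\<lambda>x. c *\<^sub>R u x)"
  by (auto simp: l2fun_def power_mult_distrib)

lemma l2fun_zero: "l2fun (\<lambda>x. 0)"
  by (auto simp: l2fun_def)

lemma l2fun_uminus: "l2fun u \<Longrightarrow> l2fun (\<lambda>x. - u x)"
  using l2fun_scaleR[of u "-1"] by simp

lemma l2fun_diff: "l2fun u \<Longrightarrow> l2fun v \<Longrightarrow> l2fun (\<lambda>x. u x - v x)"
  using l2fun_add[OF _ l2fun_uminus, of u v] by simp

text \<open>Reflexive only at square integrable functions, so the quotient by this partial
  equivalence is \<open>L\<^sup>2\<close> of the plane as a type, with the whole theory of inner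
  product spaces. Functions on a domain enter it through extension by zero.\<close>

definition l2rel :: "(pt \<Rightarrow> 'b::euclidean_space) \<Rightarrow> (pt \<Rightarrow> 'b) \<Rightarrow> bool" where
  "l2rel u v \<longleftrightarrow> l2fun u \<and> l2fun v \<and> (AE x in lebesgue. u x = v x)"

lemma part_equivp_l2rel: "part_equivp l2rel"
proof (rule part_equivpI)
  show "\<exists>x. l2rel x x" by (rule exI[of _ "\<lambda>x. 0"]) (auto simp: l2rel_def l2fun_zero)
  show "symp l2rel" by (auto simp: symp_def l2rel_def elim: eventually_mono)
  show "transp l2rel" unfolding transp_def l2rel_def by (auto elim: eventually_elim2)
qed

quotient_type (overloaded) 'b lsq = "pt \<Rightarrow> 'b::euclidean_space" / partial: l2rel
  by (rule part_equivp_l2rel)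

instantiation lsq :: (euclidean_space) real_vector
begin
lift_definition zero_lsq :: "'a lsq" is "\<lambda>x. 0" by (simp add: l2rel_def l2fun_zero)
lift_definition plus_lsq :: "'a lsq \<Rightarrow> 'a lsq \<Rightarrow> 'a lsq" is "\<lambda>u v x. u x + v x"
  unfolding l2rel_def by (auto intro: l2fun_add elim: eventually_elim2)
lift_definition uminus_lsq :: "'a lsq \<Rightarrow> 'a lsq" is "\<lambda>u x. - u x"
  unfolding l2rel_def by (auto intro: l2fun_uminus elim: eventually_mono)
lift_definition minus_lsq :: "'a lsq \<Rightarrow> 'a lsq \<Rightarrow> 'a lsq" is "\<lambda>u v x. u x - v x"
  unfolding l2rel_def by (auto intro: l2fun_diff elim: eventually_elim2)
lift_definition scaleR_lsq :: "real \<Rightarrow> 'a lsq \<Rightarrow> 'a lsq" is "\<lambda>c u x. c *\<^sub>R u x"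
  unfolding l2rel_def by (auto intro: l2fun_scaleR elim: eventually_mono)
instance
  by standard
    (transfer; auto simp: l2rel_def algebra_simps intro!: l2fun_add l2fun_scaleR l2fun_zero l2fun_uminus l2fun_diff)+
end

instantiation lsq :: (euclidean_space) real_inner
begin
lift_definition inner_lsq :: "'a lsq \<Rightarrow> 'a lsq \<Rightarrow> real" is "\<lambda>u v. \<integral>x. u x \<bullet> v x \<partial>lebesgue"
proof -
  fix u u' v v' :: "pt \<Rightarrow> 'a"
  assume 1: "l2rel u u'" and 2: "l2rel v v'"
  then have "AE x in lebesgue. u x \<bullet> v x = u' x \<bullet> v' x"
    unfolding l2rel_def by (auto elim: eventually_elim2)
  then show "(\<integral>x. u x \<bullet> v x \<partial>lebesgue) = (\<integral>x. u' x \<bullet> v' x \<partial>lebesgue)"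
    using 1 2 by (intro integral_cong_AE) (auto simp: l2rel_def l2fun_def)
qed
definition norm_lsq :: "'a lsq \<Rightarrow> real" where "norm_lsq u = sqrt (u \<bullet> u)"
definition dist_lsq :: "'a lsq \<Rightarrow> 'a lsq \<Rightarrow> real" where "dist_lsq u v = norm (u - v)"
definition sgn_lsq :: "'a lsq \<Rightarrow> 'a lsq" where "sgn_lsq u = u /\<^sub>R norm u"
definition uniformity_lsq :: "('a lsq \<times> 'a lsq) filter" where
  "uniformity_lsq = (INF e\<in>{0 <..}. principal {(x, y). dist x y < e})"
definition open_lsq :: "'a lsq set \<Rightarrow> bool" where
  "open_lsq U = (\<forall>x\<in>U. \<forall>\<^sub>F (x', y) in uniformity. x' = x \<longrightarrow> y \<in> U)"
instance
proof
  fix x y z :: "'a lsq" and r :: real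
  show "x \<bullet> y = y \<bullet> x" by transfer (simp add: inner_commute)
  show "(x + y) \<bullet> z = x \<bullet> z + y \<bullet> z"
    by transfer (simp add: l2rel_def inner_add_left l2fun_integrable_inner)
  show "(r *\<^sub>R x) \<bullet> y = r * (x \<bullet> y)" by transfer simp
  show "0 \<le> x \<bullet> x" by transfer simp
  show "(x \<bullet> x = 0) = (x = 0)"
  proof (transfer fixing: )
    fix u :: "pt \<Rightarrow> 'a" assume u: "l2rel u u"
    have "((\<integral>x. u x \<bullet> u x \<partial>lebesgue) = 0) = (AE x in lebesgue. u x \<bullet> u x = 0)"
      using u by (intro integral_nonneg_eq_0_iff_AE) (auto simp: l2rel_def l2fun_integrable_inner)
    then show "((\<integral>x. u x \<bullet> u x \<partial>lebesgue) = 0) = l2rel u (\<lambda>x. 0)"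
      using u by (simp add: l2rel_def l2fun_zero)
  qed
qed (simp_all add: norm_lsq_def dist_lsq_def sgn_lsq_def uniformity_lsq_def open_lsq_def)
end

lemma Rep_lsq_ex: "\<exists>u. l2fun u \<and> abs_lsq u = a"
proof -
  have "l2rel (rep_lsq a) (rep_lsq a)" by (rule Quotient_rep_reflp[OF Quotient_lsq])
  then show ?thesis using Quotient_abs_rep[OF Quotient_lsq] by (auto simp: l2rel_def)
qed

lemma abs_lsq_eq: "l2fun u \<Longrightarrow> l2fun v \<Longrightarrow> abs_lsq u = abs_lsq v \<longleftrightarrow> (AE x in lebesgue. u x = v x)"
  using Quotient_rel[OF Quotient_lsq, of u v] by (auto simp: l2rel_def)

lemma abs_lsq_inner: "l2fun u \<Longrightarrow> l2fun v \<Longrightarrow> abs_lsq u \<bullet> abs_lsq v = (\<integral>x. u x \<bullet> v x \<partial>lebesgue)"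
  by (rule inner_lsq.abs_eq) (auto simp: l2rel_def eq_onp_def)

lemma abs_lsq_diff: "l2fun u \<Longrightarrow> l2fun v \<Longrightarrow> abs_lsq u - abs_lsq v = abs_lsq (\<lambda>x. u x - v x)"
  by (rule minus_lsq.abs_eq) (auto simp: l2rel_def eq_onp_def)

lemma abs_lsq_scaleR: "l2fun u \<Longrightarrow> c *\<^sub>R abs_lsq u = abs_lsq (\<lambda>x. c *\<^sub>R u x)"
  by (rule scaleR_lsq.abs_eq) (auto simp: l2rel_def eq_onp_def)

lemma norm_abs_lsq_diff:
  assumes "l2fun u" "l2fun v"
  shows "(norm (abs_lsq u - abs_lsq v))\<^sup>2 = (\<integral>x. (norm (u x - v x))\<^sup>2 \<partial>lebesgue)"
  using assms by (simp add: power2_norm_eq_inner abs_lsq_diff abs_lsq_inner l2fun_diff)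

text \<open>Riesz-Fischer: along a subsequence with geometrically small increments a weighted sum of
  squared increments is finite almost everywhere, which forces pointwise convergence; Fatou's lemma
  shows that the pointwise limit is also the limit in norm.\<close>

instance lsq :: (euclidean_space) complete_space
proof
  fix X :: "nat \<Rightarrow> 'a lsq" assume C: "Cauchy X"
  \<comment> \<open>The rate 1/8 for squared norms leaves room for a weight \<open>4^k\<close>: the
    weighted integrals still decay like \<open>(1/2)^k\<close>, and a finite weighted sum at a point
    bounds the increments there by a multiple of \<open>(1/2)^k\<close>.\<close>
  have "\<exists>N. \<forall>m\<ge>N. \<forall>n\<ge>N. (norm (X m - X n))\<^sup>2 < (1/8)^k" for k
  proof -
    have "sqrt ((1/8)^k) > 0" by simp
    then obtain N where N: "\<And>m n. m \<ge> N \<Longrightarrow> n \<ge> N \<Longrightarrow> norm (X m - X n) < sqrt ((1/8)^k)"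
      using C unfolding Cauchy_def dist_norm by blast
    have "(norm (X m - X n))\<^sup>2 < (1/8)^k" if "m \<ge> N" "n \<ge> N" for m n
      using power_strict_mono[OF N[OF that], of 2] by simp
    then show ?thesis by blast
  qed
  then obtain N where N: "\<And>k m n. m \<ge> N k \<Longrightarrow> n \<ge> N k \<Longrightarrow> (norm (X m - X n))\<^sup>2 < (1/8)^k" by metis
  \<comment> \<open>Partial sums give indices that are monotone in \<open>k\<close> and still
    dominate \<open>N k\<close>.\<close>
  define s where "s k = (\<Sum>i\<le>k. N i)" for k
  have sN: "s k \<ge> N k" for k unfolding s_def by (intro member_le_sum) auto
  have smono: "s j \<le> s k" if "j \<le> k" for j k unfolding s_def using that by (intro sum_mono2) auto
  have "\<forall>k. \<exists>u. l2fun u \<and> abs_lsq u = X (s k)" using Rep_lsq_ex by blast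
  then obtain f where f: "\<And>k. l2fun (f k)" "\<And>k. abs_lsq (f k) = X (s k)" by metis
  have fm: "f k \<in> borel_measurable lebesgue" for k using f(1) by (simp add: l2fun_def)
  have fd: "(\<integral>x. (norm (f m x - f n x))\<^sup>2 \<partial>lebesgue) < (1/8)^k" if "m \<ge> k" "n \<ge> k" for m n k
    unfolding norm_abs_lsq_diff[OF f(1) f(1), symmetric] f(2)
    using N[of k] sN[of k] smono[OF that(1)] smono[OF that(2)] by (meson order_trans)
  have fi: "integrable lebesgue (\<lambda>x. (norm (f m x - f n x))\<^sup>2)" for m n
    using l2fun_diff[OF f(1) f(1)] by (simp add: l2fun_def)
  have fdn: "(\<integral>\<^sup>+x. ennreal ((norm (f m x - f n x))\<^sup>2) \<partial>lebesgue) \<le> ennreal ((1/8)^k)" if "m \<ge> k" "n \<ge> k" for m n k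
    using fd[OF that] by (subst nn_integral_eq_integral[OF fi]) (auto intro!: ennreal_leI)
  have "(\<integral>\<^sup>+x. (\<Sum>k. ennreal (4^k * (norm (f (Suc k) x - f k x))\<^sup>2)) \<partial>lebesgue)
      = (\<Sum>k. \<integral>\<^sup>+x. ennreal (4^k * (norm (f (Suc k) x - f k x))\<^sup>2) \<partial>lebesgue)"
    using fm by (intro nn_integral_suminf) measurable
  also have "\<dots> \<le> (\<Sum>k. ennreal ((1/2)^k))"
  proof (intro suminf_le summableI)
    fix k
    have "(\<integral>\<^sup>+x. ennreal (4^k * (norm (f (Suc k) x - f k x))\<^sup>2) \<partial>lebesgue)
        = ennreal (4^k) * (\<integral>\<^sup>+x. ennreal ((norm (f (Suc k) x - f k x))\<^sup>2) \<partial>lebesgue)"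
      using fm by (subst nn_integral_cmult[symmetric]) (auto simp: ennreal_mult)
    also have "\<dots> \<le> ennreal (4^k) * ennreal ((1/8)^k)"
      by (intro mult_left_mono fdn) auto
    also have "\<dots> = ennreal ((1/2)^k)"
      by (simp flip: ennreal_mult power_mult_distrib)
    finally show "(\<integral>\<^sup>+x. ennreal (4^k * (norm (f (Suc k) x - f k x))\<^sup>2) \<partial>lebesgue) \<le> ennreal ((1/2)^k)" .
  qed
  also have "\<dots> = ennreal (\<Sum>k. (1/2)^k)" by (rule suminf_ennreal2) auto
  also have "\<dots> < \<infinity>" by simp
  finally have fin: "(\<integral>\<^sup>+x. (\<Sum>k. ennreal (4^k * (norm (f (Suc k) x - f k x))\<^sup>2)) \<partial>lebesgue) \<noteq> \<infinity>" by simp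
  have "AE x in lebesgue. (\<Sum>k. ennreal (4^k * (norm (f (Suc k) x - f k x))\<^sup>2)) \<noteq> \<infinity>"
    using fm by (intro nn_integral_PInf_AE fin) measurable
  then have conv: "AE x in lebesgue. convergent (\<lambda>k. f k x)"
  proof eventually_elim
    case (elim x)
    let ?d = "\<lambda>k. f (Suc k) x - f k x"
    define S where "S = (\<Sum>k. ennreal (4^k * (norm (?d k))\<^sup>2))"
    have "S \<noteq> \<infinity>" using elim by (simp only: S_def not_False_eq_True)
    then obtain M where M: "M \<ge> 0" "S = ennreal M" by (cases S rule: ennreal_cases) auto
    have le: "4^k * (norm (?d k))\<^sup>2 \<le> M" for k
    proof -
      have le_suminf: "g i \<le> suminf g" for g :: "nat \<Rightarrow> ennreal" and i
        using sum_le_suminf[OF summableI, of "{i}" g] by simp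
      have "ennreal (4^k * (norm (?d k))\<^sup>2) \<le> ennreal M"
        unfolding M(2)[symmetric] S_def by (rule le_suminf)
      then show ?thesis using M(1) by (subst (asm) ennreal_le_iff) auto
    qed
    have "norm (?d k) \<le> sqrt M * (1/2)^k" for k
    proof -
      have "((2::real)^k)\<^sup>2 = (2\<^sup>2)^k" by (simp only: power_mult[symmetric] mult.commute)
      then have "(2^k * norm (?d k))\<^sup>2 \<le> M" using le[of k] by (simp add: power_mult_distrib)
      then have "2^k * norm (?d k) \<le> sqrt M" by (rule real_le_rsqrt)
      then show ?thesis by (simp add: power_divide field_simps)
    qed
    then have "summable ?d"
      by (intro summable_comparison_test'[OF summable_mult[OF summable_geometric[of "1/2::real"]], of 0 ?d "sqrt M"]) auto
    then have "(\<lambda>n. \<Sum>k<n. ?d k) \<longlonglongrightarrow> suminf ?d" by (rule summable_LIMSEQ)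
    then have "(\<lambda>n. f n x - f 0 x) \<longlonglongrightarrow> suminf ?d"
      by (simp only: sum_lessThan_telescope[of "\<lambda>k. f k x"])
    then have "(\<lambda>n. (f n x - f 0 x) + f 0 x) \<longlonglongrightarrow> suminf ?d + f 0 x" by (intro tendsto_intros)
    then show ?case by (auto simp: convergent_def)
  qed
  define g where "g x = lim (\<lambda>k. f k x)" for x
  have gm: "g \<in> borel_measurable lebesgue" unfolding g_def[abs_def] using fm by (intro borel_measurable_lim_metric)
  have lim: "AE x in lebesgue. (\<lambda>k. f k x) \<longlonglongrightarrow> g x"
    using conv by eventually_elim (simp add: g_def convergent_LIMSEQ_iff)
  \<comment> \<open>Fatou's lemma carries the Cauchy estimate for \<open>f m - f k\<close> over to
    \<open>g - f k\<close> as \<open>m\<close> grows.\<close>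
  have gle: "(\<integral>\<^sup>+x. ennreal ((norm (g x - f k x))\<^sup>2) \<partial>lebesgue) \<le> ennreal ((1/8)^k)" for k
  proof -
    have "(\<integral>\<^sup>+x. ennreal ((norm (g x - f k x))\<^sup>2) \<partial>lebesgue)
       = (\<integral>\<^sup>+x. liminf (\<lambda>m. ennreal ((norm (f m x - f k x))\<^sup>2)) \<partial>lebesgue)"
    proof (rule nn_integral_cong_AE)
      show "AE x in lebesgue. ennreal ((norm (g x - f k x))\<^sup>2) = liminf (\<lambda>m. ennreal ((norm (f m x - f k x))\<^sup>2))"
        using lim
      proof eventually_elim
        case (elim x)
        have "(\<lambda>m. ennreal ((norm (f m x - f k x))\<^sup>2)) \<longlonglongrightarrow> ennreal ((norm (g x - f k x))\<^sup>2)"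
          by (intro tendsto_ennrealI tendsto_intros elim)
        then show ?case by (intro lim_imp_Liminf[symmetric]) auto
      qed
    qed
    also have "\<dots> \<le> liminf (\<lambda>m. \<integral>\<^sup>+x. ennreal ((norm (f m x - f k x))\<^sup>2) \<partial>lebesgue)"
      using fm by (intro nn_integral_liminf) measurable
    also have "\<dots> \<le> ennreal ((1/8)^k)"
      by (rule Liminf_le) (auto simp: eventually_sequentially intro!: exI[of _ k] fdn)
    finally show ?thesis .
  qed
  have gfi: "l2fun (\<lambda>x. g x - f k x)" for k
    unfolding l2fun_def
  proof (intro conjI)
    show m: "(\<lambda>x. g x - f k x) \<in> borel_measurable lebesgue" using gm fm by measurable
    show "integrable lebesgue (\<lambda>x. (norm (g x - f k x))\<^sup>2)"
    proof (rule integrableI_bounded)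
      have "(\<integral>\<^sup>+x. ennreal (norm ((norm (g x - f k x))\<^sup>2)) \<partial>lebesgue) \<le> ennreal ((1/8)^k)" using gle[of k] by simp
      also have "\<dots> < \<infinity>" by simp
      finally show "(\<integral>\<^sup>+x. ennreal (norm ((norm (g x - f k x))\<^sup>2)) \<partial>lebesgue) < \<infinity>" .
    qed (use m in measurable)
  qed
  have g: "l2fun g" using l2fun_add[OF gfi[of 0] f(1)[of 0]] by simp
  have est: "(norm (abs_lsq g - X (s k)))\<^sup>2 \<le> (1/8)^k" for k
  proof -
    have "ennreal (\<integral>x. (norm (g x - f k x))\<^sup>2 \<partial>lebesgue) \<le> ennreal ((1/8)^k)"
      using gle[of k] gfi[of k] by (subst (asm) nn_integral_eq_integral) (auto simp: l2fun_def)
    then show ?thesis unfolding f(2)[symmetric] norm_abs_lsq_diff[OF g f(1)]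
      by (subst (asm) ennreal_le_iff) auto
  qed
  have "X \<longlonglongrightarrow> abs_lsq g"
  proof (rule metric_LIMSEQ_I)
    fix e :: real assume e: "e > 0"
    have "(\<lambda>k. (1/8::real)^k) \<longlonglongrightarrow> 0" by (rule LIMSEQ_realpow_zero) auto
    then have "eventually (\<lambda>k. (1/8::real)^k < (e/2)\<^sup>2) sequentially"
      using e by (intro order_tendstoD) auto
    then obtain k where k: "(1/8::real)^k < (e/2)\<^sup>2" by (auto simp: eventually_sequentially)
    have small: "norm (z::'a lsq) < e/2" if "(norm z)\<^sup>2 \<le> (1/8)^k" for z
      using k that e power2_less_imp_less[of "norm z" "e/2"] by linarith
    show "\<exists>no. \<forall>n\<ge>no. dist (X n) (abs_lsq g) < e"
    proof (intro exI allI impI)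
      fix n assume n: "n \<ge> N k"
      have "norm (X n - X (s k)) < e/2" using N[OF n sN[of k]] by (intro small) simp
      moreover have "norm (X (s k) - abs_lsq g) < e/2" using small[OF est] by (simp add: norm_minus_commute)
      ultimately show "dist (X n) (abs_lsq g) < e" unfolding dist_norm by (rule norm_diff_triangle_less[THEN less_le_trans]) simp
    qed
  qed
  then show "convergent X" by (auto simp: convergent_def)
qed

subsection \<open>Riesz representation and projection on closed subspaces\<close>

text \<open>The representer is the minimiser of the square of the norm minus \<open>2 * F\<close>.
  This functional is bounded below on \<open>M\<close>, the parallelogram law makes a minimising
  sequence Cauchy, and vanishing of the first variation is the claim. \<open>F\<close> is linear on
  \<open>M\<close> only, since functionals on \<open>V\<close> are meaningful only there.\<close>

lemma Riesz_subspace: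
  fixes M :: "'x::{real_inner,complete_space} set" and F :: "'x \<Rightarrow> real"
  assumes M: "subspace M" "closed M"
    and add: "\<And>p q. p \<in> M \<Longrightarrow> q \<in> M \<Longrightarrow> F (p + q) = F p + F q"
    and scale: "\<And>c p. p \<in> M \<Longrightarrow> F (c *\<^sub>R p) = c * F p"
    and bound: "\<And>p. p \<in> M \<Longrightarrow> \<bar>F p\<bar> \<le> C * norm p"
  shows "\<exists>m\<in>M. \<forall>q\<in>M. F q = m \<bullet> q"
proof -
  define Q where "Q p = (norm p)\<^sup>2 - 2 * F p" for p
  have lower: "Q p \<ge> - C\<^sup>2" if "p \<in> M" for p
  proof -
    have "2 * F p \<le> 2 * C * norm p" using bound[OF that] by linarith
    moreover have "0 \<le> (norm p - C)\<^sup>2" by simp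
    ultimately show ?thesis by (simp add: Q_def power2_eq_square algebra_simps)
  qed
  define d where "d = Inf (Q ` M)"
  have ne: "Q ` M \<noteq> {}" using subspace_0[OF M(1)] by auto
  have bdd: "bdd_below (Q ` M)" using lower by (intro bdd_belowI2)
  have dle: "d \<le> Q p" if "p \<in> M" for p unfolding d_def using that bdd by (intro cInf_lower) auto
  have "\<exists>p\<in>M. Q p < d + 1 / Suc n" for n
    using cInf_lessD[OF ne, of "d + 1 / Suc n"] by (auto simp: d_def)
  then obtain p where p: "\<And>n. p n \<in> M" "\<And>n. Q (p n) < d + 1 / Suc n" by metis
  \<comment> \<open>The parallelogram law; the linear parts of \<open>Q\<close> cancel on the
    right-hand side.\<close>
  have par: "(norm (x - y))\<^sup>2 = 2 * Q x + 2 * Q y - 4 * Q ((1/2) *\<^sub>R (x + y))" if "x \<in> M" "y \<in> M" for x y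
  proof -
    have "x + y \<in> M" using that M by (simp add: subspace_add)
    then have "F ((1/2) *\<^sub>R (x + y)) = (F x + F y) / 2" using scale add that by simp
    then show ?thesis
      by (simp add: Q_def power2_norm_eq_inner inner_simps inner_commute algebra_simps)
  qed
  have close: "(norm (p m - p n))\<^sup>2 \<le> 2 / Suc m + 2 / Suc n" for m n
  proof -
    have "(1/2) *\<^sub>R (p m + p n) \<in> M" using p M by (intro subspace_scale subspace_add)
    from dle[OF this] show ?thesis using p(2)[of m] p(2)[of n] unfolding par[OF p(1) p(1)] by (simp add: add_divide_distrib)
  qed
  have "Cauchy p"
  proof (rule metric_CauchyI)
    fix e :: real assume e: "e > 0"
    obtain N :: nat where N: "4 / e\<^sup>2 < real N" using reals_Archimedean2 by blast
    have "dist (p m) (p n) < e" if "m \<ge> N" "n \<ge> N" for m n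
    proof -
      have *: "2 / Suc k < e\<^sup>2 / 2" if "k \<ge> N" for k
      proof -
        have "4 / e\<^sup>2 < real (Suc k)" using N that by linarith
        then show ?thesis using e by (simp add: field_simps)
      qed
      have "(norm (p m - p n))\<^sup>2 < e\<^sup>2" using close[of m n] *[OF that(1)] *[OF that(2)] by linarith
      then show ?thesis using e power2_less_imp_less[of "norm (p m - p n)" e] by (simp add: dist_norm)
    qed
    then show "\<exists>N. \<forall>m\<ge>N. \<forall>n\<ge>N. dist (p m) (p n) < e" by blast
  qed
  then obtain m where lim: "p \<longlonglongrightarrow> m" using Cauchy_convergent convergent_def by blast
  have mM: "m \<in> M" using closed_sequentially[OF M(2) p(1) lim] .
  have Qm: "Q m \<le> d"
  proof -
    have "(\<lambda>n. F (p n) - F m) \<longlonglongrightarrow> 0"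
    proof (rule tendsto_rabs_zero_cancel, rule tendsto_sandwich[OF _ _ tendsto_const])
      show "(\<lambda>n. C * norm (p n - m)) \<longlonglongrightarrow> 0"
        using tendsto_mult_left[OF tendsto_norm_zero[OF LIM_zero[OF lim]], of C] by simp
      have "F (p n) - F m = F (p n - m)" for n
        using add[OF p(1)[of n] subspace_scale[OF M(1) mM, of "-1"]] scale[OF mM, of "-1"] by simp
      then have "\<bar>F (p n) - F m\<bar> \<le> C * norm (p n - m)" for n
        using bound[of "p n - m"] p(1) mM M by (simp add: subspace_diff)
      then show "\<forall>\<^sub>F n in sequentially. \<bar>F (p n) - F m\<bar> \<le> C * norm (p n - m)" by simp
    qed auto
    then have "(\<lambda>n. F (p n)) \<longlonglongrightarrow> F m" by (rule LIM_zero_cancel)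
    then have "(\<lambda>n. Q (p n)) \<longlonglongrightarrow> Q m" unfolding Q_def by (intro tendsto_intros lim)
    moreover have "(\<lambda>n. d + 1 / Suc n) \<longlonglongrightarrow> d + 0" by (intro tendsto_intros LIMSEQ_Suc lim_1_over_n)
    ultimately show ?thesis
      by (intro LIMSEQ_le[of _ _ "\<lambda>n. d + 1 / Suc n"]) (use p(2) in \<open>auto intro!: exI[of _ 0] less_imp_le\<close>)
  qed
  have "F q = m \<bullet> q" if q: "q \<in> M" for q
  proof (cases "q = 0")
    case True
    then show ?thesis using scale[OF q, of 0] by simp
  next
    case False
    \<comment> \<open>\<open>2 * r\<close> is the derivative of \<open>Q\<close> at \<open>m\<close>
      in the direction \<open>q\<close>, and the \<open>t\<close> below minimises the quadratic
      polynomial given by \<open>Q (m + t *\<^sub>R q)\<close>.\<close>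
    define r where "r = m \<bullet> q - F q"
    define t where "t = - (r / (norm q)\<^sup>2)"
    have "m + t *\<^sub>R q \<in> M" using q mM M by (intro subspace_add subspace_scale)
    from dle[OF this] have "Q m \<le> Q (m + t *\<^sub>R q)" using Qm by linarith
    also have "\<dots> = Q m + 2 * t * r + t\<^sup>2 * (norm q)\<^sup>2"
    proof -
      have "(norm (m + t *\<^sub>R q))\<^sup>2 = (norm m)\<^sup>2 + 2 * t * (m \<bullet> q) + t * t * (norm q)\<^sup>2"
        by (simp add: power2_norm_eq_inner inner_simps inner_commute algebra_simps)
      then show ?thesis
        using add[OF mM subspace_scale[OF M(1) q], of t] scale[OF q, of t]
        by (simp add: Q_def r_def algebra_simps power2_eq_square[of t])
    qed
    also have "\<dots> = Q m - r\<^sup>2 / (norm q)\<^sup>2" using False by (simp add: t_def field_simps power2_eq_square)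
    finally have "r\<^sup>2 / (norm q)\<^sup>2 \<le> 0" by simp
    then have "r = 0" using False by (simp add: divide_le_0_iff)
    then show ?thesis by (simp add: r_def)
  qed
  then show ?thesis using mM by blast
qed

lemma projection_exists:
  fixes M :: "'x::{real_inner,complete_space} set"
  assumes "subspace M" "closed M"
  shows "\<exists>m\<in>M. \<forall>q\<in>M. x \<bullet> q = m \<bullet> q"
proof (rule Riesz_subspace[OF assms, where C = "norm x"])
  fix p q c
  show "x \<bullet> (p + q) = x \<bullet> p + x \<bullet> q" "x \<bullet> (c *\<^sub>R p) = c * (x \<bullet> p)" by (simp_all add: inner_simps)
  show "\<bar>x \<bullet> p\<bar> \<le> norm x * norm p" by (rule Cauchy_Schwarz_ineq2)
qed

lemma subspace_closure:
  fixes M :: "'a::real_normed_vector set"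
  assumes "subspace M" shows "subspace (closure M)"
proof (rule subspaceI)
  show "0 \<in> closure M" using subspace_0[OF assms] closure_subset by blast
  fix x y :: 'a and c :: real
  assume "x \<in> closure M"
  then obtain f where f: "\<And>n. f n \<in> M" "f \<longlonglongrightarrow> x" unfolding closure_sequential by blast
  show "c *\<^sub>R x \<in> closure M" unfolding closure_sequential
    using f subspace_scale[OF assms] by (intro exI[of _ "\<lambda>n. c *\<^sub>R f n"]) (auto intro!: tendsto_intros)
  assume "y \<in> closure M"
  then obtain g where g: "\<And>n. g n \<in> M" "g \<longlonglongrightarrow> y" unfolding closure_sequential by blast
  show "x + y \<in> closure M" unfolding closure_sequential
    using f g subspace_add[OF assms] by (intro exI[of _ "\<lambda>n. f n + g n"]) (auto intro!: tendsto_intros)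
qed

subsection \<open>Continuous functional calculus by Bernstein polynomials\<close>

text \<open>The polynomial \<open>p\<close> evaluated at the operator \<open>B\<close>, by Horner's
  scheme.\<close>

definition opoly :: "('y::real_vector \<Rightarrow> 'y) \<Rightarrow> real poly \<Rightarrow> 'y \<Rightarrow> 'y" where
  "opoly B p = fold_coeffs (\<lambda>a f y. a *\<^sub>R y + B (f y)) p (\<lambda>_. 0)"

definition bern :: "nat \<Rightarrow> nat \<Rightarrow> real poly" where
  "bern n k = smult (real (n choose k)) ([:0, 1:] ^ k * [:1, -1:] ^ (n - k))"

text \<open>In the order of symmetric operators, \<open>B\<close> lies between 0 and the identity;
  its spectrum is thus in the unit interval, where the Bernstein polynomials are
  nonnegative.\<close>

locale psd_contraction =
  fixes B :: "'y::{real_inner,complete_space} \<Rightarrow> 'y"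
  assumes lin: "bounded_linear B"
    and sym: "\<And>x y. B x \<bullet> y = x \<bullet> B y"
    and pos: "\<And>x. 0 \<le> B x \<bullet> x"
    and le1: "\<And>x. B x \<bullet> x \<le> x \<bullet> x"
begin

sublocale B: bounded_linear B by (rule lin)

lemma opoly_0 [simp]: "opoly B 0 y = 0"
  by (simp add: opoly_def)

lemma opoly_pCons: "opoly B (pCons a p) y = a *\<^sub>R y + B (opoly B p y)"
  by (cases "p = 0 \<and> a = 0") (auto simp add: opoly_def B.zero)

lemma opoly_add: "opoly B (p + q) y = opoly B p y + opoly B q y"
  by (induction p q rule: poly_induct2) (simp_all add: opoly_pCons B.add algebra_simps)

lemma opoly_smult: "opoly B (smult c p) y = c *\<^sub>R opoly B p y"
  by (induction p) (simp_all add: opoly_pCons B.scaleR algebra_simps)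

lemma opoly_mult: "opoly B (p * q) y = opoly B p (opoly B q y)"
  by (induction p) (simp_all add: opoly_pCons opoly_add opoly_smult B.zero)

lemma opoly_sum: "opoly B (sum f A) y = (\<Sum>i\<in>A. opoly B (f i) y)"
  by (induction A rule: infinite_finite_induct) (simp_all add: opoly_add)

lemma opoly_1: "opoly B 1 y = y"
  by (simp add: one_pCons opoly_pCons B.zero)

lemma opoly_X: "opoly B [:0, 1:] y = B y"
  by (simp add: opoly_pCons B.zero)

lemma opoly_linear:
  "opoly B p (x + y) = opoly B p x + opoly B p y" "opoly B p (c *\<^sub>R x) = c *\<^sub>R opoly B p x"
  by (induction p) (simp_all add: opoly_pCons B.add B.scaleR algebra_simps)

lemma opoly_commute: "opoly B p (B x) = B (opoly B p x)"
  using opoly_mult[of p "[:0,1:]" x] opoly_mult[of "[:0,1:]" p x] by (simp only: opoly_X mult.commute)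

lemma opoly_sym: "opoly B p x \<bullet> y = x \<bullet> opoly B p y"
proof (induction p arbitrary: x y)
  case (pCons a p)
  then show ?case by (simp add: opoly_pCons inner_simps sym opoly_commute)
qed simp

text \<open>Polynomials in \<open>B\<close> are symmetric and commute, so the form of
  \<open>p * p * r\<close> at \<open>x\<close> is the form of \<open>r\<close> at
  \<open>opoly B p x\<close>.\<close>

lemma opoly_square_pos:
  assumes "\<And>x. 0 \<le> opoly B r x \<bullet> x"
  shows "0 \<le> opoly B (p * p * r) x \<bullet> x"
proof -
  have "opoly B (p * p * r) x = opoly B p (opoly B r (opoly B p x))"
    by (simp only: opoly_mult[symmetric] mult_ac)
  then show ?thesis using assms[of "opoly B p x"] by (simp add: opoly_sym)
qed

text \<open>Even powers split off as a square, which preserves positivity. There remain 1,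
  \<open>X\<close>, \<open>1 - X\<close> and their product, and \<open>X (1 - X)\<close> equals
  \<open>X\<^sup>2 (1 - X) + (1 - X)\<^sup>2 X\<close>, a sum of squares times positive factors. No
  square root of an operator is taken.\<close>

lemma opoly_XC_pos: "0 \<le> opoly B ([:0, 1:] ^ k * [:1, -1:] ^ m) x \<bullet> x"
proof -
  let ?X = "[:0, 1:] :: real poly" and ?C = "[:1, -1:] :: real poly"
  have c: "opoly B ?C y = y - B y" for y by (simp add: opoly_pCons B.zero B.neg)
  have P: "0 \<le> opoly B 1 y \<bullet> y" "0 \<le> opoly B ?X y \<bullet> y" "0 \<le> opoly B ?C y \<bullet> y" for y
    using pos[of y] le1[of y] by (simp_all only: opoly_1 opoly_X c inner_diff_left inner_ge_zero)
  have XC: "0 \<le> opoly B (?X * ?C) y \<bullet> y" for y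
  proof -
    have "?X * ?C = ?X * ?X * ?C + ?C * ?C * ?X" by simp
    then show ?thesis using opoly_square_pos[OF P(3), of ?X y] opoly_square_pos[OF P(2), of ?C y]
      by (simp only: opoly_add inner_add_left)
  qed
  have parity: "k mod 2 = 0 \<or> k mod 2 = 1" "m mod 2 = 0 \<or> m mod 2 = 1" by auto
  have rest: "0 \<le> opoly B (?X ^ (k mod 2) * ?C ^ (m mod 2)) y \<bullet> y" for y
    using parity P XC by (elim disjE) (simp_all only: power_0 power_one_right mult_1_left mult_1_right)
  define p where "p = ?X ^ (k div 2) * ?C ^ (m div 2)"
  have "?X ^ k = ?X ^ (k div 2) * ?X ^ (k div 2) * ?X ^ (k mod 2)"
    by (metis mult_2 div_mult_mod_eq mult.commute power_add)
  moreover have "?C ^ m = ?C ^ (m div 2) * ?C ^ (m div 2) * ?C ^ (m mod 2)"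
    by (metis mult_2 div_mult_mod_eq mult.commute power_add)
  ultimately have "?X ^ k * ?C ^ m = p * p * (?X ^ (k mod 2) * ?C ^ (m mod 2))"
    unfolding p_def by (simp only: mult_ac)
  then show ?thesis using opoly_square_pos[OF rest, of p x] by (simp only:)
qed

lemma bern_pos: "0 \<le> opoly B (bern n k) x \<bullet> x"
  unfolding bern_def opoly_smult inner_scaleR_left using opoly_XC_pos by (intro mult_nonneg_nonneg) auto

lemma bern_sum: "(\<Sum>k\<le>n. bern n k) = 1"
proof -
  have "[:0, 1:] + [:1, -1:] = (1 :: real poly)" by (simp add: one_pCons)
  then have "1 = ([:0, 1:] + [:1, -1:] :: real poly) ^ n" by (simp only: power_one)
  also have "\<dots> = (\<Sum>k\<le>n. of_nat (n choose k) * [:0, 1:] ^ k * [:1, -1:] ^ (n - k))" by (rule binomial_ring)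
  also have "\<dots> = (\<Sum>k\<le>n. bern n k)"
    unfolding bern_def by (intro sum.cong refl) (simp add: of_nat_poly mult.assoc)
  finally show ?thesis by simp
qed

text \<open>The factor that appears is exactly the new node \<open>(k + 1) / (n + 1)\<close>.
  Multiplying a Bernstein sum by \<open>B\<close> is thus multiplying its coefficients by the node,
  up to the shift from \<open>k / n\<close>.\<close>

lemma bern_Suc: "[:0, 1:] * bern n k = smult ((real k + 1) / (real n + 1)) (bern (Suc n) (Suc k))"
proof -
  have "Suc n * (n choose k) = Suc k * (Suc n choose Suc k)"
    using Suc_times_binomial_eq[of n k] by (simp add: mult.commute)
  then have "real (Suc n) * real (n choose k) = real (Suc k) * real (Suc n choose Suc k)"
    by (metis of_nat_mult)
  then have "real (n choose k) = (real k + 1) / (real n + 1) * real (Suc n choose Suc k)"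
    by (simp add: field_simps del: binomial_Suc_Suc)
  then show ?thesis unfolding bern_def by (simp add: mult_ac del: binomial_Suc_Suc)
qed

text \<open>Each Bernstein operator is a positive form, so its value at \<open>(x, v)\<close> is at
  most the mean of its values at \<open>(x, x)\<close> and \<open>(v, v)\<close>; since these
  operators add up to the identity, the means add up to the right-hand side.\<close>

lemma bern_combination_inner_le:
  assumes "\<And>k. k \<le> n \<Longrightarrow> \<bar>c k\<bar> \<le> S"
  shows "\<bar>\<Sum>k\<le>n. c k * (opoly B (bern n k) x \<bullet> v)\<bar> \<le> S * ((x \<bullet> x + v \<bullet> v) / 2)"
proof -
  let ?P = "\<lambda>k. opoly B (bern n k)"
  have one: "\<bar>?P k x \<bullet> v\<bar> \<le> (?P k x \<bullet> x + ?P k v \<bullet> v) / 2" for k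
  proof -
    have "0 \<le> ?P k (x + v) \<bullet> (x + v)" "0 \<le> ?P k (x + (-1) *\<^sub>R v) \<bullet> (x + (-1) *\<^sub>R v)" by (rule bern_pos)+
    moreover have "?P k v \<bullet> x = ?P k x \<bullet> v" by (metis opoly_sym inner_commute)
    ultimately show ?thesis unfolding opoly_linear by (simp add: inner_simps)
  qed
  have S: "S \<ge> 0" using assms[of 0] by simp
  have "\<bar>\<Sum>k\<le>n. c k * (?P k x \<bullet> v)\<bar> \<le> (\<Sum>k\<le>n. \<bar>c k * (?P k x \<bullet> v)\<bar>)" by (rule sum_abs)
  also have "\<dots> \<le> (\<Sum>k\<le>n. S * ((?P k x \<bullet> x + ?P k v \<bullet> v) / 2))"
    unfolding abs_mult using assms one S by (intro sum_mono mult_mono) auto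
  also have "\<dots> = S * (((\<Sum>k\<le>n. ?P k x) \<bullet> x + (\<Sum>k\<le>n. ?P k v) \<bullet> v) / 2)"
    by (simp add: inner_sum_left sum_distrib_left sum.distrib add_divide_distrib distrib_left sum_divide_distrib)
  also have "\<dots> = S * ((x \<bullet> x + v \<bullet> v) / 2)"
    by (simp only: opoly_sum[symmetric] bern_sum opoly_1)
  finally show ?thesis .
qed

lemma bern_combination_norm_le:
  assumes "\<And>k. k \<le> n \<Longrightarrow> \<bar>c k\<bar> \<le> S"
  shows "norm (\<Sum>k\<le>n. c k *\<^sub>R opoly B (bern n k) x) \<le> S * norm x"
proof -
  define u where "u = (\<Sum>k\<le>n. c k *\<^sub>R opoly B (bern n k) x)"
  have S: "S \<ge> 0" using assms[of 0] by simp
  show ?thesis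
  proof (cases "u = 0")
    case False
    \<comment> \<open>The multiple of \<open>u\<close> with the norm of \<open>x\<close> balances
      the two squares in the preceding bound, which then becomes
      \<open>norm x * norm u \<le> S * norm x * norm x\<close>.\<close>
    define v where "v = (norm x / norm u) *\<^sub>R u"
    have vv: "v \<bullet> v = x \<bullet> x" using False
      by (simp add: v_def power2_norm_eq_inner[symmetric] power2_eq_square)
    have "u \<bullet> v = norm x * norm u" using False
      by (simp add: v_def norm_eq_sqrt_inner real_div_sqrt field_simps)
    moreover have "u \<bullet> v \<le> S * ((x \<bullet> x + v \<bullet> v) / 2)"
      using bern_combination_inner_le[where n = n and c = c and x = x and v = v, OF assms] by (simp add: u_def inner_sum_left)
    ultimately have le: "norm x * norm u \<le> norm x * (S * norm x)"
      using vv by (simp add: power2_norm_eq_inner[symmetric] power2_eq_square mult_ac)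
    have "x \<noteq> 0" using False opoly_linear(2)[of _ 0 0] by (auto simp: u_def)
    then show ?thesis using le by (simp add: u_def)
  qed (use S in \<open>simp add: u_def[symmetric]\<close>)
qed

text \<open>For \<open>n = 0\<close> the only node is \<open>0 / 0 = 0\<close>, so all nodes lie in
  the unit interval for every \<open>n\<close>.\<close>

definition bcalc :: "nat \<Rightarrow> (real \<Rightarrow> real) \<Rightarrow> 'y \<Rightarrow> 'y" where
  "bcalc n \<phi> x = (\<Sum>k\<le>n. \<phi> (k / n) *\<^sub>R opoly B (bern n k) x)"

definition calc :: "(real \<Rightarrow> real) \<Rightarrow> 'y \<Rightarrow> 'y" where
  "calc \<phi> x = lim (\<lambda>n. bcalc n \<phi> x)"

lemma bcalc_norm_le:
  assumes "\<And>b. b \<in> {0..1} \<Longrightarrow> \<bar>\<phi> b\<bar> \<le> S"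
  shows "norm (bcalc n \<phi> x) \<le> S * norm x"
  unfolding bcalc_def
  by (rule bern_combination_norm_le) (auto intro!: assms simp: divide_le_eq_1)

lemma bcalc_diff: "bcalc n (\<lambda>b. \<phi> b - \<psi> b) x = bcalc n \<phi> x - bcalc n \<psi> x"
  by (simp add: bcalc_def scaleR_diff_left sum_subtractf)

lemma bcalc_one: "bcalc n (\<lambda>b. 1) x = x"
  by (simp add: bcalc_def bern_sum opoly_1 flip: opoly_sum)

text \<open>By \<open>bern_Suc\<close> both terms are Bernstein sums of degree \<open>n + 1\<close>;
  they differ only in taking \<open>\<phi>\<close> at \<open>k / n\<close> or at
  \<open>(k + 1) / (n + 1)\<close>. These points are at most \<open>1 / n\<close> apart, so uniform
  continuity makes the coefficients of the difference small.\<close>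

lemma bcalc_times_B:
  assumes "continuous_on {0..1} \<phi>"
  shows "(\<lambda>n. B (bcalc n \<phi> x) - bcalc (Suc n) (\<lambda>b. b * \<phi> b) x) \<longlonglongrightarrow> 0"
proof (rule metric_LIMSEQ_I)
  fix e :: real assume e: "e > 0"
  define e' where "e' = e / (norm x + 1)"
  have e': "e' > 0" using e by (simp add: e'_def add_nonneg_pos)
  have "uniformly_continuous_on {0..1} \<phi>" using assms by (rule compact_uniformly_continuous) simp
  then obtain d where d: "d > 0" "\<And>a b. a \<in> {0..1} \<Longrightarrow> b \<in> {0..1} \<Longrightarrow> dist b a < d \<Longrightarrow> dist (\<phi> b) (\<phi> a) < e'"
    using e' unfolding uniformly_continuous_on_def by metis
  obtain N :: nat where N: "1 / d < real N" using reals_Archimedean2 by blast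
  have "dist (B (bcalc n \<phi> x) - bcalc (Suc n) (\<lambda>b. b * \<phi> b) x) 0 < e" if n: "n \<ge> max N 1" for n
  proof -
    have n0: "n > 0" using n by simp
    \<comment> \<open>The coefficients of the difference with \<open>j = k + 1\<close>. The one at
      \<open>j = 0\<close> vanishes because \<open>b * \<phi> b\<close> does at
      \<open>b = 0\<close>.\<close>
    define c where "c j = (if j = 0 then 0 else
       (\<phi> ((real j - 1) / n) - \<phi> (real j / (n + 1))) * (j / (n + 1)))" for j :: nat
    have e1: "B (bcalc n \<phi> x) = (\<Sum>k\<le>n. (\<phi> (k / n) * ((real k + 1) / (real n + 1))) *\<^sub>R opoly B (bern (Suc n) (Suc k)) x)"
    proof -
      have "B (opoly B (bern n k) x) = ((real k + 1) / (real n + 1)) *\<^sub>R opoly B (bern (Suc n) (Suc k)) x" for k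
        using opoly_mult[of "[:0,1:]" "bern n k" x] unfolding bern_Suc opoly_smult opoly_X by simp
      then show ?thesis by (simp add: bcalc_def B.sum B.scaleR)
    qed
    have e2: "bcalc (Suc n) (\<lambda>b. b * \<phi> b) x
       = (\<Sum>k\<le>n. ((real k + 1) / (real n + 1) * \<phi> ((real k + 1) / (real n + 1))) *\<^sub>R opoly B (bern (Suc n) (Suc k)) x)"
      unfolding bcalc_def by (subst sum.atMost_Suc_shift) (simp add: add.commute)
    have e3: "(\<Sum>j\<le>Suc n. c j *\<^sub>R opoly B (bern (Suc n) j) x)
        = (\<Sum>k\<le>n. ((\<phi> (k / n) - \<phi> ((real k + 1) / (n + 1))) * ((real k + 1) / (n + 1))) *\<^sub>R opoly B (bern (Suc n) (Suc k)) x)"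
      by (subst sum.atMost_Suc_shift) (simp add: c_def add.commute)
    have eq: "B (bcalc n \<phi> x) - bcalc (Suc n) (\<lambda>b. b * \<phi> b) x = (\<Sum>j\<le>Suc n. c j *\<^sub>R opoly B (bern (Suc n) j) x)"
      unfolding e1 e2 e3 sum_subtractf[symmetric] scaleR_diff_left[symmetric]
      by (intro sum.cong refl) (simp add: diff_divide_distrib algebra_simps)
    have "norm (\<Sum>j\<le>Suc n. c j *\<^sub>R opoly B (bern (Suc n) j) x) \<le> e' * norm x"
    proof (rule bern_combination_norm_le)
      fix j assume j: "j \<le> Suc n"
      show "\<bar>c j\<bar> \<le> e'"
      proof (cases "j = 0")
        case False
        have j1: "real j \<ge> 1" "real j \<le> n + 1" using False j by auto
        have "(real j - 1) / n \<in> {0..1}" "real j / (n + 1) \<in> {0..1}" using j1 n0 by (auto simp: divide_le_eq_1)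
        moreover have "dist ((real j - 1) / n) (real j / (n + 1)) < d"
        proof -
          have "real j / (n + 1) - (real j - 1) / n = (n + 1 - real j) / (n * (n + 1))"
            using n0 by (simp add: field_simps)
          moreover have "0 \<le> (n + 1 - real j) / (n * (n + 1))" using j1 by simp
          moreover have "(n + 1 - real j) / (n * (n + 1)) \<le> (n + 1) / (n * (n + 1))" using j1 by (intro divide_right_mono) auto
          moreover have "(n + 1) / (n * (n + 1)) = 1 / real n"
          proof -
            have "0 < real n + real n * real n" using n0 by (simp add: add_pos_pos)
            then show ?thesis using n0 by (simp add: divide_simps algebra_simps)
          qed
          moreover have "1 / real n < d"
          proof -
            have "1 / d < real n" using N n by linarith
            then show ?thesis using d(1) n0 by (simp add: field_simps)
          qed
          ultimately show ?thesis by (simp add: dist_real_def)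
        qed
        ultimately have "\<bar>\<phi> ((real j - 1) / n) - \<phi> (real j / (n + 1))\<bar> \<le> e'"
          using d(2) by (fastforce simp: dist_real_def)
        then have "\<bar>\<phi> ((real j - 1) / n) - \<phi> (real j / (n + 1))\<bar> * \<bar>j / (n + 1)\<bar> \<le> e' * 1"
          using j1 e' by (intro mult_mono) (auto simp: divide_le_eq_1)
        then show ?thesis using False by (simp add: c_def abs_mult)
      qed (use e' in \<open>simp add: c_def\<close>)
    qed
    also have "\<dots> < e" using e by (simp add: e'_def divide_less_eq add_nonneg_pos)
    finally show ?thesis using eq by simp
  qed
  then show "\<exists>no. \<forall>n\<ge>no. dist (B (bcalc n \<phi> x) - bcalc (Suc n) (\<lambda>b. b * \<phi> b) x) 0 < e" by blast
qed

lemma bcalc_monomial: "(\<lambda>n. bcalc n (\<lambda>b. b ^ m) x) \<longlonglongrightarrow> (B ^^ m) x"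
proof (induction m)
  case 0
  then show ?case by (simp add: bcalc_one)
next
  case (Suc m)
  have "(\<lambda>n. B (bcalc n (\<lambda>b. b ^ m) x)) \<longlonglongrightarrow> B ((B ^^ m) x)" using Suc by (rule B.tendsto)
  from tendsto_diff[OF this bcalc_times_B[of "\<lambda>b. b ^ m" x]]
  have "(\<lambda>n. bcalc (Suc n) (\<lambda>b. b * b ^ m) x) \<longlonglongrightarrow> B ((B ^^ m) x)"
    by (simp add: continuous_on_power)
  then show ?case using LIMSEQ_imp_Suc by fastforce
qed

text \<open>Convergence is known for monomials and hence for polynomials; Weierstrass approximation
  together with the bound of \<open>bcalc\<close> by the supremum norm transfers the Cauchy property
  to every continuous function.\<close>

lemma bcalc_convergent:
  assumes "continuous_on {0..1} \<phi>"
  shows "convergent (\<lambda>n. bcalc n \<phi> x)"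
proof -
  have "Cauchy (\<lambda>n. bcalc n \<phi> x)"
  proof (rule metric_CauchyI)
    fix e :: real assume e: "e > 0"
    define e' where "e' = e / (4 * (norm x + 1))"
    have e': "e' > 0" using e by (simp add: e'_def add_nonneg_pos)
    obtain g where g: "real_polynomial_function g" "\<And>b. b \<in> {0..1} \<Longrightarrow> \<bar>\<phi> b - g b\<bar> < e'"
      using Stone_Weierstrass_real_polynomial_function[OF compact_Icc assms e'] by blast
    obtain a N where gN: "g = (\<lambda>b. \<Sum>i\<le>N. a i * b ^ i)"
      using g(1) unfolding real_polynomial_function_iff_sum by blast
    have "bcalc n g x = (\<Sum>i\<le>N. a i *\<^sub>R bcalc n (\<lambda>b. b ^ i) x)" for n
      unfolding bcalc_def gN scaleR_sum_left scaleR_sum_right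
      by (subst sum.swap) simp
    then have "(\<lambda>n. bcalc n g x) \<longlonglongrightarrow> (\<Sum>i\<le>N. a i *\<^sub>R (B ^^ i) x)"
      by (simp add: tendsto_intros bcalc_monomial)
    then have "Cauchy (\<lambda>n. bcalc n g x)" by (rule LIMSEQ_imp_Cauchy)
    then obtain M where M: "\<And>m n. m \<ge> M \<Longrightarrow> n \<ge> M \<Longrightarrow> norm (bcalc m g x - bcalc n g x) < e / 2"
      unfolding Cauchy_def dist_norm using half_gt_zero[OF e] by blast
    have app: "norm (bcalc n \<phi> x - bcalc n g x) < e / 4" for n
    proof -
      have "norm (bcalc n (\<lambda>b. \<phi> b - g b) x) \<le> e' * norm x" by (rule bcalc_norm_le) (use g(2) in \<open>auto intro: less_imp_le\<close>)
      also have "\<dots> < e / 4" using e by (simp add: e'_def divide_less_eq add_nonneg_pos)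
      finally show ?thesis by (simp add: bcalc_diff)
    qed
    show "\<exists>M. \<forall>m\<ge>M. \<forall>n\<ge>M. dist (bcalc m \<phi> x) (bcalc n \<phi> x) < e"
    proof (intro exI allI impI)
      fix m n assume mn: "m \<ge> M" "n \<ge> M"
      have "bcalc m \<phi> x - bcalc n \<phi> x = (bcalc m \<phi> x - bcalc m g x) + (bcalc m g x - bcalc n g x) - (bcalc n \<phi> x - bcalc n g x)"
        by simp
      from arg_cong[OF this, of norm]
      have "norm (bcalc m \<phi> x - bcalc n \<phi> x) \<le> norm (bcalc m \<phi> x - bcalc m g x) + norm (bcalc m g x - bcalc n g x) + norm (bcalc n \<phi> x - bcalc n g x)"
        using norm_triangle_ineq4[of "(bcalc m \<phi> x - bcalc m g x) + (bcalc m g x - bcalc n g x)" "bcalc n \<phi> x - bcalc n g x"]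
          norm_triangle_ineq[of "bcalc m \<phi> x - bcalc m g x" "bcalc m g x - bcalc n g x"] by linarith
      then show "dist (bcalc m \<phi> x) (bcalc n \<phi> x) < e" using M[OF mn] app[of m] app[of n] by (simp add: dist_norm)
    qed
  qed
  then show ?thesis by (rule Cauchy_convergent)
qed

lemma calc_tendsto:
  assumes "continuous_on {0..1} \<phi>"
  shows "(\<lambda>n. bcalc n \<phi> x) \<longlonglongrightarrow> calc \<phi> x"
  unfolding calc_def using bcalc_convergent[OF assms] by (simp add: convergent_LIMSEQ_iff)

lemma calc_eqI: "(\<lambda>n. bcalc n \<phi> x) \<longlonglongrightarrow> y \<Longrightarrow> calc \<phi> x = y"
  unfolding calc_def by (rule limI)

lemma calc_norm_le:
  assumes "continuous_on {0..1} \<phi>" "\<And>b. b \<in> {0..1} \<Longrightarrow> \<bar>\<phi> b\<bar> \<le> S"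
  shows "norm (calc \<phi> x) \<le> S * norm x"
  by (rule LIMSEQ_le_const2[OF tendsto_norm[OF calc_tendsto[OF assms(1)]]])
     (use bcalc_norm_le[OF assms(2)] in auto)

lemma calc_diff:
  assumes "continuous_on {0..1} \<phi>" "continuous_on {0..1} \<psi>"
  shows "calc (\<lambda>b. \<phi> b - \<psi> b) x = calc \<phi> x - calc \<psi> x"
  by (rule calc_eqI) (auto simp: bcalc_diff intro!: tendsto_intros calc_tendsto assms)

lemma calc_one: "calc (\<lambda>b. 1) x = x"
  by (rule calc_eqI) (simp add: bcalc_one)

text \<open>Plays the role of multiplicativity: the products formed later all have \<open>b\<close>
  as one factor.\<close>

lemma calc_times_B:
  assumes "continuous_on {0..1} \<phi>"
  shows "calc (\<lambda>b. b * \<phi> b) x = B (calc \<phi> x)"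
proof (rule calc_eqI)
  from tendsto_diff[OF B.tendsto[OF calc_tendsto[OF assms]] bcalc_times_B[OF assms], of x x]
  have "(\<lambda>n. bcalc (Suc n) (\<lambda>b. b * \<phi> b) x) \<longlonglongrightarrow> B (calc \<phi> x)" by simp
  then show "(\<lambda>n. bcalc n (\<lambda>b. b * \<phi> b) x) \<longlonglongrightarrow> B (calc \<phi> x)" by (rule LIMSEQ_imp_Suc)
qed

lemma calc_id: "calc (\<lambda>b. b) x = B x"
  using calc_times_B[of "\<lambda>b. 1" x] by (simp add: calc_one)

lemma bcalc_commute: "bcalc n \<phi> (B x) = B (bcalc n \<phi> x)"
  by (simp add: bcalc_def B.sum B.scaleR opoly_commute)

lemma calc_commute:
  assumes "continuous_on {0..1} \<phi>"
  shows "calc \<phi> (B x) = B (calc \<phi> x)"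
  by (rule calc_eqI) (simp add: bcalc_commute B.tendsto calc_tendsto assms)

lemma bcalc_linear: "bcalc n \<phi> (x + y) = bcalc n \<phi> x + bcalc n \<phi> y" "bcalc n \<phi> (c *\<^sub>R x) = c *\<^sub>R bcalc n \<phi> x"
  by (simp_all add: bcalc_def opoly_linear scaleR_add_right sum.distrib scaleR_sum_right mult.commute)

lemma calc_add_arg:
  assumes "continuous_on {0..1} \<phi>"
  shows "calc \<phi> (x + y) = calc \<phi> x + calc \<phi> y"
  by (rule calc_eqI) (auto simp: bcalc_linear intro!: tendsto_intros calc_tendsto assms)

end

subsection \<open>Mittag-Leffler functions\<close>

text \<open>Only the part of Euler's integral over the interval from \<open>X\<close> to
  \<open>X + 1\<close> is kept. As \<open>X\<close> is free, the Gamma function outgrows every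
  exponential.\<close>

lemma Gamma_ge_exponential:
  fixes s X :: real
  assumes "s \<ge> 1" "X \<ge> 1"
  shows "X powr (s - 1) \<le> exp (X + 1) * Gamma s"
proof -
  have I: "((\<lambda>t. t powr (s - 1) / exp t) has_integral Gamma s) {0..}"
    using Gamma_integral_real[of s] assms by simp
  have c: "((\<lambda>t. X powr (s - 1) / exp (X + 1)) has_integral (X + 1 - X) *\<^sub>R (X powr (s - 1) / exp (X + 1))) {X..X+1}"
    using has_integral_const_real[of "X powr (s - 1) / exp (X + 1)" X "X+1"] by simp
  have "((\<lambda>t. if t \<in> {X..X+1} then X powr (s - 1) / exp (X + 1) else 0) has_integral X powr (s - 1) / exp (X + 1)) {0..}"
    using c assms by (subst has_integral_restrict) auto
  then have "X powr (s - 1) / exp (X + 1) \<le> Gamma s"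
    by (rule has_integral_le[OF _ I]) (use assms in \<open>auto intro!: frac_le powr_mono2\<close>)
  then show ?thesis by (simp add: field_simps)
qed

text \<open>Comparison with a geometric series of ratio 1/2, through the exponential lower bound on
  the Gamma function for a suitable base.\<close>

lemma summable_ML:
  fixes \<alpha> \<delta> x :: real
  assumes "0 < \<alpha>" "0 < \<delta>"
  shows "summable (\<lambda>n. x ^ n / Gamma (\<alpha> * n + \<delta>))"
proof -
  \<comment> \<open>Chosen so that \<open>X powr \<alpha>\<close> is at least twice the absolute
    value of \<open>x\<close>; the maximum with 1 meets the hypothesis of
    \<open>Gamma_ge_exponential\<close>.\<close>
  define X where "X = max 1 ((2 * \<bar>x\<bar>) powr (1/\<alpha>))"
  have X1: "X \<ge> 1" by (simp add: X_def)
  have Xa: "X powr \<alpha> \<ge> 2 * \<bar>x\<bar>"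
  proof -
    have "((2 * \<bar>x\<bar>) powr (1/\<alpha>)) powr \<alpha> \<le> X powr \<alpha>"
      by (rule powr_mono2) (use assms in \<open>auto simp: X_def\<close>)
    then show ?thesis using assms by (simp add: powr_powr)
  qed
  define C where "C = exp (X + 1) * X powr (1 - \<delta>)"
  \<comment> \<open>From this index on the argument of the Gamma function is at least 1, where the
    lower bound applies.\<close>
  obtain N :: nat where N: "1 / \<alpha> < real N" using reals_Archimedean2 by blast
  have "norm (x ^ n / Gamma (\<alpha> * n + \<delta>)) \<le> C * (1/2) ^ n" if "n \<ge> N" for n
  proof -
    have "1 / \<alpha> < real n" using N that by linarith
    then have an: "\<alpha> * n + \<delta> \<ge> 1" using assms by (simp add: field_simps)
    have G: "Gamma (\<alpha> * n + \<delta>) > 0" using an by (intro Gamma_real_pos) auto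
    have le: "X powr (\<alpha> * n + \<delta> - 1) \<le> exp (X + 1) * Gamma (\<alpha> * n + \<delta>)"
      using Gamma_ge_exponential[OF an X1] .
    moreover have "X powr (\<alpha> * n + \<delta> - 1) * X powr (1 - \<delta>) = (X powr \<alpha>) ^ n"
    proof -
      have "X powr (\<alpha> * n + \<delta> - 1) * X powr (1 - \<delta>) = X powr (\<alpha> * n)"
        by (simp flip: powr_add)
      also have "\<dots> = (X powr \<alpha>) powr n" by (simp add: powr_powr)
      also have "\<dots> = (X powr \<alpha>) ^ n" using X1 by (subst powr_realpow) auto
      finally show ?thesis .
    qed
    ultimately have "(X powr \<alpha>) ^ n \<le> exp (X + 1) * Gamma (\<alpha> * n + \<delta>) * X powr (1 - \<delta>)"
      using mult_right_mono[OF le, of "X powr (1 - \<delta>)"] by simp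
    then have "(X powr \<alpha>) ^ n \<le> C * Gamma (\<alpha> * n + \<delta>)"
      by (simp only: C_def mult_ac)
    moreover have "(2 * \<bar>x\<bar>) ^ n \<le> (X powr \<alpha>) ^ n" by (rule power_mono) (use Xa in auto)
    ultimately have "2 ^ n * \<bar>x\<bar> ^ n \<le> C * Gamma (\<alpha> * n + \<delta>)" by (simp add: power_mult_distrib)
    then show ?thesis using G by (simp add: field_simps power_abs abs_mult)
  qed
  then have "\<exists>N. \<forall>n\<ge>N. norm (x ^ n / Gamma (\<alpha> * n + \<delta>)) \<le> C * (1/2) ^ n" by blast
  then show ?thesis
    by (intro summable_comparison_test[OF _ summable_mult[OF summable_geometric[of "1/2::real"]]]) auto
qed

text \<open>The entire function with \<open>E\<^sub>\<alpha>\<^sub>,\<^sub>\<delta>(-x)\<close> as value at \<open>x\<close>, \<open>E\<^sub>\<alpha>\<^sub>,\<^sub>\<delta>\<close> being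
  the two-parameter Mittag-Leffler function.\<close>

definition ml :: "real \<Rightarrow> real \<Rightarrow> real \<Rightarrow> real" where
  "ml \<alpha> \<delta> x = (\<Sum>n. (-x) ^ n / Gamma (\<alpha> * n + \<delta>))"

text \<open>The family closed under fractional integration: integrating to order
  \<open>\<beta>\<close> replaces \<open>\<delta>\<close> by \<open>\<beta> + \<delta>\<close>. The
  member with \<open>\<delta> = 1\<close> is the relaxation function with rate \<open>l\<close>, the
  one with \<open>\<delta> = \<alpha>\<close> the resolvent kernel of the Volterra equation.\<close>

definition mlk :: "real \<Rightarrow> real \<Rightarrow> real \<Rightarrow> real \<Rightarrow> real" where
  "mlk \<alpha> \<delta> l t = t powr (\<delta> - 1) * ml \<alpha> \<delta> (l * t powr \<alpha>)"

lemma isCont_ml: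
  fixes \<alpha> \<delta> x :: real
  assumes "0 < \<alpha>" "0 < \<delta>"
  shows "isCont (ml \<alpha> \<delta>) x"
proof -
  have s: "summable (\<lambda>n. (1 / Gamma (\<alpha> * n + \<delta>)) * K ^ n)" for K
    using summable_ML[OF assms, of K] by simp
  have "isCont (\<lambda>x. \<Sum>n. (1 / Gamma (\<alpha> * n + \<delta>)) * x ^ n) (-x)"
    by (rule isCont_powser[OF s[of "1 + \<bar>x\<bar>"]]) auto
  then have "isCont (\<lambda>x. \<Sum>n. (1 / Gamma (\<alpha> * n + \<delta>)) * (-x) ^ n) x"
    by (rule isCont_o2[where f = uminus, rotated]) auto
  then show ?thesis by (simp add: ml_def[abs_def])
qed

lemma continuous_on_ml:
  assumes "0 < \<alpha>" "0 < \<delta>" shows "continuous_on A (ml \<alpha> \<delta>)"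
  using isCont_ml[OF assms] by (simp add: continuous_at_imp_continuous_on)

lemma ml_0: "0 < \<alpha> \<Longrightarrow> ml \<alpha> \<delta> 0 = 1 / Gamma \<delta>"
  unfolding ml_def by (subst suminf_finite[of "{0}"]) auto

lemma continuous_on_mlk:
  assumes "0 < \<alpha>" "0 < \<delta>" shows "continuous_on {0<..} (mlk \<alpha> \<delta> l)"
  unfolding mlk_def[abs_def]
  by (intro continuous_intros continuous_on_compose2[OF continuous_on_ml[OF assms, of UNIV]]) auto

lemma mlk_sums:
  fixes \<alpha> \<delta> l t :: real
  assumes "0 < \<alpha>" "0 < \<delta>" "0 < t"
  shows "(\<lambda>n. (-l) ^ n * (t powr (\<alpha> * n + \<delta> - 1) / Gamma (\<alpha> * n + \<delta>))) sums mlk \<alpha> \<delta> l t"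
proof -
  have "(\<lambda>n. (-(l * t powr \<alpha>)) ^ n / Gamma (\<alpha> * n + \<delta>)) sums ml \<alpha> \<delta> (l * t powr \<alpha>)"
    unfolding ml_def by (rule summable_sums) (rule summable_ML[OF assms(1,2)])
  then have "(\<lambda>n. t powr (\<delta> - 1) * ((-(l * t powr \<alpha>)) ^ n / Gamma (\<alpha> * n + \<delta>))) sums mlk \<alpha> \<delta> l t"
    unfolding mlk_def by (rule sums_mult)
  moreover have "t powr (\<delta> - 1) * ((-(l * t powr \<alpha>)) ^ n / Gamma (\<alpha> * n + \<delta>))
      = (-l) ^ n * (t powr (\<alpha> * n + \<delta> - 1) / Gamma (\<alpha> * n + \<delta>))" for n
  proof -
    have "(t powr \<alpha>) ^ n = t powr (\<alpha> * n)"
      using assms by (simp add: powr_powr flip: powr_realpow)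
    moreover have "t powr (\<alpha> * n + \<delta> - 1) = t powr (\<alpha> * n) * t powr (\<delta> - 1)"
      by (simp add: add_diff_eq flip: powr_add)
    moreover have "(-(l * t powr \<alpha>)) ^ n = (-l)^n * (t powr \<alpha>)^n"
      by (metis mult_minus_left power_mult_distrib)
    ultimately show ?thesis by simp
  qed
  ultimately show ?thesis by (simp only:)
qed

text \<open>Removing the first term of the series shifts \<open>\<delta>\<close> by
  \<open>\<alpha>\<close>. With the fractional integral below, this is the Volterra equation for
  \<open>mlk\<close>.\<close>

lemma mlk_rec:
  assumes "0 < \<alpha>" "0 < \<delta>" "0 < t"
  shows "mlk \<alpha> \<delta> l t = t powr (\<delta> - 1) / Gamma \<delta> - l * mlk \<alpha> (\<alpha> + \<delta>) l t"
proof -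
  let ?f = "\<lambda>n. (-l) ^ n * (t powr (\<alpha> * real n + \<delta> - 1) / Gamma (\<alpha> * real n + \<delta>))"
  have "(\<lambda>n. ?f (Suc n)) sums (mlk \<alpha> \<delta> l t - ?f 0)"
    using mlk_sums[OF assms, of l] by (subst sums_Suc_iff) (simp only: diff_add_cancel)
  moreover have "(\<lambda>n. (-l) * ((-l) ^ n * (t powr (\<alpha> * n + (\<alpha> + \<delta>) - 1) / Gamma (\<alpha> * n + (\<alpha> + \<delta>)))))
     sums ((-l) * mlk \<alpha> (\<alpha> + \<delta>) l t)"
    by (rule sums_mult, rule mlk_sums) (use assms in auto)
  ultimately have "mlk \<alpha> \<delta> l t - ?f 0 = (-l) * mlk \<alpha> (\<alpha> + \<delta>) l t"
    by (intro sums_unique2) (simp_all add: algebra_simps)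
  then show ?thesis by simp
qed

text \<open>Affine substitution in the Beta integral: the two factors contribute the exponent
  \<open>a + b - 2\<close> of \<open>t - u\<close>, and the substitution itself contributes one
  more.\<close>

lemma Beta_integral_shifted:
  fixes a b u t :: real
  assumes "0 < a" "0 < b" "u < t"
  shows "set_integrable lebesgue {u<..<t} (\<lambda>s. (t - s) powr (a - 1) * (s - u) powr (b - 1))"
    and "(LINT s:{u<..<t}|lebesgue. (t - s) powr (a - 1) * (s - u) powr (b - 1))
           = (t - u) powr (a + b - 1) * (Gamma a * Gamma b / Gamma (a + b))"
proof -
  let ?c = "t - u"
  have c: "?c > 0" using assms by simp
  have B: "((\<lambda>x. x powr (b - 1) * (1 - x) powr (a - 1)) has_integral Beta b a) (cbox 0 1)"
    using has_integral_Beta_real[OF assms(2,1)] by simp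
  have "((\<lambda>x. (1/?c * x + (-u/?c)) powr (b - 1) * (1 - (1/?c * x + (-u/?c))) powr (a - 1)) has_integral
          (1 / \<bar>1/?c\<bar> ^ DIM(real)) *\<^sub>R Beta b a)
        ((\<lambda>x. (1 / (1/?c)) *\<^sub>R x + - ((1 / (1/?c)) *\<^sub>R (-u/?c))) ` cbox 0 1)"
    using has_integral_affinity[OF B, of "1/?c" "-u/?c"] c by simp
  moreover have "(\<lambda>x. (1 / (1/?c)) *\<^sub>R x + - ((1 / (1/?c)) *\<^sub>R (-u/?c))) ` cbox 0 1 = {u..t}"
  proof -
    have "(\<lambda>x. (1 / (1/?c)) *\<^sub>R x + - ((1 / (1/?c)) *\<^sub>R (-u/?c))) = (\<lambda>x. ?c * x + u)"
      using c by simp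
    moreover have "(\<lambda>x. ?c * x + u) ` {0..1} = {u..t}" using image_affinity_atLeastAtMost[of ?c u 0 1] c by simp
    ultimately show ?thesis by (simp only: cbox_interval)
  qed
  ultimately have "((\<lambda>x. (1/?c * x + (-u/?c)) powr (b - 1) * (1 - (1/?c * x + (-u/?c))) powr (a - 1))
        has_integral ?c * Beta b a) {u..t}" using c by simp
  then have "((\<lambda>x. (1/?c * x + (-u/?c)) powr (b - 1) * (1 - (1/?c * x + (-u/?c))) powr (a - 1))
        has_integral ?c * Beta b a) {u<..<t}"
    by (simp add: has_integral_Icc_iff_Ioo)
  then have "((\<lambda>x. ?c powr (a + b - 2) * ((1/?c * x + (-u/?c)) powr (b - 1) * (1 - (1/?c * x + (-u/?c))) powr (a - 1)))
        has_integral ?c powr (a + b - 2) * (?c * Beta b a)) {u<..<t}"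
    by (rule has_integral_mult_right)
  moreover have "?c powr (a + b - 2) * ((1/?c * x + (-u/?c)) powr (b - 1) * (1 - (1/?c * x + (-u/?c))) powr (a - 1))
      = (t - x) powr (a - 1) * (x - u) powr (b - 1)" if "x \<in> {u<..<t}" for x
  proof -
    have 1: "1/?c * x + (-u/?c) = (x - u) / ?c" by (simp add: diff_divide_distrib)
    have "1 - (x - u) / ?c = ?c / ?c - (x - u) / ?c" using c by simp
    moreover have "?c - (x - u) = t - x" by simp
    ultimately have 2: "1 - (x - u) / ?c = (t - x) / ?c" by (simp only: diff_divide_distrib[symmetric])
    have 3: "?c powr (a + b - 2) = ?c powr (a - 1) * ?c powr (b - 1)"
      by (simp flip: powr_add)
    show ?thesis unfolding 1 2 3 using that c by (simp add: powr_divide)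
  qed
  ultimately have I: "((\<lambda>x. (t - x) powr (a - 1) * (x - u) powr (b - 1))
        has_integral ?c powr (a + b - 2) * (?c * Beta b a)) {u<..<t}"
    by (rule has_integral_eq[rotated])
  have "(\<lambda>x. (t - x) powr (a - 1) * (x - u) powr (b - 1)) absolutely_integrable_on {u<..<t}"
    by (rule nonnegative_absolutely_integrable_1) (use I in auto)
  then show ii: "set_integrable lebesgue {u<..<t} (\<lambda>s. (t - s) powr (a - 1) * (s - u) powr (b - 1))" .
  have "(LINT s:{u<..<t}|lebesgue. (t - s) powr (a - 1) * (s - u) powr (b - 1)) = ?c powr (a + b - 2) * (?c * Beta b a)"
    using set_lebesgue_integral_eq_integral(2)[OF ii] I by (simp add: integral_unique)
  also have "\<dots> = ?c powr (a + b - 1) * (Gamma a * Gamma b / Gamma (a + b))"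
  proof -
    have "?c powr (a + b - 1) = ?c powr (a + b - 2) * ?c powr 1" by (subst powr_add[symmetric]) simp
    then show ?thesis using c by (simp add: Beta_def add.commute mult_ac)
  qed
  finally show "(LINT s:{u<..<t}|lebesgue. (t - s) powr (a - 1) * (s - u) powr (b - 1))
           = (t - u) powr (a + b - 1) * (Gamma a * Gamma b / Gamma (a + b))" .
qed

text \<open>Termwise integration: each power of the series is a Beta integral, and the quotient of
  Gamma values turns it into the corresponding power of the series with shifted parameter.\<close>

lemma Riemann_Liouville_mlk:
  assumes "0 < \<alpha>" "0 < \<beta>" "0 < \<delta>" "0 < t"
  shows "set_integrable lebesgue {0<..<t} (\<lambda>s. (t - s) powr (\<beta> - 1) * mlk \<alpha> \<delta> l s)"
    and "(LINT s:{0<..<t}|lebesgue. (t - s) powr (\<beta> - 1) * mlk \<alpha> \<delta> l s) = Gamma \<beta> * mlk \<alpha> (\<beta> + \<delta>) l t"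
proof -
  define f where "f n s = indicator {0<..<t} s * ((-l) ^ n * ((t - s) powr (\<beta> - 1) * (s - 0) powr (\<alpha> * real n + \<delta> - 1)) / Gamma (\<alpha> * n + \<delta>))"
    for n :: nat and s :: real
  have d: "\<alpha> * real n + \<delta> > 0" for n using assms by (simp add: add_nonneg_pos)
  note B = Beta_integral_shifted[OF assms(2) d assms(4)]
  have int: "integrable lebesgue (f n)" for n
    using integrable_mult_right[OF B(1)[of n, unfolded set_integrable_def], of "(-l)^n / Gamma (\<alpha> * n + \<delta>)"]
    by (simp add: f_def[abs_def] mult_ac)
  have Gp: "Gamma (\<alpha> * real n + \<delta>) > 0" for n using d by (rule Gamma_real_pos)
  have val: "(\<integral>s. f n s \<partial>lebesgue) = Gamma \<beta> * ((-l) ^ n * (t powr (\<alpha> * n + (\<beta> + \<delta>) - 1) / Gamma (\<alpha> * n + (\<beta> + \<delta>))))" for n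
  proof -
    have "(\<integral>s. f n s \<partial>lebesgue) = (-l)^n / Gamma (\<alpha> * n + \<delta>) * (LINT s:{0<..<t}|lebesgue. (t - s) powr (\<beta> - 1) * (s - 0) powr (\<alpha> * n + \<delta> - 1))"
      unfolding set_lebesgue_integral_def
      apply (subst integral_mult_right_zero[symmetric])
      by (intro Bochner_Integration.integral_cong) (auto simp: f_def)
    then show ?thesis unfolding B(2) using Gp[of n] by (simp add: algebra_simps)
  qed
  have normval: "(\<integral>s. norm (f n s) \<partial>lebesgue) = Gamma \<beta> * (\<bar>l\<bar> ^ n * (t powr (\<alpha> * n + (\<beta> + \<delta>) - 1) / Gamma (\<alpha> * n + (\<beta> + \<delta>))))" for n
  proof -
    have "(\<integral>s. norm (f n s) \<partial>lebesgue) = \<bar>l\<bar>^n / Gamma (\<alpha> * n + \<delta>) * (LINT s:{0<..<t}|lebesgue. (t - s) powr (\<beta> - 1) * (s - 0) powr (\<alpha> * n + \<delta> - 1))"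
      unfolding set_lebesgue_integral_def
      apply (subst integral_mult_right_zero[symmetric])
      using Gp[of n] by (intro Bochner_Integration.integral_cong) (auto simp: f_def abs_mult power_abs mult_ac)
    then show ?thesis unfolding B(2) using Gp[of n] by (simp add: algebra_simps)
  qed
  have summ: "AE x in lebesgue. summable (\<lambda>n. norm (f n x))"
  proof (rule AE_I2)
    fix x show "summable (\<lambda>n. norm (f n x))"
    proof (cases "x \<in> {0<..<t}")
      case True
      have "summable (\<lambda>n. (t - x) powr (\<beta> - 1) * (\<bar>l\<bar> ^ n * (x powr (\<alpha> * n + \<delta> - 1) / Gamma (\<alpha> * n + \<delta>))))"
        using sums_summable[OF mlk_sums[OF assms(1,3), of x "-\<bar>l\<bar>"]] True by (intro summable_mult) auto
      moreover have "norm (f n x) = (t - x) powr (\<beta> - 1) * (\<bar>l\<bar> ^ n * (x powr (\<alpha> * n + \<delta> - 1) / Gamma (\<alpha> * n + \<delta>)))" for n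
        using True Gp[of n] by (simp add: f_def abs_mult power_abs)
      ultimately show ?thesis by simp
    qed (simp add: f_def)
  qed
  \<comment> \<open>With the rate replaced by minus its absolute value the series has nonnegative
    terms, so absolute convergence of the integrated series is again convergence of an
    \<open>mlk\<close> series.\<close>
  have summ2: "summable (\<lambda>n. \<integral>s. norm (f n s) \<partial>lebesgue)"
    unfolding normval
    using sums_summable[OF mlk_sums[OF assms(1) _ assms(4), of "\<beta> + \<delta>" "-\<bar>l\<bar>"]] assms by (intro summable_mult) auto
  have eq: "(\<Sum>n. f n s) = indicator {0<..<t} s * ((t - s) powr (\<beta> - 1) * mlk \<alpha> \<delta> l s)" for s
  proof (cases "s \<in> {0<..<t}")
    case True
    have "(\<lambda>n. (t - s) powr (\<beta> - 1) * ((-l) ^ n * (s powr (\<alpha> * n + \<delta> - 1) / Gamma (\<alpha> * n + \<delta>)))) sums ((t - s) powr (\<beta> - 1) * mlk \<alpha> \<delta> l s)"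
      using True assms by (intro sums_mult mlk_sums) auto
    then have "f n s = (t - s) powr (\<beta> - 1) * ((-l) ^ n * (s powr (\<alpha> * n + \<delta> - 1) / Gamma (\<alpha> * n + \<delta>)))" for n
      using True by (simp add: f_def)
    then show ?thesis using True \<open>_ sums _\<close> by (simp add: sums_iff)
  qed (simp add: f_def)
  have "integrable lebesgue (\<lambda>s. \<Sum>n. f n s)"
    by (rule integrable_suminf[OF int summ summ2])
  then show "set_integrable lebesgue {0<..<t} (\<lambda>s. (t - s) powr (\<beta> - 1) * mlk \<alpha> \<delta> l s)"
    unfolding eq set_integrable_def by simp
  have "(\<lambda>n. \<integral>s. f n s \<partial>lebesgue) sums (\<integral>s. (\<Sum>n. f n s) \<partial>lebesgue)"
    by (rule sums_integral[OF int summ summ2])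
  moreover have "(\<lambda>n. \<integral>s. f n s \<partial>lebesgue) sums (Gamma \<beta> * mlk \<alpha> (\<beta> + \<delta>) l t)"
    unfolding val using assms by (intro sums_mult mlk_sums) auto
  ultimately have "(\<integral>s. (\<Sum>n. f n s) \<partial>lebesgue) = Gamma \<beta> * mlk \<alpha> (\<beta> + \<delta>) l t"
    by (rule sums_unique2)
  then show "(LINT s:{0<..<t}|lebesgue. (t - s) powr (\<beta> - 1) * mlk \<alpha> \<delta> l s) = Gamma \<beta> * mlk \<alpha> (\<beta> + \<delta>) l t"
    unfolding eq set_lebesgue_integral_def by simp
qed


section \<open>Positivity, monotonicity and decay of the Mittag-Leffler function\<close>

lemma Gamma_plus1_pos:
  fixes a :: real
  assumes "0 < a" shows "Gamma (a + 1) = a * Gamma a"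
  using assms by (intro Gamma_plus1) (auto elim!: nonpos_Ints_cases)

lemma LINT_nonneg:
  fixes f :: "'a \<Rightarrow> real"
  shows "(\<And>x. x \<in> A \<Longrightarrow> 0 \<le> f x) \<Longrightarrow> 0 \<le> (LINT x:A|M. f x)"
  unfolding set_lebesgue_integral_def
  by (rule Bochner_Integration.integral_nonneg) (auto simp: indicator_def)

lemma set_integrable_subinterval:
  fixes f :: "real \<Rightarrow> real"
  assumes "set_integrable lebesgue A f" "B \<subseteq> A" "B \<in> sets lebesgue"
  shows "set_integrable lebesgue B f"
  using assms set_integrable_subset by blast

lemma LINT_split:
  fixes f :: "real \<Rightarrow> real"
  assumes "set_integrable lebesgue {0<..<c} f" "0 < b" "b < c"
  shows "(LINT s:{0<..<c}|lebesgue. f s) = (LINT s:{0<..<b}|lebesgue. f s) + (LINT s:{b..<c}|lebesgue. f s)"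
proof -
  have eq: "{0<..<c} = {0<..<b} \<union> {b..<c}" using assms by auto
  show ?thesis unfolding eq
    by (rule set_integral_Un) (use assms in \<open>auto intro!: set_integrable_subinterval[OF assms(1)]\<close>)
qed

text \<open>The Beta integral with one exponent zero. The interval is half-open because it is the
  right-hand piece in \<open>LINT_split\<close>.\<close>

lemma LINT_power_kernel:
  fixes a b t :: real
  assumes "0 < a" "b < t"
  shows "set_integrable lebesgue {b..<t} (\<lambda>s. (t - s) powr (a - 1))"
    and "(LINT s:{b..<t}|lebesgue. (t - s) powr (a - 1)) = (t - b) powr a / a"
proof -
  have G: "Gamma (a + 1) = a * Gamma a" using assms(1) by (rule Gamma_plus1_pos)
  have ae: "AE s in lebesgue. s \<noteq> b" by (rule AE_I[of _ _ "{b}"]) auto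
  note B = Beta_integral_shifted[of a 1 b t, OF assms(1) zero_less_one assms(2)]
  have 1: "AE s in lebesgue. indicator {b..<t} s *\<^sub>R (t - s) powr (a - 1) = indicator {b<..<t} s *\<^sub>R ((t - s) powr (a - 1) * (s - b) powr (1 - 1))"
    using ae by eventually_elim (auto simp: indicator_def)
  have m: "(\<lambda>s. indicator {b..<t} s *\<^sub>R (t - s) powr (a - 1)) \<in> borel_measurable lebesgue"
    by (intro borel_measurable_scaleR borel_measurable_indicator measurable_completion) auto
  have m2: "(\<lambda>s. indicator {b<..<t} s *\<^sub>R ((t - s) powr (a - 1) * (s - b) powr (1 - 1))) \<in> borel_measurable lebesgue"
    using B(1) unfolding set_integrable_def by auto
  show "set_integrable lebesgue {b..<t} (\<lambda>s. (t - s) powr (a - 1))"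
    using B(1) integrable_cong_AE[OF m m2 1] unfolding set_integrable_def by simp
  have "(LINT s:{b..<t}|lebesgue. (t - s) powr (a - 1)) = (t - b) powr a * (Gamma a * 1 / Gamma (a + 1))"
    using B(2) integral_cong_AE[OF m m2 1] unfolding set_lebesgue_integral_def by simp
  then show "(LINT s:{b..<t}|lebesgue. (t - s) powr (a - 1)) = (t - b) powr a / a"
    using G Gamma_real_pos[OF assms(1)] by (simp add: field_simps)
qed

text \<open>At a first zero \<open>t0\<close> of \<open>r = mlk \<alpha> \<alpha> l\<close>, subtract from the Volterra equation at \<open>t0\<close> the one
  at \<open>t < t0\<close> scaled by \<open>(t/t0) powr (1-\<alpha>)\<close>: by log-convexity of the kernel the memory on
  \<open>{0<..<t}\<close> has a sign, so \<open>r t\<close> is controlled by the values of \<open>r\<close> on \<open>{t..t0}\<close>.\<close>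

lemma mlk_resolvent_pos:
  assumes a: "0 < \<alpha>" "\<alpha> < 1" and l: "0 < l" and t: "0 < t"
  shows "0 < mlk \<alpha> \<alpha> l t"
proof (rule ccontr)
  define r where "r = mlk \<alpha> \<alpha> l"
  assume "\<not> 0 < mlk \<alpha> \<alpha> l t"
  then have rt: "r t \<le> 0" by (simp add: r_def)
  \<comment> \<open>Dropping the factor \<open>s powr (\<alpha> - 1)\<close>, singular at 0, keeps
    the sign and gives a function continuous up to 0 and positive there, which therefore has a first
    zero if it fails to be positive.\<close>
  define p where "p s = ml \<alpha> \<alpha> (l * s powr \<alpha>)" for s
  have contp: "continuous_on {0..} p"
  proof -
    have "continuous_on {0..} (\<lambda>s. l * s powr \<alpha>)"
      using a by (intro continuous_on_mult continuous_on_const continuous_on_powr') auto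
    then show ?thesis
      unfolding p_def[abs_def] using continuous_on_compose2[OF continuous_on_ml[OF a(1) a(1), of UNIV]] by auto
  qed
  have rp: "r s = s powr (\<alpha> - 1) * p s" for s by (simp add: r_def mlk_def p_def)
  have r_sgn: "r s > 0 \<longleftrightarrow> p s > 0" "r s \<ge> 0 \<longleftrightarrow> p s \<ge> 0" if "s > 0" for s
    using that by (auto simp: rp zero_less_mult_iff zero_le_mult_iff)
  have contr: "continuous_on {0<..} r" unfolding r_def using a by (intro continuous_on_mlk)
  define Z where "Z = {s \<in> {0..t}. p s \<le> 0}"
  have "closed Z" unfolding Z_def
    by (rule continuous_on_closed_Collect_le) (auto intro: continuous_on_subset[OF contp])
  moreover have "t \<in> Z" using rt r_sgn[of t] t by (auto simp: Z_def)
  moreover have bdd: "bdd_below Z" unfolding Z_def by (rule bdd_belowI[of _ 0]) auto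
  ultimately have t0Z: "Inf Z \<in> Z" using closed_contains_Inf[of Z] by auto
  define t0 where "t0 = Inf Z"
  have p0: "p 0 > 0" using a by (simp add: p_def ml_0 Gamma_real_pos)
  have t0: "t0 > 0" "t0 \<le> t" "p t0 \<le> 0"
  proof -
    have "t0 \<noteq> 0" using t0Z p0 unfolding t0_def by (auto simp: Z_def)
    then show "t0 > 0" "t0 \<le> t" "p t0 \<le> 0" using t0Z by (auto simp: Z_def t0_def)
  qed
  have ppos: "p s > 0" if "0 \<le> s" "s < t0" for s
  proof (rule ccontr)
    assume "\<not> p s > 0"
    then have "s \<in> Z" using that t0 by (auto simp: Z_def)
    then have "t0 \<le> s" unfolding t0_def using bdd by (rule cInf_lower)
    then show False using that by simp
  qed
  have rpos: "r s > 0" if "0 < s" "s < t0" for s using ppos[of s] r_sgn(1)[of s] that by auto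
  have rt0: "r t0 \<le> 0" using t0 r_sgn(1)[of t0] by auto
  define g where "g s = s powr (\<alpha> - 1) / Gamma \<alpha>" for s
  have Gp: "Gamma \<alpha> > 0" using a by (simp add: Gamma_real_pos)
  have volt: "r s = g s - l / Gamma \<alpha> * (LINT u:{0<..<s}|lebesgue. (s - u) powr (\<alpha> - 1) * r u)"
    and vint: "set_integrable lebesgue {0<..<s} (\<lambda>u. (s - u) powr (\<alpha> - 1) * r u)" if "s > 0" for s
    using Riemann_Liouville_mlk[OF a(1) a(1) a(1) that, of l] mlk_rec[OF a(1) a(1) that, of l] Gp
    by (simp_all add: r_def g_def)
  \<comment> \<open>A window so short that the memory accumulated in it is less than half the
    maximum of \<open>r\<close> there. The bound by \<open>t0/2\<close> makes the factor
    \<open>q\<close> below at least 1/2.\<close>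
  obtain d where d: "0 < d" "d < t0" "l / Gamma (\<alpha> + 1) * d powr \<alpha> < 1/2" "d \<le> t0/2"
  proof -
    have lim: "((\<lambda>d. l / Gamma (\<alpha> + 1) * d powr \<alpha>) \<longlongrightarrow> l / Gamma (\<alpha> + 1) * 0 powr \<alpha>) (at_right 0)"
      using a by (intro tendsto_intros) (auto simp: eventually_at_filter)
    have "eventually (\<lambda>d. l / Gamma (\<alpha> + 1) * d powr \<alpha> < 1/2) (at_right 0)"
      using order_tendstoD(2)[OF lim, of "1/2"] by simp
    moreover have "eventually (\<lambda>d. d \<in> {0<..<t0/2}) (at_right 0)"
      using t0 by (intro eventually_at_right_real) auto
    ultimately have "eventually (\<lambda>d. l / Gamma (\<alpha> + 1) * d powr \<alpha> < 1/2 \<and> d \<in> {0<..<t0/2}) (at_right 0)"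
      by eventually_elim auto
    from eventually_happens'[OF trivial_limit_at_right_real this]
    obtain d where "l / Gamma (\<alpha> + 1) * d powr \<alpha> < 1/2 \<and> d \<in> {0<..<t0/2}" by blast
    then show ?thesis using that[of d] t0 by auto
  qed
  have "{t0 - d..t0} \<subseteq> {0<..}" using d by auto
  then have contd: "continuous_on {t0 - d..t0} r" by (rule continuous_on_subset[OF contr])
  \<comment> \<open>The comparison time is the maximum point of \<open>r\<close> on the window, so
    that the memory after \<open>t1\<close> is bounded by \<open>r t1\<close> itself.\<close>
  obtain t1 where t1: "t1 \<in> {t0 - d..t0}" "\<And>s. s \<in> {t0 - d..t0} \<Longrightarrow> r s \<le> r t1"
    using continuous_attains_sup[OF compact_Icc _ contd] d by auto
  have "r (t0 - d) > 0" using rpos d by auto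
  then have rt1: "r t1 > 0" using t1(2)[of "t0 - d"] d by auto
  then have t1': "0 < t1" "t1 < t0" using t1(1) rt0 d by (auto simp: less_le)
  define q where "q = (t1 / t0) powr (1 - \<alpha>)"
  have q: "q \<ge> 1/2"
  proof -
    have "1/2 \<le> t1 / t0" using t1(1) d t0 by (simp add: field_simps)
    moreover have "t1 / t0 \<le> 1" using t1' t0 by simp
    ultimately have "t1 / t0 \<le> q" unfolding q_def
      using powr_mono'[of "1 - \<alpha>" 1 "t1/t0"] a t1' t0 by simp
    then show ?thesis using \<open>1/2 \<le> t1 / t0\<close> by linarith
  qed
  have qg: "q * g t1 = g t0"
  proof -
    have "q * t1 powr (\<alpha> - 1) = t0 powr (\<alpha> - 1)"
    proof -
      have "(1 - \<alpha>) + (\<alpha> - 1) = 0" by simp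
      have "q = t1 powr (1 - \<alpha>) * t0 powr (\<alpha> - 1)"
        unfolding q_def using t1' t0 by (simp add: powr_divide powr_minus_divide[of t0 "1-\<alpha>", simplified] )
      moreover have "t1 powr (1 - \<alpha>) * t1 powr (\<alpha> - 1) = 1" using t1' by (simp flip: powr_add)
      ultimately show ?thesis by (simp add: mult_ac)
    qed
    then show ?thesis by (simp add: g_def)
  qed
  \<comment> \<open>The quotient of \<open>t1 - u\<close> by \<open>t0 - u\<close> decreases in
    \<open>u\<close>, hence is largest at \<open>u = 0\<close>, where its power
    \<open>1 - \<alpha>\<close> is \<open>q\<close>.\<close>
  have kern: "(t0 - u) powr (\<alpha> - 1) \<le> q * (t1 - u) powr (\<alpha> - 1)" if "u \<in> {0<..<t1}" for u
  proof -
    have "((t1 - u) / (t0 - u)) powr (1 - \<alpha>) \<le> q" unfolding q_def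
    proof (rule powr_mono2)
      have "u * t1 \<le> u * t0" using that t1' by (intro mult_left_mono) auto
      then show "(t1 - u) / (t0 - u) \<le> t1 / t0" using that t1' t0 by (simp add: field_simps)
    qed (use that t1' a in auto)
    then have "((t1 - u) / (t0 - u)) powr (1 - \<alpha>) * (t1 - u) powr (\<alpha> - 1) \<le> q * (t1 - u) powr (\<alpha> - 1)"
      by (rule mult_right_mono) simp
    moreover have "((t1 - u) / (t0 - u)) powr (1 - \<alpha>) * (t1 - u) powr (\<alpha> - 1) = (t0 - u) powr (\<alpha> - 1)"
    proof -
      have "((t1 - u) / (t0 - u)) powr (1 - \<alpha>) = (t1 - u) powr (1 - \<alpha>) * (t0 - u) powr (\<alpha> - 1)"
        using that t1' by (simp add: powr_divide powr_minus_divide[of "t0 - u" "1-\<alpha>", simplified])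
      moreover have "(t1 - u) powr (1 - \<alpha>) * (t1 - u) powr (\<alpha> - 1) = 1" using that by (simp flip: powr_add)
      ultimately show ?thesis by (simp add: mult_ac)
    qed
    ultimately show ?thesis by simp
  qed
  have sub: "set_integrable lebesgue {0<..<t1} (\<lambda>u. (t0 - u) powr (\<alpha> - 1) * r u)"
            "set_integrable lebesgue {t1..<t0} (\<lambda>u. (t0 - u) powr (\<alpha> - 1) * r u)"
    using t1' by (auto intro!: set_integrable_subinterval[OF vint[OF t0(1)]])
  have A: "(LINT u:{0<..<t1}|lebesgue. (t0 - u) powr (\<alpha> - 1) * r u) \<le> q * (LINT u:{0<..<t1}|lebesgue. (t1 - u) powr (\<alpha> - 1) * r u)"
    unfolding set_integral_mult_right[symmetric]
  proof (rule set_integral_mono)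
    show "set_integrable lebesgue {0<..<t1} (\<lambda>u. q * ((t1 - u) powr (\<alpha> - 1) * r u))"
      using vint[OF t1'(1)] by (rule set_integrable_mult_right)
    fix u assume u: "u \<in> {0<..<t1}"
    have "(t0 - u) powr (\<alpha> - 1) * r u \<le> (q * (t1 - u) powr (\<alpha> - 1)) * r u"
      using kern[OF u] rpos[of u] u t1' by (intro mult_right_mono) auto
    then show "(t0 - u) powr (\<alpha> - 1) * r u \<le> q * ((t1 - u) powr (\<alpha> - 1) * r u)" by (simp add: mult_ac)
  qed (rule sub)
  have B: "(LINT u:{t1..<t0}|lebesgue. (t0 - u) powr (\<alpha> - 1) * r u) \<le> (LINT u:{t1..<t0}|lebesgue. r t1 * (t0 - u) powr (\<alpha> - 1))"
  proof (rule set_integral_mono)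
    show "set_integrable lebesgue {t1..<t0} (\<lambda>u. r t1 * (t0 - u) powr (\<alpha> - 1))"
      by (intro set_integrable_mult_right LINT_power_kernel) (use a t1' in auto)
    fix u assume u: "u \<in> {t1..<t0}"
    have "(t0 - u) powr (\<alpha> - 1) * r u \<le> (t0 - u) powr (\<alpha> - 1) * r t1"
      using t1(2)[of u] t1(1) u by (intro mult_left_mono) auto
    then show "(t0 - u) powr (\<alpha> - 1) * r u \<le> r t1 * (t0 - u) powr (\<alpha> - 1)" by (simp add: mult_ac)
  qed (rule sub)
  have B': "(LINT u:{t1..<t0}|lebesgue. (t0 - u) powr (\<alpha> - 1) * r u) \<le> r t1 * ((t0 - t1) powr \<alpha> / \<alpha>)"
    using B LINT_power_kernel(2)[of \<alpha> t1 t0] a t1' by simp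
  define I0 where "I0 = (LINT u:{0<..<t1}|lebesgue. (t0 - u) powr (\<alpha> - 1) * r u)"
  define I1 where "I1 = (LINT u:{0<..<t1}|lebesgue. (t1 - u) powr (\<alpha> - 1) * r u)"
  define I2 where "I2 = (LINT u:{t1..<t0}|lebesgue. (t0 - u) powr (\<alpha> - 1) * r u)"
  have e1: "r t1 = g t1 - l / Gamma \<alpha> * I1" using volt[OF t1'(1)] by (simp add: I1_def)
  have e0: "r t0 = g t0 - l / Gamma \<alpha> * (I0 + I2)"
    using volt[OF t0(1)] LINT_split[OF vint[OF t0(1)] t1'] by (simp add: I0_def I2_def)
  have lG: "l / Gamma \<alpha> > 0" using l Gp by simp
  \<comment> \<open>The sources at \<open>t1\<close> and \<open>t0\<close> match after scaling by
    \<open>q\<close>, the memory up to \<open>t1\<close> has the right sign, and the memory on the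
    window costs less than half of \<open>r t1\<close>; this contradicts
    \<open>q \<ge> 1/2\<close>.\<close>
  have "q * r t1 = g t0 - l / Gamma \<alpha> * (q * I1)" unfolding e1 qg[symmetric] by (simp add: algebra_simps)
  also have "\<dots> \<le> g t0 - l / Gamma \<alpha> * I0" using A lG unfolding I0_def I1_def by (intro diff_left_mono mult_left_mono) auto
  also have "\<dots> \<le> l / Gamma \<alpha> * I2" using e0 rt0 unfolding distrib_left by linarith
  also have "\<dots> \<le> l / Gamma \<alpha> * (r t1 * ((t0 - t1) powr \<alpha> / \<alpha>))" using B' lG unfolding I2_def by (intro mult_left_mono) auto
  also have "\<dots> = r t1 * (l / Gamma (\<alpha> + 1) * (t0 - t1) powr \<alpha>)"
    unfolding Gamma_plus1_pos[OF a(1)] by (simp add: mult_ac)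
  also have "\<dots> \<le> r t1 * (l / Gamma (\<alpha> + 1) * d powr \<alpha>)"
    using rt1 t1(1) a l t1' by (intro mult_left_mono powr_mono2) (auto simp: Gamma_real_pos)
  also have "\<dots> < r t1 * (1/2)" using d rt1 by (intro mult_strict_left_mono) auto
  also have "\<dots> \<le> r t1 * q" using q rt1 by (intro mult_left_mono) auto
  finally show False by (simp add: mult.commute)
qed

lemma mlk_1: "0 < t \<Longrightarrow> mlk \<alpha> 1 l t = ml \<alpha> 1 (l * t powr \<alpha>)"
  by (simp add: mlk_def)

text \<open>The relaxation function is the fractional integral of order \<open>1 - \<alpha>\<close>
  of the positive resolvent kernel. Evaluation at time 1 with rate \<open>x\<close> covers every
  argument.\<close>

lemma ml_nonneg:
  assumes a: "0 < \<alpha>" "\<alpha> < 1" and x: "0 \<le> x"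
  shows "0 \<le> ml \<alpha> 1 x"
proof (cases "x = 0")
  case False
  have "0 < 1 - \<alpha>" using a by simp
  note RL = Riemann_Liouville_mlk[OF a(1) this a(1) zero_less_one, of x]
  have "0 \<le> (LINT s:{0<..<1}|lebesgue. (1 - s) powr (1 - \<alpha> - 1) * mlk \<alpha> \<alpha> x s)"
    by (rule LINT_nonneg) (use mlk_resolvent_pos[OF a] x False in \<open>auto intro!: less_imp_le\<close>)
  then have "0 \<le> Gamma (1 - \<alpha>) * mlk \<alpha> 1 x 1" using RL(2) by simp
  then show ?thesis using Gamma_real_pos[OF \<open>0 < 1 - \<alpha>\<close>] by (simp add: mlk_1 zero_le_mult_iff)
qed (use a in \<open>simp add: ml_0\<close>)

text \<open>The relaxation function is 1 minus \<open>l\<close> times the ordinary integral of the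
  positive resolvent kernel.\<close>

lemma mlk_antimono:
  assumes a: "0 < \<alpha>" "\<alpha> < 1" and l: "0 < l" and s: "0 < s" "s \<le> t"
  shows "mlk \<alpha> 1 l t \<le> mlk \<alpha> 1 l s"
proof (cases "s = t")
  case False
  have I: "mlk \<alpha> 1 l u = 1 - l * (LINT v:{0<..<u}|lebesgue. mlk \<alpha> \<alpha> l v)"
    "set_integrable lebesgue {0<..<u} (mlk \<alpha> \<alpha> l)" if "u > 0" for u
  proof -
    note RL = Riemann_Liouville_mlk[OF a(1) zero_less_one a(1) that, of l]
    have eq: "indicator {0<..<u} v *\<^sub>R ((u - v) powr (1 - 1) * mlk \<alpha> \<alpha> l v) = indicator {0<..<u} v *\<^sub>R mlk \<alpha> \<alpha> l v" for v
      by (auto simp: indicator_def)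
    show "mlk \<alpha> 1 l u = 1 - l * (LINT v:{0<..<u}|lebesgue. mlk \<alpha> \<alpha> l v)"
      using mlk_rec[OF a(1) zero_less_one that, of l] RL(2) that
      unfolding set_lebesgue_integral_def eq by (simp add: add.commute)
    show "set_integrable lebesgue {0<..<u} (mlk \<alpha> \<alpha> l)"
      using RL(1) unfolding set_integrable_def eq .
  qed
  have "(LINT v:{0<..<t}|lebesgue. mlk \<alpha> \<alpha> l v) = (LINT v:{0<..<s}|lebesgue. mlk \<alpha> \<alpha> l v) + (LINT v:{s..<t}|lebesgue. mlk \<alpha> \<alpha> l v)"
    by (rule LINT_split[OF I(2)]) (use s False in auto)
  moreover have "0 \<le> (LINT v:{s..<t}|lebesgue. mlk \<alpha> \<alpha> l v)"
    by (rule LINT_nonneg) (use mlk_resolvent_pos[OF a l] s in \<open>auto intro!: less_imp_le\<close>)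
  ultimately show ?thesis using I(1)[of s] I(1)[of t] s l by (simp add: mult_left_mono)
qed simp

text \<open>By monotonicity the value at time 1 is the least on the unit interval. Replacing the
  relaxation function by it in the Volterra equation leaves only the integral of the kernel,
  \<open>1 / \<alpha>\<close>.\<close>

lemma ml_decay:
  assumes a: "0 < \<alpha>" "\<alpha> < 1" and x: "0 \<le> x"
  shows "(1 + x / Gamma (\<alpha> + 1)) * ml \<alpha> 1 x \<le> 1"
proof (cases "x = 0")
  case False
  then have x: "0 < x" using x by simp
  note RL = Riemann_Liouville_mlk[OF a(1) a(1) zero_less_one zero_less_one, of x]
  note K = LINT_power_kernel[OF a(1) zero_less_one]
  have sub: "set_integrable lebesgue {0<..<1} (\<lambda>s. (1 - s) powr (\<alpha> - 1))"
    by (rule set_integrable_subinterval[OF K(1)]) auto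
  have K': "(LINT s:{0<..<1}|lebesgue. (1 - s) powr (\<alpha> - 1)) = 1 / \<alpha>"
  proof -
    have eq: "indicator {0<..<1} s *\<^sub>R ((1 - s) powr (\<alpha> - 1) * (s - 0) powr (1 - 1)) = indicator {0<..<1} s *\<^sub>R (1 - s) powr (\<alpha> - 1)" for s :: real
      by (auto simp: indicator_def)
    show ?thesis
      using Beta_integral_shifted(2)[OF a(1) zero_less_one zero_less_one] Gamma_real_pos[OF a(1)] a(1)
      unfolding set_lebesgue_integral_def eq by (simp add: Gamma_plus1_pos)
  qed
  have "(LINT s:{0<..<1}|lebesgue. mlk \<alpha> 1 x 1 * (1 - s) powr (\<alpha> - 1)) \<le> (LINT s:{0<..<1}|lebesgue. (1 - s) powr (\<alpha> - 1) * mlk \<alpha> 1 x s)"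
  proof (rule set_integral_mono)
    show "set_integrable lebesgue {0<..<1} (\<lambda>s. mlk \<alpha> 1 x 1 * (1 - s) powr (\<alpha> - 1))"
      using sub by (rule set_integrable_mult_right)
    fix s :: real assume s: "s \<in> {0<..<1}"
    have "(1 - s) powr (\<alpha> - 1) * mlk \<alpha> 1 x 1 \<le> (1 - s) powr (\<alpha> - 1) * mlk \<alpha> 1 x s"
      by (intro mult_left_mono mlk_antimono) (use a x s in auto)
    then show "mlk \<alpha> 1 x 1 * (1 - s) powr (\<alpha> - 1) \<le> (1 - s) powr (\<alpha> - 1) * mlk \<alpha> 1 x s" by (simp add: mult_ac)
  qed (rule RL(1))
  then have "ml \<alpha> 1 x * (1 / \<alpha>) \<le> Gamma \<alpha> * mlk \<alpha> (\<alpha> + 1) x 1"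
    using RL(2) K' by (simp add: mlk_1)
  then have "ml \<alpha> 1 x / Gamma (\<alpha> + 1) \<le> mlk \<alpha> (\<alpha> + 1) x 1"
    using a Gamma_real_pos[OF a(1)] unfolding Gamma_plus1_pos[OF a(1)] by (simp add: field_simps)
  moreover have "ml \<alpha> 1 x = 1 - x * mlk \<alpha> (\<alpha> + 1) x 1"
    using mlk_rec[OF a(1) zero_less_one zero_less_one, of x] by (simp add: mlk_1)
  ultimately have "x * (ml \<alpha> 1 x / Gamma (\<alpha> + 1)) \<le> 1 - ml \<alpha> 1 x" using x mult_left_mono[of "ml \<alpha> 1 x / Gamma (\<alpha> + 1)" _ x] by simp
  then show ?thesis by (simp add: algebra_simps)
qed (use a in \<open>simp add: ml_0\<close>)

lemma ml_le_1:
  assumes a: "0 < \<alpha>" "\<alpha> < 1" and x: "0 \<le> x"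
  shows "ml \<alpha> 1 x \<le> 1" "x * ml \<alpha> 1 x \<le> Gamma (\<alpha> + 1)"
proof -
  have G: "Gamma (\<alpha> + 1) > 0" using a by (simp add: Gamma_real_pos)
  have n: "0 \<le> ml \<alpha> 1 x" by (rule ml_nonneg[OF assms])
  have d: "ml \<alpha> 1 x + x * ml \<alpha> 1 x / Gamma (\<alpha> + 1) \<le> 1" using ml_decay[OF assms] by (simp add: algebra_simps)
  have "0 \<le> x * ml \<alpha> 1 x / Gamma (\<alpha> + 1)" using G n x by simp
  then show "ml \<alpha> 1 x \<le> 1" using d by linarith
  have "x * ml \<alpha> 1 x / Gamma (\<alpha> + 1) \<le> 1" using d n by linarith
  then show "x * ml \<alpha> 1 x \<le> Gamma (\<alpha> + 1)" using G by (simp add: field_simps)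
qed

text \<open>The Volterra equation again, now with the upper bound 1 inserted under the
  integral.\<close>

lemma ml_near_1:
  assumes a: "0 < \<alpha>" "\<alpha> < 1" and x: "0 \<le> x"
  shows "1 - ml \<alpha> 1 x \<le> x / Gamma (\<alpha> + 1)"
proof -
  note RL = Riemann_Liouville_mlk[OF a(1) a(1) zero_less_one zero_less_one, of x]
  note K = Beta_integral_shifted[OF a(1) zero_less_one zero_less_one]
  have "(LINT s:{0<..<1}|lebesgue. (1 - s) powr (\<alpha> - 1) * mlk \<alpha> 1 x s)
      \<le> (LINT s:{0<..<1}|lebesgue. (1 - s) powr (\<alpha> - 1) * (s - 0) powr (1 - 1))"
    by (rule set_integral_mono[OF RL(1) K(1)])
      (use ml_le_1(1)[OF a] x in \<open>auto simp: mlk_1 intro!: mult_left_le\<close>)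
  then have "Gamma \<alpha> * mlk \<alpha> (\<alpha> + 1) x 1 \<le> Gamma \<alpha> * (1 / Gamma (\<alpha> + 1))"
    using RL(2) K(2) by simp
  then have "mlk \<alpha> (\<alpha> + 1) x 1 \<le> 1 / Gamma (\<alpha> + 1)"
    using Gamma_real_pos[OF a(1)] by (rule mult_left_le_imp_le)
  then have "x * mlk \<alpha> (\<alpha> + 1) x 1 \<le> x * (1 / Gamma (\<alpha> + 1))" using x by (rule mult_left_mono)
  then show ?thesis using mlk_rec[OF a(1) zero_less_one zero_less_one, of x] by (simp add: mlk_1)
qed

text \<open>The scalar Caputo equation after one integration in time. Both sides are multiples of
  \<open>mlk\<close> with parameter 2: the left side first yields the parameter
  \<open>2 - \<alpha>\<close>, the power subtracted for the initial value 1 is the first term of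
  that series, and \<open>mlk_rec\<close> removes it.\<close>

lemma ml_Caputo_equation:
  assumes a: "0 < \<alpha>" "\<alpha> < 1" and t: "0 < t"
  shows "set_integrable lebesgue {0<..<t} (\<lambda>s. (t - s) powr (-\<alpha>) * (ml \<alpha> 1 (l * s powr \<alpha>) - 1))"
    and "set_integrable lebesgue {0<..<t} (\<lambda>s. ml \<alpha> 1 (l * s powr \<alpha>))"
    and "1 / Gamma (1 - \<alpha>) * (LINT s:{0<..<t}|lebesgue. (t - s) powr (-\<alpha>) * (ml \<alpha> 1 (l * s powr \<alpha>) - 1))
           = - l * (LINT s:{0<..<t}|lebesgue. ml \<alpha> 1 (l * s powr \<alpha>))"
proof -
  have b: "0 < 1 - \<alpha>" using a by simp
  note RL = Riemann_Liouville_mlk[OF a(1) b zero_less_one t, of l]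
  note RL1 = Riemann_Liouville_mlk[OF a(1) zero_less_one zero_less_one t, of l]
  note K = Beta_integral_shifted[OF b zero_less_one t]
  have eq: "indicator {0<..<t} s *\<^sub>R ((t - s) powr (-\<alpha>) * (ml \<alpha> 1 (l * s powr \<alpha>) - 1))
     = indicator {0<..<t} s *\<^sub>R ((t - s) powr (1 - \<alpha> - 1) * mlk \<alpha> 1 l s) - indicator {0<..<t} s *\<^sub>R ((t - s) powr (1 - \<alpha> - 1) * (s - 0) powr (1 - 1))" for s
    by (auto simp: indicator_def mlk_1 algebra_simps)
  have eq1: "indicator {0<..<t} s *\<^sub>R ml \<alpha> 1 (l * s powr \<alpha>) = indicator {0<..<t} s *\<^sub>R ((t - s) powr (1 - 1) * mlk \<alpha> 1 l s)" for s
    by (auto simp: indicator_def mlk_1)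
  show "set_integrable lebesgue {0<..<t} (\<lambda>s. (t - s) powr (-\<alpha>) * (ml \<alpha> 1 (l * s powr \<alpha>) - 1))"
    unfolding set_integrable_def eq using RL(1) K(1) unfolding set_integrable_def by (rule Bochner_Integration.integrable_diff)
  show "set_integrable lebesgue {0<..<t} (\<lambda>s. ml \<alpha> 1 (l * s powr \<alpha>))"
    unfolding set_integrable_def eq1 using RL1(1) unfolding set_integrable_def .
  have L: "(LINT s:{0<..<t}|lebesgue. ml \<alpha> 1 (l * s powr \<alpha>)) = mlk \<alpha> 2 l t"
    using RL1(2) unfolding set_lebesgue_integral_def eq1 by simp
  have G: "Gamma (1 - \<alpha>) > 0" "Gamma (2 - \<alpha>) > 0" using a by (auto intro!: Gamma_real_pos)
  have e1: "(LINT s:{0<..<t}|lebesgue. (t - s) powr (-\<alpha>) * (ml \<alpha> 1 (l * s powr \<alpha>) - 1))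
     = Gamma (1 - \<alpha>) * mlk \<alpha> (1 - \<alpha> + 1) l t - t powr (1 - \<alpha>) * (Gamma (1 - \<alpha>) / Gamma (2 - \<alpha>))"
    unfolding set_lebesgue_integral_def eq using RL K unfolding set_integrable_def set_lebesgue_integral_def
    by (subst Bochner_Integration.integral_diff) simp_all
  have e2: "mlk \<alpha> (1 - \<alpha> + 1) l t = t powr (1 - \<alpha>) / Gamma (2 - \<alpha>) - l * mlk \<alpha> 2 l t"
    using mlk_rec[OF a(1) _ t, of "1 - \<alpha> + 1" l] a by simp
  have "(LINT s:{0<..<t}|lebesgue. (t - s) powr (-\<alpha>) * (ml \<alpha> 1 (l * s powr \<alpha>) - 1)) = Gamma (1 - \<alpha>) * (- l * mlk \<alpha> 2 l t)"
    unfolding e1 e2 by (simp add: right_diff_distrib)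
  then show "1 / Gamma (1 - \<alpha>) * (LINT s:{0<..<t}|lebesgue. (t - s) powr (-\<alpha>) * (ml \<alpha> 1 (l * s powr \<alpha>) - 1))
           = - l * (LINT s:{0<..<t}|lebesgue. ml \<alpha> 1 (l * s powr \<alpha>))"
    using G unfolding L by simp
qed

subsection \<open>The abstract fractional evolution equation\<close>

text \<open>\<open>M\<close> stands for \<open>V\<close>, realised as a closed set of gradient
  fields with their \<open>L\<^sup>2\<close> norm, and \<open>\<iota>\<close> for its inclusion in
  \<open>L\<^sup>2\<close>, scaled to a contraction.\<close>

locale hilbert_embedding =
  fixes M :: "'x::{real_inner,complete_space} set" and \<iota> :: "'x \<Rightarrow> 'y::{real_inner,complete_space}"
  assumes M: "subspace M" "closed M"
    and emb_add: "\<And>p q. p \<in> M \<Longrightarrow> q \<in> M \<Longrightarrow> \<iota> (p + q) = \<iota> p + \<iota> q"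
    and emb_scale: "\<And>c p. p \<in> M \<Longrightarrow> \<iota> (c *\<^sub>R p) = c *\<^sub>R \<iota> p"
    and emb_norm: "\<And>p. p \<in> M \<Longrightarrow> norm (\<iota> p) \<le> norm p"
    and emb_inj: "\<And>p. p \<in> M \<Longrightarrow> \<iota> p = 0 \<Longrightarrow> p = 0"
begin

text \<open>The adjoint of the embedding \<open>\<iota>\<close>, so that \<open>B\<close> below is
  \<open>\<iota>\<close> after its adjoint, symmetric and positive.\<close>

definition J :: "'y \<Rightarrow> 'x" where
  "J y = (SOME m. m \<in> M \<and> (\<forall>q\<in>M. y \<bullet> \<iota> q = m \<bullet> q))"

definition B :: "'y \<Rightarrow> 'y" where "B y = \<iota> (J y)"

lemma J: "J y \<in> M" "q \<in> M \<Longrightarrow> J y \<bullet> q = y \<bullet> \<iota> q"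
proof -
  have "\<exists>m\<in>M. \<forall>q\<in>M. y \<bullet> \<iota> q = m \<bullet> q"
  proof (rule Riesz_subspace[OF M, where C = "norm y"])
    fix p q c assume pq: "p \<in> M"
    show "y \<bullet> \<iota> (c *\<^sub>R p) = c * (y \<bullet> \<iota> p)" using pq by (simp add: emb_scale)
    show "\<bar>y \<bullet> \<iota> p\<bar> \<le> norm y * norm p"
      using Cauchy_Schwarz_ineq2[of y "\<iota> p"] mult_left_mono[OF emb_norm[OF pq], of "norm y"] by simp
    assume "q \<in> M"
    then show "y \<bullet> \<iota> (p + q) = y \<bullet> \<iota> p + y \<bullet> \<iota> q" using pq by (simp add: emb_add inner_add_right)
  qed
  then have "\<exists>m. m \<in> M \<and> (\<forall>q\<in>M. y \<bullet> \<iota> q = m \<bullet> q)" by blast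
  from someI_ex[OF this] show "J y \<in> M" "q \<in> M \<Longrightarrow> J y \<bullet> q = y \<bullet> \<iota> q"
    unfolding J_def by auto
qed

lemma M_eqI:
  assumes "p \<in> M" "q \<in> M" "\<And>r. r \<in> M \<Longrightarrow> p \<bullet> r = q \<bullet> r" shows "p = q"
proof -
  have "p - q \<in> M" using assms M by (simp add: subspace_diff)
  then have "(p - q) \<bullet> (p - q) = 0" using assms(3) by (simp add: inner_diff_left)
  then show ?thesis by simp
qed

lemma emb_diff: "p \<in> M \<Longrightarrow> q \<in> M \<Longrightarrow> \<iota> (p - q) = \<iota> p - \<iota> q"
  using emb_add[of p "(-1) *\<^sub>R q"] emb_scale[of q "-1"] M(1) by (simp add: subspace_neg)

lemma J_add: "J (x + y) = J x + J y"
  by (rule M_eqI) (use J M in \<open>auto simp: inner_add_left subspace_add\<close>)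

lemma J_scale: "J (c *\<^sub>R y) = c *\<^sub>R J y"
  by (rule M_eqI) (use J M in \<open>auto simp: subspace_scale\<close>)

lemma J_diff: "J (x - y) = J x - J y"
  by (rule M_eqI) (use J M in \<open>auto simp: inner_diff_left subspace_diff\<close>)

lemma J_norm_sq: "(norm (J y))\<^sup>2 = B y \<bullet> y"
  unfolding power2_norm_eq_inner B_def using J(2)[OF J(1), of y y] by (simp add: inner_commute)

lemma B_norm: "norm (J y) \<le> norm y" "norm (B y) \<le> norm y"
proof -
  have le: "norm (B y) \<le> norm (J y)" unfolding B_def using J(1) by (rule emb_norm)
  have "norm (J y) * norm (J y) \<le> norm (B y) * norm y"
    using J_norm_sq[of y] norm_cauchy_schwarz[of "B y" y] by (simp add: power2_eq_square)
  also have "\<dots> \<le> norm (J y) * norm y" using le by (intro mult_right_mono) auto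
  finally show *: "norm (J y) \<le> norm y" by (cases "J y = 0") auto
  show "norm (B y) \<le> norm y" using le * by simp
qed

sublocale B: psd_contraction B
proof
  fix x y :: 'y and c :: real
  show "B (x + y) = B x + B y" unfolding B_def J_add by (intro emb_add J)
  show "B (c *\<^sub>R x) = c *\<^sub>R B x" unfolding B_def J_scale by (intro emb_scale J)
  show "\<exists>K. \<forall>x. norm (B x) \<le> norm x * K" using B_norm by (intro exI[of _ 1]) auto
  have "B x \<bullet> y = J x \<bullet> J y" for x y using J(2)[OF J(1), of y x] by (simp add: B_def inner_commute)
  then show "B x \<bullet> y = x \<bullet> B y" by (simp add: inner_commute)
  show "0 \<le> B x \<bullet> x" using J_norm_sq[of x] by (metis zero_le_power2)
  show "B x \<bullet> x \<le> x \<bullet> x"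
    using J_norm_sq[of x] power_mono[OF B_norm(1)[of x], of 2] by (simp add: power2_norm_eq_inner)
qed

text \<open>An element of \<open>M\<close> orthogonal to the range of the adjoint lies in the kernel
  of \<open>\<iota>\<close>, which is trivial.\<close>

lemma J_dense: "closure (range J) = M"
proof
  show "closure (range J) \<subseteq> M" using J M by (intro closure_minimal) auto
  have sub: "subspace (range J)"
  proof (rule subspaceI)
    show "0 \<in> range J" using J_scale[of 0 0] by (intro image_eqI[of _ _ 0]) auto
    fix x y c assume "x \<in> range J"
    then obtain a where a: "x = J a" by auto
    show "c *\<^sub>R x \<in> range J" unfolding a by (simp flip: J_scale)
    assume "y \<in> range J"
    then obtain b where "y = J b" by auto
    then show "x + y \<in> range J" unfolding a by (simp flip: J_add)
  qed
  show "M \<subseteq> closure (range J)"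
  proof
    fix g assume g: "g \<in> M"
    obtain m where m: "m \<in> closure (range J)" "\<And>q. q \<in> closure (range J) \<Longrightarrow> g \<bullet> q = m \<bullet> q"
      using projection_exists[OF subspace_closure[OF sub] closed_closure, of g] by blast
    have mM: "m \<in> M" using m \<open>closure (range J) \<subseteq> M\<close> by auto
    have gm: "g - m \<in> M" using g mM M by (simp add: subspace_diff)
    have "J z \<bullet> (g - m) = 0" for z
    proof -
      have "g \<bullet> J z = m \<bullet> J z" using m(2)[of "J z"] closure_subset[of "range J"] by auto
      then show ?thesis by (simp add: inner_diff_right inner_commute[of "J z"])
    qed
    then have "z \<bullet> \<iota> (g - m) = 0" for z using J(2)[OF gm] by metis
    then have "\<iota> (g - m) = 0" using inner_eq_zero_iff by blast
    then have "g = m" using emb_inj[OF gm] by simp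
    then show "g \<in> closure (range J)" using m by simp
  qed
qed

text \<open>The square of the norm of \<open>J y\<close> is \<open>B y \<bullet> y\<close>, so the
  norm in \<open>M\<close> is controlled by the geometric mean of a bound on
  \<open>b * \<phi> b\<close> and one on \<open>\<phi>\<close>. A smallness of the first alone
  therefore suffices for convergence in \<open>M\<close>.\<close>

lemma J_calc_norm_sq:
  assumes c: "continuous_on {0..1} \<phi>"
    and S: "\<And>b. b \<in> {0..1} \<Longrightarrow> \<bar>b * \<phi> b\<bar> \<le> S" and S': "\<And>b. b \<in> {0..1} \<Longrightarrow> \<bar>\<phi> b\<bar> \<le> S'"
  shows "(norm (J (B.calc \<phi> x)))\<^sup>2 \<le> S * S' * (norm x)\<^sup>2"
proof -
  have "(norm (J (B.calc \<phi> x)))\<^sup>2 \<le> norm (B (B.calc \<phi> x)) * norm (B.calc \<phi> x)"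
    unfolding J_norm_sq by (rule norm_cauchy_schwarz)
  also have "\<dots> \<le> (S * norm x) * (S' * norm x)"
  proof (intro mult_mono)
    show "norm (B (B.calc \<phi> x)) \<le> S * norm x"
      unfolding B.calc_times_B[OF c, symmetric] using S by (intro B.calc_norm_le continuous_intros c) auto
    show "norm (B.calc \<phi> x) \<le> S' * norm x" using S' by (intro B.calc_norm_le c) auto
    have "0 \<le> S" using S[of 0] by simp
    then show "0 \<le> S * norm x" by simp
  qed auto
  finally show ?thesis by (simp add: power2_eq_square mult_ac)
qed

end

text \<open>\<open>relax \<alpha> \<rho> t b\<close> is the solution at time \<open>t\<close>, with initial value 1, of the scalar equation
  with rate \<open>\<rho> / b\<close>; the value at \<open>b = 0\<close> is the limit.\<close>

definition relax :: "real \<Rightarrow> real \<Rightarrow> real \<Rightarrow> real \<Rightarrow> real" where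
  "relax \<alpha> \<rho> t b = (if b = 0 then 0 else ml \<alpha> 1 (\<rho> / b * t powr \<alpha>))"

text \<open>The last bound, linear in \<open>b\<close>, is what allows division by \<open>b\<close>,
  and hence lifting the evolution from \<open>L\<^sup>2\<close> to \<open>V\<close>; the price is
  the singularity at \<open>t = 0\<close>.\<close>

lemma relax_bounds:
  assumes a: "0 < \<alpha>" "\<alpha> < 1" "0 < \<rho>" and t: "0 < t" and b: "0 \<le> b"
  shows "0 \<le> relax \<alpha> \<rho> t b" "relax \<alpha> \<rho> t b \<le> 1"
    "relax \<alpha> \<rho> t b \<le> Gamma (\<alpha> + 1) / \<rho> * t powr (-\<alpha>) * b"
proof -
  show "0 \<le> relax \<alpha> \<rho> t b" "relax \<alpha> \<rho> t b \<le> 1"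
    using ml_nonneg[of \<alpha>] ml_le_1(1)[of \<alpha>] a t b by (auto simp: relax_def)
  show "relax \<alpha> \<rho> t b \<le> Gamma (\<alpha> + 1) / \<rho> * t powr (-\<alpha>) * b"
  proof (cases "b = 0")
    case False
    then have b: "b > 0" using b by simp
    have "\<rho> / b * t powr \<alpha> * ml \<alpha> 1 (\<rho> / b * t powr \<alpha>) \<le> Gamma (\<alpha> + 1)"
      using ml_le_1(2)[of \<alpha> "\<rho> / b * t powr \<alpha>"] a t b by auto
    then show ?thesis using a t b by (simp add: relax_def powr_minus field_simps)
  qed (simp add: relax_def)
qed

text \<open>The factor \<open>b\<close> cancels the rate \<open>\<rho> / b\<close>, so the bound is
  uniform in \<open>b\<close>: on the range of \<open>B\<close> the initial value is attained at a
  fixed rate.\<close>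

lemma relax_initial:
  assumes a: "0 < \<alpha>" "\<alpha> < 1" "0 < \<rho>" and t: "0 < t" and b: "0 \<le> b"
  shows "b * (1 - relax \<alpha> \<rho> t b) \<le> \<rho> * t powr \<alpha> / Gamma (\<alpha> + 1)"
proof (cases "b = 0")
  case False
  then have b: "b > 0" using b by simp
  have "1 - ml \<alpha> 1 (\<rho> / b * t powr \<alpha>) \<le> \<rho> / b * t powr \<alpha> / Gamma (\<alpha> + 1)"
    using a b by (intro ml_near_1) auto
  then have "b * (1 - ml \<alpha> 1 (\<rho> / b * t powr \<alpha>)) \<le> b * (\<rho> / b * t powr \<alpha> / Gamma (\<alpha> + 1))"
    using b by (intro mult_left_mono) auto
  then show ?thesis using b by (simp add: relax_def)
qed (use a in \<open>simp add: Gamma_real_pos\<close>)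


text \<open>At \<open>b = 0\<close>, where the rate blows up, continuity jointly in both variables
  comes from the bound linear in \<open>b\<close>.\<close>

lemma continuous_on_relax:
  assumes a: "0 < \<alpha>" "\<alpha> < 1" "0 < \<rho>"
  shows "continuous_on ({0<..} \<times> {0..}) (\<lambda>p. relax \<alpha> \<rho> (fst p) (snd p))"
  unfolding continuous_on_def
proof
  fix p :: "real \<times> real" assume p: "p \<in> {0<..} \<times> {0..}"
  let ?S = "{0<..} \<times> {0..} :: (real \<times> real) set"
  let ?f = "\<lambda>p. relax \<alpha> \<rho> (fst p) (snd p)"
  have S: "eventually (\<lambda>q. q \<in> ?S) (at p within ?S)" by (simp add: eventually_at_filter)
  show "(?f \<longlongrightarrow> ?f p) (at p within ?S)"
  proof (cases "snd p = 0")
    case True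
    have "((\<lambda>q. Gamma (\<alpha> + 1) / \<rho> * fst q powr (-\<alpha>) * snd q) \<longlongrightarrow> Gamma (\<alpha> + 1) / \<rho> * fst p powr (-\<alpha>) * snd p) (at p within ?S)"
      using p by (intro tendsto_intros tendsto_fst tendsto_snd tendsto_ident_at) auto
    then have lim: "((\<lambda>q. Gamma (\<alpha> + 1) / \<rho> * fst q powr (-\<alpha>) * snd q) \<longlongrightarrow> 0) (at p within ?S)"
      using True by simp
    have "(?f \<longlongrightarrow> 0) (at p within ?S)"
      by (rule Lim_null_comparison[OF _ lim], rule eventually_mono[OF S]) (use relax_bounds[OF a] in auto)
    then show ?thesis using True by (simp add: relax_def)
  next
    case False
    then have pos: "snd p > 0" "fst p > 0" using p by auto
    have "((\<lambda>q. \<rho> / snd q * fst q powr \<alpha>) \<longlongrightarrow> \<rho> / snd p * fst p powr \<alpha>) (at p within ?S)"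
      using pos by (intro tendsto_intros tendsto_fst tendsto_snd tendsto_ident_at) auto
    then have "((\<lambda>q. ml \<alpha> 1 (\<rho> / snd q * fst q powr \<alpha>)) \<longlongrightarrow> ml \<alpha> 1 (\<rho> / snd p * fst p powr \<alpha>)) (at p within ?S)"
      by (rule isCont_tendsto_compose[OF isCont_ml[OF a(1) zero_less_one]])
    moreover have "eventually (\<lambda>q. snd q > 0) (at p within ?S)"
      using order_tendstoD(1)[OF tendsto_snd[OF tendsto_ident_at] pos(1)] .
    then have "eventually (\<lambda>q. ml \<alpha> 1 (\<rho> / snd q * fst q powr \<alpha>) = ?f q) (at p within ?S)"
      by eventually_elim (simp add: relax_def)
    ultimately have "(?f \<longlongrightarrow> ml \<alpha> 1 (\<rho> / snd p * fst p powr \<alpha>)) (at p within ?S)"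
      by (rule Lim_transform_eventually)
    then show ?thesis using pos by (simp add: relax_def)
  qed
qed

lemma continuous_on_relax_b:
  assumes a: "0 < \<alpha>" "\<alpha> < 1" "0 < \<rho>" and t: "0 < t"
  shows "continuous_on {0..1} (relax \<alpha> \<rho> t)"
proof -
  have "continuous_on {0..1} (\<lambda>b. (t, b))" by (intro continuous_intros)
  moreover have "(\<lambda>b. (t, b)) ` {0..1} \<subseteq> {0<..} \<times> {0..}" using t by auto
  ultimately show ?thesis using continuous_on_compose2[OF continuous_on_relax[OF a]] by fastforce
qed

text \<open>Uniform continuity on a compact rectangle around \<open>t\<close> and away from time 0,
  where joint continuity is known.\<close>

lemma relax_equicontinuous:
  assumes a: "0 < \<alpha>" "\<alpha> < 1" "0 < \<rho>" and t: "0 < t" and e: "0 < e"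
  shows "\<exists>d>0. \<forall>s. \<bar>s - t\<bar> < d \<longrightarrow> t / 2 < s \<and> (\<forall>b\<in>{0..1}. \<bar>relax \<alpha> \<rho> s b - relax \<alpha> \<rho> t b\<bar> < e)"
proof -
  let ?K = "{t/2..2*t} \<times> {0..1} :: (real \<times> real) set"
  have "uniformly_continuous_on ?K (\<lambda>p. relax \<alpha> \<rho> (fst p) (snd p))"
    by (rule compact_uniformly_continuous[OF continuous_on_subset[OF continuous_on_relax[OF a]]])
      (use t in \<open>auto intro!: compact_Times\<close>)
  then obtain d where d: "d > 0" "\<And>p q. p \<in> ?K \<Longrightarrow> q \<in> ?K \<Longrightarrow> dist q p < d \<Longrightarrow>
      dist (relax \<alpha> \<rho> (fst q) (snd q)) (relax \<alpha> \<rho> (fst p) (snd p)) < e"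
    using e unfolding uniformly_continuous_on_def by metis
  show ?thesis
  proof (intro exI[of _ "min d (t/2)"] conjI allI impI ballI)
    show "min d (t/2) > 0" using d t by simp
    fix s assume s: "\<bar>s - t\<bar> < min d (t/2)"
    show "t / 2 < s" using s by linarith
    have s2: "t / 2 \<le> s" "s \<le> 2 * t" using s by linarith+
    fix b :: real assume b: "b \<in> {0..1}"
    have "dist (s, b) (t, b) < d" using s by (simp add: dist_Pair_Pair dist_real_def)
    then show "\<bar>relax \<alpha> \<rho> s b - relax \<alpha> \<rho> t b\<bar> < e"
      using d(2)[of "(t, b)" "(s, b)"] b s s2 t by (auto simp: dist_real_def)
  qed
qed

text \<open>Multiplied by \<open>b\<close>, the scalar equation has the bounded rate
  \<open>\<rho>\<close> on the right and extends to \<open>b = 0\<close>; in this form the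
  functional calculus can be applied to it.\<close>

lemma relax_equation:
  assumes a: "0 < \<alpha>" "\<alpha> < 1" "0 < \<rho>" and t: "0 < t" and b: "0 \<le> b"
  shows "set_integrable lebesgue {0<..<t} (\<lambda>s. (t - s) powr (-\<alpha>) * (b * (relax \<alpha> \<rho> s b - 1)))"
    and "set_integrable lebesgue {0<..<t} (\<lambda>s. relax \<alpha> \<rho> s b)"
    and "1 / Gamma (1 - \<alpha>) * (LINT s:{0<..<t}|lebesgue. (t - s) powr (-\<alpha>) * (b * (relax \<alpha> \<rho> s b - 1)))
           = - \<rho> * (LINT s:{0<..<t}|lebesgue. relax \<alpha> \<rho> s b)"
proof -
  consider "b = 0" | "b > 0" using b by linarith
  then have "set_integrable lebesgue {0<..<t} (\<lambda>s. (t - s) powr (-\<alpha>) * (b * (relax \<alpha> \<rho> s b - 1)))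
    \<and> set_integrable lebesgue {0<..<t} (\<lambda>s. relax \<alpha> \<rho> s b)
    \<and> 1 / Gamma (1 - \<alpha>) * (LINT s:{0<..<t}|lebesgue. (t - s) powr (-\<alpha>) * (b * (relax \<alpha> \<rho> s b - 1)))
           = - \<rho> * (LINT s:{0<..<t}|lebesgue. relax \<alpha> \<rho> s b)"
  proof cases
    case 2
    note E = ml_Caputo_equation[OF a(1,2) t, of "\<rho> / b"]
    have eq: "(t - s) powr (-\<alpha>) * (b * (relax \<alpha> \<rho> s b - 1)) = b * ((t - s) powr (-\<alpha>) * (ml \<alpha> 1 (\<rho> / b * s powr \<alpha>) - 1))" for s
      using 2 by (simp add: relax_def)
    have eq2: "relax \<alpha> \<rho> s b = ml \<alpha> 1 (\<rho> / b * s powr \<alpha>)" for s using 2 by (simp add: relax_def)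
    have "1 / Gamma (1 - \<alpha>) * (b * L) = - \<rho> * R" if "1 / Gamma (1 - \<alpha>) * L = - (\<rho> / b) * R" for L R
    proof -
      have "1 / Gamma (1 - \<alpha>) * (b * L) = b * (1 / Gamma (1 - \<alpha>) * L)" by simp
      also have "\<dots> = - \<rho> * R" unfolding that using 2 by simp
      finally show ?thesis .
    qed
    from this[OF E(3)] show ?thesis unfolding eq unfolding eq2 set_integral_mult_right
      using E(1,2) by (auto intro: set_integrable_mult_right)
  qed (simp add: relax_def set_integrable_def set_lebesgue_integral_def)
  then show "set_integrable lebesgue {0<..<t} (\<lambda>s. (t - s) powr (-\<alpha>) * (b * (relax \<alpha> \<rho> s b - 1)))"
    "set_integrable lebesgue {0<..<t} (\<lambda>s. relax \<alpha> \<rho> s b)"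
    "1 / Gamma (1 - \<alpha>) * (LINT s:{0<..<t}|lebesgue. (t - s) powr (-\<alpha>) * (b * (relax \<alpha> \<rho> s b - 1)))
           = - \<rho> * (LINT s:{0<..<t}|lebesgue. relax \<alpha> \<rho> s b)" by auto
qed

lemma set_LINT_tendsto:
  fixes f :: "nat \<Rightarrow> 'a::euclidean_space \<Rightarrow> real"
  assumes m: "\<And>n. set_borel_measurable lebesgue A (f n)"
    and lim: "\<And>s. s \<in> A \<Longrightarrow> (\<lambda>n. f n s) \<longlonglongrightarrow> F s"
    and bd: "\<And>n s. s \<in> A \<Longrightarrow> \<bar>f n s\<bar> \<le> w s" and w: "set_integrable lebesgue A w"
  shows "set_integrable lebesgue A F"
    and "(\<lambda>n. LINT s:A|lebesgue. f n s) \<longlonglongrightarrow> (LINT s:A|lebesgue. F s)"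
proof -
  have lim': "(\<lambda>n. indicator A s *\<^sub>R f n s) \<longlonglongrightarrow> indicator A s *\<^sub>R F s" for s
    using lim[of s] by (cases "s \<in> A") auto
  have mF: "(\<lambda>s. indicator A s *\<^sub>R F s) \<in> borel_measurable lebesgue"
    by (rule borel_measurable_LIMSEQ_metric[OF m[unfolded set_borel_measurable_def] lim'])
  have b: "AE s in lebesgue. norm (indicator A s *\<^sub>R f n s) \<le> indicator A s *\<^sub>R w s" for n
    using bd[of _ n] by (intro AE_I2) (auto simp: indicator_def)
  show "set_integrable lebesgue A F" unfolding set_integrable_def
    by (rule integrable_dominated_convergence[where s = "\<lambda>n s. indicator A s *\<^sub>R f n s", OF mF m[unfolded set_borel_measurable_def] w[unfolded set_integrable_def] _ b])
      (use lim' in auto)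
  show "(\<lambda>n. LINT s:A|lebesgue. f n s) \<longlonglongrightarrow> (LINT s:A|lebesgue. F s)" unfolding set_lebesgue_integral_def
    by (rule integral_dominated_convergence[where s = "\<lambda>n s. indicator A s *\<^sub>R f n s", OF mF m[unfolded set_borel_measurable_def] w[unfolded set_integrable_def] _ b])
      (use lim' in auto)
qed

lemma set_borel_measurable_continuous_lebesgue:
  fixes f :: "real \<Rightarrow> real"
  assumes "continuous_on A f" "A \<in> sets borel"
  shows "set_borel_measurable lebesgue A f"
  unfolding set_borel_measurable_def
  by (rule measurable_completion) (use borel_measurable_continuous_on_indicator[OF assms(2,1)] in simp)

lemma integrable_power_kernel:
  assumes "0 < \<alpha>" "\<alpha> < 1" "0 < t"
  shows "set_integrable lebesgue {0<..<t} (\<lambda>s. c * (t - s) powr (-\<alpha>))"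
    and "set_integrable lebesgue {0<..<t} (\<lambda>s. c * s powr (-\<alpha>))"
    and "set_integrable lebesgue {0<..<t} (\<lambda>s. c :: real)"
proof -
  have b: "0 < 1 - \<alpha>" using assms by simp
  have 1: "indicator {0<..<t} s *\<^sub>R ((t - s) powr (1 - \<alpha> - 1) * (s - 0) powr (1 - 1)) = indicator {0<..<t} s *\<^sub>R (t - s) powr (-\<alpha>)"
    "indicator {0<..<t} s *\<^sub>R ((t - s) powr (1 - 1) * (s - 0) powr (1 - \<alpha> - 1)) = indicator {0<..<t} s *\<^sub>R s powr (-\<alpha>)" for s
    by (auto simp: indicator_def)
  have "set_integrable lebesgue {0<..<t} (\<lambda>s. (t - s) powr (-\<alpha>))" "set_integrable lebesgue {0<..<t} (\<lambda>s. s powr (-\<alpha>))"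
    using Beta_integral_shifted(1)[OF b zero_less_one assms(3)] Beta_integral_shifted(1)[OF zero_less_one b assms(3)]
    unfolding set_integrable_def 1 by auto
  then show "set_integrable lebesgue {0<..<t} (\<lambda>s. c * (t - s) powr (-\<alpha>))"
    "set_integrable lebesgue {0<..<t} (\<lambda>s. c * s powr (-\<alpha>))" by auto
  show "set_integrable lebesgue {0<..<t} (\<lambda>s. c :: real)"
    unfolding set_integrable_def using assms(3) by (intro integrable_scaleR_left integrable_real_indicator) auto
qed

section \<open>The evolution obtained from the functional calculus\<close>

context hilbert_embedding
begin

text \<open>A Bernstein sum paired with \<open>z\<close> is a finite combination of scalar solutions
  at the nodes, and so solves the equation; dominated convergence passes to the limit. The factor
  \<open>b\<close> of the scalar equation becomes the \<open>B\<close> in front of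
  \<open>z\<close>.\<close>

lemma relax_calc_equation:
  fixes x z :: 'y
  assumes a: "0 < \<alpha>" "\<alpha> < 1" "0 < \<rho>" and t: "0 < t"
  defines "y \<equiv> \<lambda>s. B.calc (relax \<alpha> \<rho> s) x"
  shows "1 / Gamma (1 - \<alpha>) * (LINT s:{0<..<t}|lebesgue. (t - s) powr (-\<alpha>) * ((y s - x) \<bullet> B z))
           = - \<rho> * (LINT s:{0<..<t}|lebesgue. y s \<bullet> z)"
proof -
  define w where "w n k = opoly B (bern n k) x \<bullet> z" for n k
  have binner: "B.bcalc n \<phi> x \<bullet> z = (\<Sum>k\<le>n. \<phi> (k / n) * w n k)" for n \<phi>
    by (simp add: B.bcalc_def inner_sum_left w_def)
  have range: "real k / real n \<in> {0..1}" if "k \<le> n" for k n :: nat using that by (auto simp: divide_le_eq_1)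
  note E = relax_equation[OF a t]
  let ?\<phi> = "\<lambda>s b. b * (relax \<alpha> \<rho> s b - 1)"
  have inner_le: "\<bar>B.bcalc n \<phi> x \<bullet> z\<bar> \<le> norm x * norm z" if "\<And>b. b \<in> {0..1} \<Longrightarrow> \<bar>\<phi> b\<bar> \<le> 1" for n \<phi>
  proof -
    have "\<bar>B.bcalc n \<phi> x \<bullet> z\<bar> \<le> norm (B.bcalc n \<phi> x) * norm z" by (rule Cauchy_Schwarz_ineq2)
    also have "\<dots> \<le> (1 * norm x) * norm z" by (intro mult_right_mono B.bcalc_norm_le that) auto
    finally show ?thesis by simp
  qed
  have int1: "set_integrable lebesgue {0<..<t} (\<lambda>s. (t - s) powr (-\<alpha>) * (B.bcalc n (?\<phi> s) x \<bullet> z))"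
    and int2: "set_integrable lebesgue {0<..<t} (\<lambda>s. B.bcalc n (relax \<alpha> \<rho> s) x \<bullet> z)"
    and eq: "1 / Gamma (1 - \<alpha>) * (LINT s:{0<..<t}|lebesgue. (t - s) powr (-\<alpha>) * (B.bcalc n (?\<phi> s) x \<bullet> z))
       = - \<rho> * (LINT s:{0<..<t}|lebesgue. B.bcalc n (relax \<alpha> \<rho> s) x \<bullet> z)" for n
  proof -
    let ?b = "\<lambda>k. real k / real n"
    have e1: "(t - s) powr (-\<alpha>) * (B.bcalc n (?\<phi> s) x \<bullet> z) = (\<Sum>k\<le>n. w n k * ((t - s) powr (-\<alpha>) * ?\<phi> s (?b k)))" for s
      unfolding binner sum_distrib_left by (intro sum.cong refl) (simp add: mult_ac)
    have e2: "B.bcalc n (relax \<alpha> \<rho> s) x \<bullet> z = (\<Sum>k\<le>n. w n k * relax \<alpha> \<rho> s (?b k))" for s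
      unfolding binner by (simp add: mult.commute)
    have i1: "set_integrable lebesgue {0<..<t} (\<lambda>s. w n k * ((t - s) powr (-\<alpha>) * ?\<phi> s (?b k)))" for k
      by (intro set_integrable_mult_right E) auto
    have i2: "set_integrable lebesgue {0<..<t} (\<lambda>s. w n k * relax \<alpha> \<rho> s (?b k))" for k
      by (intro set_integrable_mult_right E) auto
    show "set_integrable lebesgue {0<..<t} (\<lambda>s. (t - s) powr (-\<alpha>) * (B.bcalc n (?\<phi> s) x \<bullet> z))"
      unfolding e1 set_integrable_def scaleR_sum_right
      by (rule Bochner_Integration.integrable_sum) (rule i1[unfolded set_integrable_def])
    show "set_integrable lebesgue {0<..<t} (\<lambda>s. B.bcalc n (relax \<alpha> \<rho> s) x \<bullet> z)"
      unfolding e2 set_integrable_def scaleR_sum_right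
      by (rule Bochner_Integration.integrable_sum) (rule i2[unfolded set_integrable_def])
    have scale: "1 / Gamma (1 - \<alpha>) * (w n k * L) = - \<rho> * (w n k * R)" if "1 / Gamma (1 - \<alpha>) * L = - \<rho> * R" for L R k
      using arg_cong[OF that, of "\<lambda>z. w n k * z"] by (simp add: mult_ac)
    have "1 / Gamma (1 - \<alpha>) * (LINT s:{0<..<t}|lebesgue. w n k * ((t - s) powr (-\<alpha>) * ?\<phi> s (?b k)))
      = - \<rho> * (LINT s:{0<..<t}|lebesgue. w n k * relax \<alpha> \<rho> s (?b k))" for k
      unfolding set_integral_mult_right by (rule scale[OF E(3)]) auto
    then show "1 / Gamma (1 - \<alpha>) * (LINT s:{0<..<t}|lebesgue. (t - s) powr (-\<alpha>) * (B.bcalc n (?\<phi> s) x \<bullet> z))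
       = - \<rho> * (LINT s:{0<..<t}|lebesgue. B.bcalc n (relax \<alpha> \<rho> s) x \<bullet> z)"
      unfolding e1 e2 using i1 i2 unfolding set_integrable_def set_lebesgue_integral_def scaleR_sum_right
      by (subst (1 2) Bochner_Integration.integral_sum) (simp_all only: sum_distrib_left)
  qed
  have rc: "continuous_on {0..1} (\<lambda>b. relax \<alpha> \<rho> s b - 1)" if "s \<in> {0<..<t}" for s
    using continuous_on_relax_b[OF a, of s] that by (intro continuous_intros) auto
  have r1: "\<bar>relax \<alpha> \<rho> s b\<bar> \<le> 1" "\<bar>?\<phi> s b\<bar> \<le> 1" if "s \<in> {0<..<t}" "b \<in> {0..1}" for s b
  proof -
    have r: "0 \<le> relax \<alpha> \<rho> s b" "relax \<alpha> \<rho> s b \<le> 1" using relax_bounds[OF a, of s b] that by auto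
    then show "\<bar>relax \<alpha> \<rho> s b\<bar> \<le> 1" by simp
    have "\<bar>b\<bar> * \<bar>relax \<alpha> \<rho> s b - 1\<bar> \<le> 1 * 1" using r that by (intro mult_mono) auto
    then show "\<bar>?\<phi> s b\<bar> \<le> 1" by (simp add: abs_mult)
  qed
  have lim1: "(\<lambda>n. LINT s:{0<..<t}|lebesgue. (t - s) powr (-\<alpha>) * (B.bcalc n (?\<phi> s) x \<bullet> z))
     \<longlonglongrightarrow> (LINT s:{0<..<t}|lebesgue. (t - s) powr (-\<alpha>) * ((y s - x) \<bullet> B z))"
  proof (rule set_LINT_tendsto(2))
    show "set_borel_measurable lebesgue {0<..<t} (\<lambda>s. (t - s) powr (-\<alpha>) * (B.bcalc n (?\<phi> s) x \<bullet> z))" for n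
      using int1[of n] unfolding set_integrable_def set_borel_measurable_def by auto
    show "set_integrable lebesgue {0<..<t} (\<lambda>s. (norm x * norm z) * (t - s) powr (-\<alpha>))"
      using integrable_power_kernel(1)[OF a(1,2) t] .
    fix s assume s: "s \<in> {0<..<t}"
    show "\<bar>(t - s) powr (-\<alpha>) * (B.bcalc n (?\<phi> s) x \<bullet> z)\<bar> \<le> (norm x * norm z) * (t - s) powr (-\<alpha>)" for n
      using mult_left_mono[OF inner_le[OF r1(2)[OF s]], where c = "(t - s) powr (-\<alpha>)"] by (simp add: abs_mult mult_ac)
    have "B.calc (?\<phi> s) x = B (y s - x)"
      unfolding B.calc_times_B[OF rc[OF s]] y_def
      using s by (subst B.calc_diff) (auto simp: B.calc_one intro!: continuous_on_relax_b[OF a])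
    then have "(y s - x) \<bullet> B z = B.calc (?\<phi> s) x \<bullet> z" by (simp add: B.sym)
    then show "(\<lambda>n. (t - s) powr (-\<alpha>) * (B.bcalc n (?\<phi> s) x \<bullet> z)) \<longlonglongrightarrow> (t - s) powr (-\<alpha>) * ((y s - x) \<bullet> B z)"
      by (simp only:) (intro tendsto_intros B.calc_tendsto continuous_intros rc[OF s])
  qed
  have lim2: "(\<lambda>n. LINT s:{0<..<t}|lebesgue. B.bcalc n (relax \<alpha> \<rho> s) x \<bullet> z) \<longlonglongrightarrow> (LINT s:{0<..<t}|lebesgue. y s \<bullet> z)"
  proof (rule set_LINT_tendsto(2))
    show "set_borel_measurable lebesgue {0<..<t} (\<lambda>s. B.bcalc n (relax \<alpha> \<rho> s) x \<bullet> z)" for n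
      using int2[of n] unfolding set_integrable_def set_borel_measurable_def by auto
    show "set_integrable lebesgue {0<..<t} (\<lambda>s. norm x * norm z)"
      using integrable_power_kernel(3)[OF a(1,2) t] .
    fix s assume s: "s \<in> {0<..<t}"
    show "\<bar>B.bcalc n (relax \<alpha> \<rho> s) x \<bullet> z\<bar> \<le> norm x * norm z" for n
      by (rule inner_le[OF r1(1)[OF s]])
    show "(\<lambda>n. B.bcalc n (relax \<alpha> \<rho> s) x \<bullet> z) \<longlonglongrightarrow> y s \<bullet> z"
      unfolding y_def using s by (intro tendsto_intros B.calc_tendsto continuous_on_relax_b[OF a]) auto
  qed
  have "(\<lambda>n. - \<rho> * (LINT s:{0<..<t}|lebesgue. B.bcalc n (relax \<alpha> \<rho> s) x \<bullet> z))
     \<longlonglongrightarrow> 1 / Gamma (1 - \<alpha>) * (LINT s:{0<..<t}|lebesgue. (t - s) powr (-\<alpha>) * ((y s - x) \<bullet> B z))"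
    unfolding eq[symmetric] by (intro tendsto_intros lim1)
  moreover have "(\<lambda>n. - \<rho> * (LINT s:{0<..<t}|lebesgue. B.bcalc n (relax \<alpha> \<rho> s) x \<bullet> z))
     \<longlonglongrightarrow> - \<rho> * (LINT s:{0<..<t}|lebesgue. y s \<bullet> z)"
    by (intro tendsto_intros lim2)
  ultimately show ?thesis by (rule LIMSEQ_unique)
qed

text \<open>Formally \<open>G t\<close> is \<open>J\<close> applied to \<open>relax (b) / b\<close>
  at \<open>b = B\<close>. That quotient is bounded but not known to be continuous at
  \<open>b = 0\<close>, so it is approximated by quotients with denominator
  \<open>b + \<epsilon>\<close>, whose images under \<open>J\<close> converge in
  \<open>M\<close>.\<close>

lemma relax_lift:
  fixes x :: 'y
  assumes a: "0 < \<alpha>" "\<alpha> < 1" "0 < \<rho>"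
  shows "\<exists>G. (\<forall>t>0. G t \<in> M \<and> \<iota> (G t) = B.calc (relax \<alpha> \<rho> t) x \<and>
      (norm (G t))\<^sup>2 \<le> Gamma (\<alpha> + 1) / \<rho> * t powr (-\<alpha>) * (norm x)\<^sup>2) \<and> continuous_on {0<..} G"
proof -
  define K where "K t = Gamma (\<alpha> + 1) / \<rho> * t powr (-\<alpha>)" for t
  have K0: "K t \<ge> 0" for t using a by (simp add: K_def Gamma_real_pos less_imp_le)
  define \<epsilon> where "\<epsilon> n = 1 / real (Suc n)" for n
  have ep: "\<epsilon> n > 0" for n by (simp add: \<epsilon>_def)
  have ep0: "\<epsilon> \<longlonglongrightarrow> 0" unfolding \<epsilon>_def by (rule LIMSEQ_Suc[OF lim_1_over_n])
  \<comment> \<open>The regularised quotient is continuous on the unit interval and keeps the bound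
    \<open>K t\<close> independently of \<open>n\<close>.\<close>
  define h where "h n t b = relax \<alpha> \<rho> t b / (b + \<epsilon> n)" for n t b
  have hc: "continuous_on {0..1} (h n t)" if "t > 0" for n t
    unfolding h_def[abs_def]
  proof (rule continuous_on_divide)
    show "\<forall>b\<in>{0..1}. b + \<epsilon> n \<noteq> 0" using ep[of n] by force
  qed (intro continuous_intros continuous_on_relax_b[OF a that])+
  have h01: "0 \<le> h n t b" "h n t b \<le> K t" "b * h n t b \<le> 1" "0 \<le> b * h n t b"
    "\<bar>b * h n t b - relax \<alpha> \<rho> t b\<bar> \<le> K t * \<epsilon> n"
    if "t > 0" "b \<in> {0..1}" for n t b
  proof -
    have r: "0 \<le> relax \<alpha> \<rho> t b" "relax \<alpha> \<rho> t b \<le> 1" "relax \<alpha> \<rho> t b \<le> K t * b"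
      using relax_bounds[OF a that(1), of b] that by (auto simp: K_def)
    have be: "b + \<epsilon> n > 0" using ep[of n] that by auto
    show h0: "0 \<le> h n t b" using r be by (simp add: h_def)
    have "relax \<alpha> \<rho> t b \<le> K t * (b + \<epsilon> n)" using r(3) mult_nonneg_nonneg[OF K0, of "\<epsilon> n" t] ep[of n] by (simp add: distrib_left)
    then show hK: "h n t b \<le> K t" using be by (simp add: h_def divide_le_eq)
    have "b * relax \<alpha> \<rho> t b \<le> b * 1" using r that by (intro mult_left_mono) auto
    then have "b * relax \<alpha> \<rho> t b \<le> b + \<epsilon> n" using ep[of n] by simp
    then show "b * h n t b \<le> 1" using be by (simp add: h_def divide_le_eq)
    show "0 \<le> b * h n t b" using h0 that by simp
    have "b * h n t b - relax \<alpha> \<rho> t b = - (\<epsilon> n * h n t b)"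
      using be by (simp add: h_def field_simps)
    then show "\<bar>b * h n t b - relax \<alpha> \<rho> t b\<bar> \<le> K t * \<epsilon> n"
      using h0 hK ep[of n] by (simp add: abs_mult mult_mono mult.commute)
  qed
  define g where "g n t = J (B.calc (h n t) x)" for n t
  have gM: "g n t \<in> M" for n t by (simp add: g_def J)
  have gle: "(norm (g n t))\<^sup>2 \<le> K t * (norm x)\<^sup>2" if "t > 0" for n t
    using J_calc_norm_sq[OF hc[OF that, of n], where S = 1 and S' = "K t" and x = x] h01[OF that, of _ n] by (simp add: g_def abs_of_nonneg)
  \<comment> \<open>The estimate uses that \<open>b * h n t b\<close> converges uniformly to
    \<open>relax \<alpha> \<rho> t b\<close>, while \<open>h n t\<close> is merely bounded;
    \<open>J_calc_norm_sq\<close> combines the two.\<close>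
  have close: "(norm (g n t - g m t))\<^sup>2 \<le> (K t * (\<epsilon> n + \<epsilon> m)) * K t * (norm x)\<^sup>2" if "t > 0" for n m t
  proof -
    have "g n t - g m t = J (B.calc (\<lambda>b. h n t b - h m t b) x)"
      unfolding g_def J_diff[symmetric] by (simp add: B.calc_diff hc that)
    also have "(norm \<dots>)\<^sup>2 \<le> (K t * (\<epsilon> n + \<epsilon> m)) * K t * (norm x)\<^sup>2"
    proof (rule J_calc_norm_sq)
      show "continuous_on {0..1} (\<lambda>b. h n t b - h m t b)" by (intro continuous_intros hc that)
      fix b :: real assume b: "b \<in> {0..1}"
      show "\<bar>b * (h n t b - h m t b)\<bar> \<le> K t * (\<epsilon> n + \<epsilon> m)"
        using h01(5)[OF that b, of n] h01(5)[OF that b, of m] unfolding right_diff_distrib distrib_left by linarith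
      show "\<bar>h n t b - h m t b\<bar> \<le> K t"
        using h01(1,2)[OF that b, of n] h01(1,2)[OF that b, of m] by linarith
    qed
    finally show ?thesis .
  qed
  have conv: "convergent (\<lambda>n. g n t)" if "t > 0" for t
  proof -
    define C where "C = K t * K t * (norm x)\<^sup>2"
    have C: "C \<ge> 0" by (simp add: C_def)
    have "Cauchy (\<lambda>n. g n t)"
    proof (rule metric_CauchyI)
      fix e :: real assume e: "e > 0"
      have "(\<lambda>n. C * (2 * \<epsilon> n)) \<longlonglongrightarrow> C * (2 * 0)" by (intro tendsto_intros ep0)
      then have "eventually (\<lambda>n. C * (2 * \<epsilon> n) < e\<^sup>2) sequentially" using e by (intro order_tendstoD) auto
      then obtain N where N: "C * (2 * \<epsilon> N) < e\<^sup>2" by (auto simp: eventually_sequentially)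
      have mono: "\<epsilon> n \<le> \<epsilon> N" if "n \<ge> N" for n using that by (simp add: \<epsilon>_def frac_le)
      have "dist (g n t) (g m t) < e" if "n \<ge> N" "m \<ge> N" for n m
      proof -
        have "(norm (g n t - g m t))\<^sup>2 \<le> C * (\<epsilon> n + \<epsilon> m)" using close[OF \<open>t > 0\<close>, of n m] by (simp add: C_def mult_ac)
        also have "\<dots> \<le> C * (2 * \<epsilon> N)" using mono[OF that(1)] mono[OF that(2)] C by (intro mult_left_mono) auto
        finally have "(norm (g n t - g m t))\<^sup>2 < e\<^sup>2" using N by simp
        then show ?thesis using e power2_less_imp_less[of "norm (g n t - g m t)" e] by (simp add: dist_norm)
      qed
      then show "\<exists>N. \<forall>m\<ge>N. \<forall>n\<ge>N. dist (g m t) (g n t) < e" by blast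
    qed
    then show ?thesis by (rule Cauchy_convergent)
  qed
  define G where "G t = lim (\<lambda>n. g n t)" for t
  have lim: "(\<lambda>n. g n t) \<longlonglongrightarrow> G t" if "t > 0" for t
    using conv[OF that] unfolding G_def by (simp add: convergent_LIMSEQ_iff)
  have GM: "G t \<in> M" if "t > 0" for t using closed_sequentially[OF M(2) gM lim[OF that]] .
  have "\<iota> (G t) = B.calc (relax \<alpha> \<rho> t) x" if "t > 0" for t
  proof (rule LIMSEQ_unique)
    have "(\<lambda>n. \<iota> (g n t) - \<iota> (G t)) \<longlonglongrightarrow> 0"
    proof (rule Lim_null_comparison)
      show "\<forall>\<^sub>F n in sequentially. norm (\<iota> (g n t) - \<iota> (G t)) \<le> norm (g n t - G t)"
        using emb_norm[of "g n t - G t" for n] gM GM[OF that] M(1) by (simp add: emb_diff subspace_diff)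
      show "(\<lambda>n. norm (g n t - G t)) \<longlonglongrightarrow> 0" by (rule tendsto_norm_zero[OF LIM_zero[OF lim[OF that]]])
    qed
    then show "(\<lambda>n. \<iota> (g n t)) \<longlonglongrightarrow> \<iota> (G t)" by (rule LIM_zero_cancel)
    have est: "norm (\<iota> (g n t) - B.calc (relax \<alpha> \<rho> t) x) \<le> (K t * \<epsilon> n) * norm x" for n
    proof -
      have "\<iota> (g n t) - B.calc (relax \<alpha> \<rho> t) x = B.calc (\<lambda>b. b * h n t b - relax \<alpha> \<rho> t b) x"
        unfolding g_def B_def[symmetric] B.calc_times_B[OF hc[OF that], symmetric]
        by (rule B.calc_diff[symmetric]) (intro continuous_intros hc that continuous_on_relax_b[OF a])+
      also have "norm \<dots> \<le> (K t * \<epsilon> n) * norm x"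
        by (rule B.calc_norm_le) (use h01(5)[OF that] in \<open>auto intro!: continuous_intros hc that continuous_on_relax_b[OF a]\<close>)
      finally show ?thesis .
    qed
    have "(\<lambda>n. (K t * \<epsilon> n) * norm x) \<longlonglongrightarrow> (K t * 0) * norm x" by (intro tendsto_intros ep0)
    then have zero: "(\<lambda>n. (K t * \<epsilon> n) * norm x) \<longlonglongrightarrow> 0" by simp
    have "(\<lambda>n. \<iota> (g n t) - B.calc (relax \<alpha> \<rho> t) x) \<longlonglongrightarrow> 0"
      by (rule Lim_null_comparison[OF always_eventually[OF allI[OF est]] zero])
    then show "(\<lambda>n. \<iota> (g n t)) \<longlonglongrightarrow> B.calc (relax \<alpha> \<rho> t) x" by (rule LIM_zero_cancel)
  qed
  moreover have "(norm (G t))\<^sup>2 \<le> Gamma (\<alpha> + 1) / \<rho> * t powr (-\<alpha>) * (norm x)\<^sup>2" if "t > 0" for t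
    using LIMSEQ_le_const2[OF tendsto_power[OF tendsto_norm[OF lim[OF that]], of 2]] gle[OF that]
    by (auto simp: K_def)
  moreover have "continuous_on {0<..} G"
    unfolding continuous_on_iff
  proof (intro ballI allI impI)
    fix t e :: real assume t: "t \<in> {0<..}" and e: "e > 0"
    then have t: "t > 0" by simp
    define C where "C = 2 * K (t/2) * (norm x)\<^sup>2"
    have C: "C \<ge> 0" using K0 by (simp add: C_def)
    define e' where "e' = e\<^sup>2 / (C + 1)"
    have e': "e' > 0" "e' * C < e\<^sup>2"
      using e C by (auto simp: e'_def add_nonneg_pos divide_simps)
    obtain d where d: "d > 0" "\<And>s. \<bar>s - t\<bar> < d \<Longrightarrow> t / 2 < s"
      "\<And>s b. \<bar>s - t\<bar> < d \<Longrightarrow> b \<in> {0..1} \<Longrightarrow> \<bar>relax \<alpha> \<rho> s b - relax \<alpha> \<rho> t b\<bar> < e'"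
      using relax_equicontinuous[OF a t e'(1)] by blast
    show "\<exists>d>0. \<forall>s\<in>{0<..}. dist s t < d \<longrightarrow> dist (G s) (G t) < e"
    proof (intro exI[of _ d] conjI ballI impI d(1))
      fix s assume s: "dist s t < d"
      then have sd: "\<bar>s - t\<bar> < d" by (simp add: dist_real_def)
      have s0: "s > 0" "t / 2 < s" using d(2)[OF sd] t by auto
      have "K r \<le> K (t/2)" if "t / 2 \<le> r" for r
        unfolding K_def
      proof (rule mult_left_mono)
        show "r powr (-\<alpha>) \<le> (t/2) powr (-\<alpha>)" using a t that by (intro powr_mono2') auto
        show "0 \<le> Gamma (\<alpha> + 1) / \<rho>" using a by (simp add: Gamma_real_pos less_imp_le)
      qed
      then have Km: "K s \<le> K (t/2)" "K t \<le> K (t/2)" using s0 t by auto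
      \<comment> \<open>Again the geometric mean: the products with \<open>b\<close> are close by
        equicontinuity of \<open>relax\<close>, and the quotients are bounded by
        \<open>K (t/2)\<close> because nearby times stay above \<open>t/2\<close>. The bound is
        uniform in \<open>n\<close>, so it survives the limit.\<close>
      have "(norm (g n s - g n t))\<^sup>2 \<le> e' * (2 * K (t/2)) * (norm x)\<^sup>2" for n
      proof -
        have "g n s - g n t = J (B.calc (\<lambda>b. h n s b - h n t b) x)"
          unfolding g_def J_diff[symmetric] by (simp add: B.calc_diff hc s0 t)
        also have "(norm \<dots>)\<^sup>2 \<le> e' * (2 * K (t/2)) * (norm x)\<^sup>2"
        proof (rule J_calc_norm_sq)
          show "continuous_on {0..1} (\<lambda>b. h n s b - h n t b)" by (intro continuous_intros hc s0 t)
          fix b :: real assume b: "b \<in> {0..1}"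
          have be: "b + \<epsilon> n > 0" using ep[of n] b by auto
          have "b * (h n s b - h n t b) = (b / (b + \<epsilon> n)) * (relax \<alpha> \<rho> s b - relax \<alpha> \<rho> t b)"
            using be by (simp add: h_def diff_divide_distrib right_diff_distrib)
          moreover have "\<bar>b / (b + \<epsilon> n)\<bar> * \<bar>relax \<alpha> \<rho> s b - relax \<alpha> \<rho> t b\<bar> \<le> 1 * e'"
            using d(3)[OF sd b] be b ep[of n] by (intro mult_mono) (auto simp: divide_le_eq_1)
          ultimately show "\<bar>b * (h n s b - h n t b)\<bar> \<le> e'" by (simp add: abs_mult)
          show "\<bar>h n s b - h n t b\<bar> \<le> 2 * K (t/2)"
            using h01(1,2)[OF s0(1) b, of n] h01(1,2)[OF t b, of n] Km K0[of "t/2"] by linarith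
        qed
        finally show ?thesis .
      qed
      then have "(norm (G s - G t))\<^sup>2 \<le> e' * (2 * K (t/2)) * (norm x)\<^sup>2"
        by (intro LIMSEQ_le_const2[OF tendsto_power[OF tendsto_norm[OF tendsto_diff[OF lim[OF s0(1)] lim[OF t]]]]]) auto
      also have "\<dots> = e' * C" by (simp add: C_def)
      also have "\<dots> < e\<^sup>2" by (rule e')
      finally show "dist (G s) (G t) < e"
        using e power2_less_imp_less[of "norm (G s - G t)" e] by (simp add: dist_norm)
    qed
  qed
  ultimately show ?thesis using GM by blast
qed

text \<open>On an element \<open>B z\<close> convergence holds with the rate of
  \<open>relax_initial\<close>. Such elements are dense in the closure of the range of
  \<open>\<iota>\<close>, and on the remainder the operators \<open>relax - 1\<close> have norm at
  most 1.\<close>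

lemma relax_calc_initial:
  fixes x :: 'y
  assumes a: "0 < \<alpha>" "\<alpha> < 1" "0 < \<rho>" and x: "x \<in> closure (\<iota> ` M)"
  shows "((\<lambda>t. B.calc (relax \<alpha> \<rho> t) x) \<longlongrightarrow> x) (at_right 0)"
proof (rule tendstoI)
  fix e :: real assume e: "e > 0"
  have "\<exists>z. norm (x - B z) < e / 2"
  proof -
    have e4: "e / 4 > 0" using e by simp
    have "\<exists>y\<in>\<iota> ` M. dist y x < e / 4" using x e4 unfolding closure_approachable by blast
    then obtain g where g: "g \<in> M" "dist (\<iota> g) x < e / 4" by blast
    have "g \<in> closure (range J)" using g(1) J_dense by simp
    then have "\<exists>y\<in>range J. dist y g < e / 4" using e4 unfolding closure_approachable by blast
    then obtain z where z: "dist (J z) g < e / 4" by blast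
    have "norm (B z - \<iota> g) \<le> norm (J z - g)"
      unfolding B_def using g J emb_norm[of "J z - g"] M(1) by (simp add: emb_diff subspace_diff)
    then have "norm (x - B z) < e / 2"
      using g(2) z norm_triangle_ineq[of "x - \<iota> g" "\<iota> g - B z"] by (simp add: dist_norm norm_minus_commute)
    then show ?thesis by blast
  qed
  then obtain z where z: "norm (x - B z) < e / 2" by blast
  define C where "C = \<rho> / Gamma (\<alpha> + 1) * norm z"
  have "((\<lambda>t. C * t powr \<alpha>) \<longlongrightarrow> C * 0 powr \<alpha>) (at_right 0)"
    using a by (intro tendsto_intros) (auto simp: eventually_at_filter)
  then have "eventually (\<lambda>t. C * t powr \<alpha> < e / 2) (at_right 0)"
    using e by (intro order_tendstoD) auto
  moreover have "eventually (\<lambda>t::real. t > 0) (at_right 0)" by (simp add: eventually_at_right_less)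
  ultimately show "eventually (\<lambda>t. dist (B.calc (relax \<alpha> \<rho> t) x) x < e) (at_right 0)"
  proof eventually_elim
    case (elim t)
    let ?\<phi> = "\<lambda>b. relax \<alpha> \<rho> t b - 1"
    have c: "continuous_on {0..1} ?\<phi>" by (intro continuous_intros continuous_on_relax_b[OF a elim(2)])
    have "B.calc (relax \<alpha> \<rho> t) x - x = B.calc ?\<phi> x"
      using B.calc_diff[OF continuous_on_relax_b[OF a elim(2)], of "\<lambda>b. 1" x] by (simp add: B.calc_one)
    also have "\<dots> = B.calc ?\<phi> (x - B z) + B.calc ?\<phi> (B z)"
      using B.calc_add_arg[OF c, of "x - B z" "B z"] by simp
    also have "B.calc ?\<phi> (B z) = B.calc (\<lambda>b. b * ?\<phi> b) z"
      unfolding B.calc_commute[OF c] B.calc_times_B[OF c] ..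
    finally have "norm (B.calc (relax \<alpha> \<rho> t) x - x) \<le> norm (B.calc ?\<phi> (x - B z)) + norm (B.calc (\<lambda>b. b * ?\<phi> b) z)"
      by (simp add: norm_triangle_ineq)
    also have "norm (B.calc ?\<phi> (x - B z)) \<le> 1 * norm (x - B z)"
    proof (rule B.calc_norm_le[OF c])
      fix b :: real assume "b \<in> {0..1}"
      then show "\<bar>relax \<alpha> \<rho> t b - 1\<bar> \<le> 1" using relax_bounds[OF a elim(2), of b] by auto
    qed
    also have "norm (B.calc (\<lambda>b. b * ?\<phi> b) z) \<le> (\<rho> * t powr \<alpha> / Gamma (\<alpha> + 1)) * norm z"
    proof (rule B.calc_norm_le)
      show "continuous_on {0..1} (\<lambda>b. b * ?\<phi> b)" by (intro continuous_intros continuous_on_relax_b[OF a elim(2)])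
      fix b :: real assume b: "b \<in> {0..1}"
      then have "0 \<le> b * (1 - relax \<alpha> \<rho> t b)" using relax_bounds[OF a elim(2), of b] by auto
      moreover have "b * ?\<phi> b = - (b * (1 - relax \<alpha> \<rho> t b))" by (simp add: right_diff_distrib)
      ultimately show "\<bar>b * ?\<phi> b\<bar> \<le> \<rho> * t powr \<alpha> / Gamma (\<alpha> + 1)"
        using relax_initial[OF a elim(2), of b] b by simp
    qed
    finally have "norm (B.calc (relax \<alpha> \<rho> t) x - x) \<le> 1 * norm (x - B z) + (\<rho> * t powr \<alpha> / Gamma (\<alpha> + 1)) * norm z"
      by simp
    moreover have "(\<rho> * t powr \<alpha> / Gamma (\<alpha> + 1)) * norm z = C * t powr \<alpha>" by (simp add: C_def)
    ultimately show ?case using elim(1) z unfolding dist_norm by linarith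
  qed
qed

text \<open>For test elements \<open>J z\<close> the equation is \<open>relax_calc_equation\<close>,
  since \<open>G s \<bullet> J z\<close> is the pairing of \<open>\<iota> (G s)\<close> with
  \<open>z\<close>; density of the range of \<open>J\<close> and dominated convergence extend it to
  all of \<open>M\<close>.\<close>

theorem evolution_exists:
  fixes x :: 'y
  assumes a: "0 < \<alpha>" "\<alpha> < 1" "0 < \<rho>" and x: "x \<in> closure (\<iota> ` M)"
  obtains G where "\<And>t. 0 < t \<Longrightarrow> G t \<in> M"
    and "((\<lambda>t. \<iota> (G t)) \<longlongrightarrow> x) (at_right 0)"
    and "continuous_on {0<..} G"
    and "\<And>t. 0 < t \<Longrightarrow> norm (\<iota> (G t)) \<le> norm x"
    and "\<And>t. 0 < t \<Longrightarrow> (norm (G t))\<^sup>2 \<le> Gamma (\<alpha> + 1) / \<rho> * t powr (-\<alpha>) * (norm x)\<^sup>2"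
    and "\<And>t g. 0 < t \<Longrightarrow> g \<in> M \<Longrightarrow>
      1 / Gamma (1 - \<alpha>) * (LINT s:{0<..<t}|lebesgue. (t - s) powr (-\<alpha>) * ((\<iota> (G s) - x) \<bullet> \<iota> g))
        = - \<rho> * (LINT s:{0<..<t}|lebesgue. G s \<bullet> g)"
proof -
  obtain G where G: "\<And>t. 0 < t \<Longrightarrow> G t \<in> M" "\<And>t. 0 < t \<Longrightarrow> \<iota> (G t) = B.calc (relax \<alpha> \<rho> t) x"
    "\<And>t. 0 < t \<Longrightarrow> (norm (G t))\<^sup>2 \<le> Gamma (\<alpha> + 1) / \<rho> * t powr (-\<alpha>) * (norm x)\<^sup>2"
    "continuous_on {0<..} G"
    using relax_lift[OF a, of x] by blast
  have ev: "eventually (\<lambda>t::real. t > 0) (at_right 0)" by (simp add: eventually_at_right_less)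
  have lim: "((\<lambda>t. \<iota> (G t)) \<longlongrightarrow> x) (at_right 0)"
    by (rule Lim_transform_eventually[OF relax_calc_initial[OF a x]], rule eventually_mono[OF ev]) (simp add: G)
  have yle: "norm (\<iota> (G t)) \<le> norm x" if "t > 0" for t
    unfolding G(2)[OF that] using relax_bounds[OF a that]
    by (intro order_trans[OF B.calc_norm_le[OF continuous_on_relax_b[OF a that], of 1]]) auto
  have "1 / Gamma (1 - \<alpha>) * (LINT s:{0<..<t}|lebesgue. (t - s) powr (-\<alpha>) * ((\<iota> (G s) - x) \<bullet> \<iota> g))
        = - \<rho> * (LINT s:{0<..<t}|lebesgue. G s \<bullet> g)" if t: "0 < t" and g: "g \<in> M" for t g
  proof -
    have eqJ: "1 / Gamma (1 - \<alpha>) * (LINT s:{0<..<t}|lebesgue. (t - s) powr (-\<alpha>) * ((\<iota> (G s) - x) \<bullet> \<iota> (J z)))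
        = - \<rho> * (LINT s:{0<..<t}|lebesgue. G s \<bullet> J z)" for z
    proof -
      have e1: "indicator {0<..<t} s *\<^sub>R ((t - s) powr (-\<alpha>) * ((\<iota> (G s) - x) \<bullet> \<iota> (J z)))
          = indicator {0<..<t} s *\<^sub>R ((t - s) powr (-\<alpha>) * ((B.calc (relax \<alpha> \<rho> s) x - x) \<bullet> B z))" for s
        using G(2)[of s] by (auto simp: indicator_def B_def)
      have e2: "indicator {0<..<t} s *\<^sub>R (G s \<bullet> J z) = indicator {0<..<t} s *\<^sub>R (B.calc (relax \<alpha> \<rho> s) x \<bullet> z)" for s
        using J(2)[OF G(1), of s z] G(2)[of s] by (auto simp: indicator_def inner_commute)
      show ?thesis using relax_calc_equation[OF a t, of x z] unfolding set_lebesgue_integral_def e1 e2 .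
    qed
    have "g \<in> closure (range J)" using g J_dense by simp
    then obtain p where pr: "\<And>n. p n \<in> range J" and pg: "p \<longlonglongrightarrow> g"
      unfolding closure_sequential by blast
    have "\<forall>n. \<exists>z. p n = J z" using pr by blast
    then obtain z where z: "\<And>n. p n = J (z n)" by metis
    have pM: "p n \<in> M" for n using z J by simp
    have ipg: "(\<lambda>n. \<iota> (p n)) \<longlonglongrightarrow> \<iota> g"
    proof (rule LIM_zero_cancel, rule Lim_null_comparison)
      show "\<forall>\<^sub>F n in sequentially. norm (\<iota> (p n) - \<iota> g) \<le> norm (p n - g)"
        using emb_norm[of "p n - g" for n] pM g M(1) by (simp add: emb_diff subspace_diff)
      show "(\<lambda>n. norm (p n - g)) \<longlonglongrightarrow> 0" by (rule tendsto_norm_zero[OF LIM_zero[OF pg]])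
    qed
    obtain C where C: "\<And>n. norm (p n) \<le> C" "C > 0"
      using convergent_imp_Bseq[OF convergentI[OF pg]] by (auto simp: Bseq_def)
    have sub: "{0<..<t} \<subseteq> {0<..}" by auto
    have contG: "continuous_on {0<..<t} G" by (rule continuous_on_subset[OF G(4) sub])
    have contiG: "continuous_on {0<..<t} (\<lambda>s. \<iota> (G s))"
      unfolding continuous_on_iff
    proof (intro ballI allI impI)
      fix s e :: real assume s: "s \<in> {0<..<t}" and e: "e > 0"
      then obtain d where d: "d > 0" "\<And>r. r \<in> {0<..<t} \<Longrightarrow> dist r s < d \<Longrightarrow> dist (G r) (G s) < e"
        using contG unfolding continuous_on_iff by meson
      have "dist (\<iota> (G r)) (\<iota> (G s)) \<le> dist (G r) (G s)" if "r \<in> {0<..<t}" for r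
        using emb_norm[of "G r - G s"] G(1)[of r] G(1)[of s] that s M(1)
        by (simp add: dist_norm emb_diff subspace_diff)
      then have "\<forall>r\<in>{0<..<t}. dist r s < d \<longrightarrow> dist (\<iota> (G r)) (\<iota> (G s)) < e"
        using d(2) by (meson le_less_trans)
      then show "\<exists>d>0. \<forall>r\<in>{0<..<t}. dist r s < d \<longrightarrow> dist (\<iota> (G r)) (\<iota> (G s)) < e"
        using d(1) by blast
    qed
    have L: "(\<lambda>n. LINT s:{0<..<t}|lebesgue. (t - s) powr (-\<alpha>) * ((\<iota> (G s) - x) \<bullet> \<iota> (p n)))
        \<longlonglongrightarrow> (LINT s:{0<..<t}|lebesgue. (t - s) powr (-\<alpha>) * ((\<iota> (G s) - x) \<bullet> \<iota> g))"
    proof (rule set_LINT_tendsto(2))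
      show "set_borel_measurable lebesgue {0<..<t} (\<lambda>s. (t - s) powr (-\<alpha>) * ((\<iota> (G s) - x) \<bullet> \<iota> (p n)))" for n
        by (intro set_borel_measurable_continuous_lebesgue continuous_intros contiG) auto
      show "set_integrable lebesgue {0<..<t} (\<lambda>s. (2 * norm x * C) * (t - s) powr (-\<alpha>))"
        by (rule integrable_power_kernel(1)[OF a(1,2) t])
      fix s assume s: "s \<in> {0<..<t}"
      show "\<bar>(t - s) powr (-\<alpha>) * ((\<iota> (G s) - x) \<bullet> \<iota> (p n))\<bar> \<le> (2 * norm x * C) * (t - s) powr (-\<alpha>)" for n
      proof -
        have "\<bar>(\<iota> (G s) - x) \<bullet> \<iota> (p n)\<bar> \<le> norm (\<iota> (G s) - x) * norm (\<iota> (p n))"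
          by (rule Cauchy_Schwarz_ineq2)
        also have "\<dots> \<le> (2 * norm x) * C"
          using yle[of s] s norm_triangle_ineq4[of "\<iota> (G s)" x] emb_norm[OF pM[of n]] C(1)[of n]
          by (intro mult_mono) auto
        finally have "(t - s) powr (-\<alpha>) * \<bar>(\<iota> (G s) - x) \<bullet> \<iota> (p n)\<bar> \<le> (t - s) powr (-\<alpha>) * ((2 * norm x) * C)"
          by (intro mult_left_mono) auto
        then show ?thesis by (simp add: abs_mult mult_ac)
      qed
      show "(\<lambda>n. (t - s) powr (-\<alpha>) * ((\<iota> (G s) - x) \<bullet> \<iota> (p n))) \<longlonglongrightarrow> (t - s) powr (-\<alpha>) * ((\<iota> (G s) - x) \<bullet> \<iota> g)"
        by (intro tendsto_intros ipg)
    qed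
    have R: "(\<lambda>n. LINT s:{0<..<t}|lebesgue. G s \<bullet> p n) \<longlonglongrightarrow> (LINT s:{0<..<t}|lebesgue. G s \<bullet> g)"
    proof (rule set_LINT_tendsto(2))
      define D where "D = (Gamma (\<alpha> + 1) / \<rho> * (norm x)\<^sup>2 + 1) * C"
      show "set_borel_measurable lebesgue {0<..<t} (\<lambda>s. G s \<bullet> p n)" for n
        by (intro set_borel_measurable_continuous_lebesgue continuous_intros contG) auto
      show "set_integrable lebesgue {0<..<t} (\<lambda>s. C * (Gamma (\<alpha> + 1) / \<rho> * (norm x)\<^sup>2) * s powr (-\<alpha>) + C)"
        by (intro set_integral_add integrable_power_kernel[OF a(1,2) t])
      fix s assume s: "s \<in> {0<..<t}"
      show "\<bar>G s \<bullet> p n\<bar> \<le> C * (Gamma (\<alpha> + 1) / \<rho> * (norm x)\<^sup>2) * s powr (-\<alpha>) + C" for n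
      proof -
        \<comment> \<open>Passing from the norm to its square plus 1 makes the available bound,
          integrable in time, applicable.\<close>
        have "2 * norm (G s) \<le> (norm (G s))\<^sup>2 + 1" using sum_squares_bound[of "norm (G s)" 1] by simp
        then have "norm (G s) \<le> (norm (G s))\<^sup>2 + 1" using norm_ge_zero[of "G s"] by linarith
        also have "\<dots> \<le> Gamma (\<alpha> + 1) / \<rho> * s powr (-\<alpha>) * (norm x)\<^sup>2 + 1" using G(3)[of s] s by simp
        finally have n: "norm (G s) \<le> Gamma (\<alpha> + 1) / \<rho> * s powr (-\<alpha>) * (norm x)\<^sup>2 + 1" .
        have "\<bar>G s \<bullet> p n\<bar> \<le> norm (G s) * norm (p n)" by (rule Cauchy_Schwarz_ineq2)
        also have "\<dots> \<le> (Gamma (\<alpha> + 1) / \<rho> * s powr (-\<alpha>) * (norm x)\<^sup>2 + 1) * C"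
          using n C(1)[of n] order_trans[OF norm_ge_zero n] by (intro mult_mono) auto
        finally show ?thesis by (simp add: algebra_simps)
      qed
      show "(\<lambda>n. G s \<bullet> p n) \<longlonglongrightarrow> G s \<bullet> g" by (intro tendsto_intros pg)
    qed
    have "(\<lambda>n. 1 / Gamma (1 - \<alpha>) * (LINT s:{0<..<t}|lebesgue. (t - s) powr (-\<alpha>) * ((\<iota> (G s) - x) \<bullet> \<iota> (p n))))
        \<longlonglongrightarrow> 1 / Gamma (1 - \<alpha>) * (LINT s:{0<..<t}|lebesgue. (t - s) powr (-\<alpha>) * ((\<iota> (G s) - x) \<bullet> \<iota> g))"
      by (intro tendsto_intros L)
    moreover have "(\<lambda>n. - \<rho> * (LINT s:{0<..<t}|lebesgue. G s \<bullet> p n)) \<longlonglongrightarrow> - \<rho> * (LINT s:{0<..<t}|lebesgue. G s \<bullet> g)"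
      by (intro tendsto_intros R)
    ultimately show ?thesis unfolding z eqJ by (rule LIMSEQ_unique)
  qed
  then show ?thesis using that[OF G(1) lim G(4) yle G(3)] by blast
qed

end

subsection \<open>Smooth functions and the fundamental lemma\<close>

lemma C_k_Suc_imp: "C_k (Suc k) f \<Longrightarrow> C_k k f"
proof (induction k arbitrary: f)
  case 0
  then show ?case
    by (simp add: continuous_at_imp_continuous_on differentiable_imp_continuous_within)
next
  case (Suc k)
  then show ?case by auto
qed

lemma C_k_const: "C_k k (\<lambda>x. c)"
  by (induction k arbitrary: c) (auto simp: frechet_derivative_const)

lemma C_k_add: "C_k k f \<Longrightarrow> C_k k g \<Longrightarrow> C_k k (\<lambda>x. f x + g x)"
proof (induction k arbitrary: f g)
  case 0
  then show ?case by (auto intro: continuous_on_add)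
next
  case (Suc k)
  then have d: "f differentiable at x" "g differentiable at x" for x by auto
  have D: "((\<lambda>x. f x + g x) has_derivative (\<lambda>h. frechet_derivative f (at x) h + frechet_derivative g (at x) h)) (at x)" for x
    using d by (intro has_derivative_add) (simp_all add: frechet_derivative_works)
  have "frechet_derivative (\<lambda>x. f x + g x) (at x) b = frechet_derivative f (at x) b + frechet_derivative g (at x) b" for x b
    by (subst frechet_derivative_at[OF D, symmetric]) simp
  then show ?case using Suc by (auto intro!: differentiable_add d)
qed

lemma C_k_mult: "C_k k f \<Longrightarrow> C_k k g \<Longrightarrow> C_k k (\<lambda>x. f x * g x)"
proof (induction k arbitrary: f g)
  case 0
  then show ?case by (auto intro: continuous_on_mult)
next
  case (Suc k)
  then have d: "f differentiable at x" "g differentiable at x" for x by auto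
  have D: "((\<lambda>x. f x * g x) has_derivative (\<lambda>h. f x * frechet_derivative g (at x) h + frechet_derivative f (at x) h * g x)) (at x)" for x
    using d by (intro has_derivative_mult) (simp_all add: frechet_derivative_works)
  have "frechet_derivative (\<lambda>x. f x * g x) (at x) b = f x * frechet_derivative g (at x) b + frechet_derivative f (at x) b * g x" for x b
    by (subst frechet_derivative_at[OF D, symmetric]) simp
  then show ?case using Suc C_k_Suc_imp[OF Suc.prems(1)] C_k_Suc_imp[OF Suc.prems(2)]
    by (auto intro!: differentiable_mult d C_k_add)
qed

lemma C_k_power: "C_k k f \<Longrightarrow> C_k k (\<lambda>x. f x ^ n)"
  by (induction n) (auto intro: C_k_const C_k_mult)

lemma C_k_cmult: "C_k k f \<Longrightarrow> C_k k (\<lambda>x. c * f x)"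
  by (intro C_k_mult C_k_const)

lemma C_k_diff: "C_k k f \<Longrightarrow> C_k k g \<Longrightarrow> C_k k (\<lambda>x. f x - g x)"
  using C_k_add[of k f "\<lambda>x. (-1) * g x"] C_k_cmult[of k g "-1"] by simp

lemma C_k_prod: "(\<And>i. i \<in> I \<Longrightarrow> C_k k (f i)) \<Longrightarrow> C_k k (\<lambda>x. \<Prod>i\<in>I. f i x)"
  by (induction I rule: infinite_finite_induct) (auto intro: C_k_const C_k_mult)

text \<open>The chain rule reproduces the same shape with the derivative of \<open>h\<close> in
  place of \<open>h\<close>, which is what the induction on \<open>k\<close> consumes.\<close>

lemma C_k_affine_inner:
  fixes b :: "'a::euclidean_space"
  shows "C_k k h \<Longrightarrow> C_k k (\<lambda>x. h (m * (x \<bullet> b) + c))"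
proof (induction k arbitrary: h)
  case 0
  then have h: "continuous_on UNIV h" by simp
  have "continuous_on UNIV (\<lambda>x::'a. m * (x \<bullet> b) + c)" by (intro continuous_intros)
  from continuous_on_compose2[OF h this] show ?case by auto
next
  case (Suc k)
  then have d: "h differentiable at y" for y by auto
  have D: "((\<lambda>x::'a. h (m * (x \<bullet> b) + c)) has_derivative (\<lambda>v. frechet_derivative h (at (m * (x \<bullet> b) + c)) (m * (v \<bullet> b)))) (at x)" for x
  proof -
    have 1: "((\<lambda>x::'a. m * (x \<bullet> b) + c) has_derivative (\<lambda>v. m * (v \<bullet> b))) (at x)"
      by (auto intro!: derivative_eq_intros)
    show ?thesis using has_derivative_compose[OF 1, of h] d by (simp add: frechet_derivative_works)
  qed
  have lin: "frechet_derivative h (at y) r = r * frechet_derivative h (at y) 1" for y r :: real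
  proof -
    have "linear (frechet_derivative h (at y))" by (rule linear_frechet_derivative[OF d])
    from linear_cmul[OF this, of r 1] show ?thesis by simp
  qed
  have "frechet_derivative (\<lambda>x::'a. h (m * (x \<bullet> b) + c)) (at x) v = m * (v \<bullet> b) * frechet_derivative h (at (m * (x \<bullet> b) + c)) 1" for x v
    by (subst frechet_derivative_at[OF D, symmetric]) (rule lin)
  moreover have "C_k k (\<lambda>x::'a. frechet_derivative h (at (m * (x \<bullet> b) + c)) 1)"
    using Suc by (intro Suc.IH[of "\<lambda>y. frechet_derivative h (at y) 1"]) auto
  ultimately show ?case using D by (auto simp: differentiable_def intro!: C_k_cmult)
qed

lemma C_k_Suc_real:
  fixes h :: "real \<Rightarrow> real"
  assumes "\<And>x. (h has_field_derivative h' x) (at x)" "C_k k h'"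
  shows "C_k (Suc k) h"
proof -
  have D: "(h has_derivative (*) (h' x)) (at x)" for x using assms(1) by (simp add: has_field_derivative_def)
  have "frechet_derivative h (at x) 1 = h' x" for x by (subst frechet_derivative_at[OF D, symmetric]) simp
  then show ?thesis using assms(2) D by (auto simp: differentiable_def)
qed

text \<open>The polynomial factor makes the family closed under differentiation, so that smoothness
  follows by induction.\<close>

definition flat :: "real poly \<Rightarrow> real \<Rightarrow> real" where
  "flat p x = (if x > 0 then poly p (1 / x) * exp (- (1 / x)) else 0)"

lemma flat_tendsto_0: "(flat p \<longlongrightarrow> 0) (at 0)"
proof -
  have "((\<lambda>y. poly p y * exp (- y)) \<longlongrightarrow> 0) at_top"
  proof -
    have "((\<lambda>y. \<Sum>i\<le>degree p. coeff p i * (y ^ i / exp y)) \<longlongrightarrow> (\<Sum>i\<le>degree p. coeff p i * 0)) at_top"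
      by (intro tendsto_intros tendsto_power_div_exp_0)
    then show ?thesis
      by (simp add: poly_altdef sum_distrib_right exp_minus divide_inverse mult.assoc)
  qed
  then have "((\<lambda>x. poly p (inverse x) * exp (- inverse x)) \<longlongrightarrow> 0) (at_right 0)"
    by (rule filterlim_compose[OF _ filterlim_inverse_at_top_right])
  then have "(flat p \<longlongrightarrow> 0) (at_right 0)"
    by (rule Lim_transform_eventually)
      (auto simp: eventually_at_filter flat_def divide_inverse)
  moreover have "(flat p \<longlongrightarrow> 0) (at_left 0)"
    by (rule tendsto_eventually) (auto simp: eventually_at_filter flat_def)
  ultimately show ?thesis by (simp add: filterlim_split_at)
qed

lemma flat_deriv: "(flat p has_field_derivative flat (monom 1 2 * (p - pderiv p)) x) (at x)"
proof -
  consider "x > 0" | "x < 0" | "x = 0" by linarith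
  then show ?thesis
  proof cases
    case 1
    have "((\<lambda>x. poly p (1 / x) * exp (- (1 / x))) has_field_derivative flat (monom 1 2 * (p - pderiv p)) x) (at x)"
      using 1 by (auto intro!: derivative_eq_intros simp: flat_def poly_monom field_simps power2_eq_square)
    then show ?thesis
      by (rule has_field_derivative_transform_within_open[of _ _ _ "{0<..}"]) (use 1 in \<open>auto simp: flat_def\<close>)
  next
    case 2
    have "((\<lambda>x. 0) has_field_derivative flat (monom 1 2 * (p - pderiv p)) x) (at x)"
      using 2 by (simp add: flat_def)
    then show ?thesis
      by (rule has_field_derivative_transform_within_open[of _ _ _ "{..<0}"]) (use 2 in \<open>auto simp: flat_def\<close>)
  next
    case 3
    \<comment> \<open>Dividing by \<open>x\<close> multiplies the polynomial in \<open>1 / x\<close>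
      by its variable, so the difference quotient at 0 is again a member of the family and tends to
      0.\<close>
    have "(\<lambda>x. (flat p x - flat p 0) / (x - 0)) = flat (pCons 0 p)"
      by (auto simp: flat_def)
    then show ?thesis using flat_tendsto_0[of "pCons 0 p"] 3
      by (simp add: has_field_derivative_iff flat_def)
  qed
qed

lemma C_k_flat: "C_k k (flat p)"
proof (induction k arbitrary: p)
  case 0
  have "isCont (flat p) x" for x by (rule DERIV_isCont[OF flat_deriv])
  then show ?case by (simp add: continuous_at_imp_continuous_on)
next
  case (Suc k)
  show ?case by (rule C_k_Suc_real[OF flat_deriv Suc])
qed

text \<open>The affine arguments are spelled out with their factors 1 and -1 so that each has the
  shape required by \<open>C_k_affine_inner\<close>.\<close>

definition bump :: "'a::euclidean_space \<Rightarrow> 'a \<Rightarrow> 'a \<Rightarrow> real" where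
  "bump a b x = (\<Prod>i\<in>Basis. flat 1 (1 * (x \<bullet> i) + (- (a \<bullet> i))) * flat 1 ((-1) * (x \<bullet> i) + b \<bullet> i))"

lemma C_k_bump: "C_k k (bump a b)"
  unfolding bump_def[abs_def] by (intro C_k_prod C_k_mult C_k_affine_inner C_k_flat)

lemma flat_1_bounds: "0 \<le> flat 1 x" "flat 1 x < 1" "flat 1 x > 0 \<longleftrightarrow> x > 0"
  by (auto simp: flat_def)

lemma bump_bounds: "0 \<le> bump a b x" "bump a b x \<le> 1"
  unfolding bump_def using flat_1_bounds(1) flat_1_bounds(2)[THEN less_imp_le]
  by (auto intro!: prod_nonneg prod_le_1 mult_le_one)

lemma bump_pos_iff: "bump a b x > 0 \<longleftrightarrow> x \<in> box a b"
proof
  assume "bump a b x > 0"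
  then have "bump a b x \<noteq> 0" by simp
  then have "flat 1 (1 * (x \<bullet> i) + (- (a \<bullet> i))) * flat 1 ((-1) * (x \<bullet> i) + b \<bullet> i) \<noteq> 0" if "i \<in> Basis" for i
    using that unfolding bump_def prod_zero_iff[OF finite_Basis] by blast
  then show "x \<in> box a b" using flat_1_bounds(1,3) by (fastforce simp: box_def less_le)
next
  assume "x \<in> box a b"
  then show "bump a b x > 0" unfolding bump_def
    by (intro prod_pos ballI mult_pos_pos) (auto simp: box_def flat_1_bounds(3))
qed

text \<open>\<open>1 - (1 - bump)\<^sup>n\<close> increases to the indicator of the open box.\<close>

lemma bump_power_test:
  assumes "cbox a b \<subseteq> U"
  shows "(\<lambda>x. 1 - (1 - bump a b x) ^ Suc n) \<in> test_functions U"
proof -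
  let ?\<phi> = "\<lambda>x. 1 - (1 - bump a b x) ^ Suc n"
  have "{x. ?\<phi> x \<noteq> 0} \<subseteq> cbox a b"
  proof
    fix x assume "x \<in> {x. ?\<phi> x \<noteq> 0}"
    then have "bump a b x \<noteq> 0" by auto
    then show "x \<in> cbox a b" using bump_pos_iff[of a b x] bump_bounds(1)[of a b x] box_subset_cbox[of a b] by auto
  qed
  then have cl: "closure {x. ?\<phi> x \<noteq> 0} \<subseteq> cbox a b" by (rule closure_minimal) (rule closed_cbox)
  then have "compact (closure {x. ?\<phi> x \<noteq> 0})" using bounded_subset[OF bounded_cbox cl] by (simp add: compact_eq_bounded_closed)
  then show ?thesis using cl assms unfolding test_functions_def
    by (auto intro!: C_k_diff C_k_const C_k_power C_k_bump simp del: power_Suc)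
qed

text \<open>On a box whose closure lies in \<open>U\<close> the integrals vanish over all smaller
  boxes, hence over all Borel sets because boxes form an intersection-stable generator. Countably
  many such boxes cover \<open>U\<close>.\<close>

lemma AE_zero_of_box_integrals:
  fixes w :: "'a::euclidean_space \<Rightarrow> real"
  assumes U: "open U"
    and int: "\<And>a b. cbox a b \<subseteq> U \<Longrightarrow> set_integrable lebesgue (cbox a b) w"
    and zero: "\<And>a b. cbox a b \<subseteq> U \<Longrightarrow> (LINT x:box a b|lebesgue. w x) = 0"
  shows "AE x in lebesgue. x \<in> U \<longrightarrow> w x = 0"
proof -
  have local: "AE x in lebesgue. x \<in> box a b \<longrightarrow> w x = 0" if ab: "cbox a b \<subseteq> U" for a b
  proof -
    define v where "v x = indicator (box a b) x * w x" for x
    have "set_integrable lebesgue (box a b) w"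
      by (rule set_integrable_subset[OF int[OF ab]]) (auto simp: box_subset_cbox)
    then have vi: "integrable lebesgue v" by (simp add: set_integrable_def v_def[abs_def])
    \<comment> \<open>A Borel representative, since the class of sets reached from boxes is the
      Borel sets and not all Lebesgue sets.\<close>
    obtain v' where v': "v' \<in> borel_measurable lborel" "AE x in lborel. v x = v' x"
      using completion_ex_borel_measurable_real[of v lborel] vi by auto
    have vv': "AE x in lebesgue. v x = v' x" using v'(2) by (rule AE_completion)
    have v'm: "v' \<in> borel_measurable lebesgue" using v'(1) by (rule measurable_completion)
    have v'i: "integrable lebesgue v'" by (rule integrable_cong_AE_imp[OF vi v'm vv'])
    have v'ib: "integrable lborel v'" using v'i v'(1) by (simp add: integrable_completion)
    have v'0: "(LINT x:A|lborel. v' x) = 0" if "A \<in> sets borel" for A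
    proof -
      have "Int_stable (range (\<lambda>(a, b). box a b :: 'a set))"
        by (auto simp: Int_stable_def box_Int_box)
      moreover have "range (\<lambda>(a, b). box a b :: 'a set) \<subseteq> Pow UNIV" by simp
      moreover have "A \<in> sigma_sets UNIV (range (\<lambda>(a, b). box a b :: 'a set))"
        using that by (simp add: borel_eq_box sets_measure_of)
      ultimately show ?thesis
      proof (induction rule: sigma_sets_induct_disjoint)
        case (basic B)
        then obtain c d where B: "B = box c d" by auto
        let ?e = "\<Sum>i\<in>Basis. max (c \<bullet> i) (a \<bullet> i) *\<^sub>R i" and ?f = "\<Sum>i\<in>Basis. min (d \<bullet> i) (b \<bullet> i) *\<^sub>R i"
        have I: "box c d \<inter> box a b = box ?e ?f" by (simp add: box_Int_box)
        have sub: "cbox ?e ?f \<subseteq> U" using ab by (auto simp: cbox_def inner_simps)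
        have "(LINT x:B|lborel. v' x) = (\<integral>x. indicator B x * v' x \<partial>lebesgue)"
          unfolding set_lebesgue_integral_def using v'(1) B by (subst integral_completion) auto
        also have "\<dots> = (\<integral>x. indicator B x * v x \<partial>lebesgue)"
        proof (rule integral_cong_AE)
          have im: "(indicator B :: 'a \<Rightarrow> real) \<in> borel_measurable lebesgue" unfolding B by (rule borel_measurable_indicator) auto
          show "(\<lambda>x. indicator B x * v' x) \<in> borel_measurable lebesgue" by (rule borel_measurable_times[OF im v'm])
          show "(\<lambda>x. indicator B x * v x) \<in> borel_measurable lebesgue"
            using borel_measurable_times[OF im] vi by auto
          show "AE x in lebesgue. indicator B x * v' x = indicator B x * v x" using vv' by eventually_elim simp
        qed
        also have "\<dots> = (LINT x:box ?e ?f|lebesgue. w x)"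
          unfolding set_lebesgue_integral_def B v_def I[symmetric]
          by (intro Bochner_Integration.integral_cong) (auto simp: indicator_def)
        also have "\<dots> = 0" by (rule zero[OF sub])
        finally show ?case .
      next
        case empty
        then show ?case by (simp add: set_lebesgue_integral_def)
      next
        case (compl B)
        then have B: "B \<in> sets borel" by (simp add: borel_eq_box sets_measure_of)
        have full: "(LINT x:UNIV|lborel. v' x) = 0"
        proof -
          have "(LINT x:UNIV|lborel. v' x) = (\<integral>x. v' x \<partial>lebesgue)"
            unfolding set_lebesgue_integral_def using v'(1) by (subst integral_completion) auto
          also have "\<dots> = (\<integral>x. v x \<partial>lebesgue)"
            using vv' by (intro integral_cong_AE) (use v'm vi in \<open>auto elim: eventually_mono\<close>)
          also have "\<dots> = (LINT x:box a b|lebesgue. w x)" by (simp add: set_lebesgue_integral_def v_def)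
          finally show ?thesis using zero[OF ab] by simp
        qed
        have si: "set_integrable lborel S v'" if "S \<in> sets borel" for S
          using v'ib that unfolding set_integrable_def by (intro integrable_mult_indicator) auto
        have "(LINT x:UNIV|lborel. v' x) = (LINT x:B|lborel. v' x) + (LINT x:UNIV - B|lborel. v' x)"
          using set_integral_Un[of B "UNIV - B" lborel v'] si B by auto
        then show ?case using full compl by simp
      next
        case (union D)
        have "D i \<in> sigma_sets UNIV (range (\<lambda>(a, b). box a b :: 'a set))" for i using union(2) by blast
        then have D: "D i \<in> sets borel" for i by (simp add: borel_eq_box sets_measure_of)
        have "(LINT x:\<Union>(range D)|lborel. v' x) = (\<Sum>i. LINT x:D i|lborel. v' x)"
        proof (rule lebesgue_integral_countable_add)
          show "set_integrable lborel (\<Union>(range D)) v'"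
            using v'ib D unfolding set_integrable_def by (intro integrable_mult_indicator) auto
        qed (use D union in \<open>auto simp: disjoint_family_on_def\<close>)
        then show ?case using union by simp
      qed
    qed
    have "AE x in lborel. v' x = 0" by (rule sigma_finite_measure.density_zero[OF sigma_finite_lborel v'ib]) (use v'0 in simp)
    then have "AE x in lebesgue. v' x = 0" by (rule AE_completion)
    then show ?thesis using vv' by eventually_elim (auto simp: v_def)
  qed
  \<comment> \<open>An exceptional null set belongs to each box; by Lindelof's theorem countably
    many boxes suffice.\<close>
  define F where "F = {box a b |a b. cbox a b \<subseteq> U}"
  have op: "\<And>S. S \<in> F \<Longrightarrow> open S" unfolding F_def using open_box by blast
  obtain F' where F': "F' \<subseteq> F" "countable F'" "\<Union>F' = \<Union>F"
    by (rule Lindelof[OF op])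
  have "U \<subseteq> \<Union>F"
  proof
    fix x assume x: "x \<in> U"
    obtain a b where "cbox a b \<subseteq> U" "x \<in> box a b" by (rule open_contains_cbox[OF U x])
    then show "x \<in> \<Union>F" unfolding F_def by (intro UnionI[of "box a b"]) auto
  qed
  moreover have "AE x in lebesgue. \<forall>S\<in>F'. x \<in> S \<longrightarrow> w x = 0"
    using F'(1,2) local by (subst AE_ball_countable) (auto simp: F_def)
  ultimately show ?thesis using F'(3) by (elim eventually_mono) blast
qed

text \<open>The test functions from \<open>bump_power_test\<close> tend boundedly to the indicator
  of a box, so dominated convergence gives vanishing box integrals.\<close>

lemma fundamental_lemma:
  fixes w :: "'a::euclidean_space \<Rightarrow> real"
  assumes U: "open U"
    and int: "\<And>a b. cbox a b \<subseteq> U \<Longrightarrow> set_integrable lebesgue (cbox a b) w"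
    and zero: "\<And>\<phi>. \<phi> \<in> test_functions U \<Longrightarrow> (LINT x:U|lebesgue. w x * \<phi> x) = 0"
  shows "AE x in lebesgue. x \<in> U \<longrightarrow> w x = 0"
proof (rule AE_zero_of_box_integrals[OF U int])
  fix a b :: 'a assume ab: "cbox a b \<subseteq> U"
  define \<phi> where "\<phi> n x = 1 - (1 - bump a b x) ^ Suc n" for n x
  have out: "\<phi> n x = 0" if "x \<notin> box a b" for n x
    using bump_pos_iff[of a b x] bump_bounds(1)[of a b x] that by (auto simp: \<phi>_def)
  have b01: "0 \<le> 1 - bump a b x" "1 - bump a b x \<le> 1" for x using bump_bounds[of a b x] by auto
  have le1: "\<bar>\<phi> n x\<bar> \<le> 1" for n x
    using power_le_one[OF b01, of x "Suc n"] zero_le_power[OF b01(1), of x "Suc n"] by (auto simp: \<phi>_def)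
  have C: "continuous_on UNIV (\<phi> n)" for n
    using bump_power_test[OF ab, of n] unfolding test_functions_def \<phi>_def[abs_def]
    by (auto dest: spec[of _ 0])
  have 0: "(LINT x:box a b|lebesgue. w x * \<phi> n x) = 0" for n
  proof -
    have "(LINT x:box a b|lebesgue. w x * \<phi> n x) = (LINT x:U|lebesgue. w x * \<phi> n x)"
      unfolding set_lebesgue_integral_def
      by (intro Bochner_Integration.integral_cong refl) (use out ab box_subset_cbox[of a b] in \<open>auto simp: indicator_def\<close>)
    also have "\<dots> = 0" unfolding \<phi>_def by (rule zero[OF bump_power_test[OF ab]])
    finally show ?thesis .
  qed
  have wi: "set_integrable lebesgue (box a b) w"
    by (rule set_integrable_subset[OF int[OF ab]]) (auto simp: box_subset_cbox)
  have "(\<lambda>n. LINT x:box a b|lebesgue. w x * \<phi> n x) \<longlonglongrightarrow> (LINT x:box a b|lebesgue. w x)"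
  proof (rule set_LINT_tendsto(2))
    show "set_integrable lebesgue (box a b) (\<lambda>x. \<bar>w x\<bar>)" using wi by (rule set_integrable_abs)
    show "set_borel_measurable lebesgue (box a b) (\<lambda>x. w x * \<phi> n x)" for n
    proof -
      have "\<phi> n \<in> borel_measurable lebesgue"
        by (rule measurable_completion) (use borel_measurable_continuous_onI[OF C] in simp)
      then have "(\<lambda>x. (indicator (box a b) x *\<^sub>R w x) * \<phi> n x) \<in> borel_measurable lebesgue"
        using wi unfolding set_integrable_def by (intro borel_measurable_times) auto
      then show ?thesis by (simp add: set_borel_measurable_def mult.assoc)
    qed
    fix x assume x: "x \<in> box a b"
    show "\<bar>w x * \<phi> n x\<bar> \<le> \<bar>w x\<bar>" for n using mult_left_mono[OF le1, of "\<bar>w x\<bar>"] by (simp add: abs_mult)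
    have "(\<lambda>n. (1 - bump a b x) ^ Suc n) \<longlonglongrightarrow> 0"
      using b01[of x] bump_pos_iff[of a b x] x by (intro LIMSEQ_Suc LIMSEQ_power_zero) auto
    then have "(\<lambda>n. \<phi> n x) \<longlonglongrightarrow> 1 - 0" unfolding \<phi>_def by (intro tendsto_intros)
    then have "(\<lambda>n. w x * \<phi> n x) \<longlonglongrightarrow> w x * (1 - 0)" by (intro tendsto_intros)
    then show "(\<lambda>n. w x * \<phi> n x) \<longlonglongrightarrow> w x" by simp
  qed
  then show "(LINT x:box a b|lebesgue. w x) = 0" unfolding 0 by (simp add: LIMSEQ_const_iff)
qed

subsection \<open>Integrals over triangles\<close>

text \<open>Makes Fubini's theorem available for the completed measure; the functions of time are
  Lebesgue measurable only.\<close>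

lemma sigma_finite_lebesgue: "sigma_finite_measure (lebesgue :: 'a::euclidean_space measure)"
proof
  obtain A :: "'a set set" where A: "countable A" "A \<subseteq> sets lborel" "\<Union>A = space lborel" "\<forall>a\<in>A. emeasure lborel a \<noteq> \<infinity>"
    using lborel.sigma_finite_countable by blast
  show "\<exists>A. countable A \<and> A \<subseteq> sets lebesgue \<and> \<Union>A = space (lebesgue :: 'a measure) \<and> (\<forall>a\<in>A. emeasure lebesgue a \<noteq> \<infinity>)"
    using A by (intro exI[of _ A]) (auto simp: emeasure_completion sets_completionI_sets)
qed

interpretation lebesgue: sigma_finite_measure lebesgue
  by (rule sigma_finite_lebesgue)

interpretation lebesgue_pair: pair_sigma_finite lebesgue lebesgue ..

text \<open>Exchange of integrations over \<open>0 < s < t < T\<close>. A bound on the inner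
  integrals of the kernel uniform in \<open>s\<close> gives integrability; this form serves the Abel
  kernel, derivatives of test functions and the constant kernel alike.\<close>

lemma Fubini_triangle:
  fixes G :: "real \<Rightarrow> real" and k :: "real \<Rightarrow> real \<Rightarrow> real"
  assumes G: "set_integrable lebesgue {0<..<T} G"
    and k: "case_prod k \<in> borel_measurable borel"
    and ki: "\<And>s. s \<in> {0<..<T} \<Longrightarrow> set_integrable lebesgue {s<..<T} (k s)"
    and kC: "\<And>s. s \<in> {0<..<T} \<Longrightarrow> (LINT t:{s<..<T}|lebesgue. \<bar>k s t\<bar>) \<le> C"
  shows "(LINT t:{0<..<T}|lebesgue. LINT s:{0<..<t}|lebesgue. G s * k s t)
       = (LINT s:{0<..<T}|lebesgue. G s * (LINT t:{s<..<T}|lebesgue. k s t))"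
    and "set_integrable lebesgue {0<..<T} (\<lambda>t. LINT s:{0<..<t}|lebesgue. G s * k s t)"
proof -
  define F where "F s t = (if 0 < s \<and> s < t \<and> t < T then (indicator {0<..<T} s *\<^sub>R G s) * k s t else 0)" for s t
  have id: "(\<lambda>x. x) \<in> lebesgue \<rightarrow>\<^sub>M (borel :: real measure)" by (rule measurable_completion) simp
  have f: "fst \<in> lebesgue \<Otimes>\<^sub>M lebesgue \<rightarrow>\<^sub>M (borel :: real measure)" and s: "snd \<in> lebesgue \<Otimes>\<^sub>M lebesgue \<rightarrow>\<^sub>M (borel :: real measure)"
    using measurable_compose[OF measurable_fst id] measurable_compose[OF measurable_snd id] by auto
  have Gm: "(\<lambda>s. indicator {0<..<T} s *\<^sub>R G s) \<in> borel_measurable lebesgue"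
    using G by (auto simp: set_integrable_def)
  have Gp: "(\<lambda>p. indicator {0<..<T} (fst p) *\<^sub>R G (fst p)) \<in> borel_measurable (lebesgue \<Otimes>\<^sub>M lebesgue)"
    by (rule measurable_compose[OF measurable_fst Gm])
  \<comment> \<open>The product measure is not complete, so measurability on the plane is assembled
    from the factors: \<open>k\<close> is Borel, and \<open>G\<close> is composed with a
    projection.\<close>
  have kp: "(\<lambda>p. k (fst p) (snd p)) \<in> borel_measurable (lebesgue \<Otimes>\<^sub>M lebesgue)"
  proof -
    have "(\<lambda>p. (fst p, snd p)) \<in> lebesgue \<Otimes>\<^sub>M lebesgue \<rightarrow>\<^sub>M (borel \<Otimes>\<^sub>M borel :: (real \<times> real) measure)"
      using f s by (rule measurable_Pair)
    then have "(\<lambda>p. (fst p, snd p)) \<in> lebesgue \<Otimes>\<^sub>M lebesgue \<rightarrow>\<^sub>M (borel :: (real \<times> real) measure)"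
      by (simp only: borel_prod)
    from measurable_compose[OF this k] show ?thesis by simp
  qed
  have Fm: "case_prod F \<in> borel_measurable (lebesgue \<Otimes>\<^sub>M lebesgue)"
    unfolding F_def case_prod_beta'
  proof (rule measurable_If)
    show "(\<lambda>p. indicator {0<..<T} (fst p) *\<^sub>R G (fst p) * k (fst p) (snd p)) \<in> borel_measurable (lebesgue \<Otimes>\<^sub>M lebesgue)"
      using Gp kp by (rule borel_measurable_times)
    show "{p \<in> space (lebesgue \<Otimes>\<^sub>M lebesgue). 0 < fst p \<and> fst p < snd p \<and> snd p < T} \<in> sets (lebesgue \<Otimes>\<^sub>M lebesgue)"
      using f s by (intro sets.sets_Collect_conj borel_measurable_less) auto
  qed simp
  have Fi: "integrable lebesgue (\<lambda>t. F s t)" and Fn: "(\<integral>t. norm (F s t) \<partial>lebesgue) = indicator {0<..<T} s * (\<bar>G s\<bar> * (LINT t:{s<..<T}|lebesgue. \<bar>k s t\<bar>))"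
    and Fv: "(\<integral>t. F s t \<partial>lebesgue) = indicator {0<..<T} s * (G s * (LINT t:{s<..<T}|lebesgue. k s t))" for s
  proof -
    have e: "F s = (\<lambda>t. (indicator {0<..<T} s * G s) * (indicator {s<..<T} t *\<^sub>R k s t))"
      by (auto simp: F_def indicator_def)
    show "integrable lebesgue (\<lambda>t. F s t)"
      unfolding e using ki[of s] by (cases "s \<in> {0<..<T}") (auto simp: set_integrable_def)
    show "(\<integral>t. norm (F s t) \<partial>lebesgue) = indicator {0<..<T} s * (\<bar>G s\<bar> * (LINT t:{s<..<T}|lebesgue. \<bar>k s t\<bar>))"
      unfolding e by (simp add: abs_mult set_lebesgue_integral_def)
    show "(\<integral>t. F s t \<partial>lebesgue) = indicator {0<..<T} s * (G s * (LINT t:{s<..<T}|lebesgue. k s t))"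
      unfolding e by (simp add: set_lebesgue_integral_def)
  qed
  have "integrable lebesgue (\<lambda>s. \<integral>t. norm (F s t) \<partial>lebesgue)"
  proof (rule Bochner_Integration.integrable_bound)
    show "integrable lebesgue (\<lambda>s. C * \<bar>indicator {0<..<T} s *\<^sub>R G s\<bar>)"
      using G by (auto simp: set_integrable_def)
    show "(\<lambda>s. \<integral>t. norm (F s t) \<partial>lebesgue) \<in> borel_measurable lebesgue"
      using Fm by (intro lebesgue.borel_measurable_lebesgue_integral) (simp add: case_prod_beta')
    have "\<bar>G s\<bar> * (LINT t:{s<..<T}|lebesgue. \<bar>k s t\<bar>) \<le> \<bar>G s\<bar> * C" if "s \<in> {0<..<T}" for s
      using kC[OF that] by (intro mult_left_mono) auto
    moreover have p: "0 \<le> (LINT t:{s<..<T}|lebesgue. \<bar>k s t\<bar>)" for s by (rule LINT_nonneg) simp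
    moreover have "0 \<le> C" if "s \<in> {0<..<T}" for s using order_trans[OF p kC[OF that]] .
    ultimately have "norm (\<integral>t. norm (F s t) \<partial>lebesgue) \<le> norm (C * \<bar>indicator {0<..<T} s *\<^sub>R G s\<bar>)" for s
      unfolding Fn by (cases "s \<in> {0<..<T}") (simp_all add: abs_mult mult.commute)
    then show "AE s in lebesgue. norm (\<integral>t. norm (F s t) \<partial>lebesgue) \<le> norm (C * \<bar>indicator {0<..<T} s *\<^sub>R G s\<bar>)"
      by simp
  qed
  then have FF: "integrable (lebesgue \<Otimes>\<^sub>M lebesgue) (case_prod F)"
    using Fm Fi by (intro lebesgue_pair.Fubini_integrable) auto
  have inner: "(\<integral>s. F s t \<partial>lebesgue) = indicator {0<..<T} t *\<^sub>R (LINT s:{0<..<t}|lebesgue. G s * k s t)" for t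
  proof (cases "t \<in> {0<..<T}")
    case True
    then show ?thesis unfolding set_lebesgue_integral_def
      by (simp, intro Bochner_Integration.integral_cong) (auto simp: F_def indicator_def)
  next
    case False
    then have "F s t = 0" for s by (auto simp: F_def)
    then show ?thesis using False by simp
  qed
  show "(LINT t:{0<..<T}|lebesgue. LINT s:{0<..<t}|lebesgue. G s * k s t)
       = (LINT s:{0<..<T}|lebesgue. G s * (LINT t:{s<..<T}|lebesgue. k s t))"
    using lebesgue_pair.Fubini_integral[OF FF] unfolding inner Fv set_lebesgue_integral_def by simp
  show "set_integrable lebesgue {0<..<T} (\<lambda>t. LINT s:{0<..<t}|lebesgue. G s * k s t)"
    using lebesgue_pair.integrable_snd[OF FF] unfolding inner set_integrable_def .
qed

text \<open>Applying the integral of order \<open>\<alpha>\<close> to one of order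
  \<open>1 - \<alpha>\<close> gives, after Fubini, the inner Beta integral
  \<open>Gamma \<alpha> * Gamma (1 - \<alpha>)\<close>, independent of the endpoints, and hence the
  ordinary integral of \<open>a\<close>.\<close>

lemma Abel_inversion:
  fixes a b :: "real \<Rightarrow> real"
  assumes \<alpha>: "0 < \<alpha>" "\<alpha> < 1"
    and a: "set_integrable lebesgue {0<..<T} a"
    and eq: "AE t in lebesgue. t \<in> {0<..<T} \<longrightarrow>
      1 / Gamma (1 - \<alpha>) * (LINT s:{0<..<t}|lebesgue. (t - s) powr (-\<alpha>) * a s) = b t"
    and t: "t \<in> {0<..<T}"
  shows "set_integrable lebesgue {0<..<t} (\<lambda>s. (t - s) powr (\<alpha> - 1) * b s)"
    and "(LINT s:{0<..<t}|lebesgue. a s) = 1 / Gamma \<alpha> * (LINT s:{0<..<t}|lebesgue. (t - s) powr (\<alpha> - 1) * b s)"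
proof -
  have \<beta>: "0 < 1 - \<alpha>" using \<alpha> by simp
  have G: "Gamma \<alpha> > 0" "Gamma (1 - \<alpha>) > 0" using \<alpha> by (auto intro: Gamma_real_pos)
  let ?k = "\<lambda>r s. (t - s) powr (\<alpha> - 1) * (s - r) powr (-\<alpha>)"
  have at: "set_integrable lebesgue {0<..<t} a"
    by (rule set_integrable_subinterval[OF a]) (use t in auto)
  have km: "case_prod ?k \<in> borel_measurable borel"
    unfolding case_prod_beta' by (simp add: borel_prod[symmetric])
  have B: "set_integrable lebesgue {r<..<t} (?k r)" "(LINT s:{r<..<t}|lebesgue. ?k r s) = Gamma \<alpha> * Gamma (1 - \<alpha>)"
    if "r \<in> {0<..<t}" for r
    using Beta_integral_shifted[OF \<alpha>(1) \<beta>, of r t] that by simp_all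
  have B': "(LINT s:{r<..<t}|lebesgue. \<bar>?k r s\<bar>) \<le> Gamma \<alpha> * Gamma (1 - \<alpha>)" if "r \<in> {0<..<t}" for r
    using B(2)[OF that] by (simp add: abs_mult)
  note F = Fubini_triangle[OF at km B(1) B']
  have ae: "AE s in lebesgue. indicator {0<..<t} s *\<^sub>R (LINT r:{0<..<s}|lebesgue. a r * ?k r s)
      = Gamma (1 - \<alpha>) * (indicator {0<..<t} s *\<^sub>R ((t - s) powr (\<alpha> - 1) * b s))"
    using eq
  proof eventually_elim
    case (elim s)
    show ?case
    proof (cases "s \<in> {0<..<t}")
      case True
      then have "b s = 1 / Gamma (1 - \<alpha>) * (LINT r:{0<..<s}|lebesgue. (s - r) powr (-\<alpha>) * a r)" using elim t by auto
      moreover have "(LINT r:{0<..<s}|lebesgue. a r * ?k r s) = (t - s) powr (\<alpha> - 1) * (LINT r:{0<..<s}|lebesgue. (s - r) powr (-\<alpha>) * a r)"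
        unfolding set_integral_mult_right[symmetric] by (simp add: mult_ac)
      ultimately show ?thesis using True G by simp
    qed simp
  qed
  have m1: "(\<lambda>s. indicator {0<..<t} s *\<^sub>R (LINT r:{0<..<s}|lebesgue. a r * ?k r s)) \<in> borel_measurable lebesgue"
    using F(2) by (auto simp: set_integrable_def)
  have m2: "(\<lambda>s. Gamma (1 - \<alpha>) * (indicator {0<..<t} s *\<^sub>R ((t - s) powr (\<alpha> - 1) * b s))) \<in> borel_measurable lebesgue"
    by (rule borel_measurable_AE[OF m1 ae])
  have "integrable lebesgue (\<lambda>s. Gamma (1 - \<alpha>) * (indicator {0<..<t} s *\<^sub>R ((t - s) powr (\<alpha> - 1) * b s)))"
    by (rule integrable_cong_AE_imp[OF _ m2 ae]) (use F(2) in \<open>simp add: set_integrable_def\<close>)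
  then show "set_integrable lebesgue {0<..<t} (\<lambda>s. (t - s) powr (\<alpha> - 1) * b s)"
    using G by (simp add: set_integrable_def)
  have "(LINT s:{0<..<t}|lebesgue. LINT r:{0<..<s}|lebesgue. a r * ?k r s)
      = Gamma (1 - \<alpha>) * (LINT s:{0<..<t}|lebesgue. (t - s) powr (\<alpha> - 1) * b s)"
    unfolding set_lebesgue_integral_def using integral_cong_AE[OF m1 m2 ae]
    by (simp add: set_lebesgue_integral_def)
  moreover have "(LINT r:{0<..<t}|lebesgue. a r * (LINT s:{r<..<t}|lebesgue. ?k r s)) = (LINT r:{0<..<t}|lebesgue. (Gamma \<alpha> * Gamma (1 - \<alpha>)) * a r)"
    unfolding set_lebesgue_integral_def
    using B(2) by (intro Bochner_Integration.integral_cong) (auto simp: indicator_def set_lebesgue_integral_def mult_ac)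
  ultimately have "Gamma (1 - \<alpha>) * (LINT s:{0<..<t}|lebesgue. (t - s) powr (\<alpha> - 1) * b s)
      = Gamma (1 - \<alpha>) * (Gamma \<alpha> * (LINT r:{0<..<t}|lebesgue. a r))"
    using F(1) by (simp add: mult_ac)
  then show "(LINT s:{0<..<t}|lebesgue. a s) = 1 / Gamma \<alpha> * (LINT s:{0<..<t}|lebesgue. (t - s) powr (\<alpha> - 1) * b s)"
    using G by simp
qed

subsection \<open>Weak derivatives on an interval\<close>

lemma test_real:
  fixes \<phi> :: "real \<Rightarrow> real"
  assumes \<phi>: "\<phi> \<in> test_functions {0<..<T}" and T: "0 < T"
  shows "(\<phi> has_real_derivative deriv \<phi> t) (at t)"
    and "continuous_on UNIV \<phi>" and "continuous_on UNIV (deriv \<phi>)"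
    and "\<exists>a b. 0 < a \<and> b < T \<and> (\<forall>t. t \<notin> {a..b} \<longrightarrow> \<phi> t = 0 \<and> deriv \<phi> t = 0)"
    and "\<exists>K. \<forall>t. \<bar>\<phi> t\<bar> \<le> K \<and> \<bar>deriv \<phi> t\<bar> \<le> K"
proof -
  have c1: "C_k (Suc 0) \<phi>" using \<phi> unfolding test_functions_def by blast
  have D: "(\<phi> has_real_derivative deriv \<phi> t) (at t)" for t
    using c1 by (auto simp: DERIV_deriv_iff_real_differentiable)
  then show "(\<phi> has_real_derivative deriv \<phi> t) (at t)" .
  show c: "continuous_on UNIV \<phi>" using D by (auto intro!: continuous_at_imp_continuous_on DERIV_isCont)
  have "deriv \<phi> t = frechet_derivative \<phi> (at t) 1" for t
    using fun_cong[OF frechet_derivative_at[OF D[of t, unfolded has_field_derivative_def]], of 1] by simp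
  then have "deriv \<phi> = (\<lambda>t. frechet_derivative \<phi> (at t) 1)" by blast
  then show c': "continuous_on UNIV (deriv \<phi>)" using c1 by auto
  define K where "K = closure {t. \<phi> t \<noteq> 0}"
  have Kc: "compact K" "K \<subseteq> {0<..<T}" using \<phi> by (auto simp: test_functions_def K_def)
  have zero: "\<phi> t = 0" if "t \<notin> K" for t using that closure_subset[of "{t. \<phi> t \<noteq> 0}"] by (auto simp: K_def)
  have zero': "deriv \<phi> t = 0" if "t \<notin> K" for t
  proof -
    have "((\<lambda>t. 0) has_real_derivative 0) (at t)" by simp
    then have "(\<phi> has_real_derivative 0) (at t)"
      by (rule has_field_derivative_transform_within_open[of _ _ _ "- K"])
        (use Kc that zero in \<open>auto simp: compact_imp_closed open_Compl\<close>)
    then show ?thesis by (rule DERIV_imp_deriv)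
  qed
  show sup: "\<exists>a b. 0 < a \<and> b < T \<and> (\<forall>t. t \<notin> {a..b} \<longrightarrow> \<phi> t = 0 \<and> deriv \<phi> t = 0)"
  proof (cases "K = {}")
    case True
    then show ?thesis using T zero zero' by (intro exI[of _ "T/2"]) auto
  next
    case False
    obtain a where a: "a \<in> K" "\<forall>t\<in>K. a \<le> t" using compact_attains_inf[OF Kc(1) False] by blast
    obtain b where b: "b \<in> K" "\<forall>t\<in>K. t \<le> b" using compact_attains_sup[OF Kc(1) False] by blast
    have "t \<notin> K" if "t \<notin> {a..b}" for t using a(2) b(2) that by auto
    moreover have "0 < a" "b < T" using a(1) b(1) Kc(2) by auto
    ultimately show ?thesis using zero zero' by blast
  qed
  have "bounded (\<phi> ` {0..T})" "bounded (deriv \<phi> ` {0..T})"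
    using c c' by (auto intro!: compact_imp_bounded compact_continuous_image intro: continuous_on_subset)
  then obtain K1 K2 where K: "\<forall>x\<in>\<phi> ` {0..T}. norm x \<le> K1" "\<forall>x\<in>deriv \<phi> ` {0..T}. norm x \<le> K2"
    unfolding bounded_iff by blast
  have K12: "\<bar>\<phi> t\<bar> \<le> K1" "\<bar>deriv \<phi> t\<bar> \<le> K2" if "t \<in> {0..T}" for t using K that by auto
  show "\<exists>K. \<forall>t. \<bar>\<phi> t\<bar> \<le> K \<and> \<bar>deriv \<phi> t\<bar> \<le> K"
  proof (intro exI[of _ "max K1 K2"] allI)
    fix t
    show "\<bar>\<phi> t\<bar> \<le> max K1 K2 \<and> \<bar>deriv \<phi> t\<bar> \<le> max K1 K2"
    proof (cases "t \<in> {0..T}")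
      case True
      then show ?thesis using K12[OF True] by auto
    next
      case False
      then have "t \<notin> K" using Kc(2) by auto
      moreover have "0 \<le> K1" using K12(1)[of 0] T by auto
      ultimately show ?thesis using zero zero' by auto
    qed
  qed
qed

lemma test_zero_at_T:
  fixes \<phi> :: "real \<Rightarrow> real"
  assumes "\<phi> \<in> test_functions {0<..<T}" "0 < T" shows "\<phi> T = 0"
  using test_real(4)[OF assms] by force

lemma LINT_deriv_test:
  fixes \<phi> :: "real \<Rightarrow> real"
  assumes \<phi>: "\<phi> \<in> test_functions {0<..<T}" and T: "0 < T" and s: "s < T"
  shows "set_integrable lebesgue {s<..<T} (deriv \<phi>)" "(LINT t:{s<..<T}|lebesgue. deriv \<phi> t) = - \<phi> s"
proof -
  have "deriv \<phi> absolutely_integrable_on {s..T}"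
    by (rule absolutely_integrable_continuous_real) (rule continuous_on_subset[OF test_real(3)[OF \<phi> T]], simp)
  then show i: "set_integrable lebesgue {s<..<T} (deriv \<phi>)" by (rule set_integrable_subset) auto
  have "(deriv \<phi> has_integral (\<phi> T - \<phi> s)) {s..T}"
    by (rule fundamental_theorem_of_calculus)
      (use s test_real(1)[OF \<phi> T] in \<open>auto simp: has_real_derivative_iff_has_vector_derivative[symmetric] intro: has_field_derivative_at_within\<close>)
  then have "(deriv \<phi> has_integral (- \<phi> s)) {s<..<T}"
    using test_zero_at_T[OF \<phi> T] by (simp add: has_integral_Icc_iff_Ioo)
  then show "(LINT t:{s<..<T}|lebesgue. deriv \<phi> t) = - \<phi> s"
    using set_lebesgue_integral_eq_integral(2)[OF i] by (simp add: integral_unique)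
qed

text \<open>Fubini on the triangle with the derivative of the test function as kernel; its integral
  from \<open>s\<close> to \<open>T\<close> is minus the value at \<open>s\<close>, because the test
  function vanishes at \<open>T\<close>.\<close>

lemma indefinite_integral_weak_deriv:
  fixes g \<phi> :: "real \<Rightarrow> real"
  assumes g: "set_integrable lebesgue {0<..<T} g" and \<phi>: "\<phi> \<in> test_functions {0<..<T}" and T: "0 < T"
  shows "set_integrable lebesgue {0<..<T} (\<lambda>t. (LINT s:{0<..<t}|lebesgue. g s) * deriv \<phi> t)"
    and "(LINT t:{0<..<T}|lebesgue. (LINT s:{0<..<t}|lebesgue. g s) * deriv \<phi> t) = - (LINT t:{0<..<T}|lebesgue. g t * \<phi> t)"
proof -
  obtain K where K: "\<And>t. \<bar>deriv \<phi> t\<bar> \<le> K" using test_real(5)[OF \<phi> T] by blast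
  have K0: "K \<ge> 0" using K[of 0] by linarith
  have km: "(\<lambda>(s, t). deriv \<phi> t) \<in> borel_measurable (borel :: (real \<times> real) measure)"
  proof -
    have "deriv \<phi> \<in> borel_measurable borel" by (rule borel_measurable_continuous_onI[OF test_real(3)[OF \<phi> T]])
    then show ?thesis unfolding borel_prod[symmetric] by measurable
  qed
  have ki: "set_integrable lebesgue {s<..<T} (deriv \<phi>)" if "s \<in> {0<..<T}" for s
    using LINT_deriv_test(1)[OF \<phi> T] that by auto
  have kC: "(LINT t:{s<..<T}|lebesgue. \<bar>deriv \<phi> t\<bar>) \<le> K * T" if s: "s \<in> {0<..<T}" for s
  proof -
    have fin: "emeasure lebesgue {s<..<T} < \<infinity>" using s by simp
    have "(LINT t:{s<..<T}|lebesgue. \<bar>deriv \<phi> t\<bar>) \<le> (LINT t:{s<..<T}|lebesgue. K)"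
      by (rule set_integral_mono[OF set_integrable_abs[OF ki[OF s]]]) (use K fin in \<open>auto simp: set_integrable_def\<close>)
    also have "\<dots> = K * (T - s)" using s by (simp add: set_lebesgue_integral_def)
    also have "\<dots> \<le> K * T" using s K0 by (intro mult_left_mono) auto
    finally show ?thesis .
  qed
  note F = Fubini_triangle[of T g "\<lambda>s t. deriv \<phi> t", OF g km ki kC]
  have e: "(LINT s:{0<..<t}|lebesgue. g s * deriv \<phi> t) = (LINT s:{0<..<t}|lebesgue. g s) * deriv \<phi> t" for t
    by simp
  show "set_integrable lebesgue {0<..<T} (\<lambda>t. (LINT s:{0<..<t}|lebesgue. g s) * deriv \<phi> t)"
    using F(2) unfolding e .
  have "(LINT s:{0<..<T}|lebesgue. g s * (LINT t:{s<..<T}|lebesgue. deriv \<phi> t)) = (LINT s:{0<..<T}|lebesgue. - (g s * \<phi> s))"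
    unfolding set_lebesgue_integral_def
    using LINT_deriv_test(2)[OF \<phi> T] by (intro Bochner_Integration.integral_cong) (auto simp: indicator_def set_lebesgue_integral_def)
  then show "(LINT t:{0<..<T}|lebesgue. (LINT s:{0<..<t}|lebesgue. g s) * deriv \<phi> t) = - (LINT t:{0<..<T}|lebesgue. g t * \<phi> t)"
    using F(1) unfolding e by (simp add: set_lebesgue_integral_def)
qed

text \<open>The factor \<open>h\<close> is integrable only away from the endpoints 0 and
  \<open>T\<close>; the support of the test function stays away from them.\<close>

lemma set_integrable_mult_test:
  fixes h \<psi> :: "real \<Rightarrow> real"
  assumes h: "\<And>a b. 0 < a \<Longrightarrow> b < T \<Longrightarrow> set_integrable lebesgue {a..b} h"
    and ab: "0 < a" "b < T" "\<And>t. t \<notin> {a..b} \<Longrightarrow> \<psi> t = 0"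
    and c: "continuous_on UNIV \<psi>" and K: "\<And>t. \<bar>\<psi> t\<bar> \<le> K"
  shows "set_integrable lebesgue {0<..<T} (\<lambda>t. h t * \<psi> t)"
  unfolding set_integrable_def
proof (rule Bochner_Integration.integrable_bound)
  have hi: "integrable lebesgue (\<lambda>t. indicator {a..b} t *\<^sub>R h t)" using h[OF ab(1,2)] by (simp add: set_integrable_def)
  show "integrable lebesgue (\<lambda>t. K * \<bar>indicator {a..b} t *\<^sub>R h t\<bar>)" using hi by (intro integrable_mult_right integrable_abs)
  have pm: "\<psi> \<in> borel_measurable lebesgue" by (rule measurable_completion) (use borel_measurable_continuous_onI[OF c] in simp)
  have e: "indicator {0<..<T} t *\<^sub>R (h t * \<psi> t) = (indicator {a..b} t *\<^sub>R h t) * \<psi> t" for t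
    using ab by (auto simp: indicator_def)
  show "(\<lambda>t. indicator {0<..<T} t *\<^sub>R (h t * \<psi> t)) \<in> borel_measurable lebesgue"
    unfolding e using hi pm by (intro borel_measurable_times) auto
  show "AE t in lebesgue. norm (indicator {0<..<T} t *\<^sub>R (h t * \<psi> t)) \<le> norm (K * \<bar>indicator {a..b} t *\<^sub>R h t\<bar>)"
  proof (rule AE_I2)
    fix t
    have "\<bar>indicator {a..b} t *\<^sub>R h t\<bar> * \<bar>\<psi> t\<bar> \<le> \<bar>indicator {a..b} t *\<^sub>R h t\<bar> * K"
      using K by (intro mult_left_mono) auto
    then show "norm (indicator {0<..<T} t *\<^sub>R (h t * \<psi> t)) \<le> norm (K * \<bar>indicator {a..b} t *\<^sub>R h t\<bar>)"
      unfolding e using order_trans[OF abs_ge_zero K] by (simp add: abs_mult mult.commute mult.left_commute)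
  qed
qed

lemma test_functions_lincomb:
  assumes "\<psi> \<in> test_functions U" "\<theta> \<in> test_functions U"
  shows "(\<lambda>t. a * \<psi> t - b * \<theta> t) \<in> test_functions U"
proof -
  let ?S = "\<lambda>\<phi>. closure {x. \<phi> x \<noteq> 0}"
  have sub: "?S (\<lambda>t. a * \<psi> t - b * \<theta> t) \<subseteq> ?S \<psi> \<union> ?S \<theta>"
    by (subst closure_Un[symmetric], rule closure_mono) auto
  have c: "compact (?S \<psi> \<union> ?S \<theta>)" using assms by (auto simp: test_functions_def intro!: compact_Un)
  have "compact (?S (\<lambda>t. a * \<psi> t - b * \<theta> t))"
    using bounded_subset[OF compact_imp_bounded[OF c] sub] by (simp add: compact_eq_bounded_closed)
  then show ?thesis using assms sub unfolding test_functions_def by (auto intro!: C_k_diff C_k_cmult)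
qed

text \<open>The primitive vanishes to the left of the support trivially and to the right of it
  because the total integral is 0, so it has compact support again.\<close>

lemma test_antiderivative:
  fixes \<eta> :: "real \<Rightarrow> real"
  assumes \<eta>: "\<eta> \<in> test_functions {0<..<T}" and T: "0 < T" and zero: "(LINT t:{0<..<T}|lebesgue. \<eta> t) = 0"
  shows "\<exists>\<Phi>\<in>test_functions {0<..<T}. deriv \<Phi> = \<eta>"
proof -
  obtain a b where ab: "0 < a" "b < T" "\<And>t. t \<notin> {a..b} \<Longrightarrow> \<eta> t = 0"
    using test_real(4)[OF \<eta> T] by blast
  have c: "continuous_on A \<eta>" for A using test_real(2)[OF \<eta> T] continuous_on_subset by blast
  define F where "F t = integral {-1..t} \<eta>" for t
  define \<Phi> where "\<Phi> t = (if t \<le> 0 then 0 else F t)" for t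
  have F_LINT: "F t = (LINT s:{-1..t}|lebesgue. \<eta> s)" for t
    unfolding F_def using set_lebesgue_integral_eq_integral(2)[OF absolutely_integrable_continuous_real[OF c]] by simp
  have F0: "F t = 0" if "t < a" for t
  proof -
    have z: "indicator {-1..t} s *\<^sub>R \<eta> s = 0" for s using ab(3)[of s] that by (auto simp: indicator_def)
    show ?thesis unfolding F_LINT set_lebesgue_integral_def z by simp
  qed
  have Fb: "F t = 0" if "t > b" "t > 0" for t
  proof -
    have z: "indicator {-1..t} s *\<^sub>R \<eta> s = indicator {0<..<T} s *\<^sub>R \<eta> s" for s
      using ab(1,2) ab(3)[of s] that by (auto simp: indicator_def)
    show ?thesis unfolding F_LINT set_lebesgue_integral_def z using zero by (simp add: set_lebesgue_integral_def)
  qed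
  have D: "(\<Phi> has_real_derivative \<eta> t) (at t)" for t
  proof (cases "t < a")
    case True
    have "((\<lambda>t. 0) has_real_derivative \<eta> t) (at t)" using ab(3)[of t] True by auto
    then show ?thesis
      by (rule has_field_derivative_transform_within_open[of _ _ _ "{..<a}"]) (use True F0 in \<open>auto simp: \<Phi>_def\<close>)
  next
    case False
    have F1: "(F has_real_derivative \<eta> t) (at t within {-1..t+1})"
      unfolding F_def[abs_def] by (rule integral_has_real_derivative[OF c]) (use False ab in auto)
    have ti: "t \<in> interior {-1..t+1}" using False ab by auto
    have "(F has_real_derivative \<eta> t) (at t)" using F1 unfolding at_within_interior[OF ti] .
    then show ?thesis
      by (rule has_field_derivative_transform_within_open[of _ _ _ "{0<..}"]) (use False ab in \<open>auto simp: \<Phi>_def\<close>)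
  qed
  have Ck: "C_k k \<Phi>" for k
    by (rule C_k_Suc_imp, rule C_k_Suc_real[OF D]) (use \<eta> in \<open>auto simp: test_functions_def\<close>)
  have "{t. \<Phi> t \<noteq> 0} \<subseteq> {a..b}"
  proof
    fix t assume "t \<in> {t. \<Phi> t \<noteq> 0}"
    then have "t > 0" "F t \<noteq> 0" by (auto simp: \<Phi>_def split: if_splits)
    then show "t \<in> {a..b}" using F0[of t] Fb[of t] by (cases "t < a"; cases "t > b") auto
  qed
  then have cl: "closure {t. \<Phi> t \<noteq> 0} \<subseteq> {a..b}" by (rule closure_minimal) simp
  then have "compact (closure {t. \<Phi> t \<noteq> 0})"
    using bounded_subset[OF bounded_closed_interval cl] by (simp add: compact_eq_bounded_closed)
  moreover have "{a..b} \<subseteq> {0<..<T}" using ab by auto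
  ultimately have "\<Phi> \<in> test_functions {0<..<T}" using Ck cl unfolding test_functions_def by blast
  moreover have "deriv \<Phi> = \<eta>" using D DERIV_imp_deriv by blast
  ultimately show ?thesis by blast
qed

text \<open>Subtracting from a test function the right multiple of a fixed \<open>\<theta>\<close>
  with nonzero integral leaves mean zero, hence a derivative of a test function. So
  \<open>h - c\<close> annihilates all test functions for the \<open>c\<close> determined by
  \<open>\<theta>\<close>.\<close>

lemma du_Bois_Reymond:
  fixes h :: "real \<Rightarrow> real"
  assumes T: "0 < T"
    and h: "\<And>a b. 0 < a \<Longrightarrow> b < T \<Longrightarrow> set_integrable lebesgue {a..b} h"
    and zero: "\<And>\<phi>. \<phi> \<in> test_functions {0<..<T} \<Longrightarrow> (LINT t:{0<..<T}|lebesgue. h t * deriv \<phi> t) = 0"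
  shows "\<exists>c. AE t in lebesgue. t \<in> {0<..<T} \<longrightarrow> h t = c"
proof -
  let ?I = "{0<..<T}"
  have hmult: "set_integrable lebesgue ?I (\<lambda>t. h' t * \<psi> t)"
    if H: "\<psi> \<in> test_functions ?I" "\<And>a b. 0 < a \<Longrightarrow> b < T \<Longrightarrow> set_integrable lebesgue {a..b} h'" for \<psi> h'
  proof -
    obtain a b where "0 < a" "b < T" "\<And>t. t \<notin> {a..b} \<Longrightarrow> \<psi> t = 0" using test_real(4)[OF H(1) T] by blast
    moreover obtain K where "\<And>t. \<bar>\<psi> t\<bar> \<le> K" using test_real(5)[OF H(1) T] by blast
    ultimately show ?thesis using set_integrable_mult_test[OF H(2)] test_real(2)[OF H(1) T] by blast
  qed
  have one: "set_integrable lebesgue {a..b} (\<lambda>t. c::real)" for a b c :: real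
    by (rule absolutely_integrable_continuous_real) simp
  \<comment> \<open>If all integrals of test functions vanished, the fundamental lemma would make
    the constant function 1 vanish almost everywhere on the interval.\<close>
  have "\<exists>\<theta>\<in>test_functions ?I. (LINT t:?I|lebesgue. \<theta> t) \<noteq> 0"
  proof (rule ccontr)
    assume "\<not> ?thesis"
    then have "AE t in lebesgue. t \<in> ?I \<longrightarrow> (1::real) = 0"
      by (intro fundamental_lemma) (auto intro: one simp: cbox_interval)
    then have "AE t in lebesgue. t \<notin> ?I" by (auto elim: eventually_mono)
    then have "?I \<in> null_sets lebesgue" by (subst AE_iff_null_sets) auto
    then show False using T by (auto simp: null_sets_def)
  qed
  then obtain \<theta> where \<theta>: "\<theta> \<in> test_functions ?I" and L: "(LINT t:?I|lebesgue. \<theta> t) \<noteq> 0" by blast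
  define c where "c = (LINT t:?I|lebesgue. h t * \<theta> t) / (LINT t:?I|lebesgue. \<theta> t)"
  have ti: "set_integrable lebesgue ?I \<psi>" if "\<psi> \<in> test_functions ?I" for \<psi>
    using hmult[OF that one[of _ _ 1]] by simp
  have "AE t in lebesgue. t \<in> ?I \<longrightarrow> h t - c = 0"
  proof (rule fundamental_lemma)
    fix a b :: real assume "cbox a b \<subseteq> ?I"
    then show "set_integrable lebesgue (cbox a b) (\<lambda>t. h t - c)"
    proof (cases "a \<le> b")
      case True
      then have "0 < a" "b < T" using \<open>cbox a b \<subseteq> ?I\<close> by (auto simp: cbox_interval)
      then show ?thesis unfolding cbox_interval by (rule set_integral_diff(1)[OF h one])
    qed (simp add: set_integrable_def)
  next
    fix \<psi> assume \<psi>: "\<psi> \<in> test_functions ?I"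
    let ?L = "LINT t:?I|lebesgue. \<theta> t" and ?P = "LINT t:?I|lebesgue. \<psi> t"
    define \<eta> where "\<eta> t = ?L * \<psi> t - ?P * \<theta> t" for t
    have \<eta>: "\<eta> \<in> test_functions ?I" unfolding \<eta>_def[abs_def] by (rule test_functions_lincomb[OF \<psi> \<theta>])
    have "(LINT t:?I|lebesgue. \<eta> t) = 0"
      unfolding \<eta>_def using ti[OF \<psi>] ti[OF \<theta>] by (subst set_integral_diff) auto
    then obtain \<Phi> where "\<Phi> \<in> test_functions ?I" "deriv \<Phi> = \<eta>" using test_antiderivative[OF \<eta> T] by blast
    then have "(LINT t:?I|lebesgue. h t * \<eta> t) = 0" using zero by metis
    moreover have "(LINT t:?I|lebesgue. h t * \<eta> t) = ?L * (LINT t:?I|lebesgue. h t * \<psi> t) - ?P * (LINT t:?I|lebesgue. h t * \<theta> t)"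
    proof -
      have "(LINT t:?I|lebesgue. h t * \<eta> t) = (LINT t:?I|lebesgue. ?L * (h t * \<psi> t) - ?P * (h t * \<theta> t))"
        by (simp add: \<eta>_def algebra_simps)
      also have "\<dots> = (LINT t:?I|lebesgue. ?L * (h t * \<psi> t)) - (LINT t:?I|lebesgue. ?P * (h t * \<theta> t))"
        using hmult[OF \<psi> h] hmult[OF \<theta> h] by (intro set_integral_diff set_integrable_mult_right)
      finally show ?thesis by simp
    qed
    ultimately have "(LINT t:?I|lebesgue. h t * \<psi> t) = c * ?P" using L by (simp add: c_def field_simps)
    moreover have "(LINT t:?I|lebesgue. (h t - c) * \<psi> t) = (LINT t:?I|lebesgue. h t * \<psi> t) - (LINT t:?I|lebesgue. c * \<psi> t)"
      unfolding left_diff_distrib using hmult[OF \<psi> h] ti[OF \<psi>] by (intro set_integral_diff) auto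
    ultimately show "(LINT t:?I|lebesgue. (h t - c) * \<psi> t) = 0" by simp
  qed simp
  then show ?thesis by (intro exI[of _ c]) (auto elim: eventually_mono)
qed

section \<open>Uniqueness for the integrated abstract equation\<close>

context hilbert_embedding
begin

text \<open>If \<open>\<phi>\<close> vanishes below \<open>\<delta>\<close>, then
  \<open>\<phi> (B) q\<close> is \<open>B\<close> applied to an element of the same kind. The
  equation can thus be used any number of times, each use contributing a factor
  \<open>\<rho> / \<delta>\<close> and a fractional integration of order \<open>\<alpha>\<close>.
  The integrable majorant \<open>N\<close> starts the iteration.\<close>

theorem evolution_unique:
  fixes \<zeta> :: "real \<Rightarrow> 'y" and N :: "real \<Rightarrow> real"
  assumes a: "0 < \<alpha>" "\<alpha> < 1" "0 < \<rho>"
    and m: "\<And>q. set_integrable lebesgue {0<..<T} (\<lambda>t. \<zeta> t \<bullet> q)"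
    and N: "set_integrable lebesgue {0<..<T} N"
    and bd: "AE t in lebesgue. t \<in> {0<..<T} \<longrightarrow> norm (\<zeta> t) \<le> N t"
    and eq: "\<And>q t. t \<in> {0<..<T} \<Longrightarrow>
        set_integrable lebesgue {0<..<t} (\<lambda>s. (t - s) powr (\<alpha> - 1) * (- \<rho> * (LINT r:{0<..<s}|lebesgue. \<zeta> r \<bullet> q)))"
      "\<And>q t. t \<in> {0<..<T} \<Longrightarrow> (LINT s:{0<..<t}|lebesgue. \<zeta> s \<bullet> B q)
        = 1 / Gamma \<alpha> * (LINT s:{0<..<t}|lebesgue. (t - s) powr (\<alpha> - 1) * (- \<rho> * (LINT r:{0<..<s}|lebesgue. \<zeta> r \<bullet> q)))"
  shows "AE t in lebesgue. t \<in> {0<..<T} \<longrightarrow> \<zeta> t \<bullet> B q = 0"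
proof -
  define A where "A q t = (LINT s:{0<..<t}|lebesgue. \<zeta> s \<bullet> q)" for q t
  define C where "C = (LINT s:{0<..<T}|lebesgue. \<bar>N s\<bar>)"
  have C0: "C \<ge> 0" unfolding C_def by (rule LINT_nonneg) simp
  have sub: "set_integrable lebesgue {0<..<t} (\<lambda>s. \<zeta> s \<bullet> q)" if "t \<in> {0<..<T}" for t q
    by (rule set_integrable_subinterval[OF m]) (use that in auto)
  have A_le: "\<bar>A q t\<bar> \<le> C * norm q" if t: "t \<in> {0<..<T}" for q t
  proof -
    have "\<bar>A q t\<bar> \<le> (\<integral>s. norm (indicator {0<..<t} s *\<^sub>R (\<zeta> s \<bullet> q)) \<partial>lebesgue)"
      unfolding A_def set_lebesgue_integral_def using integral_norm_bound[of lebesgue "\<lambda>s. indicator {0<..<t} s *\<^sub>R (\<zeta> s \<bullet> q)"] by simp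
    also have "\<dots> \<le> (\<integral>s. norm q * (indicator {0<..<T} s *\<^sub>R \<bar>N s\<bar>) \<partial>lebesgue)"
    proof (rule integral_mono_AE)
      show "integrable lebesgue (\<lambda>s. norm (indicator {0<..<t} s *\<^sub>R (\<zeta> s \<bullet> q)))"
        using sub[OF t] by (intro integrable_norm) (simp add: set_integrable_def)
      show "integrable lebesgue (\<lambda>s. norm q * (indicator {0<..<T} s *\<^sub>R \<bar>N s\<bar>))"
        using set_integrable_abs[OF N] by (intro integrable_mult_right) (simp add: set_integrable_def)
      show "AE s in lebesgue. norm (indicator {0<..<t} s *\<^sub>R (\<zeta> s \<bullet> q)) \<le> norm q * (indicator {0<..<T} s *\<^sub>R \<bar>N s\<bar>)"
        using bd
      proof eventually_elim
        case (elim s)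
        show ?case
        proof (cases "s \<in> {0<..<t}")
          case True
          then have "s \<in> {0<..<T}" using t by auto
          then have "\<bar>\<zeta> s \<bullet> q\<bar> \<le> \<bar>N s\<bar> * norm q"
            using elim Cauchy_Schwarz_ineq2[of "\<zeta> s" q] mult_right_mono[of "norm (\<zeta> s)" "\<bar>N s\<bar>" "norm q"] by fastforce
          then show ?thesis using True \<open>s \<in> {0<..<T}\<close> by (simp add: mult.commute)
        qed simp
      qed
    qed
    also have "\<dots> = C * norm q" by (simp add: C_def set_lebesgue_integral_def)
    finally show ?thesis .
  qed
  have A_diff: "A (p - q) t = A p t - A q t" if t: "t \<in> {0<..<T}" for p q t
    unfolding A_def inner_diff_right by (rule set_integral_diff[OF sub[OF t] sub[OF t]])
  have rec: "set_integrable lebesgue {0<..<t} (\<lambda>s. (t - s) powr (\<alpha> - 1) * (- \<rho> * A q s))"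
    "A (B q) t = 1 / Gamma \<alpha> * (LINT s:{0<..<t}|lebesgue. (t - s) powr (\<alpha> - 1) * (- \<rho> * A q s))"
    if t: "t \<in> {0<..<T}" for q t
    using eq[OF t, of q] by (simp_all add: A_def)
  have step: "\<bar>A (B.calc \<phi> q) t\<bar> \<le> (\<rho> / \<delta>) ^ m * S * C * norm q * (t powr (\<alpha> * m) / Gamma (\<alpha> * m + 1))"
    if "0 < \<delta>" "continuous_on {0..1} \<phi>" "\<And>b. b \<in> {0..1} \<Longrightarrow> \<bar>\<phi> b\<bar> \<le> S" "\<And>b. b \<in> {0..1} \<Longrightarrow> b \<le> \<delta> \<Longrightarrow> \<phi> b = 0"
      "t \<in> {0<..<T}" for \<delta> \<phi> S t m
    using that
  proof (induction m arbitrary: \<phi> S t)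
    case 0
    have "\<bar>A (B.calc \<phi> q) t\<bar> \<le> C * (S * norm q)"
      using A_le[OF 0(5), of "B.calc \<phi> q"] B.calc_norm_le[OF 0(2,3), of q] C0
      by (meson mult_left_mono order_trans)
    then show ?case using 0(5) by (simp add: mult_ac)
  next
    case (Suc m)
    \<comment> \<open>The quotient \<open>\<phi> b / b\<close>; the maximum in the denominator
      changes it only where \<open>\<phi>\<close> vanishes and keeps it continuous. Its bound is
      \<open>S / \<delta>\<close>.\<close>
    define \<psi> where "\<psi> b = \<phi> b / max b \<delta>" for b
    have \<psi>c: "continuous_on {0..1} \<psi>"
      unfolding \<psi>_def[abs_def] using Suc.prems(1) by (intro continuous_on_divide Suc.prems continuous_intros) auto
    have S0: "0 \<le> S" using Suc.prems(3)[of 0] by simp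
    have \<psi>S: "\<bar>\<psi> b\<bar> \<le> S / \<delta>" if "b \<in> {0..1}" for b
      unfolding \<psi>_def abs_divide using Suc.prems(1) Suc.prems(3)[OF that] by (intro frac_le) auto
    have \<psi>0: "\<psi> b = 0" if "b \<in> {0..1}" "b \<le> \<delta>" for b using Suc.prems(4)[OF that] by (simp add: \<psi>_def)
    have bpsi: "b * \<psi> b = \<phi> b" if "b \<in> {0..1}" for b
      using Suc.prems(1) Suc.prems(4)[OF that] by (cases "b \<le> \<delta>") (auto simp: \<psi>_def)
    have "real k / real n * \<psi> (real k / real n) = \<phi> (real k / real n)" if "k \<le> n" for k n :: nat
      by (rule bpsi) (use that in \<open>auto simp: divide_le_eq_1\<close>)
    then have "B.bcalc n (\<lambda>b. b * \<psi> b) q = B.bcalc n \<phi> q" for n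
      unfolding B.bcalc_def by (intro sum.cong refl) (simp only: atMost_iff)
    then have "B.calc \<phi> q = B.calc (\<lambda>b. b * \<psi> b) q" by (simp add: B.calc_def)
    then have cB: "B.calc \<phi> q = B (B.calc \<psi> q)" using B.calc_times_B[OF \<psi>c] by simp
    define D where "D = (\<rho> / \<delta>) ^ m * (S / \<delta>) * C * norm q / Gamma (\<alpha> * m + 1)"
    have IH: "\<bar>A (B.calc \<psi> q) s\<bar> \<le> D * s powr (\<alpha> * m)" if "s \<in> {0<..<T}" for s
      using Suc.IH[OF Suc.prems(1) \<psi>c \<psi>S \<psi>0 that] by (simp add: D_def)
    let ?t = t
    note R = rec[OF Suc.prems(5), of "B.calc \<psi> q"]
    have pm: "0 < \<alpha> * m + 1" using a by (simp add: add_nonneg_pos)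
    have tp: "0 < t" using Suc.prems(5) by simp
    note Bt = Beta_integral_shifted[OF a(1) pm tp]
    have Gp: "Gamma \<alpha> > 0" "Gamma (\<alpha> * m + 1) > 0" using a pm by (auto intro: Gamma_real_pos)
    have "\<bar>LINT s:{0<..<t}|lebesgue. (t - s) powr (\<alpha> - 1) * (- \<rho> * A (B.calc \<psi> q) s)\<bar>
       \<le> (LINT s:{0<..<t}|lebesgue. (\<rho> * D) * ((t - s) powr (\<alpha> - 1) * (s - 0) powr (\<alpha> * m + 1 - 1)))"
    proof -
      let ?f = "\<lambda>s. (t - s) powr (\<alpha> - 1) * (- \<rho> * A (B.calc \<psi> q) s)"
      have "\<bar>LINT s:{0<..<t}|lebesgue. ?f s\<bar> \<le> (LINT s:{0<..<t}|lebesgue. \<bar>?f s\<bar>)"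
        using integral_norm_bound[of lebesgue "\<lambda>s. indicator {0<..<t} s *\<^sub>R ?f s"]
        by (simp add: set_lebesgue_integral_def abs_mult)
      also have "\<dots> \<le> (LINT s:{0<..<t}|lebesgue. (\<rho> * D) * ((t - s) powr (\<alpha> - 1) * (s - 0) powr (\<alpha> * m + 1 - 1)))"
      proof (rule set_integral_mono)
        show "set_integrable lebesgue {0<..<t} (\<lambda>s. \<bar>?f s\<bar>)" using R(1) by (rule set_integrable_abs)
        show "set_integrable lebesgue {0<..<t} (\<lambda>s. (\<rho> * D) * ((t - s) powr (\<alpha> - 1) * (s - 0) powr (\<alpha> * m + 1 - 1)))"
          using Bt(1) by (rule set_integrable_mult_right)
        fix s assume s: "s \<in> {0<..<t}"
        have "(t - s) powr (\<alpha> - 1) * \<rho> * \<bar>A (B.calc \<psi> q) s\<bar> \<le> (t - s) powr (\<alpha> - 1) * \<rho> * (D * s powr (\<alpha> * m))"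
          using IH[of s] s Suc.prems(5) a by (intro mult_left_mono) auto
        then show "\<bar>?f s\<bar> \<le> (\<rho> * D) * ((t - s) powr (\<alpha> - 1) * (s - 0) powr (\<alpha> * m + 1 - 1))"
          using a by (simp add: abs_mult mult_ac)
      qed
      finally show ?thesis .
    qed
    also have "\<dots> = (\<rho> * D) * (t powr (\<alpha> + \<alpha> * m) * (Gamma \<alpha> * Gamma (\<alpha> * m + 1) / Gamma (\<alpha> + \<alpha> * m + 1)))"
      unfolding set_integral_mult_right Bt(2) by (simp add: add.assoc)
    finally have LE: "\<bar>LINT s:{0<..<t}|lebesgue. (t - s) powr (\<alpha> - 1) * (- \<rho> * A (B.calc \<psi> q) s)\<bar>
       \<le> (\<rho> * D) * (t powr (\<alpha> + \<alpha> * m) * (Gamma \<alpha> * Gamma (\<alpha> * m + 1) / Gamma (\<alpha> + \<alpha> * m + 1)))" .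
    have "\<bar>A (B.calc \<phi> q) t\<bar> = 1 / Gamma \<alpha> * \<bar>LINT s:{0<..<t}|lebesgue. (t - s) powr (\<alpha> - 1) * (- \<rho> * A (B.calc \<psi> q) s)\<bar>"
      unfolding cB R(2) using Gp by (subst abs_mult) simp
    also have "\<dots> \<le> 1 / Gamma \<alpha> * ((\<rho> * D) * (t powr (\<alpha> + \<alpha> * m) * (Gamma \<alpha> * Gamma (\<alpha> * m + 1) / Gamma (\<alpha> + \<alpha> * m + 1))))"
      using LE Gp by (intro mult_left_mono) auto
    also have "\<dots> = (\<rho> / \<delta>) ^ Suc m * S * C * norm q * (t powr (\<alpha> * Suc m) / Gamma (\<alpha> * Suc m + 1))"
    proof -
      have "\<alpha> * Suc m = \<alpha> + \<alpha> * m" by (simp add: algebra_simps)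
      then show ?thesis using Gp Suc.prems(1) by (simp add: D_def field_simps)
    qed
    finally show ?case .
  qed
  have van: "A (B.calc \<phi> q) t = 0"
    if d: "0 < \<delta>" "continuous_on {0..1} \<phi>" "\<And>b. b \<in> {0..1} \<Longrightarrow> \<bar>\<phi> b\<bar> \<le> 1" "\<And>b. b \<in> {0..1} \<Longrightarrow> b \<le> \<delta> \<Longrightarrow> \<phi> b = 0"
      "t \<in> {0<..<T}" for \<delta> \<phi> t
  proof -
    \<comment> \<open>The bound after \<open>n\<close> iterations is a constant times the general
      term of a convergent Mittag-Leffler series.\<close>
    have "(\<lambda>n. (\<rho> / \<delta> * t powr \<alpha>) ^ n / Gamma (\<alpha> * n + 1)) \<longlonglongrightarrow> 0"
      by (rule summable_LIMSEQ_zero[OF summable_ML[OF a(1) zero_less_one]])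
    then have "(\<lambda>n. (C * norm q) * ((\<rho> / \<delta> * t powr \<alpha>) ^ n / Gamma (\<alpha> * n + 1))) \<longlonglongrightarrow> (C * norm q) * 0"
      by (intro tendsto_intros)
    moreover have "\<bar>A (B.calc \<phi> q) t\<bar> \<le> (C * norm q) * ((\<rho> / \<delta> * t powr \<alpha>) ^ n / Gamma (\<alpha> * n + 1))" for n
    proof -
      have "t powr (\<alpha> * n) = (t powr \<alpha>) ^ n" using d(5) by (simp add: powr_powr flip: powr_realpow)
      then have e: "(\<rho> / \<delta>) ^ n * t powr (\<alpha> * n) = (\<rho> / \<delta> * t powr \<alpha>) ^ n" by (simp only: power_mult_distrib)
      have "(\<rho> / \<delta>) ^ n * 1 * C * norm q * (t powr (\<alpha> * n) / Gamma (\<alpha> * n + 1))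
          = (C * norm q) * (((\<rho> / \<delta>) ^ n * t powr (\<alpha> * n)) / Gamma (\<alpha> * n + 1))" by simp
      then show ?thesis using step[OF d, of n] unfolding e by (simp only:)
    qed
    ultimately have "\<bar>A (B.calc \<phi> q) t\<bar> \<le> (C * norm q) * 0"
      by (intro LIMSEQ_le_const) auto
    then show ?thesis by simp
  qed
  have A0: "A (B q) t = 0" if t: "t \<in> {0<..<T}" for t
  proof -
    have le: "\<bar>A (B q) t\<bar> \<le> e" if e: "e > 0" for e
    proof -
      define x where "x = C * norm q"
      define \<delta> where "\<delta> = e / (x + 1)"
      have x: "x \<ge> 0" using C0 by (simp add: x_def)
      then have "x * e \<le> e * (x + 1)" using e by (simp add: algebra_simps)
      then have d: "\<delta> > 0" "C * norm q * \<delta> \<le> e"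
        using e x unfolding x_def[symmetric] by (simp_all add: \<delta>_def divide_le_eq add_nonneg_pos)
      \<comment> \<open>A continuous function vanishing below \<open>\<delta>\<close> and within
        \<open>\<delta>\<close> of the identity, so \<open>B q\<close> is approximated in
        norm.\<close>
      let ?\<phi> = "\<lambda>b. max (b - \<delta>) 0"
      have c: "continuous_on {0..1} ?\<phi>" by (intro continuous_intros)
      have "A (B.calc ?\<phi> q) t = 0" by (rule van[OF d(1) c _ _ t]) (use d in auto)
      then have "A (B q) t = A (B q - B.calc ?\<phi> q) t" using A_diff[OF t] by simp
      also have "B q - B.calc ?\<phi> q = B.calc (\<lambda>b. b - ?\<phi> b) q"
        using B.calc_diff[OF continuous_on_id c, of q] by (simp only: B.calc_id)
      also have "\<bar>A (B.calc (\<lambda>b. b - ?\<phi> b) q) t\<bar> \<le> C * norm (B.calc (\<lambda>b. b - ?\<phi> b) q)" by (rule A_le[OF t])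
      also have "\<dots> \<le> C * (\<delta> * norm q)"
        using C0 d by (intro mult_left_mono B.calc_norm_le continuous_intros) auto
      finally show ?thesis using d(2) by (simp add: mult_ac)
    qed
    show ?thesis
    proof (rule ccontr)
      assume "A (B q) t \<noteq> 0"
      then show False using le[of "\<bar>A (B q) t\<bar> / 2"] by simp
    qed
  qed
  \<comment> \<open>\<open>A (B q)\<close> is the primitive of the pairing in question; as it
    vanishes identically, so do the integrals over all intervals.\<close>
  show ?thesis
  proof (rule AE_zero_of_box_integrals)
    fix c d :: real assume cd: "cbox c d \<subseteq> {0<..<T}"
    show "set_integrable lebesgue (cbox c d) (\<lambda>t. \<zeta> t \<bullet> B q)"
      by (rule set_integrable_subset[OF m _ cd]) simp
    show "(LINT t:box c d|lebesgue. \<zeta> t \<bullet> B q) = 0"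
    proof (cases "c < d")
      case True
      then have cdT: "0 < c" "c < d" "d \<in> {0<..<T}" "c \<in> {0<..<T}" using cd by (auto simp: subset_iff cbox_interval)
      have ae: "AE s in lebesgue. s \<noteq> c" by (rule AE_I[of _ _ "{c}"]) auto
      have "(LINT t:box c d|lebesgue. \<zeta> t \<bullet> B q) = (LINT t:{c..<d}|lebesgue. \<zeta> t \<bullet> B q)"
        unfolding set_lebesgue_integral_def
      proof (rule integral_cong_AE)
        have "set_integrable lebesgue {c..<d} (\<lambda>t. \<zeta> t \<bullet> B q)" "set_integrable lebesgue (box c d) (\<lambda>t. \<zeta> t \<bullet> B q)"
          using cdT by (auto intro!: set_integrable_subset[OF m])
        then show "(\<lambda>t. indicator (box c d) t *\<^sub>R (\<zeta> t \<bullet> B q)) \<in> borel_measurable lebesgue"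
          "(\<lambda>t. indicator {c..<d} t *\<^sub>R (\<zeta> t \<bullet> B q)) \<in> borel_measurable lebesgue"
          by (auto simp: set_integrable_def)
        show "AE t in lebesgue. indicator (box c d) t *\<^sub>R (\<zeta> t \<bullet> B q) = indicator {c..<d} t *\<^sub>R (\<zeta> t \<bullet> B q)"
          using ae by eventually_elim (auto simp: indicator_def box_real)
      qed
      also have "\<dots> = A (B q) d - A (B q) c"
        unfolding A_def using LINT_split[OF sub[OF cdT(3)] cdT(1,2), of "B q"] by simp
      finally show ?thesis using A0 cdT by simp
    next
      case False
      then show ?thesis by (simp add: set_lebesgue_integral_def)
    qed
  qed simp
qed

end

subsection \<open>Square integrable functions on a planar domain\<close>

text \<open>Extension by zero embeds \<open>L2 \<Omega>\<close> isometrically in the Hilbert space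
  of classes on the plane, so that one type serves every domain.\<close>

definition ext :: "pt set \<Rightarrow> (pt \<Rightarrow> 'b::euclidean_space) \<Rightarrow> pt \<Rightarrow> 'b" where
  "ext \<Omega> u x = (if x \<in> \<Omega> then u x else 0)"

definition cl :: "pt set \<Rightarrow> (pt \<Rightarrow> 'b::euclidean_space) \<Rightarrow> 'b lsq" where
  "cl \<Omega> u = abs_lsq (ext \<Omega> u)"

locale planar_domain =
  fixes \<Omega> :: "pt set"
  assumes open_dom: "open \<Omega>" and bounded_dom: "bounded \<Omega>"
begin

lemma sets_dom [simp]: "\<Omega> \<in> sets lebesgue" "\<Omega> \<in> sets borel"
  using open_dom by auto

lemma finite_dom: "emeasure lebesgue \<Omega> < \<infinity>"
  using lmeasurable_open[OF bounded_dom open_dom] by (simp add: fmeasurable_def)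

lemma integral_dom: "(\<integral>x. f x \<partial>lebesgue_on \<Omega>) = (LINT x:\<Omega>|lebesgue. f x :: real)"
  by (simp add: integral_restrict_space set_lebesgue_integral_def)

lemma L2_iff: "u \<in> L2 \<Omega> \<longleftrightarrow> l2fun (ext \<Omega> u)"
proof -
  have e: "(norm (ext \<Omega> u x))\<^sup>2 = indicator \<Omega> x *\<^sub>R (norm (u x))\<^sup>2" for x by (simp add: ext_def indicator_def)
  have m: "u \<in> borel_measurable (lebesgue_on \<Omega>) \<longleftrightarrow> ext \<Omega> u \<in> borel_measurable lebesgue"
    using borel_measurable_if[of \<Omega> u] by (simp add: ext_def[abs_def])
  have i: "integrable (lebesgue_on \<Omega>) (\<lambda>x. (norm (u x))\<^sup>2) \<longleftrightarrow> integrable lebesgue (\<lambda>x. indicator \<Omega> x *\<^sub>R (norm (u x))\<^sup>2)"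
    by (rule integrable_restrict_space) simp
  show ?thesis unfolding L2_def l2fun_def mem_Collect_eq m i e by simp
qed

text \<open>Combinations \<open>a u - b v\<close> cover differences, sums (\<open>b = -1\<close>)
  and multiples (\<open>b = 0\<close>) at once; the linearity facts below all have this
  form.\<close>

lemma ext_lin: "ext \<Omega> (\<lambda>x. a *\<^sub>R u x - b *\<^sub>R v x) = (\<lambda>x. a *\<^sub>R ext \<Omega> u x - b *\<^sub>R ext \<Omega> v x)"
  by (auto simp: ext_def)

lemma L2_lin: "u \<in> L2 \<Omega> \<Longrightarrow> v \<in> L2 \<Omega> \<Longrightarrow> (\<lambda>x. a *\<^sub>R u x - b *\<^sub>R v x) \<in> L2 \<Omega>"
  unfolding L2_iff ext_lin by (intro l2fun_diff l2fun_scaleR)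

lemma cl_lin:
  assumes "u \<in> L2 \<Omega>" "v \<in> L2 \<Omega>"
  shows "cl \<Omega> (\<lambda>x. a *\<^sub>R u x - b *\<^sub>R v x) = a *\<^sub>R cl \<Omega> u - b *\<^sub>R cl \<Omega> v"
  using assms unfolding L2_iff cl_def ext_lin
  by (simp add: abs_lsq_scaleR abs_lsq_diff l2fun_scaleR)

lemma L2_diff: "u \<in> L2 \<Omega> \<Longrightarrow> v \<in> L2 \<Omega> \<Longrightarrow> (\<lambda>x. u x - v x) \<in> L2 \<Omega>"
  using L2_lin[of u v 1 1] by simp

lemma cl_diff: "u \<in> L2 \<Omega> \<Longrightarrow> v \<in> L2 \<Omega> \<Longrightarrow> cl \<Omega> (\<lambda>x. u x - v x) = cl \<Omega> u - cl \<Omega> v"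
  using cl_lin[of u v 1 1] by simp

lemma cl_inner: "u \<in> L2 \<Omega> \<Longrightarrow> v \<in> L2 \<Omega> \<Longrightarrow> cl \<Omega> u \<bullet> cl \<Omega> v = L2_inner \<Omega> u v"
  unfolding L2_iff cl_def L2_inner_def integral_dom set_lebesgue_integral_def
  by (subst abs_lsq_inner) (auto simp: ext_def indicator_def intro!: Bochner_Integration.integral_cong)

lemma cl_norm: "u \<in> L2 \<Omega> \<Longrightarrow> norm (cl \<Omega> u) = L2_norm \<Omega> u"
  by (simp add: norm_eq_sqrt_inner cl_inner L2_norm_def)

lemma AE_dom: "(AE x in lebesgue_on \<Omega>. P x) \<longleftrightarrow> (AE x in lebesgue. x \<in> \<Omega> \<longrightarrow> P x)"
  by (rule AE_restrict_space_iff) simp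

lemma cl_eq_iff: "u \<in> L2 \<Omega> \<Longrightarrow> v \<in> L2 \<Omega> \<Longrightarrow> cl \<Omega> u = cl \<Omega> v \<longleftrightarrow> (AE x in lebesgue_on \<Omega>. u x = v x)"
  unfolding L2_iff cl_def AE_dom
  by (subst abs_lsq_eq) (auto simp: ext_def elim!: eventually_mono intro!: AE_cong split: if_splits)

text \<open>The domain is bounded, hence of finite measure, and the absolute value of
  \<open>y\<close> is at most \<open>1 + y\<^sup>2\<close>.\<close>

lemma L2_integrable:
  fixes w :: "pt \<Rightarrow> real"
  assumes "w \<in> L2 \<Omega>" shows "set_integrable lebesgue \<Omega> w"
  unfolding set_integrable_def
proof (rule Bochner_Integration.integrable_bound)
  have e: "indicator \<Omega> x *\<^sub>R w x = ext \<Omega> w x" for x by (simp add: ext_def indicator_def)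
  have l: "l2fun (ext \<Omega> w)" using assms by (simp add: L2_iff)
  show "integrable lebesgue (\<lambda>x. indicator \<Omega> x + (norm (ext \<Omega> w x))\<^sup>2)"
    using l finite_dom by (intro Bochner_Integration.integrable_add integrable_real_indicator) (auto simp: l2fun_def)
  show "(\<lambda>x. indicator \<Omega> x *\<^sub>R w x) \<in> borel_measurable lebesgue"
    unfolding e using l by (auto simp: l2fun_def)
  have "\<bar>y\<bar> \<le> 1 + y\<^sup>2" for y :: real
    using sum_squares_bound[of "\<bar>y\<bar>" 1] abs_ge_zero[of y] by (simp; linarith)
  then show "AE x in lebesgue. norm (indicator \<Omega> x *\<^sub>R w x) \<le> norm (indicator \<Omega> x + (norm (ext \<Omega> w x))\<^sup>2)"
    by (intro AE_I2) (auto simp: ext_def indicator_def)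
qed

text \<open>A limit class has some representative on the plane; cutting it off outside
  \<open>\<Omega>\<close> does not increase its distance to the \<open>v n\<close>, so the cut-off
  is the limit too.\<close>

lemma cl_surj_closed:
  assumes v: "\<And>n. v n \<in> L2 \<Omega>" and lim: "(\<lambda>n. cl \<Omega> (v n)) \<longlonglongrightarrow> a"
  shows "\<exists>u\<in>L2 \<Omega>. cl \<Omega> u = a"
proof -
  obtain u where u: "l2fun u" "abs_lsq u = a" using Rep_lsq_ex by blast
  have uL: "l2fun (ext \<Omega> u)"
  proof -
    have "ext \<Omega> u = (\<lambda>x. indicator \<Omega> x *\<^sub>R u x)" by (auto simp: ext_def indicator_def)
    moreover have mI: "(\<lambda>x. indicator \<Omega> x *\<^sub>R u x) \<in> borel_measurable lebesgue"
      using u by (intro borel_measurable_scaleR borel_measurable_indicator) (auto simp: l2fun_def)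
    moreover have "integrable lebesgue (\<lambda>x. (norm (indicator \<Omega> x *\<^sub>R u x))\<^sup>2)"
    proof (rule Bochner_Integration.integrable_bound)
      show "integrable lebesgue (\<lambda>x. (norm (u x))\<^sup>2)" using u by (simp add: l2fun_def)
      show "(\<lambda>x. (norm (indicator \<Omega> x *\<^sub>R u x))\<^sup>2) \<in> borel_measurable lebesgue"
        by (rule borel_measurable_power[OF measurable_compose[OF mI borel_measurable_norm]])
    qed (auto simp: indicator_def)
    ultimately show ?thesis by (simp add: l2fun_def)
  qed
  have vl: "l2fun (ext \<Omega> (v n))" for n using v by (simp add: L2_iff)
  have "norm (cl \<Omega> u - cl \<Omega> (v n)) \<le> norm (a - cl \<Omega> (v n))" for n
  proof -
    have "(norm (cl \<Omega> u - cl \<Omega> (v n)))\<^sup>2 \<le> (norm (a - cl \<Omega> (v n)))\<^sup>2"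
      unfolding cl_def u(2)[symmetric] norm_abs_lsq_diff[OF uL vl] norm_abs_lsq_diff[OF u(1) vl]
      using l2fun_diff[OF uL vl] l2fun_diff[OF u(1) vl]
      by (intro integral_mono) (auto simp: l2fun_def ext_def)
    then show ?thesis by (rule power2_le_imp_le) simp
  qed
  moreover have "(\<lambda>n. norm (a - cl \<Omega> (v n))) \<longlonglongrightarrow> norm (a - a)" by (intro tendsto_intros lim)
  ultimately have "(\<lambda>n. norm (cl \<Omega> u - cl \<Omega> (v n))) \<longlonglongrightarrow> 0"
    by (intro tendsto_sandwich[of "\<lambda>_. 0" "\<lambda>n. norm (cl \<Omega> u - cl \<Omega> (v n))" _ "\<lambda>n. norm (a - cl \<Omega> (v n))"]) auto
  then have "(\<lambda>n. cl \<Omega> u - cl \<Omega> (v n)) \<longlonglongrightarrow> 0" by (rule tendsto_norm_zero_cancel)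
  then have "(\<lambda>n. cl \<Omega> u - (cl \<Omega> u - cl \<Omega> (v n))) \<longlonglongrightarrow> cl \<Omega> u - 0" by (intro tendsto_intros)
  then have "(\<lambda>n. cl \<Omega> (v n)) \<longlonglongrightarrow> cl \<Omega> u" by simp
  then have "cl \<Omega> u = a" using lim LIMSEQ_unique by blast
  then show ?thesis using uL by (auto simp: L2_iff)
qed

lemma L2_dominated:
  assumes m: "f \<in> borel_measurable (lebesgue_on \<Omega>)" and g: "g \<in> L2 \<Omega>" and le: "\<And>x. x \<in> \<Omega> \<Longrightarrow> norm (f x) \<le> C * norm (g x)"
    and C: "0 \<le> C"
  shows "f \<in> L2 \<Omega>" "norm (cl \<Omega> f) \<le> C * norm (cl \<Omega> g)"
proof -
  have sq: "(norm (f x))\<^sup>2 \<le> C\<^sup>2 * (norm (g x))\<^sup>2" if "x \<in> \<Omega>" for x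
    using power_mono[OF le[OF that], of 2] by (simp add: power_mult_distrib)
  have gi: "integrable (lebesgue_on \<Omega>) (\<lambda>x. (norm (g x))\<^sup>2)" using g by (simp add: L2_def)
  have fi: "integrable (lebesgue_on \<Omega>) (\<lambda>x. (norm (f x))\<^sup>2)"
    by (rule Bochner_Integration.integrable_bound[of _ "\<lambda>x. C\<^sup>2 * (norm (g x))\<^sup>2"]) (use gi m sq in auto)
  then show fL: "f \<in> L2 \<Omega>" using m by (simp add: L2_def)
  have "(norm (cl \<Omega> f))\<^sup>2 \<le> (C * norm (cl \<Omega> g))\<^sup>2"
    unfolding power_mult_distrib power2_norm_eq_inner cl_inner[OF fL fL] cl_inner[OF g g] L2_inner_def
    unfolding power2_norm_eq_inner[symmetric] Bochner_Integration.integral_mult_right_zero[symmetric]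
    by (rule integral_mono) (use fi gi sq in auto)
  then show "norm (cl \<Omega> f) \<le> C * norm (cl \<Omega> g)" by (rule power2_le_imp_le) (use C in simp)
qed

lemma component_L2:
  fixes u :: "pt \<Rightarrow> 'b::euclidean_space ^ 'n"
  assumes "u \<in> L2 \<Omega>"
  shows "(\<lambda>x. u x $ i) \<in> L2 \<Omega>" "norm (cl \<Omega> (\<lambda>x. u x $ i)) \<le> norm (cl \<Omega> u)"
proof -
  have "(\<lambda>x. u x $ i) \<in> borel_measurable (lebesgue_on \<Omega>)"
    using assms measurable_compose[OF _ borel_measurable_continuous_onI[of "\<lambda>v. v $ i"]]
    by (auto simp: L2_def continuous_intros)
  from L2_dominated[OF this assms, of 1] show "(\<lambda>x. u x $ i) \<in> L2 \<Omega>" "norm (cl \<Omega> (\<lambda>x. u x $ i)) \<le> norm (cl \<Omega> u)"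
    using Finite_Cartesian_Product.norm_nth_le[of "u _" i] by auto
qed

lemma component_tendsto:
  fixes u :: "pt \<Rightarrow> 'b::euclidean_space ^ 'n"
  assumes u: "u \<in> L2 \<Omega>" and v: "\<And>n. v n \<in> L2 \<Omega>" and lim: "(\<lambda>n. cl \<Omega> (v n)) \<longlonglongrightarrow> cl \<Omega> u"
  shows "(\<lambda>n. cl \<Omega> (\<lambda>x. v n x $ i)) \<longlonglongrightarrow> cl \<Omega> (\<lambda>x. u x $ i)"
proof (rule LIM_zero_cancel, rule Lim_null_comparison)
  show "\<forall>\<^sub>F n in sequentially. norm (cl \<Omega> (\<lambda>x. v n x $ i) - cl \<Omega> (\<lambda>x. u x $ i)) \<le> norm (cl \<Omega> (v n) - cl \<Omega> u)"
    using component_L2(2)[OF L2_diff[OF v u], where i = i] component_L2(1)[OF v, where i = i] component_L2(1)[OF u, where i = i]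
    by (simp add: cl_diff v u)
  show "(\<lambda>n. norm (cl \<Omega> (v n) - cl \<Omega> u)) \<longlonglongrightarrow> 0" by (rule tendsto_norm_zero[OF LIM_zero[OF lim]])
qed

lemma vec_L2:
  fixes u :: "pt \<Rightarrow> 'b::euclidean_space ^ 'n"
  assumes c: "\<And>i. (\<lambda>x. u x $ i) \<in> L2 \<Omega>"
  shows "u \<in> L2 \<Omega>" and "(norm (cl \<Omega> u))\<^sup>2 = (\<Sum>i\<in>UNIV. (norm (cl \<Omega> (\<lambda>x. u x $ i)))\<^sup>2)"
proof -
  have "(\<lambda>x. u x \<bullet> b) \<in> borel_measurable (lebesgue_on \<Omega>)" for b
  proof -
    have "(\<lambda>x. u x $ i) \<in> borel_measurable (lebesgue_on \<Omega>)" for i using c by (simp add: L2_def)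
    then show ?thesis unfolding inner_vec_def by (intro borel_measurable_sum borel_measurable_inner) auto
  qed
  then have m: "u \<in> borel_measurable (lebesgue_on \<Omega>)" by (subst borel_measurable_euclidean_space) auto
  have n: "(norm (u x))\<^sup>2 = (\<Sum>i\<in>UNIV. (norm (u x $ i))\<^sup>2)" for x
    by (simp add: power2_norm_eq_inner inner_vec_def)
  have ci: "integrable (lebesgue_on \<Omega>) (\<lambda>x. (norm (u x $ i))\<^sup>2)" for i using c by (simp add: L2_def)
  have "integrable (lebesgue_on \<Omega>) (\<lambda>x. (norm (u x))\<^sup>2)"
    unfolding n by (rule Bochner_Integration.integrable_sum) (rule ci)
  then show uL: "u \<in> L2 \<Omega>" using m by (simp add: L2_def)
  show "(norm (cl \<Omega> u))\<^sup>2 = (\<Sum>i\<in>UNIV. (norm (cl \<Omega> (\<lambda>x. u x $ i)))\<^sup>2)"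
    unfolding power2_norm_eq_inner cl_inner[OF uL uL] cl_inner[OF c c] L2_inner_def
    unfolding power2_norm_eq_inner[symmetric] n by (rule Bochner_Integration.integral_sum) (rule ci)
qed

lemma vec_inner:
  fixes u v :: "pt \<Rightarrow> 'b::euclidean_space ^ 'n"
  assumes "u \<in> L2 \<Omega>" "v \<in> L2 \<Omega>"
  shows "L2_inner \<Omega> u v = (\<Sum>i\<in>UNIV. L2_inner \<Omega> (\<lambda>x. u x $ i) (\<lambda>x. v x $ i))"
  unfolding L2_inner_def inner_vec_def
proof (rule Bochner_Integration.integral_sum)
  fix i
  have "l2fun (ext \<Omega> (\<lambda>x. u x $ i))" "l2fun (ext \<Omega> (\<lambda>x. v x $ i))" using component_L2 assms by (auto simp flip: L2_iff)
  from l2fun_integrable_inner[OF this]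
  show "integrable (lebesgue_on \<Omega>) (\<lambda>x. u x $ i \<bullet> v x $ i)"
    by (subst integrable_restrict_space) (auto simp: ext_def indicator_def if_distrib cong: if_cong elim!: back_subst[of "integrable _"])
qed

subsection \<open>Test functions and weak gradients\<close>

lemma test_fun:
  assumes \<phi>: "\<phi> \<in> test_functions \<Omega>"
  shows "\<phi> differentiable (at x)" "continuous_on UNIV \<phi>" "continuous_on UNIV (\<lambda>x. grad \<phi> x $ i)"
    "\<exists>K. compact K \<and> K \<subseteq> \<Omega> \<and> (\<forall>x. x \<notin> K \<longrightarrow> \<phi> x = 0 \<and> grad \<phi> x = 0)"
    "\<phi> \<in> L2 \<Omega>" "grad \<phi> \<in> L2 \<Omega>"
proof -
  have C: "C_k k \<phi>" for k using \<phi> by (simp add: test_functions_def)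
  have d: "\<phi> differentiable (at x)" for x using C[of "Suc 0"] by simp
  then show "\<phi> differentiable (at x)" .
  show c: "continuous_on UNIV \<phi>" using C[of 0] by simp
  show cg: "continuous_on UNIV (\<lambda>x. grad \<phi> x $ i)" for i
    using C[of "Suc 0"] by (simp add: grad_def axis_in_Basis_iff)
  define K where "K = closure {x. \<phi> x \<noteq> 0}"
  have K: "compact K" "K \<subseteq> \<Omega>" using \<phi> by (auto simp: test_functions_def K_def)
  have z: "\<phi> x = 0" if "x \<notin> K" for x using that closure_subset[of "{x. \<phi> x \<noteq> 0}"] by (auto simp: K_def)
  have gz: "grad \<phi> x = 0" if x: "x \<notin> K" for x
  proof -
    have "((\<lambda>x. 0) has_derivative (\<lambda>h. 0)) (at x)" by simp
    then have "(\<phi> has_derivative (\<lambda>h. 0)) (at x)"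
      by (rule has_derivative_transform_within_open[of _ _ _ _ "- K"])
        (use K x z in \<open>auto simp: compact_imp_closed open_Compl\<close>)
    from frechet_derivative_at[OF this, symmetric] show ?thesis by (simp add: grad_def vec_eq_iff)
  qed
  show "\<exists>K. compact K \<and> K \<subseteq> \<Omega> \<and> (\<forall>x. x \<notin> K \<longrightarrow> \<phi> x = 0 \<and> grad \<phi> x = 0)"
    using K z gz by blast
  have L: "f \<in> L2 \<Omega>" if f: "continuous_on UNIV f" "\<And>x. x \<notin> K \<Longrightarrow> f x = 0" for f :: "pt \<Rightarrow> real"
  proof -
    have "bounded (f ` K)" using compact_continuous_image[OF continuous_on_subset[OF f(1)] K(1)] compact_imp_bounded by auto
    then obtain M where M: "\<And>x. x \<in> K \<Longrightarrow> \<bar>f x\<bar> \<le> M" unfolding bounded_iff by auto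
    have le: "\<bar>f x\<bar> \<le> \<bar>M\<bar>" for x using M[of x] f(2)[of x] by (cases "x \<in> K") auto
    have m: "f \<in> borel_measurable (lebesgue_on \<Omega>)"
      using borel_measurable_continuous_onI[OF f(1)] by (auto intro!: measurable_restrict_space1 measurable_completion)
    have "integrable (lebesgue_on \<Omega>) (\<lambda>x. (norm (f x))\<^sup>2)"
    proof (rule Bochner_Integration.integrable_bound)
      show "integrable (lebesgue_on \<Omega>) (\<lambda>x. M\<^sup>2)"
        using finite_dom by (subst integrable_restrict_space) auto
      show "AE x in lebesgue_on \<Omega>. norm ((norm (f x))\<^sup>2) \<le> norm (M\<^sup>2)"
      proof (rule AE_I2)
        fix x show "norm ((norm (f x))\<^sup>2) \<le> norm (M\<^sup>2)" using power_mono[OF le[of x], of 2] by simp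
      qed
    qed (use m in auto)
    then show ?thesis using m by (simp add: L2_def)
  qed
  show "\<phi> \<in> L2 \<Omega>" by (rule L[OF c z])
  show "grad \<phi> \<in> L2 \<Omega>" by (rule vec_L2(1), rule L[OF cg]) (simp add: gz)
qed

lemma grad_lin:
  assumes "\<phi> \<in> test_functions \<Omega>" "\<psi> \<in> test_functions \<Omega>"
  shows "grad (\<lambda>x. a * \<phi> x - b * \<psi> x) = (\<lambda>x. a *\<^sub>R grad \<phi> x - b *\<^sub>R grad \<psi> x)"
proof
  fix x
  have "((\<lambda>x. a * \<phi> x - b * \<psi> x) has_derivative (\<lambda>h. a * frechet_derivative \<phi> (at x) h - b * frechet_derivative \<psi> (at x) h)) (at x)"
    using test_fun(1)[OF assms(1)] test_fun(1)[OF assms(2)]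
    by (intro has_derivative_diff has_derivative_mult_right) (simp_all add: frechet_derivative_works)
  from frechet_derivative_at[OF this, symmetric]
  show "grad (\<lambda>x. a * \<phi> x - b * \<psi> x) x = a *\<^sub>R grad \<phi> x - b *\<^sub>R grad \<psi> x"
    by (simp add: grad_def vec_eq_iff)
qed

lemma fundamental_lemma_dom:
  assumes w: "w \<in> L2 \<Omega>" and z: "\<And>\<phi>. \<phi> \<in> test_functions \<Omega> \<Longrightarrow> L2_inner \<Omega> w \<phi> = 0"
  shows "cl \<Omega> w = 0"
proof -
  have "AE x in lebesgue. x \<in> \<Omega> \<longrightarrow> w x = 0"
  proof (rule fundamental_lemma[OF open_dom])
    fix a b assume "cbox a b \<subseteq> \<Omega>"
    then show "set_integrable lebesgue (cbox a b) w" by (intro set_integrable_subset[OF L2_integrable[OF w]]) auto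
  next
    fix \<phi> assume "\<phi> \<in> test_functions \<Omega>"
    then show "(LINT x:\<Omega>|lebesgue. w x * \<phi> x) = 0" using z by (simp add: L2_inner_def integral_dom)
  qed
  moreover have "(\<lambda>x. 0) \<in> L2 \<Omega>" by (simp add: L2_def)
  moreover have "cl \<Omega> (\<lambda>x. 0 :: real) = 0" by (simp add: cl_def ext_def[abs_def] zero_lsq.abs_eq)
  ultimately show ?thesis using cl_eq_iff[OF w, of "\<lambda>x. 0"] by (simp add: AE_dom)
qed

lemma is_weak_grad_iff:
  "is_weak_grad \<Omega> w g \<longleftrightarrow> (\<forall>\<phi>\<in>test_functions \<Omega>. \<forall>i. L2_inner \<Omega> w (\<lambda>x. grad \<phi> x $ i) = - L2_inner \<Omega> (\<lambda>x. g x $ i) \<phi>)"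
  by (simp add: is_weak_grad_def L2_inner_def)

lemma L2_inner_cl: "u \<in> L2 \<Omega> \<Longrightarrow> v \<in> L2 \<Omega> \<Longrightarrow> L2_inner \<Omega> u v = cl \<Omega> u \<bullet> cl \<Omega> v"
  by (simp add: cl_inner)

lemma weak_grad_unique:
  assumes g: "g \<in> L2 \<Omega>" "is_weak_grad \<Omega> w g" and h: "h \<in> L2 \<Omega>" "is_weak_grad \<Omega> w h"
  shows "cl \<Omega> g = cl \<Omega> h"
proof -
  have "cl \<Omega> (\<lambda>x. g x $ i - h x $ i) = 0" for i
  proof (rule fundamental_lemma_dom)
    show "(\<lambda>x. g x $ i - h x $ i) \<in> L2 \<Omega>" by (intro L2_diff component_L2 g h)
    fix \<phi> assume \<phi>: "\<phi> \<in> test_functions \<Omega>"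
    have "L2_inner \<Omega> (\<lambda>x. g x $ i) \<phi> = L2_inner \<Omega> (\<lambda>x. h x $ i) \<phi>"
      using g(2) h(2) \<phi> unfolding is_weak_grad_iff by (metis neg_equal_iff_equal)
    then show "L2_inner \<Omega> (\<lambda>x. g x $ i - h x $ i) \<phi> = 0"
      by (simp add: L2_inner_cl L2_diff component_L2 g h cl_diff test_fun[OF \<phi>] inner_diff_left)
  qed
  then have "(norm (cl \<Omega> (\<lambda>x. g x - h x)))\<^sup>2 = 0"
    by (subst vec_L2(2)) (auto intro!: component_L2 L2_diff g h)
  then show ?thesis by (simp add: cl_diff g h)
qed

lemma weak_grad: "w \<in> H1 \<Omega> \<Longrightarrow> w \<in> L2 \<Omega> \<and> weak_grad \<Omega> w \<in> L2 \<Omega> \<and> is_weak_grad \<Omega> w (weak_grad \<Omega> w)"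
proof -
  assume w: "w \<in> H1 \<Omega>"
  then have "\<exists>g. g \<in> L2 \<Omega> \<and> is_weak_grad \<Omega> w g" by (auto simp: H1_def)
  from someI_ex[OF this] show ?thesis using w unfolding weak_grad_def by (simp add: H1_def)
qed

text \<open>The value of \<open>weak_grad\<close> is an arbitrary choice within a class, so
  statements about it are made for the class.\<close>

lemma weak_grad_eqI:
  assumes "w \<in> L2 \<Omega>" "g \<in> L2 \<Omega>" "is_weak_grad \<Omega> w g"
  shows "w \<in> H1 \<Omega>" "cl \<Omega> (weak_grad \<Omega> w) = cl \<Omega> g"
proof -
  show w: "w \<in> H1 \<Omega>" using assms by (auto simp: H1_def)
  show "cl \<Omega> (weak_grad \<Omega> w) = cl \<Omega> g" using weak_grad_unique[of "weak_grad \<Omega> w" w g] weak_grad[OF w] assms by blast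
qed

lemma weak_grad_lin:
  assumes "w \<in> H1 \<Omega>" "z \<in> H1 \<Omega>"
  shows "(\<lambda>x. a * w x - b * z x) \<in> H1 \<Omega>"
    and "cl \<Omega> (weak_grad \<Omega> (\<lambda>x. a * w x - b * z x)) = a *\<^sub>R cl \<Omega> (weak_grad \<Omega> w) - b *\<^sub>R cl \<Omega> (weak_grad \<Omega> z)"
proof -
  let ?g = "\<lambda>x. a *\<^sub>R weak_grad \<Omega> w x - b *\<^sub>R weak_grad \<Omega> z x"
  note W = weak_grad[OF assms(1)] and Z = weak_grad[OF assms(2)]
  have L: "(\<lambda>x. a * w x - b * z x) \<in> L2 \<Omega>" using L2_lin[of w z a b] W Z by simp
  have g: "?g \<in> L2 \<Omega>" using L2_lin W Z by blast
  have "is_weak_grad \<Omega> (\<lambda>x. a * w x - b * z x) ?g"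
    unfolding is_weak_grad_iff
  proof (intro ballI allI)
    fix \<phi> i assume \<phi>: "\<phi> \<in> test_functions \<Omega>"
    have c: "cl \<Omega> (\<lambda>x. a * w x - b * z x) = a *\<^sub>R cl \<Omega> w - b *\<^sub>R cl \<Omega> z" using cl_lin[of w z a b] W Z by simp
    have ci: "cl \<Omega> (\<lambda>x. ?g x $ i) = a *\<^sub>R cl \<Omega> (\<lambda>x. weak_grad \<Omega> w x $ i) - b *\<^sub>R cl \<Omega> (\<lambda>x. weak_grad \<Omega> z x $ i)"
      using cl_lin[of "\<lambda>x. weak_grad \<Omega> w x $ i" "\<lambda>x. weak_grad \<Omega> z x $ i" a b] W Z by (simp add: component_L2)
    have 1: "L2_inner \<Omega> w (\<lambda>x. grad \<phi> x $ i) = - L2_inner \<Omega> (\<lambda>x. weak_grad \<Omega> w x $ i) \<phi>"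
      "L2_inner \<Omega> z (\<lambda>x. grad \<phi> x $ i) = - L2_inner \<Omega> (\<lambda>x. weak_grad \<Omega> z x $ i) \<phi>"
      using W Z \<phi> by (auto simp: is_weak_grad_iff)
    show "L2_inner \<Omega> (\<lambda>x. a * w x - b * z x) (\<lambda>x. grad \<phi> x $ i) = - L2_inner \<Omega> (\<lambda>x. ?g x $ i) \<phi>"
      using 1 L component_L2(1)[OF g, of i] W Z
      by (simp add: L2_inner_cl component_L2 test_fun[OF \<phi>] c ci inner_diff_left del: vector_minus_component vector_scaleR_component)
  qed
  from weak_grad_eqI[OF L g this]
  show "(\<lambda>x. a * w x - b * z x) \<in> H1 \<Omega>"
    "cl \<Omega> (weak_grad \<Omega> (\<lambda>x. a * w x - b * z x)) = a *\<^sub>R cl \<Omega> (weak_grad \<Omega> w) - b *\<^sub>R cl \<Omega> (weak_grad \<Omega> z)"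
    using cl_lin[of "weak_grad \<Omega> w" "weak_grad \<Omega> z" a b] W Z by auto
qed

lemma H1_0_iff:
  "w \<in> H1_0 \<Omega> \<longleftrightarrow> w \<in> H1 \<Omega> \<and> (\<exists>\<phi>. (\<forall>n. \<phi> n \<in> test_functions \<Omega>) \<and>
     (\<lambda>n. cl \<Omega> (\<phi> n)) \<longlonglongrightarrow> cl \<Omega> w \<and> (\<lambda>n. cl \<Omega> (grad (\<phi> n))) \<longlonglongrightarrow> cl \<Omega> (weak_grad \<Omega> w))"
proof -
  have "(\<lambda>n. L2_norm \<Omega> (\<lambda>x. \<phi> n x - w x)) \<longlonglongrightarrow> 0 \<longleftrightarrow> (\<lambda>n. cl \<Omega> (\<phi> n)) \<longlonglongrightarrow> cl \<Omega> w"
    "(\<lambda>n. L2_norm \<Omega> (\<lambda>x. grad (\<phi> n) x - weak_grad \<Omega> w x)) \<longlonglongrightarrow> 0 \<longleftrightarrow> (\<lambda>n. cl \<Omega> (grad (\<phi> n))) \<longlonglongrightarrow> cl \<Omega> (weak_grad \<Omega> w)"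
    if "w \<in> H1 \<Omega>" "\<forall>n. \<phi> n \<in> test_functions \<Omega>" for \<phi> :: "nat \<Rightarrow> pt \<Rightarrow> real"
  proof -
    have t: "\<phi> n \<in> L2 \<Omega>" "grad (\<phi> n) \<in> L2 \<Omega>" for n using test_fun that by auto
    note W = weak_grad[OF that(1)]
    have e: "L2_norm \<Omega> (\<lambda>x. \<phi> n x - w x) = norm (cl \<Omega> (\<phi> n) - cl \<Omega> w)"
      "L2_norm \<Omega> (\<lambda>x. grad (\<phi> n) x - weak_grad \<Omega> w x) = norm (cl \<Omega> (grad (\<phi> n)) - cl \<Omega> (weak_grad \<Omega> w))" for n
      using t W by (auto simp: L2_diff cl_diff simp flip: cl_norm)
    show "(\<lambda>n. L2_norm \<Omega> (\<lambda>x. \<phi> n x - w x)) \<longlonglongrightarrow> 0 \<longleftrightarrow> (\<lambda>n. cl \<Omega> (\<phi> n)) \<longlonglongrightarrow> cl \<Omega> w"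
      "(\<lambda>n. L2_norm \<Omega> (\<lambda>x. grad (\<phi> n) x - weak_grad \<Omega> w x)) \<longlonglongrightarrow> 0 \<longleftrightarrow> (\<lambda>n. cl \<Omega> (grad (\<phi> n))) \<longlonglongrightarrow> cl \<Omega> (weak_grad \<Omega> w)"
      unfolding e by (simp_all add: tendsto_norm_zero_iff LIM_zero_iff)
  qed
  then show ?thesis unfolding H1_0_def by blast
qed

end

subsection \<open>The Poincare inequality\<close>

text \<open>The difference quotients have integral 0 by translation invariance and converge to the
  derivative under a common bound and a common bounded support.\<close>

lemma integral_directional_derivative:
  fixes \<psi> \<psi>' :: "'a::euclidean_space \<Rightarrow> real"
  assumes D: "\<And>x. ((\<lambda>h. \<psi> (x + h *\<^sub>R e)) has_real_derivative \<psi>' x) (at 0)"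
    and c: "continuous_on UNIV \<psi>" and c': "continuous_on UNIV \<psi>'"
    and K: "compact K" "\<And>x. x \<notin> K \<Longrightarrow> \<psi> x = 0 \<and> \<psi>' x = 0"
  shows "(\<integral>x. \<psi>' x \<partial>lborel) = 0"
proof -
  have "bounded (\<psi>' ` K)" using compact_continuous_image[OF continuous_on_subset[OF c'] K(1)] compact_imp_bounded by auto
  then obtain M0 where M0: "\<And>x. x \<in> K \<Longrightarrow> \<bar>\<psi>' x\<bar> \<le> M0" unfolding bounded_iff by auto
  define M where "M = \<bar>M0\<bar>"
  have M: "\<bar>\<psi>' x\<bar> \<le> M" for x using M0[of x] K(2)[of x] by (cases "x \<in> K") (auto simp: M_def)
  have D': "((\<lambda>h. \<psi> (x + h *\<^sub>R e)) has_real_derivative \<psi>' (x + t *\<^sub>R e)) (at t)" for x t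
  proof -
    have "((\<lambda>h. \<psi> ((x + t *\<^sub>R e) + h *\<^sub>R e)) has_real_derivative \<psi>' (x + t *\<^sub>R e)) (at 0)" by (rule D)
    then have "((\<lambda>h. \<psi> (x + (h + t) *\<^sub>R e)) has_real_derivative \<psi>' (x + t *\<^sub>R e)) (at 0)"
      by (simp add: algebra_simps)
    then show ?thesis using DERIV_shift[of "\<lambda>h. \<psi> (x + h *\<^sub>R e)" "\<psi>' (x + t *\<^sub>R e)" 0 t] by simp
  qed
  define \<epsilon> where "\<epsilon> n = 1 / real (Suc n)" for n
  have ep: "\<epsilon> n > 0" "\<epsilon> n \<le> 1" for n by (auto simp: \<epsilon>_def)
  have ep0: "\<epsilon> \<longlonglongrightarrow> 0" unfolding \<epsilon>_def by (rule LIMSEQ_Suc[OF lim_1_over_n])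
  obtain R where R: "\<And>x. x \<in> K \<Longrightarrow> norm x \<le> R" using compact_imp_bounded[OF K(1)] unfolding bounded_iff by auto
  \<comment> \<open>The steps are at most 1, so a shift along \<open>e\<close> reaches the support
    only from inside this enlarged ball.\<close>
  define W where "W = cball (0::'a) (R + norm e)"
  have \<psi>i: "integrable lborel \<psi>"
  proof -
    have "integrable lborel (\<lambda>x. indicator K x *\<^sub>R \<psi> x)"
      by (rule borel_integrable_compact[OF K(1) continuous_on_subset[OF c]]) simp
    moreover have e: "indicator K x *\<^sub>R \<psi> x = \<psi> x" for x using K(2)[of x] by (cases "x \<in> K") auto
    ultimately show ?thesis unfolding e by simp
  qed
  have shift: "integrable lborel (\<lambda>x. \<psi> (x + y))" "(\<integral>x. \<psi> (x + y) \<partial>lborel) = (\<integral>x. \<psi> x \<partial>lborel)" for y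
  proof -
    have d: "distr lborel borel (\<lambda>x. x + y) = (lborel :: 'a measure)"
      using lborel_distr_plus[of y] by (subst add.commute[abs_def]) simp
    have m: "\<psi> \<in> borel_measurable borel" by (rule borel_measurable_continuous_onI[OF c])
    show "integrable lborel (\<lambda>x. \<psi> (x + y))"
      using integrable_distr_eq[of "\<lambda>x. x + y" lborel borel \<psi>] \<psi>i m unfolding d by simp
    show "(\<integral>x. \<psi> (x + y) \<partial>lborel) = (\<integral>x. \<psi> x \<partial>lborel)"
      using integral_distr[of "\<lambda>x. x + y" lborel borel \<psi>] m unfolding d by simp
  qed
  define q where "q n x = (\<psi> (x + \<epsilon> n *\<^sub>R e) - \<psi> x) / \<epsilon> n" for n x
  have q0: "(\<integral>x. q n x \<partial>lborel) = 0" for n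
    unfolding q_def using shift \<psi>i by simp
  have mvt: "\<exists>t. 0 < t \<and> t < \<epsilon> n \<and> q n x = \<psi>' (x + t *\<^sub>R e)" for n x
  proof -
    obtain t where "0 < t" "t < \<epsilon> n" "\<psi> (x + \<epsilon> n *\<^sub>R e) - \<psi> (x + 0 *\<^sub>R e) = (\<epsilon> n - 0) * \<psi>' (x + t *\<^sub>R e)"
      using MVT2[OF ep(1)[of n], of "\<lambda>h. \<psi> (x + h *\<^sub>R e)" "\<lambda>t. \<psi>' (x + t *\<^sub>R e)"] D' by blast
    then show ?thesis using ep(1)[of n] by (intro exI[of _ t]) (simp add: q_def)
  qed
  have "(\<lambda>n. \<integral>x. q n x \<partial>lborel) \<longlonglongrightarrow> (\<integral>x. \<psi>' x \<partial>lborel)"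
  proof (rule integral_dominated_convergence[where w = "\<lambda>x. M * indicator W x"])
    show "\<psi>' \<in> borel_measurable lborel" using borel_measurable_continuous_onI[OF c'] by simp
    show "q n \<in> borel_measurable lborel" for n
      unfolding q_def[abs_def] using shift(1) \<psi>i by auto
    have "emeasure lborel W < \<infinity>" unfolding W_def by (rule emeasure_lborel_cball_finite)
    then show "integrable lborel (\<lambda>x. M * indicator W x)"
      by (intro integrable_mult_right integrable_real_indicator) (auto simp: W_def)
    have "(\<lambda>n. q n x) \<longlonglongrightarrow> \<psi>' x" for x
    proof -
      have "((\<lambda>h. (\<psi> (x + h *\<^sub>R e) - \<psi> (x + 0 *\<^sub>R e)) / (h - 0)) \<longlongrightarrow> \<psi>' x) (at 0)"
        using D[of x] unfolding has_field_derivative_iff by simp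
      moreover have "filterlim \<epsilon> (at 0) sequentially"
        using ep0 ep(1) by (auto simp: filterlim_at less_imp_neq[symmetric] intro!: always_eventually)
      ultimately have "(\<lambda>n. (\<psi> (x + \<epsilon> n *\<^sub>R e) - \<psi> (x + 0 *\<^sub>R e)) / (\<epsilon> n - 0)) \<longlonglongrightarrow> \<psi>' x"
        by (rule filterlim_compose)
      then show ?thesis by (simp add: q_def)
    qed
    then show "AE x in lborel. (\<lambda>n. q n x) \<longlonglongrightarrow> \<psi>' x" by simp
    have "\<bar>q n x\<bar> \<le> M * indicator W x" for n x
    proof -
      obtain t where t: "0 < t" "t < \<epsilon> n" "q n x = \<psi>' (x + t *\<^sub>R e)" using mvt by blast
      show ?thesis
      proof (cases "x \<in> W")
        case True
        then show ?thesis using M t by simp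
      next
        case False
        have "norm (t *\<^sub>R e) \<le> norm e" using t ep(2)[of n] by (simp add: mult_left_le_one_le)
        then have "norm (x + t *\<^sub>R e) > R"
          using False norm_triangle_ineq4[of "x + t *\<^sub>R e" "t *\<^sub>R e"] by (auto simp: W_def)
        then have "x + t *\<^sub>R e \<notin> K" using R by force
        then show ?thesis using t K(2) False by simp
      qed
    qed
    then show "AE x in lborel. norm (q n x) \<le> M * indicator W x" for n by simp
  qed
  then show ?thesis unfolding q0 by (simp add: LIMSEQ_const_iff)
qed

context planar_domain
begin

text \<open>The first partial derivative of \<open>x $ 1 * (\<phi> x)\<^sup>2\<close> integrates to
  0. Its two terms express the square of the norm of \<open>\<phi>\<close> by a pairing with the
  gradient, and the coordinate is at most \<open>R\<close> on the domain.\<close>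

lemma Poincare_test:
  assumes R: "\<And>x. x \<in> \<Omega> \<Longrightarrow> norm x \<le> R" "0 \<le> R" and \<phi>: "\<phi> \<in> test_functions \<Omega>"
  shows "norm (cl \<Omega> \<phi>) \<le> 2 * R * norm (cl \<Omega> (grad \<phi>))"
proof -
  let ?e = "axis 1 1 :: pt"
  obtain K where K: "compact K" "K \<subseteq> \<Omega>" "\<And>x. x \<notin> K \<Longrightarrow> \<phi> x = 0 \<and> grad \<phi> x = 0" using test_fun(4)[OF \<phi>] by blast
  define \<psi> where "\<psi> x = x $ 1 * (\<phi> x)\<^sup>2" for x :: pt
  define \<psi>' where "\<psi>' x = (\<phi> x)\<^sup>2 + \<phi> x * (2 * x $ 1 * grad \<phi> x $ 1)" for x :: pt
  have "(\<integral>x. \<psi>' x \<partial>lborel) = 0"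
  proof (rule integral_directional_derivative[OF _ _ _ K(1)])
    show "continuous_on UNIV \<psi>" unfolding \<psi>_def[abs_def] by (intro continuous_intros test_fun[OF \<phi>])
    show "continuous_on UNIV \<psi>'" unfolding \<psi>'_def[abs_def] by (intro continuous_intros test_fun[OF \<phi>])
    show "\<psi> x = 0 \<and> \<psi>' x = 0" if "x \<notin> K" for x using K(3)[OF that] by (simp add: \<psi>_def \<psi>'_def)
    fix x
    have lin: "linear (frechet_derivative \<phi> (at x))" by (rule linear_frechet_derivative[OF test_fun(1)[OF \<phi>]])
    have l: "((\<lambda>h::real. x + h *\<^sub>R ?e) has_derivative (\<lambda>h. h *\<^sub>R ?e)) (at 0)"
      by (auto intro!: derivative_eq_intros)
    have "(\<phi> has_derivative frechet_derivative \<phi> (at x)) (at (x + 0 *\<^sub>R ?e))"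
      using test_fun(1)[OF \<phi>] by (simp add: frechet_derivative_works)
    from has_derivative_compose[OF l this]
    have "((\<lambda>h. \<phi> (x + h *\<^sub>R ?e)) has_derivative (\<lambda>h. frechet_derivative \<phi> (at x) (h *\<^sub>R ?e))) (at 0)" .
    then have "((\<lambda>h. \<phi> (x + h *\<^sub>R ?e)) has_derivative (*) (grad \<phi> x $ 1)) (at 0)"
      by (rule has_derivative_eq_rhs) (auto simp: linear_cmul[OF lin] grad_def mult.commute)
    then have d: "((\<lambda>h. \<phi> (x + h *\<^sub>R ?e)) has_real_derivative grad \<phi> x $ 1) (at 0)"
      by (simp add: has_field_derivative_def)
    have x1: "((\<lambda>h. (x + h *\<^sub>R ?e) $ 1) has_real_derivative 1) (at 0)"
      by (auto intro!: derivative_eq_intros)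
    show "((\<lambda>h. \<psi> (x + h *\<^sub>R ?e)) has_real_derivative \<psi>' x) (at 0)"
      unfolding \<psi>_def \<psi>'_def
      by (rule DERIV_cong[OF DERIV_mult[OF x1 DERIV_power[OF d]]]) (simp add: algebra_simps)
  qed
  \<comment> \<open>With this choice \<open>\<psi>'\<close> is the square of \<open>\<phi>\<close>
    minus \<open>\<phi> * f\<close>.\<close>
  define f where "f x = (- 2 * x $ 1) * grad \<phi> x $ 1" for x :: pt
  note T = test_fun[OF \<phi>]
  have fm: "f \<in> borel_measurable (lebesgue_on \<Omega>)"
  proof -
    have "continuous_on UNIV f" unfolding f_def[abs_def] by (intro continuous_intros T)
    then show ?thesis
      using borel_measurable_continuous_onI by (auto intro!: measurable_restrict_space1 measurable_completion)
  qed
  have fle: "norm (f x) \<le> (2 * R) * norm (grad \<phi> x)" if "x \<in> \<Omega>" for x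
  proof -
    have "\<bar>x $ 1\<bar> \<le> R" using R(1)[OF that] component_le_norm_cart[of x 1] by linarith
    then have "(2 * \<bar>x $ 1\<bar>) * \<bar>grad \<phi> x $ 1\<bar> \<le> (2 * R) * norm (grad \<phi> x)"
      using component_le_norm_cart[of "grad \<phi> x" 1] R(2) by (intro mult_mono) auto
    then show ?thesis by (simp add: f_def abs_mult)
  qed
  have f: "f \<in> L2 \<Omega>" "norm (cl \<Omega> f) \<le> (2 * R) * norm (cl \<Omega> (grad \<phi>))"
    using L2_dominated[OF fm T(6) fle] R(2) by auto
  have "(\<integral>x. \<psi>' x \<partial>lborel) = L2_inner \<Omega> \<phi> \<phi> - L2_inner \<Omega> \<phi> f"
  proof -
    have i: "integrable (lebesgue_on \<Omega>) (\<lambda>x. \<phi> x \<bullet> g x)" if "g \<in> L2 \<Omega>" for g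
    proof -
      have "l2fun (ext \<Omega> \<phi>)" "l2fun (ext \<Omega> g)" using T(5) that by (auto simp flip: L2_iff)
      from l2fun_integrable_inner[OF this] show ?thesis
        by (subst integrable_restrict_space) (auto simp: ext_def indicator_def if_distrib cong: if_cong elim!: back_subst[of "integrable _"])
    qed
    have z: "\<psi>' x = 0" if "x \<notin> \<Omega>" for x
    proof -
      have "x \<notin> K" using K(2) that by blast
      from K(3)[OF this] show ?thesis by (simp add: \<psi>'_def)
    qed
    have "\<psi>' \<in> borel_measurable lborel"
      unfolding \<psi>'_def[abs_def] using borel_measurable_continuous_onI[of "\<lambda>x. (\<phi> x)\<^sup>2 + \<phi> x * (2 * x $ 1 * grad \<phi> x $ 1)"]
      by (simp add: continuous_intros T)
    then have "(\<integral>x. \<psi>' x \<partial>lborel) = (\<integral>x. \<psi>' x \<partial>lebesgue)" by (simp add: integral_completion)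
    also have "\<dots> = (LINT x:\<Omega>|lebesgue. \<psi>' x)"
      unfolding set_lebesgue_integral_def
      by (intro Bochner_Integration.integral_cong) (auto simp: indicator_def z)
    also have "\<dots> = (\<integral>x. \<phi> x \<bullet> \<phi> x - \<phi> x \<bullet> f x \<partial>lebesgue_on \<Omega>)"
      unfolding integral_dom by (simp add: \<psi>'_def f_def power2_eq_square)
    also have "\<dots> = L2_inner \<Omega> \<phi> \<phi> - L2_inner \<Omega> \<phi> f"
      unfolding L2_inner_def by (rule Bochner_Integration.integral_diff) (intro i T f)+
    finally show ?thesis .
  qed
  then have "cl \<Omega> \<phi> \<bullet> cl \<Omega> \<phi> = cl \<Omega> \<phi> \<bullet> cl \<Omega> f"
    using \<open>(\<integral>x. \<psi>' x \<partial>lborel) = 0\<close> by (simp add: cl_inner T f)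
  then have "norm (cl \<Omega> \<phi>) * norm (cl \<Omega> \<phi>) \<le> norm (cl \<Omega> \<phi>) * norm (cl \<Omega> f)"
    using norm_cauchy_schwarz[of "cl \<Omega> \<phi>" "cl \<Omega> f"] by (simp add: power2_norm_eq_inner[symmetric] power2_eq_square)
  then have "norm (cl \<Omega> \<phi>) \<le> norm (cl \<Omega> f)" by (cases "cl \<Omega> \<phi> = 0") auto
  then show ?thesis using f(2) by simp
qed

lemma Poincare_scalar:
  assumes R: "\<And>x. x \<in> \<Omega> \<Longrightarrow> norm x \<le> R" "0 \<le> R" and w: "w \<in> H1_0 \<Omega>"
  shows "norm (cl \<Omega> w) \<le> 2 * R * norm (cl \<Omega> (weak_grad \<Omega> w))"
proof -
  obtain \<phi> where \<phi>: "\<And>n. \<phi> n \<in> test_functions \<Omega>" "(\<lambda>n. cl \<Omega> (\<phi> n)) \<longlonglongrightarrow> cl \<Omega> w"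
    "(\<lambda>n. cl \<Omega> (grad (\<phi> n))) \<longlonglongrightarrow> cl \<Omega> (weak_grad \<Omega> w)" using w unfolding H1_0_iff by blast
  have "(\<lambda>n. 2 * R * norm (cl \<Omega> (grad (\<phi> n)))) \<longlonglongrightarrow> 2 * R * norm (cl \<Omega> (weak_grad \<Omega> w))"
    by (intro tendsto_intros \<phi>)
  from LIMSEQ_le[OF tendsto_norm[OF \<phi>(2)] this] show ?thesis using Poincare_test[OF R \<phi>(1)] by auto
qed

subsection \<open>The spaces V and H\<close>

text \<open>The Jacobian matrix, with the gradient of each component as a row. It turns the inner
  product of \<open>V\<close> into the \<open>L\<^sup>2\<close> inner product of matrix
  fields.\<close>

definition gradm :: "field \<Rightarrow> pt \<Rightarrow> real ^ 2 ^ 2" where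
  "gradm v x = (\<chi> i. weak_grad \<Omega> (\<lambda>x. v x $ i) x)"

lemma V_space:
  assumes "v \<in> V_space \<Omega>"
  shows "(\<lambda>x. v x $ i) \<in> H1_0 \<Omega>" "(\<lambda>x. v x $ i) \<in> H1 \<Omega>" "(\<lambda>x. v x $ i) \<in> L2 \<Omega>"
    "weak_grad \<Omega> (\<lambda>x. v x $ i) \<in> L2 \<Omega>" "v \<in> L2 \<Omega>" "gradm v \<in> L2 \<Omega>"
    "\<phi> \<in> test_functions \<Omega> \<Longrightarrow> L2_inner \<Omega> v (grad \<phi>) = 0"
proof -
  show 0: "(\<lambda>x. v x $ i) \<in> H1_0 \<Omega>" for i using assms by (simp add: V_space_def)
  then show 1: "(\<lambda>x. v x $ i) \<in> H1 \<Omega>" for i by (simp add: H1_0_def)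
  then show 2: "(\<lambda>x. v x $ i) \<in> L2 \<Omega>" and 3: "weak_grad \<Omega> (\<lambda>x. v x $ i) \<in> L2 \<Omega>" for i using weak_grad by blast+
  show "v \<in> L2 \<Omega>" by (rule vec_L2(1)[OF 2])
  show "gradm v \<in> L2 \<Omega>" by (rule vec_L2(1)) (simp add: gradm_def 3)
  show "\<phi> \<in> test_functions \<Omega> \<Longrightarrow> L2_inner \<Omega> v (grad \<phi>) = 0"
    using assms by (simp add: V_space_def has_weak_div_def L2_inner_def)
qed

lemma V_inner_cl:
  assumes "u \<in> V_space \<Omega>" "v \<in> V_space \<Omega>"
  shows "V_inner \<Omega> u v = cl \<Omega> (gradm u) \<bullet> cl \<Omega> (gradm v)"
proof -
  have "cl \<Omega> (gradm u) \<bullet> cl \<Omega> (gradm v) = L2_inner \<Omega> (gradm u) (gradm v)"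
    by (intro cl_inner V_space assms)
  also have "\<dots> = V_inner \<Omega> u v"
    by (subst vec_inner) (auto simp: V_space assms V_inner_def gradm_def)
  finally show ?thesis by simp
qed

lemma V_norm_cl: "v \<in> V_space \<Omega> \<Longrightarrow> V_norm \<Omega> v = norm (cl \<Omega> (gradm v))"
  by (simp add: V_norm_def V_inner_cl norm_eq_sqrt_inner)

lemma Poincare:
  "\<exists>C>0. \<forall>v\<in>V_space \<Omega>. norm (cl \<Omega> v) \<le> C * norm (cl \<Omega> (gradm v))"
proof -
  obtain R0 where R0: "\<And>x. x \<in> \<Omega> \<Longrightarrow> norm x \<le> R0" using bounded_dom unfolding bounded_iff by blast
  \<comment> \<open>The added 1 keeps the constant strictly positive, as is required for dividing by
    it later.\<close>
  define R where "R = \<bar>R0\<bar> + 1"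
  have R: "norm x \<le> R" if "x \<in> \<Omega>" for x using R0[OF that] by (simp add: R_def)
  have R1: "R > 0" by (simp add: R_def)
  have "norm (cl \<Omega> v) \<le> 2 * R * norm (cl \<Omega> (gradm v))" if v: "v \<in> V_space \<Omega>" for v
  proof -
    have "(norm (cl \<Omega> v))\<^sup>2 = (\<Sum>i\<in>UNIV. (norm (cl \<Omega> (\<lambda>x. v x $ i)))\<^sup>2)" by (rule vec_L2(2)[OF V_space(3)[OF v]])
    also have "\<dots> \<le> (\<Sum>i\<in>UNIV. (2 * R * norm (cl \<Omega> (weak_grad \<Omega> (\<lambda>x. v x $ i))))\<^sup>2)"
      using Poincare_scalar[OF R _ V_space(1)[OF v]] R1 by (intro sum_mono power_mono) auto
    also have "\<dots> = (2 * R)\<^sup>2 * (\<Sum>i\<in>UNIV. (norm (cl \<Omega> (\<lambda>x. gradm v x $ i)))\<^sup>2)"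
      by (simp add: power_mult_distrib sum_distrib_left gradm_def)
    also have "\<dots> = (2 * R * norm (cl \<Omega> (gradm v)))\<^sup>2"
      using vec_L2(2)[of "gradm v"] V_space(4)[OF v] by (simp add: power_mult_distrib gradm_def)
    finally have "(norm (cl \<Omega> v))\<^sup>2 \<le> (2 * R * norm (cl \<Omega> (gradm v)))\<^sup>2" .
    then show ?thesis by (rule power2_le_imp_le) (use R1 in simp)
  qed
  then show ?thesis using R1 by (intro exI[of _ "2 * R"]) auto
qed

lemma H1_0_lin:
  assumes "w \<in> H1_0 \<Omega>" "z \<in> H1_0 \<Omega>"
  shows "(\<lambda>x. a * w x - b * z x) \<in> H1_0 \<Omega>"
proof -
  obtain \<phi> where \<phi>: "\<And>n. \<phi> n \<in> test_functions \<Omega>" "(\<lambda>n. cl \<Omega> (\<phi> n)) \<longlonglongrightarrow> cl \<Omega> w"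
    "(\<lambda>n. cl \<Omega> (grad (\<phi> n))) \<longlonglongrightarrow> cl \<Omega> (weak_grad \<Omega> w)" using assms(1) unfolding H1_0_iff by blast
  obtain \<theta> where \<theta>: "\<And>n. \<theta> n \<in> test_functions \<Omega>" "(\<lambda>n. cl \<Omega> (\<theta> n)) \<longlonglongrightarrow> cl \<Omega> z"
    "(\<lambda>n. cl \<Omega> (grad (\<theta> n))) \<longlonglongrightarrow> cl \<Omega> (weak_grad \<Omega> z)" using assms(2) unfolding H1_0_iff by blast
  have H: "w \<in> H1 \<Omega>" "z \<in> H1 \<Omega>" using assms by (auto simp: H1_0_def)
  note W = weak_grad[OF H(1)] and Z = weak_grad[OF H(2)]
  let ?\<eta> = "\<lambda>n x. a * \<phi> n x - b * \<theta> n x"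
  have "cl \<Omega> (?\<eta> n) = a *\<^sub>R cl \<Omega> (\<phi> n) - b *\<^sub>R cl \<Omega> (\<theta> n)" for n
    using cl_lin[of "\<phi> n" "\<theta> n" a b] test_fun(5)[OF \<phi>(1)] test_fun(5)[OF \<theta>(1)] by simp
  moreover have "cl \<Omega> (\<lambda>x. a * w x - b * z x) = a *\<^sub>R cl \<Omega> w - b *\<^sub>R cl \<Omega> z"
    using cl_lin[of w z a b] W Z by simp
  ultimately have 1: "(\<lambda>n. cl \<Omega> (?\<eta> n)) \<longlonglongrightarrow> cl \<Omega> (\<lambda>x. a * w x - b * z x)"
    by (simp add: tendsto_intros \<phi> \<theta>)
  have "cl \<Omega> (grad (?\<eta> n)) = a *\<^sub>R cl \<Omega> (grad (\<phi> n)) - b *\<^sub>R cl \<Omega> (grad (\<theta> n))" for n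
    unfolding grad_lin[OF \<phi>(1) \<theta>(1)] by (rule cl_lin) (intro test_fun \<phi> \<theta>)+
  then have 2: "(\<lambda>n. cl \<Omega> (grad (?\<eta> n))) \<longlonglongrightarrow> cl \<Omega> (weak_grad \<Omega> (\<lambda>x. a * w x - b * z x))"
    unfolding weak_grad_lin(2)[OF H] by (simp add: tendsto_intros \<phi> \<theta>)
  show ?thesis unfolding H1_0_iff
    using 1 2 weak_grad_lin(1)[OF H] test_functions_lincomb[OF \<phi>(1) \<theta>(1)] by (intro conjI exI[of _ ?\<eta>]) auto
qed

lemma V_lin:
  assumes "u \<in> V_space \<Omega>" "v \<in> V_space \<Omega>"
  shows "(\<lambda>x. a *\<^sub>R u x - b *\<^sub>R v x) \<in> V_space \<Omega>"
    and "cl \<Omega> (gradm (\<lambda>x. a *\<^sub>R u x - b *\<^sub>R v x)) = a *\<^sub>R cl \<Omega> (gradm u) - b *\<^sub>R cl \<Omega> (gradm v)"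
proof -
  let ?w = "\<lambda>x. a *\<^sub>R u x - b *\<^sub>R v x"
  have h: "(\<lambda>x. ?w x $ i) \<in> H1_0 \<Omega>" for i using H1_0_lin[OF V_space(1)[OF assms(1)] V_space(1)[OF assms(2)]] by simp
  moreover have "has_weak_div \<Omega> ?w (\<lambda>x. 0)"
    unfolding has_weak_div_def
  proof
    fix \<phi> assume \<phi>: "\<phi> \<in> test_functions \<Omega>"
    have "L2_inner \<Omega> ?w (grad \<phi>) = 0"
      using V_space(7)[OF assms(1) \<phi>] V_space(7)[OF assms(2) \<phi>]
      by (simp add: L2_inner_cl L2_lin cl_lin V_space[OF assms(1)] V_space[OF assms(2)] test_fun[OF \<phi>] inner_diff_left)
    then show "(\<integral>x. ?w x \<bullet> grad \<phi> x \<partial>lebesgue_on \<Omega>) = - (\<integral>x. 0 * \<phi> x \<partial>lebesgue_on \<Omega>)" by (simp add: L2_inner_def)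
  qed
  ultimately show w: "?w \<in> V_space \<Omega>" by (simp add: V_space_def)
  let ?g = "\<lambda>x. a *\<^sub>R gradm u x - b *\<^sub>R gradm v x"
  have gL: "?g \<in> L2 \<Omega>" by (intro L2_lin V_space assms)
  have c: "cl \<Omega> (\<lambda>x. gradm ?w x $ i) = cl \<Omega> (\<lambda>x. ?g x $ i)" for i
    using weak_grad_lin(2)[OF V_space(2)[OF assms(1)] V_space(2)[OF assms(2)], of a i b i]
      cl_lin[OF V_space(4)[OF assms(1)] V_space(4)[OF assms(2)], of a i b i] by (simp add: gradm_def)
  have gi: "(\<lambda>x. gradm ?w x $ i) \<in> L2 \<Omega>" for i by (rule component_L2[OF V_space(6)[OF w]])
  have e: "cl \<Omega> (\<lambda>x. (gradm ?w x - ?g x) $ i) = 0" for i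
  proof -
    have "cl \<Omega> (\<lambda>x. (gradm ?w x - ?g x) $ i) = cl \<Omega> (\<lambda>x. gradm ?w x $ i) - cl \<Omega> (\<lambda>x. ?g x $ i)"
      unfolding vector_minus_component[of "gradm ?w _" "?g _"] by (rule cl_diff[OF gi component_L2(1)[OF gL]])
    then show ?thesis by (simp only: c diff_self)
  qed
  have "(norm (cl \<Omega> (\<lambda>x. gradm ?w x - ?g x)))\<^sup>2 = 0"
    by (subst vec_L2(2)[OF component_L2(1)[OF L2_diff[OF V_space(6)[OF w] gL]]])
      (simp only: e norm_zero zero_power2 sum.neutral_const)
  then show "cl \<Omega> (gradm ?w) = a *\<^sub>R cl \<Omega> (gradm u) - b *\<^sub>R cl \<Omega> (gradm v)"
    by (simp add: cl_diff V_space(6)[OF w] gL cl_lin V_space assms)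
qed

lemma L2_inner_tendsto:
  assumes "\<And>n. v n \<in> L2 \<Omega>" "u \<in> L2 \<Omega>" "g \<in> L2 \<Omega>" "(\<lambda>n. cl \<Omega> (v n)) \<longlonglongrightarrow> cl \<Omega> u"
  shows "(\<lambda>n. L2_inner \<Omega> (v n) g) \<longlonglongrightarrow> L2_inner \<Omega> u g"
  using assms by (simp add: L2_inner_cl tendsto_intros)

text \<open>Weak gradient and divergence are conditions on pairings with fixed test functions and
  pass to the limit; membership in \<open>H1_0\<close> needs a new approximating sequence.\<close>

lemma V_closed:
  assumes v: "\<And>n. v n \<in> V_space \<Omega>" and a: "(\<lambda>n. cl \<Omega> (v n)) \<longlonglongrightarrow> a" and g: "(\<lambda>n. cl \<Omega> (gradm (v n))) \<longlonglongrightarrow> g"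
  shows "\<exists>u\<in>V_space \<Omega>. cl \<Omega> u = a \<and> cl \<Omega> (gradm u) = g"
proof -
  obtain u where u: "u \<in> L2 \<Omega>" "cl \<Omega> u = a" using cl_surj_closed[OF V_space(5)[OF v] a] by blast
  obtain G where G: "G \<in> L2 \<Omega>" "cl \<Omega> G = g" using cl_surj_closed[OF V_space(6)[OF v] g] by blast
  have lu: "(\<lambda>n. cl \<Omega> (\<lambda>x. v n x $ i)) \<longlonglongrightarrow> cl \<Omega> (\<lambda>x. u x $ i)" for i
    by (rule component_tendsto[OF u(1) V_space(5)[OF v]]) (simp add: a u)
  have lG: "(\<lambda>n. cl \<Omega> (weak_grad \<Omega> (\<lambda>x. v n x $ i))) \<longlonglongrightarrow> cl \<Omega> (\<lambda>x. G x $ i)" for i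
    using component_tendsto[OF G(1) V_space(6)[OF v], where i = i] g G by (simp add: gradm_def)
  have ui: "(\<lambda>x. u x $ i) \<in> L2 \<Omega>" and Gi: "(\<lambda>x. G x $ i) \<in> L2 \<Omega>" for i using component_L2 u G by blast+
  have wg: "is_weak_grad \<Omega> (\<lambda>x. u x $ i) (\<lambda>x. G x $ i)" for i
    unfolding is_weak_grad_iff
  proof (intro ballI allI)
    fix \<phi> j assume \<phi>: "\<phi> \<in> test_functions \<Omega>"
    have "(\<lambda>n. L2_inner \<Omega> (\<lambda>x. v n x $ i) (\<lambda>x. grad \<phi> x $ j)) \<longlonglongrightarrow> L2_inner \<Omega> (\<lambda>x. u x $ i) (\<lambda>x. grad \<phi> x $ j)"
      by (intro L2_inner_tendsto V_space[OF v] ui component_L2 test_fun[OF \<phi>] lu)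
    moreover have "(\<lambda>n. - L2_inner \<Omega> (\<lambda>x. weak_grad \<Omega> (\<lambda>x. v n x $ i) x $ j) \<phi>) \<longlonglongrightarrow> - L2_inner \<Omega> (\<lambda>x. G x $ i $ j) \<phi>"
      by (intro tendsto_minus L2_inner_tendsto component_L2 V_space[OF v] Gi test_fun[OF \<phi>] component_tendsto lG)
    moreover have "L2_inner \<Omega> (\<lambda>x. v n x $ i) (\<lambda>x. grad \<phi> x $ j) = - L2_inner \<Omega> (\<lambda>x. weak_grad \<Omega> (\<lambda>x. v n x $ i) x $ j) \<phi>" for n
      using weak_grad[OF V_space(2)[OF v]] \<phi> by (simp add: is_weak_grad_iff)
    ultimately show "L2_inner \<Omega> (\<lambda>x. u x $ i) (\<lambda>x. grad \<phi> x $ j) = - L2_inner \<Omega> (\<lambda>x. G x $ i $ j) \<phi>"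
      using LIMSEQ_unique by simp
  qed
  note WG = weak_grad_eqI[OF ui Gi wg]
  have "(\<lambda>x. u x $ i) \<in> H1_0 \<Omega>" for i
  proof -
    \<comment> \<open>Diagonal choice: for each \<open>n\<close> one test function close to the
      component of \<open>v n\<close> in both norms.\<close>
    have "\<exists>\<phi>. \<phi> \<in> test_functions \<Omega> \<and> norm (cl \<Omega> \<phi> - cl \<Omega> (\<lambda>x. v n x $ i)) < 1 / Suc n
        \<and> norm (cl \<Omega> (grad \<phi>) - cl \<Omega> (weak_grad \<Omega> (\<lambda>x. v n x $ i))) < 1 / Suc n" for n
    proof -
      obtain \<phi> where \<phi>: "\<And>m. \<phi> m \<in> test_functions \<Omega>" "(\<lambda>m. cl \<Omega> (\<phi> m)) \<longlonglongrightarrow> cl \<Omega> (\<lambda>x. v n x $ i)"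
        "(\<lambda>m. cl \<Omega> (grad (\<phi> m))) \<longlonglongrightarrow> cl \<Omega> (weak_grad \<Omega> (\<lambda>x. v n x $ i))"
        using V_space(1)[OF v, of n i] unfolding H1_0_iff by blast
      have "eventually (\<lambda>m. norm (cl \<Omega> (\<phi> m) - cl \<Omega> (\<lambda>x. v n x $ i)) < 1 / Suc n) sequentially"
        "eventually (\<lambda>m. norm (cl \<Omega> (grad (\<phi> m)) - cl \<Omega> (weak_grad \<Omega> (\<lambda>x. v n x $ i))) < 1 / Suc n) sequentially"
        using tendstoD[OF \<phi>(2), of "1 / Suc n"] tendstoD[OF \<phi>(3), of "1 / Suc n"] by (auto simp: dist_norm)
      then have "eventually (\<lambda>m. norm (cl \<Omega> (\<phi> m) - cl \<Omega> (\<lambda>x. v n x $ i)) < 1 / Suc n \<and>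
          norm (cl \<Omega> (grad (\<phi> m)) - cl \<Omega> (weak_grad \<Omega> (\<lambda>x. v n x $ i))) < 1 / Suc n) sequentially"
        by (rule eventually_conj)
      then obtain m where "norm (cl \<Omega> (\<phi> m) - cl \<Omega> (\<lambda>x. v n x $ i)) < 1 / Suc n \<and>
          norm (cl \<Omega> (grad (\<phi> m)) - cl \<Omega> (weak_grad \<Omega> (\<lambda>x. v n x $ i))) < 1 / Suc n"
        unfolding eventually_sequentially by blast
      then show ?thesis using \<phi>(1) by blast
    qed
    then obtain \<phi> where \<phi>: "\<And>n. \<phi> n \<in> test_functions \<Omega>"
      "\<And>n. norm (cl \<Omega> (\<phi> n) - cl \<Omega> (\<lambda>x. v n x $ i)) < 1 / Suc n"
      "\<And>n. norm (cl \<Omega> (grad (\<phi> n)) - cl \<Omega> (weak_grad \<Omega> (\<lambda>x. v n x $ i))) < 1 / Suc n" by metis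
    have z: "(\<lambda>n. 1 / real (Suc n)) \<longlonglongrightarrow> 0" by (rule LIMSEQ_Suc[OF lim_1_over_n])
    have "(\<lambda>n. cl \<Omega> (\<phi> n) - cl \<Omega> (\<lambda>x. v n x $ i)) \<longlonglongrightarrow> 0"
      by (rule Lim_null_comparison[OF always_eventually[OF allI[OF less_imp_le[OF \<phi>(2)]]] z])
    from tendsto_add[OF this lu[of i]] have 1: "(\<lambda>n. cl \<Omega> (\<phi> n)) \<longlonglongrightarrow> cl \<Omega> (\<lambda>x. u x $ i)" by simp
    have "(\<lambda>n. cl \<Omega> (grad (\<phi> n)) - cl \<Omega> (weak_grad \<Omega> (\<lambda>x. v n x $ i))) \<longlonglongrightarrow> 0"
      by (rule Lim_null_comparison[OF always_eventually[OF allI[OF less_imp_le[OF \<phi>(3)]]] z])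
    from tendsto_add[OF this lG[of i]] have 2: "(\<lambda>n. cl \<Omega> (grad (\<phi> n))) \<longlonglongrightarrow> cl \<Omega> (weak_grad \<Omega> (\<lambda>x. u x $ i))"
      by (simp add: WG)
    show ?thesis unfolding H1_0_iff using WG(1) \<phi>(1) 1 2 by blast
  qed
  moreover have "has_weak_div \<Omega> u (\<lambda>x. 0)"
    unfolding has_weak_div_def
  proof
    fix \<phi> assume \<phi>: "\<phi> \<in> test_functions \<Omega>"
    have "(\<lambda>n. L2_inner \<Omega> (v n) (grad \<phi>)) \<longlonglongrightarrow> L2_inner \<Omega> u (grad \<phi>)"
      by (intro L2_inner_tendsto V_space[OF v] u test_fun[OF \<phi>]) (simp add: u a)
    then have "L2_inner \<Omega> u (grad \<phi>) = 0" by (simp add: V_space(7)[OF v \<phi>] LIMSEQ_const_iff)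
    then show "(\<integral>x. u x \<bullet> grad \<phi> x \<partial>lebesgue_on \<Omega>) = - (\<integral>x. 0 * \<phi> x \<partial>lebesgue_on \<Omega>)" by (simp add: L2_inner_def)
  qed
  ultimately have V: "u \<in> V_space \<Omega>" by (simp add: V_space_def)
  have "(norm (cl \<Omega> (\<lambda>x. gradm u x - G x)))\<^sup>2 = 0"
    by (subst vec_L2(2)) (auto simp: cl_diff component_L2[OF V_space(6)[OF V]] Gi L2_diff, simp add: gradm_def WG)
  then have "cl \<Omega> (gradm u) = cl \<Omega> G" by (simp add: cl_diff V_space(6)[OF V] G)
  then show ?thesis using V u G by blast
qed

text \<open>The inclusion of \<open>V\<close> in \<open>H\<close>. Integration by parts moves the
  derivative from \<open>w\<close> to \<open>v\<close>, where the trace of the gradient is the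
  divergence and vanishes as a class.\<close>

lemma V_orthogonal_gradients:
  assumes v: "v \<in> V_space \<Omega>" and w: "w \<in> H1 \<Omega>"
  shows "L2_inner \<Omega> v (weak_grad \<Omega> w) = 0"
proof -
  note W = weak_grad[OF w]
  define d where "d x = (\<Sum>i\<in>UNIV. weak_grad \<Omega> (\<lambda>x. v x $ i) x $ i)" for x
  have di: "(\<lambda>x. weak_grad \<Omega> (\<lambda>x. v x $ i) x $ i) \<in> L2 \<Omega>" for i :: 2 by (intro component_L2 V_space[OF v])
  have d2: "d = (\<lambda>x. weak_grad \<Omega> (\<lambda>x. v x $ 1) x $ 1 - (-1) * weak_grad \<Omega> (\<lambda>x. v x $ 2) x $ 2)"
    by (simp add: d_def sum_2 fun_eq_iff)
  have dL: "d \<in> L2 \<Omega>" unfolding d2 using L2_lin[OF di[of 1] di[of 2], of 1 "-1"] by simp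
  have dc: "cl \<Omega> d = (\<Sum>i\<in>UNIV. cl \<Omega> (\<lambda>x. weak_grad \<Omega> (\<lambda>x. v x $ i) x $ i))"
    unfolding d2 using cl_lin[OF di[of 1] di[of 2], of 1 "-1"] by (simp add: sum_2)
  have d0: "cl \<Omega> d = 0"
  proof (rule fundamental_lemma_dom[OF dL])
    fix \<phi> assume \<phi>: "\<phi> \<in> test_functions \<Omega>"
    have "L2_inner \<Omega> d \<phi> = (\<Sum>i\<in>UNIV. L2_inner \<Omega> (\<lambda>x. weak_grad \<Omega> (\<lambda>x. v x $ i) x $ i) \<phi>)"
      by (simp add: L2_inner_cl dL di test_fun[OF \<phi>] dc inner_sum_left)
    also have "\<dots> = (\<Sum>i\<in>UNIV. - L2_inner \<Omega> (\<lambda>x. v x $ i) (\<lambda>x. grad \<phi> x $ i))"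
      using weak_grad[OF V_space(2)[OF v]] \<phi> by (simp add: is_weak_grad_iff)
    also have "\<dots> = - L2_inner \<Omega> v (grad \<phi>)"
      by (subst vec_inner) (auto simp: V_space[OF v] test_fun[OF \<phi>] sum_negf)
    finally show "L2_inner \<Omega> d \<phi> = 0" using V_space(7)[OF v \<phi>] by simp
  qed
  have comp: "L2_inner \<Omega> (\<lambda>x. v x $ i) (\<lambda>x. weak_grad \<Omega> w x $ i) = - L2_inner \<Omega> w (\<lambda>x. weak_grad \<Omega> (\<lambda>x. v x $ i) x $ i)" for i
  proof -
    \<comment> \<open>The components of \<open>v\<close> are the ones replaced by test functions, so
      \<open>w\<close> may have arbitrary boundary values.\<close>
    obtain \<phi> where \<phi>: "\<And>n. \<phi> n \<in> test_functions \<Omega>" "(\<lambda>n. cl \<Omega> (\<phi> n)) \<longlonglongrightarrow> cl \<Omega> (\<lambda>x. v x $ i)"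
      "(\<lambda>n. cl \<Omega> (grad (\<phi> n))) \<longlonglongrightarrow> cl \<Omega> (weak_grad \<Omega> (\<lambda>x. v x $ i))"
      using V_space(1)[OF v, of i] unfolding H1_0_iff by blast
    have wi: "(\<lambda>x. weak_grad \<Omega> w x $ i) \<in> L2 \<Omega>" using W component_L2 by blast
    have "(\<lambda>n. L2_inner \<Omega> (\<phi> n) (\<lambda>x. weak_grad \<Omega> w x $ i)) \<longlonglongrightarrow> L2_inner \<Omega> (\<lambda>x. v x $ i) (\<lambda>x. weak_grad \<Omega> w x $ i)"
      by (intro L2_inner_tendsto test_fun[OF \<phi>(1)] V_space[OF v] wi \<phi>(2))
    moreover have "(\<lambda>n. - L2_inner \<Omega> (\<lambda>x. grad (\<phi> n) x $ i) w) \<longlonglongrightarrow> - L2_inner \<Omega> (\<lambda>x. weak_grad \<Omega> (\<lambda>x. v x $ i) x $ i) w"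
      using W by (intro tendsto_minus L2_inner_tendsto component_L2 test_fun[OF \<phi>(1)] di component_tendsto V_space[OF v] \<phi>(3)) auto
    moreover have "L2_inner \<Omega> (\<phi> n) (\<lambda>x. weak_grad \<Omega> w x $ i) = - L2_inner \<Omega> (\<lambda>x. grad (\<phi> n) x $ i) w" for n
      using W \<phi>(1)[of n] by (simp add: is_weak_grad_iff L2_inner_def mult.commute)
    ultimately have "L2_inner \<Omega> (\<lambda>x. v x $ i) (\<lambda>x. weak_grad \<Omega> w x $ i) = - L2_inner \<Omega> (\<lambda>x. weak_grad \<Omega> (\<lambda>x. v x $ i) x $ i) w"
      using LIMSEQ_unique by simp
    then show ?thesis by (simp add: L2_inner_def mult.commute)
  qed
  have "L2_inner \<Omega> v (weak_grad \<Omega> w) = (\<Sum>i\<in>UNIV. - L2_inner \<Omega> w (\<lambda>x. weak_grad \<Omega> (\<lambda>x. v x $ i) x $ i))"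
    using W V_space[OF v] by (subst vec_inner) (auto simp: comp)
  also have "\<dots> = - (cl \<Omega> w \<bullet> cl \<Omega> d)"
    using W di by (simp add: dc L2_inner_cl inner_sum_right sum_negf)
  finally show ?thesis by (simp add: d0)
qed

lemma H_spaceI:
  assumes u: "u \<in> L2 \<Omega>" and div: "\<And>\<phi>. \<phi> \<in> test_functions \<Omega> \<Longrightarrow> L2_inner \<Omega> u (grad \<phi>) = 0"
    and orth: "\<And>w. w \<in> H1 \<Omega> \<Longrightarrow> L2_inner \<Omega> u (weak_grad \<Omega> w) = 0"
  shows "u \<in> H_space \<Omega>"
proof -
  have "has_weak_div \<Omega> u (\<lambda>x. 0)" using div by (simp add: has_weak_div_def L2_inner_def)
  moreover have "(\<lambda>x. 0) \<in> L2 \<Omega>" by (simp add: L2_def)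
  ultimately show ?thesis using u orth unfolding H_space_def zero_normal_trace_def L2_inner_def
    by (auto intro!: bexI[of _ "\<lambda>x. 0"])
qed

text \<open>Membership in \<open>H\<close> follows from orthogonality relations, which survive
  limits. This places the projected initial value in \<open>H\<close>.\<close>

lemma V_closure_in_H:
  assumes "y \<in> closure (cl \<Omega> ` V_space \<Omega>)"
  shows "\<exists>u\<in>H_space \<Omega>. cl \<Omega> u = y"
proof -
  obtain p where p: "\<And>n. p n \<in> cl \<Omega> ` V_space \<Omega>" "p \<longlonglongrightarrow> y" using assms unfolding closure_sequential by blast
  then have "\<forall>n. \<exists>v. v \<in> V_space \<Omega> \<and> p n = cl \<Omega> v" by blast
  then obtain v where v: "\<And>n. v n \<in> V_space \<Omega>" "\<And>n. p n = cl \<Omega> (v n)" by metis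
  have "p = (\<lambda>n. cl \<Omega> (v n))" using v(2) by (rule ext)
  then have lim: "(\<lambda>n. cl \<Omega> (v n)) \<longlonglongrightarrow> y" using p(2) by simp
  obtain u where u: "u \<in> L2 \<Omega>" "cl \<Omega> u = y" using cl_surj_closed[OF V_space(5)[OF v(1)] lim] by blast
  have "L2_inner \<Omega> u g = 0" if "g \<in> L2 \<Omega>" "\<And>n. L2_inner \<Omega> (v n) g = 0" for g
    using L2_inner_tendsto[OF V_space(5)[OF v(1)] u(1) that(1)] lim u(2) that(2) by (simp add: LIMSEQ_const_iff)
  then have "u \<in> H_space \<Omega>"
    using u(1) V_space(7)[OF v(1)] V_orthogonal_gradients[OF v(1)] test_fun weak_grad by (intro H_spaceI) auto
  then show ?thesis using u by blast
qed

end

section \<open>Integrating a Riemann-Liouville derivative in time\<close>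

lemma AE_interval_nonempty:
  fixes P :: "real \<Rightarrow> bool"
  assumes "AE t in lebesgue. P t" "0 < e"
  shows "\<exists>t. 0 < t \<and> t < e \<and> P t"
proof (rule ccontr)
  assume n: "\<not> ?thesis"
  obtain M where M: "M \<in> null_sets lebesgue" "{t \<in> space lebesgue. \<not> P t} \<subseteq> M"
    using assms(1) unfolding eventually_ae_filter by blast
  have "{0<..<e} \<subseteq> M" using n M(2) by auto
  then have "emeasure lebesgue {0<..<e} \<le> emeasure lebesgue M" by (rule emeasure_mono) (use M in auto)
  then show False using M assms(2) by auto
qed

lemma indefinite_integral_integrable:
  fixes g' :: "real \<Rightarrow> real"
  assumes g': "set_integrable lebesgue {0<..<T} g'"
  shows "set_integrable lebesgue {0<..<T} (\<lambda>t. LINT s:{0<..<t}|lebesgue. g' s)"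
proof -
  have i1: "set_integrable lebesgue {s<..<T} (\<lambda>t. 1 :: real)" if "s \<in> {0<..<T}" for s
    using that by (auto simp: set_integrable_def intro!: integrable_real_indicator)
  have "(LINT t:{s<..<T}|lebesgue. \<bar>1::real\<bar>) \<le> T" if "s \<in> {0<..<T}" for s
    using that by (simp add: set_lebesgue_integral_def)
  from Fubini_triangle(2)[OF g', of "\<lambda>_ _. 1", OF _ i1 this] show ?thesis by simp
qed

text \<open>Two functions with the same weak derivative differ by a constant, and the constant is
  read off at times tending to 0. Boundedness of \<open>y\<close> near 0 makes it vanish; it
  excludes functions such as \<open>t powr (\<alpha> - 1)\<close>, whose integral of order
  \<open>1 - \<alpha>\<close> is a nonzero constant.\<close>

lemma RL_deriv_integral:
  fixes y g g' :: "real \<Rightarrow> real"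
  assumes \<alpha>: "0 < \<alpha>" "\<alpha> < 1" and T: "0 < T" and RL: "has_RL_deriv \<alpha> T y g"
    and gg: "AE t in lebesgue. t \<in> {0<..<T} \<longrightarrow> g t = g' t" and g': "set_integrable lebesgue {0<..<T} g'"
    and bd: "0 < \<delta>" "AE t in lebesgue. t \<in> {0<..<\<delta>} \<longrightarrow> \<bar>y t\<bar> \<le> K"
  shows "AE t in lebesgue. t \<in> {0<..<T} \<longrightarrow>
    1 / Gamma (1 - \<alpha>) * (LINT s:{0<..<t}|lebesgue. (t - s) powr (-\<alpha>) * y s) = (LINT s:{0<..<t}|lebesgue. g' s)"
proof -
  define h where "h t = 1 / Gamma (1 - \<alpha>) * (LINT s:{0<..<t}|lebesgue. (t - s) powr (-\<alpha>) * y s)" for t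
  define \<Phi> where "\<Phi> t = (LINT s:{0<..<t}|lebesgue. g' s)" for t
  have W: "has_weak_deriv T h g" using RL unfolding has_RL_deriv_def h_def[abs_def] by simp
  then have hi: "set_integrable lebesgue {a..b} h" and gi: "set_integrable lebesgue {a..b} g" if "0 < a" "b < T" for a b
    using that by (auto simp: has_weak_deriv_def)
  have gi': "set_integrable lebesgue {a..b} g'" if "0 < a" "b < T" for a b
    by (rule set_integrable_subinterval[OF g']) (use that in auto)
  have \<Phi>i: "set_integrable lebesgue {0<..<T} \<Phi>"
    unfolding \<Phi>_def[abs_def] by (rule indefinite_integral_integrable[OF g'])
  have "\<exists>c. AE t in lebesgue. t \<in> {0<..<T} \<longrightarrow> h t - \<Phi> t = c"
  proof (rule du_Bois_Reymond[OF T])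
    fix a b :: real assume ab: "0 < a" "b < T"
    have "set_integrable lebesgue {a..b} \<Phi>" by (rule set_integrable_subinterval[OF \<Phi>i]) (use ab in auto)
    then show "set_integrable lebesgue {a..b} (\<lambda>t. h t - \<Phi> t)" using hi[OF ab] by (rule set_integral_diff[rotated])
  next
    fix \<phi> assume \<phi>: "\<phi> \<in> test_functions {0<..<T}"
    note P = test_real[OF \<phi> T]
    obtain a b where ab: "0 < a" "b < T" and z: "\<And>t. t \<notin> {a..b} \<Longrightarrow> \<phi> t = 0 \<and> deriv \<phi> t = 0" using P(4) by blast
    obtain K where K: "\<And>t. \<bar>\<phi> t\<bar> \<le> K \<and> \<bar>deriv \<phi> t\<bar> \<le> K" using P(5) by blast
    have 1: "set_integrable lebesgue {0<..<T} (\<lambda>t. h t * deriv \<phi> t)"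
      by (rule set_integrable_mult_test[OF hi ab _ P(3)]) (use z K in auto)
    have 2: "set_integrable lebesgue {0<..<T} (\<lambda>t. g t * \<phi> t)"
      by (rule set_integrable_mult_test[OF gi ab _ P(2)]) (use z K in auto)
    have 3: "set_integrable lebesgue {0<..<T} (\<lambda>t. g' t * \<phi> t)"
      by (rule set_integrable_mult_test[OF gi' ab _ P(2)]) (use z K in auto)
    note I = indefinite_integral_weak_deriv[OF g' \<phi> T]
    have e: "(LINT t:{0<..<T}|lebesgue. g t * \<phi> t) = (LINT t:{0<..<T}|lebesgue. g' t * \<phi> t)"
      unfolding set_lebesgue_integral_def
    proof (rule integral_cong_AE)
      show "AE t in lebesgue. indicator {0<..<T} t *\<^sub>R (g t * \<phi> t) = indicator {0<..<T} t *\<^sub>R (g' t * \<phi> t)"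
        using gg by eventually_elim (auto simp: indicator_def)
    qed (use 2 3 in \<open>auto simp: set_integrable_def\<close>)
    have "(LINT t:{0<..<T}|lebesgue. (h t - \<Phi> t) * deriv \<phi> t)
        = (LINT t:{0<..<T}|lebesgue. h t * deriv \<phi> t) - (LINT t:{0<..<T}|lebesgue. \<Phi> t * deriv \<phi> t)"
      unfolding left_diff_distrib by (rule set_integral_diff(2)[OF 1]) (use I(1) in \<open>simp add: \<Phi>_def\<close>)
    also have "\<dots> = 0" using W \<phi> I(2) e by (simp add: has_weak_deriv_def \<Phi>_def)
    finally show "(LINT t:{0<..<T}|lebesgue. (h t - \<Phi> t) * deriv \<phi> t) = 0" .
  qed
  then obtain c where c: "AE t in lebesgue. t \<in> {0<..<T} \<longrightarrow> h t - \<Phi> t = c" by blast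
  \<comment> \<open>The identity holds almost everywhere only, so the times tending to 0 are picked
    inside shrinking intervals that stay below \<open>T\<close> and \<open>\<delta>\<close>.\<close>
  define d where "d n = min T \<delta> / real (Suc n)" for n
  have d: "d n > 0" "d n \<le> T" "d n \<le> \<delta>" for n
  proof -
    show "d n > 0" using T bd by (simp add: d_def)
    have "d n \<le> min T \<delta> / 1" unfolding d_def using T bd by (intro divide_left_mono) auto
    then show "d n \<le> T" "d n \<le> \<delta>" by auto
  qed
  have "\<exists>t. 0 < t \<and> t < d n \<and> h t - \<Phi> t = c" for n
    using AE_interval_nonempty[OF c d(1)[of n]] d[of n] by auto
  then obtain t where t: "\<And>n. 0 < t n" "\<And>n. t n < d n" "\<And>n. h (t n) - \<Phi> (t n) = c" by metis
  have d0: "d \<longlonglongrightarrow> 0" unfolding d_def using LIMSEQ_Suc[OF lim_const_over_n[of "min T \<delta>"]] .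
  have t0: "t \<longlonglongrightarrow> 0"
    by (rule tendsto_sandwich[OF _ _ tendsto_const d0]) (use t in \<open>auto intro!: always_eventually less_imp_le\<close>)
  have "(\<lambda>n. \<Phi> (t n)) \<longlonglongrightarrow> (LINT s:{0<..<T}|lebesgue. 0)"
  proof -
    have "\<Phi> (t n) = (LINT s:{0<..<T}|lebesgue. indicator {0<..<t n} s * g' s)" for n
    proof -
      have "t n < T" using t(2)[of n] d(2)[of n] by linarith
      then show ?thesis unfolding \<Phi>_def set_lebesgue_integral_def
        by (intro Bochner_Integration.integral_cong) (auto simp: indicator_def)
    qed
    moreover have "(\<lambda>n. LINT s:{0<..<T}|lebesgue. indicator {0<..<t n} s * g' s) \<longlonglongrightarrow> (LINT s:{0<..<T}|lebesgue. 0)"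
    proof (rule set_LINT_tendsto(2)[OF _ _ _ set_integrable_abs[OF g']])
      fix n
      have "(\<lambda>s. indicator {0<..<t n} s * (indicator {0<..<T} s *\<^sub>R g' s)) \<in> borel_measurable lebesgue"
        using g' by (intro borel_measurable_times borel_measurable_indicator) (auto simp: set_integrable_def)
      then show "set_borel_measurable lebesgue {0<..<T} (\<lambda>s. indicator {0<..<t n} s * g' s)"
        by (simp add: set_borel_measurable_def mult_ac)
    next
      fix s :: real assume s: "s \<in> {0<..<T}"
      have "\<forall>\<^sub>F n in sequentially. t n < s" using order_tendstoD(2)[OF t0, of s] s by simp
      then have "\<forall>\<^sub>F n in sequentially. indicator {0<..<t n} s * g' s = 0"
        by eventually_elim (simp add: indicator_def)
      then show "(\<lambda>n. indicator {0<..<t n} s * g' s) \<longlonglongrightarrow> 0" by (rule tendsto_eventually)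
    qed (auto simp: indicator_def)
    ultimately show ?thesis by simp
  qed
  then have \<Phi>0: "(\<lambda>n. \<Phi> (t n)) \<longlonglongrightarrow> 0" by (simp add: set_lebesgue_integral_def)
  \<comment> \<open>Where \<open>y\<close> is bounded, the integral of order
    \<open>1 - \<alpha>\<close> is bounded by a multiple of
    \<open>t powr (1 - \<alpha>)\<close>.\<close>
  have h0: "(\<lambda>n. h (t n)) \<longlonglongrightarrow> 0"
  proof (rule Lim_null_comparison)
    have G: "Gamma (1 - \<alpha>) > 0" using \<alpha> by (auto intro: Gamma_real_pos)
    show "\<forall>\<^sub>F n in sequentially. norm (h (t n)) \<le> 1 / Gamma (1 - \<alpha>) * (\<bar>K\<bar> * (t n powr (1 - \<alpha>) / (1 - \<alpha>)))"
    proof (rule always_eventually, rule allI)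
      fix n
      let ?t = "t n"
      have td: "?t < \<delta>" using t(2)[of n] d(3)[of n] by linarith
      have \<alpha>1: "0 < 1 - \<alpha>" using \<alpha> by simp
      note L = LINT_power_kernel[OF \<alpha>1 t(1)[of n]]
      have i: "set_integrable lebesgue {0..<?t} (\<lambda>s. \<bar>K\<bar> * (?t - s) powr (-\<alpha>))"
        using set_integrable_mult_right[OF L(1), of "\<bar>K\<bar>"] by simp
      have "\<bar>LINT s:{0<..<?t}|lebesgue. (?t - s) powr (-\<alpha>) * y s\<bar>
          \<le> (\<integral>s. norm (indicator {0<..<?t} s *\<^sub>R ((?t - s) powr (-\<alpha>) * y s)) \<partial>lebesgue)"
        unfolding set_lebesgue_integral_def using integral_norm_bound[of lebesgue "\<lambda>s. indicator {0<..<?t} s *\<^sub>R ((?t - s) powr (-\<alpha>) * y s)"] by simp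
      also have "\<dots> \<le> (\<integral>s. indicator {0..<?t} s *\<^sub>R (\<bar>K\<bar> * (?t - s) powr (-\<alpha>)) \<partial>lebesgue)"
      proof (rule integral_mono_AE')
        show "integrable lebesgue (\<lambda>s. indicator {0..<?t} s *\<^sub>R (\<bar>K\<bar> * (?t - s) powr (-\<alpha>)))"
          using i by (simp add: set_integrable_def)
        show "AE s in lebesgue. norm (indicator {0<..<?t} s *\<^sub>R ((?t - s) powr (-\<alpha>) * y s))
            \<le> indicator {0..<?t} s *\<^sub>R (\<bar>K\<bar> * (?t - s) powr (-\<alpha>))"
          using bd(2)
        proof eventually_elim
          case (elim s)
          show ?case
          proof (cases "s \<in> {0<..<?t}")
            case True
            then have "\<bar>y s\<bar> \<le> \<bar>K\<bar>" using elim td by auto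
            then have "(?t - s) powr (-\<alpha>) * \<bar>y s\<bar> \<le> (?t - s) powr (-\<alpha>) * \<bar>K\<bar>" by (intro mult_left_mono) auto
            then show ?thesis using True by (simp add: abs_mult mult.commute)
          qed simp
        qed
      qed simp
      also have "\<dots> = (LINT s:{0..<?t}|lebesgue. \<bar>K\<bar> * (?t - s) powr (-\<alpha>))"
        by (simp only: set_lebesgue_integral_def)
      also have "\<dots> = \<bar>K\<bar> * (?t powr (1 - \<alpha>) / (1 - \<alpha>))"
        unfolding set_integral_mult_right using L(2) by simp
      finally have "1 / Gamma (1 - \<alpha>) * \<bar>LINT s:{0<..<?t}|lebesgue. (?t - s) powr (-\<alpha>) * y s\<bar>
          \<le> 1 / Gamma (1 - \<alpha>) * (\<bar>K\<bar> * (?t powr (1 - \<alpha>) / (1 - \<alpha>)))" using G by (intro mult_left_mono) auto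
      then show "norm (h ?t) \<le> 1 / Gamma (1 - \<alpha>) * (\<bar>K\<bar> * (?t powr (1 - \<alpha>) / (1 - \<alpha>)))"
        using G by (simp add: h_def abs_mult)
    qed
    have "(\<lambda>n. t n powr (1 - \<alpha>)) \<longlonglongrightarrow> 0 powr (1 - \<alpha>)"
      using t(1) \<alpha> by (intro tendsto_powr2 t0 tendsto_const) (auto intro!: always_eventually less_imp_le)
    from this have "(\<lambda>n. 1 / Gamma (1 - \<alpha>) * (\<bar>K\<bar> * (t n powr (1 - \<alpha>) / (1 - \<alpha>)))) \<longlonglongrightarrow> 1 / Gamma (1 - \<alpha>) * (\<bar>K\<bar> * (0 powr (1 - \<alpha>) / (1 - \<alpha>)))"
      using \<alpha> by (intro tendsto_mult tendsto_divide tendsto_const) auto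
    then show "(\<lambda>n. 1 / Gamma (1 - \<alpha>) * (\<bar>K\<bar> * (t n powr (1 - \<alpha>) / (1 - \<alpha>)))) \<longlonglongrightarrow> 0" by simp
  qed
  have "c = 0" using tendsto_diff[OF h0 \<Phi>0] unfolding t(3) by (simp add: LIMSEQ_const_iff)
  then show ?thesis using c unfolding h_def \<Phi>_def by simp
qed

subsection \<open>Functions of time\<close>

text \<open>Composing a continuous function with these steps yields the simple functions of the
  Bochner definition. The \<open>+ 1\<close> after the floor keeps the step values positive, since
  the functions of time are controlled only after time 0.\<close>

lemma uniform_steps:
  fixes t T :: real
  assumes "0 < T"
  defines "\<tau> \<equiv> \<lambda>n t. T * (\<lfloor>(real n + 1) * t / T\<rfloor> + 1) / (real n + 2)"
  shows "0 < t \<Longrightarrow> 0 < \<tau> n t" and "(\<lambda>n. \<tau> n t) \<longlonglongrightarrow> t"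
    and "simple_function (lebesgue_on {0<..<T}) (\<tau> n)"
proof -
  show "0 < \<tau> n t" if "0 < t"
  proof -
    have "0 \<le> \<lfloor>(real n + 1) * t / T\<rfloor>" using that assms(1) by simp
    then have "0 < real_of_int \<lfloor>(real n + 1) * t / T\<rfloor> + 1" by linarith
    then show ?thesis unfolding \<tau>_def using assms(1) by (intro divide_pos_pos mult_pos_pos) auto
  qed
  have lim: "(\<lambda>n. t * ((real n + 1) / (real n + 2)) + c / (real n + 2)) \<longlonglongrightarrow> t * 1 + 0" for c
  proof (intro tendsto_intros)
    have z: "(\<lambda>n. c / (real n + 2)) \<longlonglongrightarrow> 0" for c
      using LIMSEQ_ignore_initial_segment[OF lim_const_over_n[of c], of 2] by (simp add: add.commute)
    show "(\<lambda>n. c / (real n + 2)) \<longlonglongrightarrow> 0" by (rule z)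
    have "(\<lambda>n. 1 - 1 / (real n + 2)) \<longlonglongrightarrow> 1 - 0" by (intro tendsto_intros z)
    moreover have "1 - 1 / (real n + 2) = (real n + 1) / (real n + 2)" for n by (simp add: field_simps)
    ultimately show "(\<lambda>n. (real n + 1) / (real n + 2)) \<longlonglongrightarrow> 1" by simp
  qed
  show "(\<lambda>n. \<tau> n t) \<longlonglongrightarrow> t"
  proof (rule tendsto_sandwich)
    have fl: "(real n + 1) * t / T - 1 \<le> \<lfloor>(real n + 1) * t / T\<rfloor>" "\<lfloor>(real n + 1) * t / T\<rfloor> \<le> (real n + 1) * t / T" for n by linarith+
    have e: "T * ((real n + 1) * t / T + c) / (real n + 2) = t * ((real n + 1) / (real n + 2)) + c * T / (real n + 2)" for n c
    proof -
      have "T * ((real n + 1) * t / T + c) = t * (real n + 1) + c * T" using assms(1) by (simp add: field_simps)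
      then show ?thesis by (simp only: add_divide_distrib[of "t * (real n + 1)" "c * T"] times_divide_eq_right)
    qed
    have "T * ((real n + 1) * t / T + 0) / (real n + 2) \<le> \<tau> n t" "\<tau> n t \<le> T * ((real n + 1) * t / T + 1) / (real n + 2)" for n
      unfolding \<tau>_def using fl[of n] assms(1) by (intro divide_right_mono mult_left_mono; simp)+
    then show "\<forall>\<^sub>F n in sequentially. t * ((real n + 1) / (real n + 2)) + 0 * T / (real n + 2) \<le> \<tau> n t"
      "\<forall>\<^sub>F n in sequentially. \<tau> n t \<le> t * ((real n + 1) / (real n + 2)) + 1 * T / (real n + 2)"
      unfolding e by (auto intro: always_eventually)
  qed (use lim[of "0 * T"] lim[of "1 * T"] in simp_all)
  have "simple_function (lebesgue_on {0<..<T}) (\<lambda>t. \<lfloor>(real n + 1) * t / T\<rfloor>)"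
    unfolding simple_function_def
  proof (intro conjI ballI)
    have "(\<lambda>t. \<lfloor>(real n + 1) * t / T\<rfloor>) ` {0<..<T} \<subseteq> {0..int n + 1}"
    proof (rule image_subsetI)
      fix t :: real assume "t \<in> {0<..<T}"
      then have t: "0 < t" "t < T" by auto
      then have "(real n + 1) * t / T \<le> (real n + 1) * T / T" using assms(1) by (intro divide_right_mono mult_left_mono) auto
      then have "(real n + 1) * t / T \<le> real n + 1" using assms(1) by simp
      then have "\<lfloor>(real n + 1) * t / T\<rfloor> \<le> int n + 1" by linarith
      moreover have "0 \<le> (real n + 1) * t / T" using t by simp
      ultimately show "\<lfloor>(real n + 1) * t / T\<rfloor> \<in> {0..int n + 1}" by simp
    qed
    then show "finite ((\<lambda>t. \<lfloor>(real n + 1) * t / T\<rfloor>) ` space (lebesgue_on {0<..<T}))"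
      by (simp add: space_restrict_space finite_subset)
    fix k
    have "(\<lambda>t. (real n + 1) * t / T) \<in> borel_measurable borel" by measurable
    then have "(\<lambda>t. \<lfloor>(real n + 1) * t / T\<rfloor>) \<in> measurable borel (count_space UNIV)"
      by (rule measurable_compose) (rule measurable_real_floor)
    then have "(\<lambda>t. \<lfloor>(real n + 1) * t / T\<rfloor>) \<in> measurable (lebesgue_on {0<..<T}) (count_space UNIV)"
      by (intro measurable_restrict_space1 measurable_completion) simp
    then show "(\<lambda>t. \<lfloor>(real n + 1) * t / T\<rfloor>) -` {k} \<inter> space (lebesgue_on {0<..<T}) \<in> sets (lebesgue_on {0<..<T})"
      by (rule measurable_sets) simp
  qed
  from simple_function_compose1[OF this, of "\<lambda>k. T * (real_of_int k + 1) / (real n + 2)"]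
  show "simple_function (lebesgue_on {0<..<T}) (\<tau> n)" by (simp add: \<tau>_def)
qed

text \<open>The seminorm on representatives is realised as a norm through \<open>\<Psi>\<close>;
  this serves both \<open>V\<close> and its dual. The singularity of order \<open>-\<alpha>\<close>
  allowed at time 0 is integrable.\<close>

lemma L2_time_continuous:
  fixes U :: "real \<Rightarrow> 'b::minus" and \<Psi> :: "real \<Rightarrow> 'x::real_normed_vector"
  assumes \<alpha>: "0 < \<alpha>" "\<alpha> < 1" and T: "0 < T"
    and S: "\<And>t. 0 < t \<Longrightarrow> U t \<in> S"
    and N: "\<And>s t. 0 < s \<Longrightarrow> 0 < t \<Longrightarrow> N (U s - U t) = norm (\<Psi> s - \<Psi> t)" "\<And>t. 0 < t \<Longrightarrow> N (U t) = norm (\<Psi> t)"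
    and c: "continuous_on {0<..} \<Psi>" and bd: "\<And>t. 0 < t \<Longrightarrow> (norm (\<Psi> t))\<^sup>2 \<le> K * t powr (-\<alpha>) + L"
  shows "U \<in> L2_time T S N"
proof -
  define \<tau> where "\<tau> n t = T * (\<lfloor>(real n + 1) * t / T\<rfloor> + 1) / (real n + 2)" for n t
  note \<tau> = uniform_steps[OF T, folded \<tau>_def]
  have dom: "(AE t in lebesgue_on {0<..<T}. P t)" if "\<And>t. t \<in> {0<..<T} \<Longrightarrow> P t" for P
    using that by (intro AE_I2) (auto simp: space_restrict_space)
  have "(\<lambda>n. N (U (\<tau> n t) - U t)) \<longlonglongrightarrow> 0" if t: "t \<in> {0<..<T}" for t
  proof -
    have "(\<lambda>n. \<Psi> (\<tau> n t)) \<longlonglongrightarrow> \<Psi> t"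
      by (rule continuous_on_tendsto_compose[OF c \<tau>(2)]) (use t \<tau>(1) in auto)
    then have "(\<lambda>n. norm (\<Psi> (\<tau> n t) - \<Psi> t)) \<longlonglongrightarrow> 0" by (intro tendsto_norm_zero LIM_zero)
    then show ?thesis using t \<tau>(1) by (simp add: N)
  qed
  moreover have "integrable (lebesgue_on {0<..<T}) (\<lambda>t. (N (U t))\<^sup>2)"
  proof -
    have "set_integrable lebesgue {0<..<T} (\<lambda>t. (norm (\<Psi> t))\<^sup>2)"
    proof (rule set_integrable_bound)
      show "set_integrable lebesgue {0<..<T} (\<lambda>t. K * t powr (-\<alpha>) + L)"
        by (intro set_integral_add integrable_power_kernel[OF \<alpha> T])
      show "set_borel_measurable lebesgue {0<..<T} (\<lambda>t. (norm (\<Psi> t))\<^sup>2)"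
        by (intro set_borel_measurable_continuous_lebesgue continuous_intros continuous_on_subset[OF c]) auto
      show "AE t in lebesgue. t \<in> {0<..<T} \<longrightarrow> norm ((norm (\<Psi> t))\<^sup>2) \<le> norm (K * t powr (-\<alpha>) + L)"
        by (intro AE_I2) (auto intro!: order_trans[OF bd abs_ge_self])
    qed
    moreover have "(\<lambda>t. indicator {0<..<T} t *\<^sub>R (N (U t))\<^sup>2) = (\<lambda>t. indicator {0<..<T} t *\<^sub>R (norm (\<Psi> t))\<^sup>2)"
      using N(2) by (auto simp: indicator_def)
    ultimately show ?thesis by (subst integrable_restrict_space) (simp_all add: set_integrable_def)
  qed
  moreover have "simple_function (lebesgue_on {0<..<T}) (\<lambda>t. U (\<tau> n t))" for n
    by (rule simple_function_compose1[OF \<tau>(3)])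
  ultimately show ?thesis using S \<tau>(1) unfolding L2_time_def
    by (auto intro!: dom exI[of _ "\<lambda>n t. U (\<tau> n t)"])
qed

text \<open>A function that is Lipschitz in the seminorm carries the approximating simple functions
  to real ones converging almost everywhere.\<close>

lemma L2_time_measurable:
  fixes L :: "'b::minus \<Rightarrow> real"
  assumes u: "u \<in> L2_time T S N" and L: "\<And>a b. a \<in> S \<Longrightarrow> b \<in> S \<Longrightarrow> \<bar>L a - L b\<bar> \<le> K * N (a - b)"
  shows "set_borel_measurable lebesgue {0<..<T} (\<lambda>t. L (u t))"
proof -
  obtain s where s: "\<And>n. simple_function (lebesgue_on {0<..<T}) (s n)" "\<And>n t. t \<in> {0<..<T} \<Longrightarrow> s n t \<in> S"
    "AE t in lebesgue_on {0<..<T}. (\<lambda>n. N (s n t - u t)) \<longlonglongrightarrow> 0"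
    and uS: "AE t in lebesgue_on {0<..<T}. u t \<in> S" using u unfolding L2_time_def by blast
  have "(\<lambda>t. L (s n t)) \<in> borel_measurable (lebesgue_on {0<..<T})" for n
    by (rule borel_measurable_simple_function[OF simple_function_compose1[OF s(1)]])
  then have "(\<lambda>t. lim (\<lambda>n. L (s n t))) \<in> borel_measurable (lebesgue_on {0<..<T})" by (rule borel_measurable_lim_metric)
  then have m: "(\<lambda>t. if t \<in> {0<..<T} then lim (\<lambda>n. L (s n t)) else 0) \<in> borel_measurable lebesgue"
    by (subst borel_measurable_if) auto
  have 1: "AE t in lebesgue. t \<in> {0<..<T} \<longrightarrow> (\<lambda>n. N (s n t - u t)) \<longlonglongrightarrow> 0"
    "AE t in lebesgue. t \<in> {0<..<T} \<longrightarrow> u t \<in> S" using s(3) uS by (simp_all add: AE_restrict_space_iff)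
  have "AE t in lebesgue. (if t \<in> {0<..<T} then lim (\<lambda>n. L (s n t)) else 0) = indicator {0<..<T} t *\<^sub>R L (u t)"
    using 1
  proof eventually_elim
    case (elim t)
    show ?case
    proof (cases "t \<in> {0<..<T}")
      case True
      have "(\<lambda>n. L (s n t) - L (u t)) \<longlonglongrightarrow> 0"
      proof (rule Lim_null_comparison)
        show "\<forall>\<^sub>F n in sequentially. norm (L (s n t) - L (u t)) \<le> K * N (s n t - u t)"
          using L s(2) True elim by (intro always_eventually) auto
        show "(\<lambda>n. K * N (s n t - u t)) \<longlonglongrightarrow> 0" using elim True by (auto intro: tendsto_mult_right_zero)
      qed
      then have "lim (\<lambda>n. L (s n t)) = L (u t)" by (rule limI[OF LIM_zero_cancel])
      then show ?thesis using True by simp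
    qed auto
  qed
  from borel_measurable_AE[OF m this] show ?thesis by (simp add: set_borel_measurable_def)
qed

section \<open>\<open>V\<close> as a Hilbert space of gradients, and its dual\<close>

locale poincare_domain = planar_domain +
  fixes C :: real
  assumes C_pos: "0 < C" and Poincare_C: "\<And>v. v \<in> V_space \<Omega> \<Longrightarrow> norm (cl \<Omega> v) \<le> C * norm (cl \<Omega> (gradm v))"
begin

definition D :: "(real ^ 2 ^ 2) lsq set" where "D = (\<lambda>v. cl \<Omega> (gradm v)) ` V_space \<Omega>"

text \<open>Recovers a field from its gradient; by the Poincare inequality the choice is determined
  up to a null set.\<close>

definition pot :: "(real ^ 2 ^ 2) lsq \<Rightarrow> field" where
  "pot p = (SOME v. v \<in> V_space \<Omega> \<and> cl \<Omega> (gradm v) = p)"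

text \<open>The factor \<open>1 / C\<close> makes the embedding of \<open>V\<close> into \<open>L\<^sup>2\<close> a contraction; in exchange the evolution
  is run with \<open>\<rho> / C\<^sup>2\<close> in place of \<open>\<rho>\<close>.\<close>

definition emb :: "(real ^ 2 ^ 2) lsq \<Rightarrow> (real ^ 2) lsq" where
  "emb p = (1 / C) *\<^sub>R cl \<Omega> (pot p)"

lemma pot: "p \<in> D \<Longrightarrow> pot p \<in> V_space \<Omega>" "p \<in> D \<Longrightarrow> cl \<Omega> (gradm (pot p)) = p"
proof -
  assume "p \<in> D"
  then have "\<exists>v. v \<in> V_space \<Omega> \<and> cl \<Omega> (gradm v) = p" by (auto simp: D_def)
  from someI_ex[OF this] show "pot p \<in> V_space \<Omega>" "cl \<Omega> (gradm (pot p)) = p" by (simp_all add: pot_def)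
qed

lemma gradm_in_D: "v \<in> V_space \<Omega> \<Longrightarrow> cl \<Omega> (gradm v) \<in> D" by (simp add: D_def)

lemma cl_V_diff:
  assumes "u \<in> V_space \<Omega>" "v \<in> V_space \<Omega>"
  shows "(\<lambda>x. u x - v x) \<in> V_space \<Omega>" "cl \<Omega> (gradm (\<lambda>x. u x - v x)) = cl \<Omega> (gradm u) - cl \<Omega> (gradm v)"
    "cl \<Omega> (\<lambda>x. u x - v x) = cl \<Omega> u - cl \<Omega> v"
  using V_lin[OF assms, of 1 1] cl_diff[OF V_space(5)[OF assms(1)] V_space(5)[OF assms(2)]] by simp_all

lemma cl_eq_of_gradm_eq:
  assumes "u \<in> V_space \<Omega>" "v \<in> V_space \<Omega>" "cl \<Omega> (gradm u) = cl \<Omega> (gradm v)"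
  shows "cl \<Omega> u = cl \<Omega> v"
  using Poincare_C[OF cl_V_diff(1)[OF assms(1,2)]] assms by (simp add: cl_V_diff)

lemma emb_cl: "v \<in> V_space \<Omega> \<Longrightarrow> emb (cl \<Omega> (gradm v)) = (1 / C) *\<^sub>R cl \<Omega> v"
  unfolding emb_def using cl_eq_of_gradm_eq[OF pot(1)[OF gradm_in_D] _ pot(2)[OF gradm_in_D]] by simp

text \<open>Injectivity of the embedding: a weak gradient is determined by its pairings with test
  functions, and these depend only on the class of the field.\<close>

lemma gradm_zero:
  assumes v: "v \<in> V_space \<Omega>" and z: "cl \<Omega> v = 0"
  shows "cl \<Omega> (gradm v) = 0"
proof -
  have zi: "cl \<Omega> (\<lambda>x. v x $ i) = 0" for i using component_L2(2)[OF V_space(5)[OF v], of i] z by simp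
  have gL: "(\<lambda>x. gradm v x $ i) \<in> L2 \<Omega>" for i by (rule component_L2[OF V_space(6)[OF v]])
  have "cl \<Omega> (\<lambda>x. weak_grad \<Omega> (\<lambda>x. v x $ i) x $ j) = 0" for i j
  proof (rule fundamental_lemma_dom)
    show "(\<lambda>x. weak_grad \<Omega> (\<lambda>x. v x $ i) x $ j) \<in> L2 \<Omega>" by (intro component_L2 V_space[OF v])
    fix \<phi> assume \<phi>: "\<phi> \<in> test_functions \<Omega>"
    have "L2_inner \<Omega> (\<lambda>x. v x $ i) (\<lambda>x. grad \<phi> x $ j) = - L2_inner \<Omega> (\<lambda>x. weak_grad \<Omega> (\<lambda>x. v x $ i) x $ j) \<phi>"
      using weak_grad[OF V_space(2)[OF v]] \<phi> by (simp add: is_weak_grad_iff)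
    moreover have "L2_inner \<Omega> (\<lambda>x. v x $ i) (\<lambda>x. grad \<phi> x $ j) = 0"
      by (simp add: L2_inner_cl V_space[OF v] component_L2 test_fun[OF \<phi>] zi)
    ultimately show "L2_inner \<Omega> (\<lambda>x. weak_grad \<Omega> (\<lambda>x. v x $ i) x $ j) \<phi> = 0" by simp
  qed
  then have "(norm (cl \<Omega> (weak_grad \<Omega> (\<lambda>x. v x $ i))))\<^sup>2 = 0" for i
    by (subst vec_L2(2)[OF component_L2(1)[OF V_space(4)[OF v]]]) simp
  then have "(norm (cl \<Omega> (gradm v)))\<^sup>2 = 0"
    by (subst vec_L2(2)[OF gL]) (simp add: gradm_def)
  then show ?thesis by simp
qed

lemma cl_zero: "cl \<Omega> (\<lambda>x. 0) = 0" by (simp add: cl_def ext_def[abs_def] zero_lsq.abs_eq)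

lemma V_zero: "(\<lambda>x. 0) \<in> V_space \<Omega>"
proof -
  have "(\<lambda>x. 0 :: real) \<in> H1_0 \<Omega>"
  proof -
    have t: "(\<lambda>x. 0 :: real) \<in> test_functions \<Omega>"
    proof -
      have "C_k k (\<lambda>x::pt. 0::real)" for k by (induction k) auto
      then show ?thesis by (simp add: test_functions_def)
    qed
    have zL: "(\<lambda>x. 0 :: real) \<in> L2 \<Omega>" "(\<lambda>x. 0 :: pt) \<in> L2 \<Omega>" by (simp_all add: L2_def)
    have g: "grad (\<lambda>x. 0) = (\<lambda>x. 0)" by (simp add: grad_def fun_eq_iff vec_eq_iff)
    have "is_weak_grad \<Omega> (\<lambda>x. 0) (\<lambda>x. 0)" by (simp add: is_weak_grad_def)
    note W = weak_grad_eqI[OF zL this]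
    show ?thesis unfolding H1_0_iff using W t cl_zero g by (intro conjI exI[of _ "\<lambda>n x. 0"]) auto
  qed
  then show ?thesis by (simp add: V_space_def has_weak_div_def)
qed

sublocale hilbert_embedding D emb
proof
  show sub: "subspace D"
  proof (rule subspaceI)
    show "0 \<in> D" using gradm_in_D[OF V_zero] gradm_zero[OF V_zero] by (simp add: cl_zero)
  next
    fix p q assume "p \<in> D" "q \<in> D"
    then show "p + q \<in> D" using V_lin[of "pot p" "pot q" 1 "-1"] gradm_in_D[of "\<lambda>x. 1 *\<^sub>R pot p x - (-1) *\<^sub>R pot q x"] pot by simp
  next
    fix c p assume "p \<in> D"
    then show "c *\<^sub>R p \<in> D" using V_lin[of "pot p" "pot p" c 0] gradm_in_D[of "\<lambda>x. c *\<^sub>R pot p x - 0 *\<^sub>R pot p x"] pot by simp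
  qed
  fix p assume p: "p \<in> D"
  show "emb (c *\<^sub>R p) = c *\<^sub>R emb p" for c
    using emb_cl[OF V_lin(1)[OF pot(1)[OF p] pot(1)[OF p], of c 0]] V_lin(2)[OF pot(1)[OF p] pot(1)[OF p], of c 0]
      cl_lin[OF V_space(5)[OF pot(1)[OF p]] V_space(5)[OF pot(1)[OF p]], of c 0] pot(2)[OF p] C_pos by (simp add: emb_def)
  show "norm (emb p) \<le> norm p"
    using Poincare_C[OF pot(1)[OF p]] C_pos by (simp add: emb_def pot(2)[OF p] field_simps)
  show "p = 0" if "emb p = 0"
    using gradm_zero[OF pot(1)[OF p]] pot(2)[OF p] that C_pos by (simp add: emb_def)
  show "emb (p + q) = emb p + emb q" if q: "q \<in> D" for q
    using emb_cl[OF V_lin(1)[OF pot(1)[OF p] pot(1)[OF q], of 1 "-1"]] V_lin(2)[OF pot(1)[OF p] pot(1)[OF q], of 1 "-1"]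
      cl_lin[OF V_space(5)[OF pot(1)[OF p]] V_space(5)[OF pot(1)[OF q]], of 1 "-1"] pot(2)[OF p] pot(2)[OF q] C_pos
    by (simp add: emb_def scaleR_add_right)
next
  \<comment> \<open>By the Poincare inequality convergence of the gradients makes the fields
    themselves Cauchy, and \<open>V_closed\<close> applies.\<close>
  show "closed D"
    unfolding closed_sequential_limits
  proof (intro allI impI, elim conjE)
    fix p g assume p: "\<forall>n. p n \<in> D" and lim: "p \<longlonglongrightarrow> g"
    have V: "pot (p n) \<in> V_space \<Omega>" "cl \<Omega> (gradm (pot (p n))) = p n" for n using pot p by blast+
    have "Cauchy (\<lambda>n. cl \<Omega> (pot (p n)))"
    proof (rule metric_CauchyI)
      fix e :: real assume "0 < e"
      then obtain M where M: "\<And>m n. m \<ge> M \<Longrightarrow> n \<ge> M \<Longrightarrow> dist (p m) (p n) < e / C"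
        using metric_CauchyD[OF LIMSEQ_imp_Cauchy[OF lim], of "e / C"] C_pos by auto
      show "\<exists>M. \<forall>m\<ge>M. \<forall>n\<ge>M. dist (cl \<Omega> (pot (p m))) (cl \<Omega> (pot (p n))) < e"
      proof (intro exI[of _ M] allI impI)
        fix m n assume mn: "m \<ge> M" "n \<ge> M"
        have "dist (cl \<Omega> (pot (p m))) (cl \<Omega> (pot (p n))) \<le> C * dist (p m) (p n)"
          using Poincare_C[OF cl_V_diff(1)[OF V(1)[of m] V(1)[of n]]]
          unfolding cl_V_diff(2,3)[OF V(1)[of m] V(1)[of n]] V(2) dist_norm .
        also have "\<dots> < e" using M[OF mn] C_pos by (simp add: field_simps)
        finally show "dist (cl \<Omega> (pot (p m))) (cl \<Omega> (pot (p n))) < e" .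
      qed
    qed
    then obtain a where a: "(\<lambda>n. cl \<Omega> (pot (p n))) \<longlonglongrightarrow> a" using Cauchy_convergent unfolding convergent_def by blast
    have "(\<lambda>n. cl \<Omega> (gradm (pot (p n)))) \<longlonglongrightarrow> g" using lim unfolding V(2) .
    from V_closed[OF V(1) a this] show "g \<in> D" using gradm_in_D by blast
  qed
qed

text \<open>\<open>F\<close> acts on representatives, so before Riesz's theorem applies it has to be
  shown to depend on the class of the gradient only.\<close>

lemma V_dual_Riesz:
  assumes "F \<in> V_dual \<Omega>"
  obtains m where "m \<in> D" "\<And>v. v \<in> V_space \<Omega> \<Longrightarrow> F v = m \<bullet> cl \<Omega> (gradm v)"
proof -
  have add: "F (\<lambda>x. v x + w x) = F v + F w" and sc: "F (\<lambda>x. c *\<^sub>R v x) = c * F v"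
    if "v \<in> V_space \<Omega>" "w \<in> V_space \<Omega>" for v w c using assms that by (auto simp: V_dual_def)
  obtain K where K: "\<And>v. v \<in> V_space \<Omega> \<Longrightarrow> \<bar>F v\<bar> \<le> K * norm (cl \<Omega> (gradm v))"
  proof -
    obtain K where "\<forall>v\<in>V_space \<Omega>. \<bar>F v\<bar> \<le> K * V_norm \<Omega> v" using assms unfolding V_dual_def by blast
    then show thesis by (intro that[of K]) (simp add: V_norm_cl)
  qed
  have lin: "F (\<lambda>x. a *\<^sub>R v x - b *\<^sub>R w x) = a * F v - b * F w" if "v \<in> V_space \<Omega>" "w \<in> V_space \<Omega>" for v w a b
  proof -
    have "(\<lambda>x. a *\<^sub>R v x) \<in> V_space \<Omega>" "(\<lambda>x. (-b) *\<^sub>R w x) \<in> V_space \<Omega>"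
      using V_lin(1)[OF that(1) that(1), of a 0] V_lin(1)[OF that(2) that(2), of "-b" 0] by simp_all
    from add[OF this] show ?thesis using sc[OF that(1) that(1), of a] sc[OF that(2) that(2), of "-b"] by simp
  qed
  \<comment> \<open>The difference has zero \<open>V\<close> norm, and boundedness of
    \<open>F\<close> makes its value there 0.\<close>
  have eq: "F v = F w" if "v \<in> V_space \<Omega>" "w \<in> V_space \<Omega>" "cl \<Omega> (gradm v) = cl \<Omega> (gradm w)" for v w
    using lin[OF that(1,2), of 1 1] K[OF cl_V_diff(1)[OF that(1,2)]] that(3) by (simp add: cl_V_diff(2)[OF that(1,2)])
  have "\<exists>m\<in>D. \<forall>q\<in>D. F (pot q) = m \<bullet> q"
  proof (rule Riesz_subspace[OF M])
    fix p q assume pq: "p \<in> D" "q \<in> D"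
    note l = V_lin[OF pot(1)[OF pq(1)] pot(1)[OF pq(2)], of 1 "-1"]
    have "p + q \<in> D" using pq M(1) by (rule subspace_add[rotated])
    then have "F (pot (p + q)) = F (\<lambda>x. 1 *\<^sub>R pot p x - (-1) *\<^sub>R pot q x)"
      using l pot(2) pq by (intro eq pot(1)) simp_all
    then show "F (pot (p + q)) = F (pot p) + F (pot q)" unfolding lin[OF pot(1)[OF pq(1)] pot(1)[OF pq(2)]] by simp
  next
    fix c p assume p: "p \<in> D"
    note l = V_lin[OF pot(1)[OF p] pot(1)[OF p], of c 0]
    have "c *\<^sub>R p \<in> D" using p M(1) by (rule subspace_scale[rotated])
    then have "F (pot (c *\<^sub>R p)) = F (\<lambda>x. c *\<^sub>R pot p x - 0 *\<^sub>R pot p x)"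
      using l pot(2) p by (intro eq pot(1)) simp_all
    then show "F (pot (c *\<^sub>R p)) = c * F (pot p)" unfolding lin[OF pot(1)[OF p] pot(1)[OF p]] by simp
  next
    show "\<bar>F (pot p)\<bar> \<le> K * norm p" if "p \<in> D" for p using K[OF pot(1)[OF that]] by (simp add: pot(2)[OF that])
  qed
  then obtain m where m: "m \<in> D" "\<And>q. q \<in> D \<Longrightarrow> F (pot q) = m \<bullet> q" by blast
  show thesis
  proof (rule that[OF m(1)])
    fix v assume v: "v \<in> V_space \<Omega>"
    have "F v = F (pot (cl \<Omega> (gradm v)))" using pot gradm_in_D[OF v] by (intro eq v) auto
    then show "F v = m \<bullet> cl \<Omega> (gradm v)" using m(2)[OF gradm_in_D[OF v]] by simp
  qed
qed

lemma V_dualI: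
  assumes "\<And>v. v \<in> V_space \<Omega> \<Longrightarrow> F v = m \<bullet> cl \<Omega> (gradm v)"
  shows "F \<in> V_dual \<Omega>"
proof -
  have "F (\<lambda>x. v x + w x) = F v + F w" if "v \<in> V_space \<Omega>" "w \<in> V_space \<Omega>" for v w
    using V_lin[OF that, of 1 "-1"] that by (simp add: assms inner_add_right)
  moreover have "F (\<lambda>x. c *\<^sub>R v x) = c * F v" if "v \<in> V_space \<Omega>" for v c
    using V_lin[OF that that, of c 0] that by (simp add: assms)
  moreover have "\<bar>F v\<bar> \<le> norm m * V_norm \<Omega> v" if "v \<in> V_space \<Omega>" for v
    using that by (simp add: assms V_norm_cl Cauchy_Schwarz_ineq2)
  ultimately show ?thesis unfolding V_dual_def by blast
qed

text \<open>The supremum in \<open>V_dual_norm\<close> carries information only for a set bounded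
  above, which the constant \<open>K\<close> supplies.\<close>

lemma V_dual_norm_le:
  assumes F: "\<And>v. v \<in> V_space \<Omega> \<Longrightarrow> \<bar>F v\<bar> \<le> K * V_norm \<Omega> v" and K: "0 \<le> K"
  shows "0 \<le> V_dual_norm \<Omega> F" "V_dual_norm \<Omega> F \<le> K"
    and "v \<in> V_space \<Omega> \<Longrightarrow> V_norm \<Omega> v \<le> 1 \<Longrightarrow> \<bar>F v\<bar> \<le> V_dual_norm \<Omega> F"
proof -
  have le: "\<bar>F v\<bar> \<le> K" if "v \<in> {v \<in> V_space \<Omega>. V_norm \<Omega> v \<le> 1}" for v
    using F[of v] that mult_left_mono[OF _ K, of "V_norm \<Omega> v" 1] by simp
  have bdd: "bdd_above ((\<lambda>v. \<bar>F v\<bar>) ` {v \<in> V_space \<Omega>. V_norm \<Omega> v \<le> 1})"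
    by (rule bdd_aboveI2[OF le])
  have z: "(\<lambda>x. 0) \<in> {v \<in> V_space \<Omega>. V_norm \<Omega> v \<le> 1}"
    using gradm_zero[OF V_zero] by (simp add: V_zero V_norm_cl cl_zero)
  show "0 \<le> V_dual_norm \<Omega> F" unfolding V_dual_norm_def by (rule cSUP_upper2[OF bdd z]) simp
  show "V_dual_norm \<Omega> F \<le> K" unfolding V_dual_norm_def by (rule cSUP_least[OF _ le]) (use z in auto)
  show "\<bar>F v\<bar> \<le> V_dual_norm \<Omega> F" if "v \<in> V_space \<Omega>" "V_norm \<Omega> v \<le> 1"
    unfolding V_dual_norm_def by (rule cSUP_upper[OF _ bdd]) (use that in simp)
qed

text \<open>The supremum is attained at the normalised representer. Continuity and measurability in
  the dual thereby reduce to those of the representer.\<close>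

lemma V_dual_norm_eq:
  assumes m: "m \<in> D" and F: "\<And>v. v \<in> V_space \<Omega> \<Longrightarrow> F v = m \<bullet> cl \<Omega> (gradm v)"
  shows "V_dual_norm \<Omega> F = norm m"
proof (rule antisym)
  have le: "\<bar>F v\<bar> \<le> norm m * V_norm \<Omega> v" if "v \<in> V_space \<Omega>" for v
    using that by (simp add: F V_norm_cl Cauchy_Schwarz_ineq2)
  note N = V_dual_norm_le[OF le norm_ge_zero]
  show "V_dual_norm \<Omega> F \<le> norm m" by (rule N(2))
  show "norm m \<le> V_dual_norm \<Omega> F"
  proof (cases "m = 0")
    case True
    then show ?thesis using N(1) by simp
  next
    case False
    let ?v = "\<lambda>x. (1 / norm m) *\<^sub>R pot m x - 0 *\<^sub>R pot m x"
    note v = V_lin[OF pot(1)[OF m] pot(1)[OF m], of "1 / norm m" 0]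
    have g: "cl \<Omega> (gradm ?v) = (1 / norm m) *\<^sub>R m" unfolding v(2) by (simp add: pot(2)[OF m])
    have "V_norm \<Omega> ?v = 1" unfolding V_norm_cl[OF v(1)] g using False by simp
    moreover have "F ?v = norm m" unfolding F[OF v(1)] g using False
      by (simp add: power2_norm_eq_inner[symmetric] power2_eq_square)
    ultimately show ?thesis using N(3)[OF _ v(1)] by simp
  qed
qed

end

subsection \<open>Uniqueness of weak solutions\<close>

lemma le_one_plus_square: "x \<le> 1 + x\<^sup>2" for x :: real
  using zero_le_power2[of "x - 1 / 2"] by (simp add: power2_eq_square algebra_simps)

lemma LINT_cong_AE:
  fixes f g :: "real \<Rightarrow> real"
  assumes "set_integrable lebesgue A f" "set_integrable lebesgue A g" "AE x in lebesgue. x \<in> A \<longrightarrow> f x = g x"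
  shows "(LINT x:A|lebesgue. f x) = (LINT x:A|lebesgue. g x)"
  unfolding set_lebesgue_integral_def
proof (rule integral_cong_AE)
  show "AE x in lebesgue. indicator A x *\<^sub>R f x = indicator A x *\<^sub>R g x"
    using assms(3) by eventually_elim (auto simp: indicator_def)
qed (use assms(1,2) in \<open>auto simp: set_integrable_def\<close>)

context poincare_domain
begin

lemma V_norm_diff:
  "a \<in> V_space \<Omega> \<Longrightarrow> b \<in> V_space \<Omega> \<Longrightarrow> V_norm \<Omega> (a - b) = norm (cl \<Omega> (gradm a) - cl \<Omega> (gradm b))"
  by (simp add: fun_diff_def V_norm_cl cl_V_diff)

lemma cl_V_diff_le:
  assumes "a \<in> V_space \<Omega>" "b \<in> V_space \<Omega>"
  shows "norm (cl \<Omega> a - cl \<Omega> b) \<le> C * norm (cl \<Omega> (gradm a) - cl \<Omega> (gradm b))"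
  using Poincare_C[OF cl_V_diff(1)[OF assms]] unfolding cl_V_diff(2,3)[OF assms] .

lemma emb_gradm_diff:
  assumes "a \<in> V_space \<Omega>" "b \<in> V_space \<Omega>"
  shows "cl \<Omega> (gradm a) - cl \<Omega> (gradm b) \<in> D"
    "emb (cl \<Omega> (gradm a) - cl \<Omega> (gradm b)) = (1 / C) *\<^sub>R (cl \<Omega> a - cl \<Omega> b)"
  using gradm_in_D[OF cl_V_diff(1)[OF assms]] emb_cl[OF cl_V_diff(1)[OF assms]] unfolding cl_V_diff(2,3)[OF assms] .

text \<open>The interval is finite and the norm is at most 1 plus its square, so square
  integrability in time makes bounded functionals of \<open>u\<close> integrable.\<close>

lemma L2_time_V_functional:
  assumes u: "u \<in> L2_time T (V_space \<Omega>) (V_norm \<Omega>)"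
    and L: "\<And>a b. a \<in> V_space \<Omega> \<Longrightarrow> b \<in> V_space \<Omega> \<Longrightarrow> \<bar>L a - L b\<bar> \<le> K * V_norm \<Omega> (a - b)"
      "\<And>a. a \<in> V_space \<Omega> \<Longrightarrow> \<bar>L a\<bar> \<le> K * V_norm \<Omega> a" and K: "0 \<le> K"
  shows "AE t in lebesgue. t \<in> {0<..<T} \<longrightarrow> u t \<in> V_space \<Omega>"
    and "set_integrable lebesgue {0<..<T} (\<lambda>t. K * (1 + (V_norm \<Omega> (u t))\<^sup>2))"
    and "a \<in> V_space \<Omega> \<Longrightarrow> \<bar>L a\<bar> \<le> K * (1 + (V_norm \<Omega> a)\<^sup>2)"
    and "set_integrable lebesgue {0<..<T} (\<lambda>t. L (u t))"
proof -
  show V: "AE t in lebesgue. t \<in> {0<..<T} \<longrightarrow> u t \<in> V_space \<Omega>"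
    using u by (simp add: L2_time_def AE_restrict_space_iff)
  have "integrable (lebesgue_on {0<..<T}) (\<lambda>t. (V_norm \<Omega> (u t))\<^sup>2)" using u by (simp add: L2_time_def)
  then have i2: "set_integrable lebesgue {0<..<T} (\<lambda>t. (V_norm \<Omega> (u t))\<^sup>2)"
    by (subst (asm) integrable_restrict_space) (simp_all add: set_integrable_def)
  have i1: "set_integrable lebesgue {0<..<T} (\<lambda>t. 1 :: real)"
    by (cases "0 \<le> T") (auto simp: set_integrable_def intro!: integrable_real_indicator)
  show i: "set_integrable lebesgue {0<..<T} (\<lambda>t. K * (1 + (V_norm \<Omega> (u t))\<^sup>2))"
    by (intro set_integrable_mult_right set_integral_add i1 i2)
  show le: "\<bar>L a\<bar> \<le> K * (1 + (V_norm \<Omega> a)\<^sup>2)" if "a \<in> V_space \<Omega>" for a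
    using L(2)[OF that] mult_left_mono[OF le_one_plus_square[of "V_norm \<Omega> a"] K] by linarith
  show "set_integrable lebesgue {0<..<T} (\<lambda>t. L (u t))"
  proof (rule set_integrable_bound[OF i L2_time_measurable[OF u, OF L(1)]])
    show "AE t in lebesgue. t \<in> {0<..<T} \<longrightarrow> norm (L (u t)) \<le> norm (K * (1 + (V_norm \<Omega> (u t))\<^sup>2))"
      using V by eventually_elim (use le K in auto)
  qed
qed

text \<open>The equation identifies the scalar Caputo derivative with an integrable function almost
  everywhere; one integration and Abel inversion remove all derivatives in time.\<close>

lemma weak_solution_integrated:
  assumes \<alpha>: "0 < \<alpha>" "\<alpha> < 1" and T: "0 < T"
    and u: "weak_solution \<Omega> \<alpha> T \<rho> f u0 u" and v: "v \<in> V_space \<Omega>"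
  shows "set_integrable lebesgue {0<..<T} (\<lambda>t. L2_inner \<Omega> (u t) v - L2_inner \<Omega> u0 v)"
    and "set_integrable lebesgue {0<..<T} (\<lambda>t. f v - \<rho> * V_inner \<Omega> (u t) v)"
    and "t \<in> {0<..<T} \<Longrightarrow> set_integrable lebesgue {0<..<t}
      (\<lambda>s. (t - s) powr (\<alpha> - 1) * (LINT r:{0<..<s}|lebesgue. f v - \<rho> * V_inner \<Omega> (u r) v))"
    and "t \<in> {0<..<T} \<Longrightarrow> (LINT s:{0<..<t}|lebesgue. L2_inner \<Omega> (u s) v - L2_inner \<Omega> u0 v)
      = 1 / Gamma \<alpha> * (LINT s:{0<..<t}|lebesgue. (t - s) powr (\<alpha> - 1) * (LINT r:{0<..<s}|lebesgue. f v - \<rho> * V_inner \<Omega> (u r) v))"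
proof -
  have uL: "u \<in> L2_time T (V_space \<Omega>) (V_norm \<Omega>)" using u by (simp add: weak_solution_def)
  obtain g where Cap: "has_Caputo_deriv \<alpha> T (\<lambda>t. L2_inner \<Omega> (u t) v) (L2_inner \<Omega> u0 v) g"
    and g: "AE t in lebesgue_on {0<..<T}. g t + \<rho> * V_inner \<Omega> (u t) v = f v"
    using u v unfolding weak_solution_def by blast
  have RL: "has_RL_deriv \<alpha> T (\<lambda>t. L2_inner \<Omega> (u t) v - L2_inner \<Omega> u0 v) g"
    and iv: "has_initial_value T abs (\<lambda>t. L2_inner \<Omega> (u t) v) (L2_inner \<Omega> u0 v)"
    using Cap by (auto simp: has_Caputo_deriv_def)
  show y: "set_integrable lebesgue {0<..<T} (\<lambda>t. L2_inner \<Omega> (u t) v - L2_inner \<Omega> u0 v)"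
    using RL by (simp add: has_RL_deriv_def)
  have Vi: "set_integrable lebesgue {0<..<T} (\<lambda>t. V_inner \<Omega> (u t) v)"
  proof (rule L2_time_V_functional(4)[OF uL])
    fix a b assume ab: "a \<in> V_space \<Omega>" "b \<in> V_space \<Omega>"
    show "\<bar>V_inner \<Omega> a v - V_inner \<Omega> b v\<bar> \<le> V_norm \<Omega> v * V_norm \<Omega> (a - b)"
      using Cauchy_Schwarz_ineq2[of "cl \<Omega> (gradm a) - cl \<Omega> (gradm b)" "cl \<Omega> (gradm v)"]
      by (simp add: V_inner_cl ab v V_norm_diff V_norm_cl inner_diff_left mult.commute)
  next
    fix a assume a: "a \<in> V_space \<Omega>"
    show "\<bar>V_inner \<Omega> a v\<bar> \<le> V_norm \<Omega> v * V_norm \<Omega> a"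
      using Cauchy_Schwarz_ineq2[of "cl \<Omega> (gradm a)" "cl \<Omega> (gradm v)"]
      by (simp add: V_inner_cl a v V_norm_cl mult.commute)
  qed (simp add: V_norm_cl v)
  show g': "set_integrable lebesgue {0<..<T} (\<lambda>t. f v - \<rho> * V_inner \<Omega> (u t) v)"
    using T by (intro set_integral_diff set_integrable_mult_right Vi)
      (auto simp: set_integrable_def intro!: integrable_real_indicator)
  have gg: "AE t in lebesgue. t \<in> {0<..<T} \<longrightarrow> g t = f v - \<rho> * V_inner \<Omega> (u t) v"
    using g by (simp add: AE_restrict_space_iff algebra_simps)
  obtain w' where w': "AE t in lebesgue. t \<in> {0<..<T} \<longrightarrow> w' t = L2_inner \<Omega> (u t) v"
    "((\<lambda>t. \<bar>w' t - L2_inner \<Omega> u0 v\<bar>) \<longlongrightarrow> 0) (at_right 0)"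
    using iv by (auto simp: has_initial_value_def AE_restrict_space_iff)
  \<comment> \<open>The initial condition enters here, as the boundedness near 0 required by
    \<open>RL_deriv_integral\<close>.\<close>
  have "\<forall>\<^sub>F t in at_right 0. \<bar>w' t - L2_inner \<Omega> u0 v\<bar> < 1" using order_tendstoD(2)[OF w'(2), of 1] by simp
  then obtain b where b: "0 < b" "\<And>t. 0 < t \<Longrightarrow> t < b \<Longrightarrow> \<bar>w' t - L2_inner \<Omega> u0 v\<bar> < 1"
    unfolding eventually_at_right_field by auto
  have bd: "AE t in lebesgue. t \<in> {0<..<min b T} \<longrightarrow> \<bar>L2_inner \<Omega> (u t) v - L2_inner \<Omega> u0 v\<bar> \<le> 1"
    using w'(1) by eventually_elim (use b(2) in \<open>force intro: less_imp_le\<close>)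
  have "0 < min b T" using b(1) T by simp
  note E = RL_deriv_integral[OF \<alpha> T RL gg g' this bd]
  show "set_integrable lebesgue {0<..<t}
      (\<lambda>s. (t - s) powr (\<alpha> - 1) * (LINT r:{0<..<s}|lebesgue. f v - \<rho> * V_inner \<Omega> (u r) v))"
    "(LINT s:{0<..<t}|lebesgue. L2_inner \<Omega> (u s) v - L2_inner \<Omega> u0 v)
      = 1 / Gamma \<alpha> * (LINT s:{0<..<t}|lebesgue. (t - s) powr (\<alpha> - 1) * (LINT r:{0<..<s}|lebesgue. f v - \<rho> * V_inner \<Omega> (u r) v))"
    if "t \<in> {0<..<T}" using Abel_inversion[OF \<alpha> y E that] by blast+
qed

lemma B_tendsto:
  assumes "x \<longlonglongrightarrow> y" shows "(\<lambda>n. B (x n)) \<longlonglongrightarrow> B y"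
proof (rule LIM_zero_cancel, rule Lim_null_comparison)
  show "\<forall>\<^sub>F n in sequentially. norm (B (x n) - B y) \<le> norm (x n - y)"
    using B_norm(2)[of "x _ - y"] by (simp add: B_def J_diff emb_diff J)
  show "(\<lambda>n. norm (x n - y)) \<longlonglongrightarrow> 0" by (rule tendsto_norm_zero[OF LIM_zero[OF assms]])
qed

text \<open>The difference satisfies the abstract integrated equation with rate
  \<open>\<rho> / C\<^sup>2\<close>. Its conclusion holds for each fixed element outside a null set
  depending on that element, and countably many elements have to suffice to test the difference with
  itself.\<close>

theorem weak_solution_unique:
  assumes \<alpha>: "0 < \<alpha>" "\<alpha> < 1" and T: "0 < T" and \<rho>: "0 < \<rho>"
    and u: "weak_solution \<Omega> \<alpha> T \<rho> f u0 u" and w: "weak_solution \<Omega> \<alpha> T \<rho> f u0 w"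
  shows "AE t in lebesgue_on {0<..<T}. AE x in lebesgue_on \<Omega>. w t x = u t x"
proof -
  have uL: "u \<in> L2_time T (V_space \<Omega>) (V_norm \<Omega>)" and wL: "w \<in> L2_time T (V_space \<Omega>) (V_norm \<Omega>)"
    using u w by (simp_all add: weak_solution_def)
  define \<zeta> where "\<zeta> t = cl \<Omega> (w t) - cl \<Omega> (u t)" for t
  have Lq: "\<bar>cl \<Omega> a \<bullet> q - cl \<Omega> b \<bullet> q\<bar> \<le> (C * norm q) * V_norm \<Omega> (a - b)" "\<bar>cl \<Omega> a \<bullet> q\<bar> \<le> (C * norm q) * V_norm \<Omega> a"
    if "a \<in> V_space \<Omega>" "b \<in> V_space \<Omega>" for a b q
  proof -
    have "\<bar>(cl \<Omega> a - cl \<Omega> b) \<bullet> q\<bar> \<le> (C * norm (cl \<Omega> (gradm a) - cl \<Omega> (gradm b))) * norm q"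
      using Cauchy_Schwarz_ineq2 mult_right_mono[OF cl_V_diff_le[OF that]] norm_ge_zero by (meson order_trans)
    then show "\<bar>cl \<Omega> a \<bullet> q - cl \<Omega> b \<bullet> q\<bar> \<le> (C * norm q) * V_norm \<Omega> (a - b)"
      by (simp add: V_norm_diff that inner_diff_left mult_ac)
    have "\<bar>cl \<Omega> a \<bullet> q\<bar> \<le> (C * norm (cl \<Omega> (gradm a))) * norm q"
      using Cauchy_Schwarz_ineq2 mult_right_mono[OF Poincare_C[OF that(1)]] norm_ge_zero by (meson order_trans)
    then show "\<bar>cl \<Omega> a \<bullet> q\<bar> \<le> (C * norm q) * V_norm \<Omega> a" by (simp add: V_norm_cl that mult_ac)
  qed
  have Cq: "0 \<le> C * norm q" for q :: "pt lsq" using C_pos by simp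
  have V: "AE t in lebesgue. t \<in> {0<..<T} \<longrightarrow> u t \<in> V_space \<Omega> \<and> w t \<in> V_space \<Omega>"
    using uL wL by (auto simp: L2_time_def AE_restrict_space_iff)
  have m: "set_integrable lebesgue {0<..<T} (\<lambda>t. \<zeta> t \<bullet> q)" for q
  proof -
    have F: "set_integrable lebesgue {0<..<T} (\<lambda>t. cl \<Omega> (z t) \<bullet> q)" if z: "z \<in> L2_time T (V_space \<Omega>) (V_norm \<Omega>)" for z
      by (rule L2_time_V_functional(4)[OF z Lq(1) Lq(2)[OF _ V_zero] Cq])
    show ?thesis unfolding \<zeta>_def inner_diff_left by (intro set_integral_diff F uL wL)
  qed
  define N where "N t = C * (1 + (V_norm \<Omega> (w t))\<^sup>2) + C * (1 + (V_norm \<Omega> (u t))\<^sup>2)" for t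
  have le1: "norm (cl \<Omega> a) \<le> C * (1 + (V_norm \<Omega> a)\<^sup>2)" if "a \<in> V_space \<Omega>" for a
  proof -
    have "C * V_norm \<Omega> a \<le> C * (1 + (V_norm \<Omega> a)\<^sup>2)" using C_pos by (intro mult_left_mono le_one_plus_square) auto
    then show ?thesis using Poincare_C[OF that] by (simp add: V_norm_cl that)
  qed
  have Ni: "set_integrable lebesgue {0<..<T} N"
  proof -
    have c: "set_integrable lebesgue {0<..<T} (\<lambda>t. C * (1 + (V_norm \<Omega> (z t))\<^sup>2))"
      if z: "z \<in> L2_time T (V_space \<Omega>) (V_norm \<Omega>)" for z
      using C_pos by (intro L2_time_V_functional(2)[OF z, of "\<lambda>_. 0"]) (auto simp: V_norm_cl V_norm_diff)
    show ?thesis unfolding N_def[abs_def] by (intro set_integral_add c uL wL)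
  qed
  have bd: "AE t in lebesgue. t \<in> {0<..<T} \<longrightarrow> norm (\<zeta> t) \<le> N t"
    using V
  proof eventually_elim
    case (elim t)
    then show ?case using norm_triangle_ineq4[of "cl \<Omega> (w t)" "cl \<Omega> (u t)"] le1[of "w t"] le1[of "u t"]
      unfolding \<zeta>_def N_def by fastforce
  qed
  have sub: "set_integrable lebesgue {0<..<t} h" if "set_integrable lebesgue {0<..<T} h" "t \<in> {0<..<T}" for h :: "real \<Rightarrow> real" and t
    by (rule set_integrable_subinterval[OF that(1)]) (use that(2) in auto)
  let ?\<rho> = "\<rho> / C\<^sup>2"
  have key: "set_integrable lebesgue {0<..<t} (\<lambda>s. (t - s) powr (\<alpha> - 1) * (- ?\<rho> * (LINT r:{0<..<s}|lebesgue. \<zeta> r \<bullet> q)))"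
    "(LINT s:{0<..<t}|lebesgue. \<zeta> s \<bullet> B q)
        = 1 / Gamma \<alpha> * (LINT s:{0<..<t}|lebesgue. (t - s) powr (\<alpha> - 1) * (- ?\<rho> * (LINT r:{0<..<s}|lebesgue. \<zeta> r \<bullet> q)))"
    if t: "t \<in> {0<..<T}" for q t
  proof -
    \<comment> \<open>For a test field of this form both terms of the equation are pairings of the
      difference in \<open>L\<^sup>2\<close>: the gradient term with \<open>q\<close>, the time
      derivative with \<open>B q\<close>, up to powers of \<open>C\<close>.\<close>
    define v where "v = pot (J q)"
    have v: "v \<in> V_space \<Omega>" "cl \<Omega> (gradm v) = J q" unfolding v_def using pot J(1) by blast+
    have cv: "cl \<Omega> v = C *\<^sub>R B q" using C_pos by (simp add: B_def emb_def v_def)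
    have p1: "L2_inner \<Omega> a v - L2_inner \<Omega> b v = C * ((cl \<Omega> a - cl \<Omega> b) \<bullet> B q)"
      and p2: "V_inner \<Omega> a v - V_inner \<Omega> b v = (1 / C) * ((cl \<Omega> a - cl \<Omega> b) \<bullet> q)"
      if ab: "a \<in> V_space \<Omega>" "b \<in> V_space \<Omega>" for a b
    proof -
      show "L2_inner \<Omega> a v - L2_inner \<Omega> b v = C * ((cl \<Omega> a - cl \<Omega> b) \<bullet> B q)"
        by (simp add: L2_inner_cl V_space(5) ab v cv inner_diff_left algebra_simps)
      have "V_inner \<Omega> a v - V_inner \<Omega> b v = (cl \<Omega> (gradm a) - cl \<Omega> (gradm b)) \<bullet> J q"
        by (simp add: V_inner_cl ab v inner_diff_left)
      also have "\<dots> = q \<bullet> emb (cl \<Omega> (gradm a) - cl \<Omega> (gradm b))"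
        using J(2)[OF emb_gradm_diff(1)[OF ab], of q] by (simp add: inner_commute)
      finally show "V_inner \<Omega> a v - V_inner \<Omega> b v = (1 / C) * ((cl \<Omega> a - cl \<Omega> b) \<bullet> q)"
        unfolding emb_gradm_diff(2)[OF ab] by (simp add: inner_commute)
    qed
    note Iu = weak_solution_integrated[OF \<alpha> T u v(1)] and Iw = weak_solution_integrated[OF \<alpha> T w v(1)]
    define Gu where "Gu s = (LINT r:{0<..<s}|lebesgue. f v - \<rho> * V_inner \<Omega> (u r) v)" for s
    define Gw where "Gw s = (LINT r:{0<..<s}|lebesgue. f v - \<rho> * V_inner \<Omega> (w r) v)" for s
    have G: "- ?\<rho> * (LINT r:{0<..<s}|lebesgue. \<zeta> r \<bullet> q) = (1 / C) * (Gw s - Gu s)" if s: "s \<in> {0<..<T}" for s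
    proof -
      have "Gw s - Gu s = (LINT r:{0<..<s}|lebesgue. (f v - \<rho> * V_inner \<Omega> (w r) v) - (f v - \<rho> * V_inner \<Omega> (u r) v))"
        unfolding Gw_def Gu_def by (rule set_integral_diff(2)[symmetric, OF sub[OF Iw(2) s] sub[OF Iu(2) s]])
      also have "\<dots> = (LINT r:{0<..<s}|lebesgue. (- \<rho> / C) * (\<zeta> r \<bullet> q))"
      proof (rule LINT_cong_AE)
        show "AE r in lebesgue. r \<in> {0<..<s} \<longrightarrow>
            (f v - \<rho> * V_inner \<Omega> (w r) v) - (f v - \<rho> * V_inner \<Omega> (u r) v) = (- \<rho> / C) * (\<zeta> r \<bullet> q)"
          using V
        proof eventually_elim
          case (elim r)
          show ?case
          proof
            assume "r \<in> {0<..<s}"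
            then have "V_inner \<Omega> (w r) v - V_inner \<Omega> (u r) v = (1 / C) * (\<zeta> r \<bullet> q)"
              using elim s unfolding \<zeta>_def by (intro p2) auto
            then have "\<rho> * V_inner \<Omega> (w r) v - \<rho> * V_inner \<Omega> (u r) v = \<rho> * ((1 / C) * (\<zeta> r \<bullet> q))"
              by (simp only: right_diff_distrib[symmetric])
            then show "(f v - \<rho> * V_inner \<Omega> (w r) v) - (f v - \<rho> * V_inner \<Omega> (u r) v) = (- \<rho> / C) * (\<zeta> r \<bullet> q)"
              by simp
          qed
        qed
        show "set_integrable lebesgue {0<..<s} (\<lambda>r. (f v - \<rho> * V_inner \<Omega> (w r) v) - (f v - \<rho> * V_inner \<Omega> (u r) v))"
          by (rule set_integral_diff(1)[OF sub[OF Iw(2) s] sub[OF Iu(2) s]])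
        show "set_integrable lebesgue {0<..<s} (\<lambda>r. (- \<rho> / C) * (\<zeta> r \<bullet> q))"
          by (intro set_integrable_mult_right sub[OF m s])
      qed
      also have "\<dots> = (- \<rho> / C) * (LINT r:{0<..<s}|lebesgue. \<zeta> r \<bullet> q)" by (rule set_integral_mult_right)
      finally show ?thesis using C_pos by (simp add: power2_eq_square)
    qed
    have tT: "s \<in> {0<..<T}" if "s \<in> {0<..<t}" for s using that t by auto
    have e: "(t - s) powr (\<alpha> - 1) * (- ?\<rho> * (LINT r:{0<..<s}|lebesgue. \<zeta> r \<bullet> q))
        = (1 / C) * ((t - s) powr (\<alpha> - 1) * Gw s - (t - s) powr (\<alpha> - 1) * Gu s)" if "s \<in> {0<..<t}" for s
      unfolding G[OF tT[OF that]] by (simp add: algebra_simps)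
    have i: "set_integrable lebesgue {0<..<t} (\<lambda>s. (1 / C) * ((t - s) powr (\<alpha> - 1) * Gw s - (t - s) powr (\<alpha> - 1) * Gu s))"
      unfolding Gw_def Gu_def by (intro set_integrable_mult_right set_integral_diff Iw(3)[OF t] Iu(3)[OF t])
    show "set_integrable lebesgue {0<..<t} (\<lambda>s. (t - s) powr (\<alpha> - 1) * (- ?\<rho> * (LINT r:{0<..<s}|lebesgue. \<zeta> r \<bullet> q)))"
      by (rule iffD2[OF set_integrable_cong[OF refl refl e] i])
    have "(LINT s:{0<..<t}|lebesgue. (t - s) powr (\<alpha> - 1) * (- ?\<rho> * (LINT r:{0<..<s}|lebesgue. \<zeta> r \<bullet> q)))
        = (LINT s:{0<..<t}|lebesgue. (1 / C) * ((t - s) powr (\<alpha> - 1) * Gw s - (t - s) powr (\<alpha> - 1) * Gu s))"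
      by (rule set_lebesgue_integral_cong) (use e in auto)
    also have "\<dots> = (1 / C) * ((LINT s:{0<..<t}|lebesgue. (t - s) powr (\<alpha> - 1) * Gw s) - (LINT s:{0<..<t}|lebesgue. (t - s) powr (\<alpha> - 1) * Gu s))"
      unfolding set_integral_mult_right Gw_def Gu_def by (subst set_integral_diff(2)[OF Iw(3)[OF t] Iu(3)[OF t]]) simp
    finally have I: "(LINT s:{0<..<t}|lebesgue. (t - s) powr (\<alpha> - 1) * (- ?\<rho> * (LINT r:{0<..<s}|lebesgue. \<zeta> r \<bullet> q)))
        = (1 / C) * ((LINT s:{0<..<t}|lebesgue. (t - s) powr (\<alpha> - 1) * Gw s) - (LINT s:{0<..<t}|lebesgue. (t - s) powr (\<alpha> - 1) * Gu s))" .
    have R: "1 / Gamma \<alpha> * (LINT s:{0<..<t}|lebesgue. (t - s) powr (\<alpha> - 1) * (- ?\<rho> * (LINT r:{0<..<s}|lebesgue. \<zeta> r \<bullet> q)))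
        = (1 / C) * ((LINT s:{0<..<t}|lebesgue. L2_inner \<Omega> (w s) v - L2_inner \<Omega> u0 v)
            - (LINT s:{0<..<t}|lebesgue. L2_inner \<Omega> (u s) v - L2_inner \<Omega> u0 v))"
      unfolding I Iw(4)[OF t] Iu(4)[OF t] Gw_def[symmetric] Gu_def[symmetric] by (simp add: algebra_simps)
    have "(LINT s:{0<..<t}|lebesgue. L2_inner \<Omega> (w s) v - L2_inner \<Omega> u0 v) - (LINT s:{0<..<t}|lebesgue. L2_inner \<Omega> (u s) v - L2_inner \<Omega> u0 v)
        = (LINT s:{0<..<t}|lebesgue. (L2_inner \<Omega> (w s) v - L2_inner \<Omega> u0 v) - (L2_inner \<Omega> (u s) v - L2_inner \<Omega> u0 v))"
      by (rule set_integral_diff(2)[symmetric, OF sub[OF Iw(1) t] sub[OF Iu(1) t]])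
    also have "\<dots> = (LINT s:{0<..<t}|lebesgue. C * (\<zeta> s \<bullet> B q))"
    proof (rule LINT_cong_AE)
      show "AE s in lebesgue. s \<in> {0<..<t} \<longrightarrow>
          (L2_inner \<Omega> (w s) v - L2_inner \<Omega> u0 v) - (L2_inner \<Omega> (u s) v - L2_inner \<Omega> u0 v) = C * (\<zeta> s \<bullet> B q)"
        using V
      proof eventually_elim
        case (elim s)
        show ?case
        proof
          assume "s \<in> {0<..<t}"
          then have "L2_inner \<Omega> (w s) v - L2_inner \<Omega> (u s) v = C * (\<zeta> s \<bullet> B q)"
            using elim t unfolding \<zeta>_def by (intro p1) auto
          then show "(L2_inner \<Omega> (w s) v - L2_inner \<Omega> u0 v) - (L2_inner \<Omega> (u s) v - L2_inner \<Omega> u0 v) = C * (\<zeta> s \<bullet> B q)"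
            by simp
        qed
      qed
      show "set_integrable lebesgue {0<..<t} (\<lambda>s. (L2_inner \<Omega> (w s) v - L2_inner \<Omega> u0 v) - (L2_inner \<Omega> (u s) v - L2_inner \<Omega> u0 v))"
        by (rule set_integral_diff(1)[OF sub[OF Iw(1) t] sub[OF Iu(1) t]])
      show "set_integrable lebesgue {0<..<t} (\<lambda>s. C * (\<zeta> s \<bullet> B q))"
        by (intro set_integrable_mult_right sub[OF m t])
    qed
    also have "\<dots> = C * (LINT s:{0<..<t}|lebesgue. \<zeta> s \<bullet> B q)" by (rule set_integral_mult_right)
    finally show "(LINT s:{0<..<t}|lebesgue. \<zeta> s \<bullet> B q)
        = 1 / Gamma \<alpha> * (LINT s:{0<..<t}|lebesgue. (t - s) powr (\<alpha> - 1) * (- ?\<rho> * (LINT r:{0<..<s}|lebesgue. \<zeta> r \<bullet> q)))"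
      unfolding R using C_pos by simp
  qed
  have \<rho>': "0 < ?\<rho>" using \<rho> C_pos by simp
  have Z: "AE t in lebesgue. t \<in> {0<..<T} \<longrightarrow> \<zeta> t \<bullet> B q = 0" for q
    by (rule evolution_unique[OF \<alpha> \<rho>' m Ni bd key])
  have approx: "\<exists>s. (\<forall>n::nat. finite (s n ` {0<..<T})) \<and>
      (AE t in lebesgue. t \<in> {0<..<T} \<longrightarrow> (\<lambda>n. cl \<Omega> (s n t)) \<longlonglongrightarrow> cl \<Omega> (z t))"
    if z: "z \<in> L2_time T (V_space \<Omega>) (V_norm \<Omega>)" for z
  proof -
    obtain s where s: "\<And>n::nat. simple_function (lebesgue_on {0<..<T}) (s n)" "\<And>n t. t \<in> {0<..<T} \<Longrightarrow> s n t \<in> V_space \<Omega>"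
      "AE t in lebesgue_on {0<..<T}. (\<lambda>n. V_norm \<Omega> (s n t - z t)) \<longlonglongrightarrow> 0"
      and zV: "AE t in lebesgue_on {0<..<T}. z t \<in> V_space \<Omega>" using z unfolding L2_time_def by blast
    have "finite (s n ` {0<..<T})" for n using simple_functionD(1)[OF s(1)] by (simp add: space_restrict_space)
    moreover have "AE t in lebesgue. t \<in> {0<..<T} \<longrightarrow> (\<lambda>n. V_norm \<Omega> (s n t - z t)) \<longlonglongrightarrow> 0"
      "AE t in lebesgue. t \<in> {0<..<T} \<longrightarrow> z t \<in> V_space \<Omega>" using s(3) zV by (simp_all add: AE_restrict_space_iff)
    then have "AE t in lebesgue. t \<in> {0<..<T} \<longrightarrow> (\<lambda>n. cl \<Omega> (s n t)) \<longlonglongrightarrow> cl \<Omega> (z t)"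
    proof eventually_elim
      case (elim t)
      show ?case
      proof
        assume t: "t \<in> {0<..<T}"
        show "(\<lambda>n. cl \<Omega> (s n t)) \<longlonglongrightarrow> cl \<Omega> (z t)"
        proof (rule LIM_zero_cancel, rule Lim_null_comparison)
          show "\<forall>\<^sub>F n in sequentially. norm (cl \<Omega> (s n t) - cl \<Omega> (z t)) \<le> C * V_norm \<Omega> (s n t - z t)"
            using elim t cl_V_diff_le[OF s(2)[OF t]] V_norm_diff[OF s(2)[OF t]] by simp
          show "(\<lambda>n. C * V_norm \<Omega> (s n t - z t)) \<longlonglongrightarrow> 0" using elim t by (auto intro: tendsto_mult_right_zero)
        qed
      qed
    qed
    ultimately show ?thesis by blast
  qed
  obtain sw where sw: "\<And>n::nat. finite (sw n ` {0<..<T})"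
    "AE t in lebesgue. t \<in> {0<..<T} \<longrightarrow> (\<lambda>n. cl \<Omega> (sw n t)) \<longlonglongrightarrow> cl \<Omega> (w t)" using approx[OF wL] by blast
  obtain su where su: "\<And>n::nat. finite (su n ` {0<..<T})"
    "AE t in lebesgue. t \<in> {0<..<T} \<longrightarrow> (\<lambda>n. cl \<Omega> (su n t)) \<longlonglongrightarrow> cl \<Omega> (u t)" using approx[OF uL] by blast
  \<comment> \<open>All values of the simple functions approximating the two solutions: a countable
    set whose classes approximate \<open>w t\<close> and \<open>u t\<close> for almost every
    \<open>t\<close>.\<close>
  define Q where "Q = (\<Union>n. sw n ` {0<..<T}) \<union> (\<Union>n. su n ` {0<..<T})"
  have "countable Q" unfolding Q_def using sw(1) su(1) by (intro countable_Un countable_UN countableI_type) (auto intro: countable_finite)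
  then have "AE t in lebesgue. \<forall>a\<in>Q. t \<in> {0<..<T} \<longrightarrow> \<zeta> t \<bullet> B (cl \<Omega> a) = 0"
    unfolding AE_ball_countable[OF \<open>countable Q\<close>] using Z by blast
  then have "AE t in lebesgue. t \<in> {0<..<T} \<longrightarrow> (AE x in lebesgue_on \<Omega>. w t x = u t x)"
    using sw(2) su(2) V
  proof eventually_elim
    case (elim t)
    show ?case
    proof
      assume t: "t \<in> {0<..<T}"
      then have tV: "u t \<in> V_space \<Omega>" "w t \<in> V_space \<Omega>" using elim by auto
      have q: "\<zeta> t \<bullet> B (cl \<Omega> (sw n t)) = 0" "\<zeta> t \<bullet> B (cl \<Omega> (su n t)) = 0" for n
      proof -
        have "sw n t \<in> Q" "su n t \<in> Q" unfolding Q_def using t by blast+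
        then show "\<zeta> t \<bullet> B (cl \<Omega> (sw n t)) = 0" "\<zeta> t \<bullet> B (cl \<Omega> (su n t)) = 0" using elim(1) t by blast+
      qed
      have "(\<lambda>n. \<zeta> t \<bullet> B (cl \<Omega> (sw n t))) \<longlonglongrightarrow> \<zeta> t \<bullet> B (cl \<Omega> (w t))"
        "(\<lambda>n. \<zeta> t \<bullet> B (cl \<Omega> (su n t))) \<longlonglongrightarrow> \<zeta> t \<bullet> B (cl \<Omega> (u t))"
        using elim(2,3) t by (auto intro!: tendsto_inner B_tendsto)
      then have "\<zeta> t \<bullet> B (cl \<Omega> (w t)) = 0" "\<zeta> t \<bullet> B (cl \<Omega> (u t)) = 0"
        unfolding q by (simp_all add: LIMSEQ_const_iff)
      \<comment> \<open>The form of \<open>B\<close> at \<open>\<zeta> t\<close> is the square of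
        the norm of \<open>J (\<zeta> t)\<close>. As \<open>\<zeta> t\<close> itself comes from
        \<open>V\<close>, its pairing with itself is a pairing of \<open>J (\<zeta> t)\<close> with
        a gradient and vanishes.\<close>
      then have "B (\<zeta> t) \<bullet> \<zeta> t = 0" by (simp add: \<zeta>_def B_def J_diff emb_diff J inner_commute inner_diff_right)
      then have "J (\<zeta> t) = 0" using J_norm_sq[of "\<zeta> t"] by simp
      then have "\<zeta> t \<bullet> \<zeta> t = 0"
        using J(2)[OF emb_gradm_diff(1)[OF tV(2,1)], of "\<zeta> t"] C_pos
        unfolding emb_gradm_diff(2)[OF tV(2,1)] \<zeta>_def[symmetric] by simp
      then have "cl \<Omega> (w t) = cl \<Omega> (u t)" by (simp add: \<zeta>_def)
      then show "AE x in lebesgue_on \<Omega>. w t x = u t x" by (simp add: cl_eq_iff V_space(5) tV)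
    qed
  qed
  then show ?thesis by (simp add: AE_restrict_space_iff)
qed

end

subsection \<open>Existence of weak solutions\<close>

context poincare_domain
begin

lemma range_emb: "emb ` D = cl \<Omega> ` V_space \<Omega>"
proof (intro equalityI image_subsetI)
  fix p assume p: "p \<in> D"
  note v = pot[OF p]
  have "emb p = cl \<Omega> (\<lambda>x. (1 / C) *\<^sub>R pot p x - 0 *\<^sub>R pot p x)"
    using cl_lin[OF V_space(5)[OF v(1)] V_space(5)[OF v(1)], of "1 / C" 0] by (simp add: emb_def)
  then show "emb p \<in> cl \<Omega> ` V_space \<Omega>" using V_lin(1)[OF v(1) v(1), of "1 / C" 0] by blast
next
  fix v assume v: "v \<in> V_space \<Omega>"
  have "cl \<Omega> v = emb (C *\<^sub>R cl \<Omega> (gradm v))" using C_pos by (simp add: emb_scale gradm_in_D v emb_cl)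
  then show "cl \<Omega> v \<in> emb ` D" using subspace_scale[OF M(1) gradm_in_D[OF v]] by blast
qed

lemma subspace_range_emb: "subspace (emb ` D)"
proof (rule subspaceI)
  show "0 \<in> emb ` D" unfolding range_emb using V_zero cl_zero[symmetric] by blast
  show "x + y \<in> emb ` D" if "x \<in> emb ` D" "y \<in> emb ` D" for x y
    using that emb_add[symmetric] subspace_add[OF M(1)] by auto
  show "c *\<^sub>R x \<in> emb ` D" if "x \<in> emb ` D" for c x
    using that emb_scale[symmetric] subspace_scale[OF M(1)] by auto
qed

text \<open>The solution is the stationary field plus the evolution started at the difference
  between the projected initial value and that field.\<close>

lemma solution_exists:
  assumes \<alpha>: "0 < \<alpha>" "\<alpha> < 1" and \<rho>: "0 < \<rho>" and f: "f \<in> V_dual \<Omega>" and u0: "u0 \<in> L2 \<Omega>"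
  obtains u K L R where "\<And>t. 0 < t \<Longrightarrow> u t \<in> V_space \<Omega>" and "u 0 \<in> H_space \<Omega>"
    and "\<And>v. v \<in> V_space \<Omega> \<Longrightarrow> L2_inner \<Omega> u0 v = cl \<Omega> (u 0) \<bullet> cl \<Omega> v"
    and "continuous_on {0<..} (\<lambda>t. cl \<Omega> (gradm (u t)))"
    and "((\<lambda>t. cl \<Omega> (u t)) \<longlongrightarrow> cl \<Omega> (u 0)) (at_right 0)"
    and "\<And>t. 0 < t \<Longrightarrow> (norm (cl \<Omega> (gradm (u t))))\<^sup>2 \<le> K * t powr (-\<alpha>) + L"
    and "\<And>t. 0 < t \<Longrightarrow> norm (cl \<Omega> (u t)) \<le> R"
    and "\<And>t v. 0 < t \<Longrightarrow> v \<in> V_space \<Omega> \<Longrightarrow>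
      1 / Gamma (1 - \<alpha>) * (LINT s:{0<..<t}|lebesgue. (t - s) powr (-\<alpha>) * ((cl \<Omega> (u s) - cl \<Omega> (u 0)) \<bullet> cl \<Omega> v))
        = (LINT s:{0<..<t}|lebesgue. f v - \<rho> * V_inner \<Omega> (u s) v)"
proof -
  obtain m where m: "m \<in> D" "\<And>v. v \<in> V_space \<Omega> \<Longrightarrow> f v = m \<bullet> cl \<Omega> (gradm v)" using V_dual_Riesz[OF f] by blast
  \<comment> \<open>The stationary solution: \<open>\<rho>\<close> times its inner product with
    \<open>v\<close> in \<open>V\<close> is \<open>f v\<close>, because \<open>m\<close> represents
    \<open>f\<close>.\<close>
  define ui where "ui = pot ((1 / \<rho>) *\<^sub>R m)"
  have ui: "ui \<in> V_space \<Omega>" "cl \<Omega> (gradm ui) = (1 / \<rho>) *\<^sub>R m"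
    unfolding ui_def using pot subspace_scale[OF M(1) m(1)] by blast+
  let ?E = "closure (emb ` D)"
  have sE: "subspace ?E" by (rule subspace_closure[OF subspace_range_emb])
  obtain P where P: "P \<in> ?E" "\<And>q. q \<in> ?E \<Longrightarrow> cl \<Omega> u0 \<bullet> q = P \<bullet> q"
    using projection_exists[OF sE closed_closure, of "cl \<Omega> u0"] by blast
  have clE: "cl \<Omega> v \<in> ?E" if "v \<in> V_space \<Omega>" for v
    using that closure_subset[of "emb ` D"] unfolding range_emb by blast
  \<comment> \<open>The abstract evolution lives in the image of \<open>emb\<close>, which carries
    the factor \<open>1 / C\<close>; the initial difference is scaled accordingly.\<close>
  define x where "x = (1 / C) *\<^sub>R (P - cl \<Omega> ui)"
  have xE: "x \<in> ?E" unfolding x_def by (intro subspace_scale[OF sE] subspace_diff[OF sE] P clE ui)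
  have \<rho>': "0 < \<rho> / C\<^sup>2" using \<rho> C_pos by simp
  obtain G where G: "\<And>t. 0 < t \<Longrightarrow> G t \<in> D" "((\<lambda>t. emb (G t)) \<longlongrightarrow> x) (at_right 0)" "continuous_on {0<..} G"
    "\<And>t. 0 < t \<Longrightarrow> norm (emb (G t)) \<le> norm x"
    "\<And>t. 0 < t \<Longrightarrow> (norm (G t))\<^sup>2 \<le> Gamma (\<alpha> + 1) / (\<rho> / C\<^sup>2) * t powr (-\<alpha>) * (norm x)\<^sup>2"
    "\<And>t g. 0 < t \<Longrightarrow> g \<in> D \<Longrightarrow>
      1 / Gamma (1 - \<alpha>) * (LINT s:{0<..<t}|lebesgue. (t - s) powr (-\<alpha>) * ((emb (G s) - x) \<bullet> emb g))
        = - (\<rho> / C\<^sup>2) * (LINT s:{0<..<t}|lebesgue. G s \<bullet> g)"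
    by (rule evolution_exists[OF \<alpha> \<rho>' xE]) blast
  obtain h0 where h0: "h0 \<in> H_space \<Omega>" "cl \<Omega> h0 = P" using V_closure_in_H[of P] P(1) unfolding range_emb by blast
  \<comment> \<open>The projected initial value need not belong to \<open>V\<close>, so at time 0 a
    representative in \<open>H\<close> is used.\<close>
  define u where "u t = (if 0 < t then (\<lambda>x. 1 *\<^sub>R ui x - (-1) *\<^sub>R pot (G t) x) else h0)" for t
  have uV: "u t \<in> V_space \<Omega>" "cl \<Omega> (gradm (u t)) = cl \<Omega> (gradm ui) + G t" "cl \<Omega> (u t) = cl \<Omega> ui + C *\<^sub>R emb (G t)"
    if t: "0 < t" for t
    using V_lin[OF ui(1) pot(1)[OF G(1)[OF t]], of 1 "-1"] cl_lin[OF V_space(5)[OF ui(1)] V_space(5)[OF pot(1)[OF G(1)[OF t]]], of 1 "-1"]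
      t C_pos pot(2)[OF G(1)[OF t]] by (simp_all add: u_def emb_def)
  have u0': "u 0 = h0" by (simp add: u_def)
  have Cx: "cl \<Omega> ui + C *\<^sub>R x = P" using C_pos by (simp add: x_def)
  show thesis
  proof (rule that[of u "2 * (Gamma (\<alpha> + 1) / (\<rho> / C\<^sup>2) * (norm x)\<^sup>2)" "2 * (norm (cl \<Omega> (gradm ui)))\<^sup>2" "norm (cl \<Omega> ui) + C * norm x"])
    show "u 0 \<in> H_space \<Omega>" by (simp add: u0' h0)
    show "L2_inner \<Omega> u0 v = cl \<Omega> (u 0) \<bullet> cl \<Omega> v" if "v \<in> V_space \<Omega>" for v
      using P(2)[OF clE[OF that]] by (simp add: u0' h0 L2_inner_cl u0 V_space(5) that)
    have "continuous_on {0<..} (\<lambda>t. cl \<Omega> (gradm ui) + G t)" by (intro continuous_intros G)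
    then show "continuous_on {0<..} (\<lambda>t. cl \<Omega> (gradm (u t)))" by (rule continuous_on_eq) (simp add: uV)
    have "((\<lambda>t. cl \<Omega> ui + C *\<^sub>R emb (G t)) \<longlongrightarrow> cl \<Omega> ui + C *\<^sub>R x) (at_right 0)" by (intro tendsto_intros G)
    then have "((\<lambda>t. cl \<Omega> ui + C *\<^sub>R emb (G t)) \<longlongrightarrow> cl \<Omega> (u 0)) (at_right 0)" by (simp only: Cx u0' h0)
    then show "((\<lambda>t. cl \<Omega> (u t)) \<longlongrightarrow> cl \<Omega> (u 0)) (at_right 0)"
      by (rule Lim_transform_eventually) (simp add: eventually_at_right_less uV eventually_mono[OF eventually_at_right_less])
  next
    fix t :: real assume t: "0 < t"
    show "u t \<in> V_space \<Omega>" by (rule uV(1)[OF t])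
    have sq: "(a + b)\<^sup>2 \<le> 2 * b\<^sup>2 + 2 * a\<^sup>2" for a b :: real
      using zero_le_power2[of "a - b"] by (simp add: power2_sum power2_diff)
    have "(norm (cl \<Omega> (gradm (u t))))\<^sup>2 \<le> (norm (cl \<Omega> (gradm ui)) + norm (G t))\<^sup>2"
      unfolding uV(2)[OF t] by (intro power_mono norm_triangle_ineq) simp
    also have "\<dots> \<le> 2 * (norm (G t))\<^sup>2 + 2 * (norm (cl \<Omega> (gradm ui)))\<^sup>2" by (rule sq)
    also have "\<dots> \<le> 2 * (Gamma (\<alpha> + 1) / (\<rho> / C\<^sup>2) * t powr (-\<alpha>) * (norm x)\<^sup>2) + 2 * (norm (cl \<Omega> (gradm ui)))\<^sup>2"
      using G(5)[OF t] by simp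
    finally show "(norm (cl \<Omega> (gradm (u t))))\<^sup>2
        \<le> 2 * (Gamma (\<alpha> + 1) / (\<rho> / C\<^sup>2) * (norm x)\<^sup>2) * t powr (-\<alpha>) + 2 * (norm (cl \<Omega> (gradm ui)))\<^sup>2"
      by (simp add: mult_ac)
    have "norm (cl \<Omega> (u t)) \<le> norm (cl \<Omega> ui) + C * norm (emb (G t))"
      unfolding uV(3)[OF t] using norm_triangle_ineq[of "cl \<Omega> ui" "C *\<^sub>R emb (G t)"] C_pos by simp
    also have "\<dots> \<le> norm (cl \<Omega> ui) + C * norm x" using G(4)[OF t] C_pos by simp
    finally show "norm (cl \<Omega> (u t)) \<le> norm (cl \<Omega> ui) + C * norm x" .
    fix v assume v: "v \<in> V_space \<Omega>"
    have e1: "(emb (G s) - x) \<bullet> emb (cl \<Omega> (gradm v)) = (1 / C\<^sup>2) * ((cl \<Omega> (u s) - cl \<Omega> (u 0)) \<bullet> cl \<Omega> v)" if "s \<in> {0<..<t}" for s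
    proof -
      have "cl \<Omega> (u s) - cl \<Omega> (u 0) = C *\<^sub>R (emb (G s) - x)"
        using that uV(3)[of s] Cx by (simp add: u0' h0 scaleR_diff_right algebra_simps)
      then show ?thesis using C_pos by (simp add: emb_cl[OF v] power2_eq_square)
    qed
    have e2: "f v - \<rho> * V_inner \<Omega> (u s) v = - \<rho> * (G s \<bullet> cl \<Omega> (gradm v))" if "s \<in> {0<..<t}" for s
      using that \<rho> by (simp add: V_inner_cl uV v ui m(2) inner_add_left algebra_simps)
    have "1 / Gamma (1 - \<alpha>) * (LINT s:{0<..<t}|lebesgue. (1 / C\<^sup>2) * ((t - s) powr (-\<alpha>) * ((cl \<Omega> (u s) - cl \<Omega> (u 0)) \<bullet> cl \<Omega> v)))
        = 1 / Gamma (1 - \<alpha>) * (LINT s:{0<..<t}|lebesgue. (t - s) powr (-\<alpha>) * ((emb (G s) - x) \<bullet> emb (cl \<Omega> (gradm v))))"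
      by (intro arg_cong[of _ _ "\<lambda>z. 1 / Gamma (1 - \<alpha>) * z"] set_lebesgue_integral_cong) (auto simp: e1)
    also have "\<dots> = - (\<rho> / C\<^sup>2) * (LINT s:{0<..<t}|lebesgue. G s \<bullet> cl \<Omega> (gradm v))" by (rule G(6)[OF t gradm_in_D[OF v]])
    finally have I: "1 / Gamma (1 - \<alpha>) * (LINT s:{0<..<t}|lebesgue. (1 / C\<^sup>2) * ((t - s) powr (-\<alpha>) * ((cl \<Omega> (u s) - cl \<Omega> (u 0)) \<bullet> cl \<Omega> v)))
        = - (\<rho> / C\<^sup>2) * (LINT s:{0<..<t}|lebesgue. G s \<bullet> cl \<Omega> (gradm v))" .
    \<comment> \<open>Both the pairing in \<open>L\<^sup>2\<close> and the rate contain
      \<open>1 / C\<^sup>2\<close>, so the scaling disappears from the equation.\<close>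
    have cancel: "a * b = - \<rho> * c" if "a * ((1 / C\<^sup>2) * b) = - (\<rho> / C\<^sup>2) * c" for a b c :: real
    proof -
      have "(a * b) / C\<^sup>2 = (- \<rho> * c) / C\<^sup>2" using that by simp
      then have "C\<^sup>2 = 0 \<or> a * b = - \<rho> * c" by (simp only: divide_cancel_right)
      then show ?thesis using C_pos by auto
    qed
    have "1 / Gamma (1 - \<alpha>) * (LINT s:{0<..<t}|lebesgue. (t - s) powr (-\<alpha>) * ((cl \<Omega> (u s) - cl \<Omega> (u 0)) \<bullet> cl \<Omega> v))
        = - \<rho> * (LINT s:{0<..<t}|lebesgue. G s \<bullet> cl \<Omega> (gradm v))"
      using I unfolding set_integral_mult_right[of _ _ "1 / C\<^sup>2"] by (rule cancel)
    also have "\<dots> = (LINT s:{0<..<t}|lebesgue. - \<rho> * (G s \<bullet> cl \<Omega> (gradm v)))" by (rule set_integral_mult_right[symmetric])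
    also have "\<dots> = (LINT s:{0<..<t}|lebesgue. f v - \<rho> * V_inner \<Omega> (u s) v)"
      by (rule set_lebesgue_integral_cong) (auto simp: e2)
    finally show "1 / Gamma (1 - \<alpha>) * (LINT s:{0<..<t}|lebesgue. (t - s) powr (-\<alpha>) * ((cl \<Omega> (u s) - cl \<Omega> (u 0)) \<bullet> cl \<Omega> v))
        = (LINT s:{0<..<t}|lebesgue. f v - \<rho> * V_inner \<Omega> (u s) v)" .
  qed
qed

text \<open>The initial condition is stated for pairings with \<open>V\<close>, on which
  \<open>u0\<close> and its projection \<open>u 0\<close> agree; continuity in \<open>H\<close>
  refers to \<open>u 0\<close> at time 0 and follows from continuity in \<open>V\<close>
  afterwards.\<close>

theorem weak_solution_exists:
  assumes \<alpha>: "0 < \<alpha>" "\<alpha> < 1" and T: "0 < T" and \<rho>: "0 < \<rho>" and f: "f \<in> V_dual \<Omega>" and u0: "u0 \<in> L2 \<Omega>"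
  shows "\<exists>u. weak_solution \<Omega> \<alpha> T \<rho> f u0 u \<and> u \<in> C_time T (H_space \<Omega>) (L2_norm \<Omega>)"
proof -
  obtain u K L R where V: "\<And>t. 0 < t \<Longrightarrow> u t \<in> V_space \<Omega>" and H0: "u 0 \<in> H_space \<Omega>"
    and u0P: "\<And>v. v \<in> V_space \<Omega> \<Longrightarrow> L2_inner \<Omega> u0 v = cl \<Omega> (u 0) \<bullet> cl \<Omega> v"
    and c: "continuous_on {0<..} (\<lambda>t. cl \<Omega> (gradm (u t)))"
    and lim: "((\<lambda>t. cl \<Omega> (u t)) \<longlongrightarrow> cl \<Omega> (u 0)) (at_right 0)"
    and K: "\<And>t. 0 < t \<Longrightarrow> (norm (cl \<Omega> (gradm (u t))))\<^sup>2 \<le> K * t powr (-\<alpha>) + L"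
    and R: "\<And>t. 0 < t \<Longrightarrow> norm (cl \<Omega> (u t)) \<le> R"
    and eq: "\<And>t v. 0 < t \<Longrightarrow> v \<in> V_space \<Omega> \<Longrightarrow>
      1 / Gamma (1 - \<alpha>) * (LINT s:{0<..<t}|lebesgue. (t - s) powr (-\<alpha>) * ((cl \<Omega> (u s) - cl \<Omega> (u 0)) \<bullet> cl \<Omega> v))
        = (LINT s:{0<..<t}|lebesgue. f v - \<rho> * V_inner \<Omega> (u s) v)"
    by (rule solution_exists[OF \<alpha> \<rho> f u0]) blast
  obtain m where m: "m \<in> D" "\<And>v. v \<in> V_space \<Omega> \<Longrightarrow> f v = m \<bullet> cl \<Omega> (gradm v)" using V_dual_Riesz[OF f] by blast
  have H: "u t \<in> H_space \<Omega>" if "0 < t" for t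
    using V_space(5,7)[OF V[OF that]] V_orthogonal_gradients[OF V[OF that]] by (intro H_spaceI) auto
  have HL2: "u t \<in> L2 \<Omega>" if "0 \<le> t" for t using H[of t] H0 that by (cases "t = 0") (auto simp: H_space_def)
  have cH: "((\<lambda>s. cl \<Omega> (u s)) \<longlongrightarrow> cl \<Omega> (u t)) (at t within {0<..})" if t: "0 < t" for t
  proof (rule LIM_zero_cancel, rule Lim_null_comparison)
    show "\<forall>\<^sub>F s in at t within {0<..}. norm (cl \<Omega> (u s) - cl \<Omega> (u t)) \<le> C * norm (cl \<Omega> (gradm (u s)) - cl \<Omega> (gradm (u t)))"
      unfolding eventually_at_filter by (rule always_eventually) (use cl_V_diff_le V t in auto)
    have "((\<lambda>s. cl \<Omega> (gradm (u s))) \<longlongrightarrow> cl \<Omega> (gradm (u t))) (at t within {0<..})"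
      using c t by (simp add: continuous_on_def)
    then have "((\<lambda>s. C * norm (cl \<Omega> (gradm (u s)) - cl \<Omega> (gradm (u t)))) \<longlongrightarrow> C * norm (cl \<Omega> (gradm (u t)) - cl \<Omega> (gradm (u t)))) (at t within {0<..})"
      by (intro tendsto_intros)
    then show "((\<lambda>s. C * norm (cl \<Omega> (gradm (u s)) - cl \<Omega> (gradm (u t)))) \<longlongrightarrow> 0) (at t within {0<..})" by simp
  qed
  have cH': "continuous_on {0<..} (\<lambda>t. cl \<Omega> (u t))" using cH by (simp add: continuous_on_def)
  have "u \<in> C_time T (H_space \<Omega>) (L2_norm \<Omega>)"
    unfolding C_time_def
  proof (intro CollectI ballI conjI)
    fix t assume t: "t \<in> {0..T}"
    show "u t \<in> H_space \<Omega>" using H H0 t by (cases "t = 0") auto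
    have "((\<lambda>s. cl \<Omega> (u s)) \<longlongrightarrow> cl \<Omega> (u t)) (at t within {0..T})"
    proof (cases "t = 0")
      case True
      show ?thesis unfolding True by (rule tendsto_within_subset[OF lim[folded at_within_Ici_at_right]]) auto
    next
      case False
      then have "0 < t" using t by simp
      have "at t within {0<..} = at t" using \<open>0 < t\<close> by (intro at_within_open) auto
      with cH[OF \<open>0 < t\<close>] have "((\<lambda>s. cl \<Omega> (u s)) \<longlongrightarrow> cl \<Omega> (u t)) (at t)" by (simp only:)
      then show ?thesis by (rule tendsto_within_subset) simp
    qed
    then have "((\<lambda>s. norm (cl \<Omega> (u s) - cl \<Omega> (u t))) \<longlongrightarrow> 0) (at t within {0..T})" by (intro tendsto_norm_zero LIM_zero)
    then show "((\<lambda>s. L2_norm \<Omega> (u s - u t)) \<longlongrightarrow> 0) (at t within {0..T})"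
    proof (rule Lim_transform_eventually)
      show "\<forall>\<^sub>F s in at t within {0..T}. norm (cl \<Omega> (u s) - cl \<Omega> (u t)) = L2_norm \<Omega> (u s - u t)"
        unfolding eventually_at_filter
      proof (rule always_eventually, intro allI impI)
        fix s assume "s \<in> {0..T}"
        then show "norm (cl \<Omega> (u s) - cl \<Omega> (u t)) = L2_norm \<Omega> (u s - u t)"
          using t HL2[of s] HL2[of t] by (simp add: fun_diff_def L2_diff cl_diff flip: cl_norm)
      qed
    qed
  qed
  have uL: "u \<in> L2_time T (V_space \<Omega>) (V_norm \<Omega>)"
    by (rule L2_time_continuous[OF \<alpha> T V _ _ c K]) (auto simp: V_norm_diff V_norm_cl V)
  define F where "F t v = f v - \<rho> * V_inner \<Omega> (u t) v" for t v
  \<comment> \<open>The Riesz representer of the candidate \<open>F t\<close> for the Caputo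
    derivative in the dual; it is continuous in positive time and inherits the growth of
    \<open>u\<close> at 0.\<close>
  define r where "r t = m - \<rho> *\<^sub>R cl \<Omega> (gradm (u t))" for t
  have r: "r t \<in> D" "v \<in> V_space \<Omega> \<Longrightarrow> F t v = r t \<bullet> cl \<Omega> (gradm v)" if "0 < t" for t v
    using m(1) gradm_in_D[OF V[OF that]] M(1) that
    by (auto simp: r_def F_def m(2) V_inner_cl V inner_diff_left intro!: subspace_diff subspace_scale)
  have rc: "continuous_on {0<..} r" unfolding r_def[abs_def] by (intro continuous_intros c)
  have sq: "(norm (a - b))\<^sup>2 \<le> 2 * (norm b)\<^sup>2 + 2 * (norm a)\<^sup>2" for a b :: "(real ^ 2 ^ 2) lsq"
    using zero_le_power2[of "norm a - norm b"] power_mono[OF norm_triangle_ineq4[of a b] norm_ge_zero, of 2]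
    by (simp add: power2_sum power2_diff)
  have rbd: "(norm (r t))\<^sup>2 \<le> (2 * \<rho>\<^sup>2 * K) * t powr (-\<alpha>) + (2 * \<rho>\<^sup>2 * L + 2 * (norm m)\<^sup>2)" if "0 < t" for t
  proof -
    have "(norm (r t))\<^sup>2 \<le> 2 * (\<rho>\<^sup>2 * (norm (cl \<Omega> (gradm (u t))))\<^sup>2) + 2 * (norm m)\<^sup>2"
      unfolding r_def using sq[of m "\<rho> *\<^sub>R cl \<Omega> (gradm (u t))"] by (simp add: power_mult_distrib)
    also have "\<dots> \<le> 2 * (\<rho>\<^sup>2 * (K * t powr (-\<alpha>) + L)) + 2 * (norm m)\<^sup>2"
      by (intro add_right_mono mult_left_mono K that) auto
    finally show ?thesis by (simp add: algebra_simps)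
  qed
  have FL: "F \<in> L2_time T (V_dual \<Omega>) (V_dual_norm \<Omega>)"
  proof (rule L2_time_continuous[OF \<alpha> T _ _ _ rc])
    show "F t \<in> V_dual \<Omega>" "V_dual_norm \<Omega> (F t) = norm (r t)" if "0 < t" for t
      using r[OF that] by (auto intro!: V_dualI[of _ "r t"] V_dual_norm_eq)
    show "V_dual_norm \<Omega> (F s - F t) = norm (r s - r t)" if "0 < s" "0 < t" for s t
      using r[OF that(1)] r[OF that(2)] M(1)
      by (intro V_dual_norm_eq) (auto simp: inner_diff_left intro!: subspace_diff)
  qed (rule rbd)
  have iv: "((\<lambda>t. norm (cl \<Omega> (u t) - cl \<Omega> (u 0))) \<longlongrightarrow> 0) (at_right 0)" using lim by (intro tendsto_norm_zero LIM_zero)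
  have yle: "\<bar>L2_inner \<Omega> (u t) v - L2_inner \<Omega> u0 v\<bar> \<le> norm (cl \<Omega> (u t) - cl \<Omega> (u 0)) * norm (cl \<Omega> v)"
    and y: "L2_inner \<Omega> (u t) v - L2_inner \<Omega> u0 v = (cl \<Omega> (u t) - cl \<Omega> (u 0)) \<bullet> cl \<Omega> v"
    if "0 < t" "v \<in> V_space \<Omega>" for t v
  proof -
    show y: "L2_inner \<Omega> (u t) v - L2_inner \<Omega> u0 v = (cl \<Omega> (u t) - cl \<Omega> (u 0)) \<bullet> cl \<Omega> v"
      using that by (simp add: u0P inner_diff_left L2_inner_cl V_space(5) V)
    show "\<bar>L2_inner \<Omega> (u t) v - L2_inner \<Omega> u0 v\<bar> \<le> norm (cl \<Omega> (u t) - cl \<Omega> (u 0)) * norm (cl \<Omega> v)"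
      unfolding y by (rule Cauchy_Schwarz_ineq2)
  qed
  \<comment> \<open>The distance of pairings in the dual norm is at most the
    \<open>L\<^sup>2\<close> distance of \<open>u t\<close> to \<open>u 0\<close> times the Poincare
    constant.\<close>
  have init: "has_initial_value T (V_dual_norm \<Omega>) (\<lambda>t. L2_inner \<Omega> (u t)) (L2_inner \<Omega> u0)"
    unfolding has_initial_value_def
  proof (intro exI conjI)
    show "AE t in lebesgue_on {0<..<T}. L2_inner \<Omega> (u t) = L2_inner \<Omega> (u t)" by simp
    have le: "\<bar>(L2_inner \<Omega> (u t) - L2_inner \<Omega> u0) v\<bar> \<le> (norm (cl \<Omega> (u t) - cl \<Omega> (u 0)) * C) * V_norm \<Omega> v"
      if "0 < t" "v \<in> V_space \<Omega>" for t v
      using order_trans[OF yle[OF that] mult_left_mono[OF Poincare_C[OF that(2)] norm_ge_zero]] that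
      by (simp add: V_norm_cl mult_ac)
    have nn: "0 \<le> norm (cl \<Omega> (u t) - cl \<Omega> (u 0)) * C" for t using C_pos by simp
    have "((\<lambda>t. norm (cl \<Omega> (u t) - cl \<Omega> (u 0)) * C) \<longlongrightarrow> 0) (at_right 0)" by (rule tendsto_mult_left_zero[OF iv])
    then show "((\<lambda>t. V_dual_norm \<Omega> (L2_inner \<Omega> (u t) - L2_inner \<Omega> u0)) \<longlongrightarrow> 0) (at_right 0)"
    proof (rule Lim_null_comparison[rotated])
      show "\<forall>\<^sub>F t in at_right 0. norm (V_dual_norm \<Omega> (L2_inner \<Omega> (u t) - L2_inner \<Omega> u0)) \<le> norm (cl \<Omega> (u t) - cl \<Omega> (u 0)) * C"
        using eventually_at_right_less[of 0]
      proof eventually_elim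
        case (elim t)
        have "0 \<le> V_dual_norm \<Omega> (L2_inner \<Omega> (u t) - L2_inner \<Omega> u0)"
          "V_dual_norm \<Omega> (L2_inner \<Omega> (u t) - L2_inner \<Omega> u0) \<le> norm (cl \<Omega> (u t) - cl \<Omega> (u 0)) * C"
          by (rule V_dual_norm_le[OF le[OF elim] nn]; assumption)+
        then show ?case by simp
      qed
    qed
  qed
  have RL: "has_RL_deriv \<alpha> T (\<lambda>t. L2_inner \<Omega> (u t) v - L2_inner \<Omega> u0 v) (\<lambda>t. F t v)" if v: "v \<in> V_space \<Omega>" for v
  proof -
    have Fi: "set_integrable lebesgue {0<..<T} (\<lambda>t. F t v)"
    proof (rule set_integrable_bound)
      let ?g = "cl \<Omega> (gradm v)"
      show "set_integrable lebesgue {0<..<T} (\<lambda>t. norm ?g + norm ?g * ((2 * \<rho>\<^sup>2 * K) * t powr (-\<alpha>) + (2 * \<rho>\<^sup>2 * L + 2 * (norm m)\<^sup>2)))"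
        by (intro set_integral_add set_integrable_mult_right integrable_power_kernel[OF \<alpha> T])
      have "continuous_on {0<..<T} (\<lambda>t. r t \<bullet> ?g)" by (intro continuous_intros continuous_on_subset[OF rc]) auto
      then have "continuous_on {0<..<T} (\<lambda>t. F t v)" by (rule continuous_on_eq) (simp add: r v)
      then show "set_borel_measurable lebesgue {0<..<T} (\<lambda>t. F t v)" by (rule set_borel_measurable_continuous_lebesgue) simp
      have "norm (F t v) \<le> norm ?g + norm ?g * ((2 * \<rho>\<^sup>2 * K) * t powr (-\<alpha>) + (2 * \<rho>\<^sup>2 * L + 2 * (norm m)\<^sup>2))" if t: "0 < t" for t
      proof -
        have "norm (F t v) \<le> norm ?g * norm (r t)" using Cauchy_Schwarz_ineq2[of "r t" ?g] by (simp add: r t v mult.commute)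
        also have "\<dots> \<le> norm ?g * (1 + (norm (r t))\<^sup>2)" by (intro mult_left_mono le_one_plus_square) simp
        also have "\<dots> \<le> norm ?g * (1 + ((2 * \<rho>\<^sup>2 * K) * t powr (-\<alpha>) + (2 * \<rho>\<^sup>2 * L + 2 * (norm m)\<^sup>2)))"
          by (intro mult_left_mono add_left_mono rbd t) simp
        finally show ?thesis by (simp only: distrib_left mult_1_right)
      qed
      then show "AE t in lebesgue. t \<in> {0<..<T} \<longrightarrow> norm (F t v)
          \<le> norm (norm ?g + norm ?g * ((2 * \<rho>\<^sup>2 * K) * t powr (-\<alpha>) + (2 * \<rho>\<^sup>2 * L + 2 * (norm m)\<^sup>2)))"
        by (intro AE_I2) (auto intro: order_trans[OF _ abs_ge_self])
    qed
    have yi: "set_integrable lebesgue {0<..<T} (\<lambda>t. L2_inner \<Omega> (u t) v - L2_inner \<Omega> u0 v)"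
    proof (rule set_integrable_bound[OF integrable_power_kernel(3)[OF \<alpha> T, of "(R + norm (cl \<Omega> (u 0))) * norm (cl \<Omega> v)"]])
      have "continuous_on {0<..<T} (\<lambda>t. (cl \<Omega> (u t) - cl \<Omega> (u 0)) \<bullet> cl \<Omega> v)"
        by (intro continuous_intros continuous_on_subset[OF cH']) auto
      then have "continuous_on {0<..<T} (\<lambda>t. L2_inner \<Omega> (u t) v - L2_inner \<Omega> u0 v)" by (rule continuous_on_eq) (simp add: y v)
      then show "set_borel_measurable lebesgue {0<..<T} (\<lambda>t. L2_inner \<Omega> (u t) v - L2_inner \<Omega> u0 v)"
        by (rule set_borel_measurable_continuous_lebesgue) simp
      have "norm (L2_inner \<Omega> (u t) v - L2_inner \<Omega> u0 v) \<le> (R + norm (cl \<Omega> (u 0))) * norm (cl \<Omega> v)" if t: "0 < t" for t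
      proof -
        have "norm (cl \<Omega> (u t) - cl \<Omega> (u 0)) \<le> R + norm (cl \<Omega> (u 0))"
          using norm_triangle_ineq4[of "cl \<Omega> (u t)" "cl \<Omega> (u 0)"] R[OF t] by linarith
        then show ?thesis using order_trans[OF yle[OF t v] mult_right_mono] by auto
      qed
      then show "AE t in lebesgue. t \<in> {0<..<T} \<longrightarrow> norm (L2_inner \<Omega> (u t) v - L2_inner \<Omega> u0 v)
          \<le> norm ((R + norm (cl \<Omega> (u 0))) * norm (cl \<Omega> v))"
        by (intro AE_I2) (auto intro: order_trans[OF _ abs_ge_self])
    qed
    \<comment> \<open>By the integrated equation the integral of order \<open>1 - \<alpha>\<close>
      is a primitive of \<open>F\<close>, and \<open>indefinite_integral_weak_deriv\<close>
      identifies its weak derivative.\<close>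
    define h where "h t = 1 / Gamma (1 - \<alpha>) * (LINT s:{0<..<t}|lebesgue. (t - s) powr (-\<alpha>) * (L2_inner \<Omega> (u s) v - L2_inner \<Omega> u0 v))" for t
    have h: "h t = (LINT s:{0<..<t}|lebesgue. F s v)" if "0 < t" for t
    proof -
      have "(LINT s:{0<..<t}|lebesgue. (t - s) powr (-\<alpha>) * (L2_inner \<Omega> (u s) v - L2_inner \<Omega> u0 v))
          = (LINT s:{0<..<t}|lebesgue. (t - s) powr (-\<alpha>) * ((cl \<Omega> (u s) - cl \<Omega> (u 0)) \<bullet> cl \<Omega> v))"
        by (rule set_lebesgue_integral_cong) (auto simp: y v)
      then show ?thesis using eq[OF that v] by (simp add: h_def F_def)
    qed
    have "has_weak_deriv T h (\<lambda>t. F t v)"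
      unfolding has_weak_deriv_def
    proof (intro conjI allI impI ballI)
      fix a b :: real assume ab: "0 < a \<and> b < T"
      then have sub: "{a..b} \<subseteq> {0<..<T}" by auto
      have "set_integrable lebesgue {0<..<T} (\<lambda>t. LINT s:{0<..<t}|lebesgue. F s v)" by (rule indefinite_integral_integrable[OF Fi])
      from set_integrable_subinterval[OF this sub]
      have I: "set_integrable lebesgue {a..b} (\<lambda>t. LINT s:{0<..<t}|lebesgue. F s v)" by simp
      have he: "h t = (LINT s:{0<..<t}|lebesgue. F s v)" if "t \<in> {a..b}" for t using h that ab by auto
      show "set_integrable lebesgue {a..b} h" by (rule iffD2[OF set_integrable_cong[OF refl refl he] I])
      show "set_integrable lebesgue {a..b} (\<lambda>t. F t v)" by (rule set_integrable_subinterval[OF Fi sub]) simp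
    next
      fix \<phi> assume \<phi>: "\<phi> \<in> test_functions {0<..<T}"
      have "(LINT t:{0<..<T}|lebesgue. h t * deriv \<phi> t) = (LINT t:{0<..<T}|lebesgue. (LINT s:{0<..<t}|lebesgue. F s v) * deriv \<phi> t)"
        by (rule set_lebesgue_integral_cong) (auto simp: h)
      then show "(LINT t:{0<..<T}|lebesgue. h t * deriv \<phi> t) = - (LINT t:{0<..<T}|lebesgue. F t v * \<phi> t)"
        using indefinite_integral_weak_deriv(2)[OF Fi \<phi> T] by simp
    qed
    then show ?thesis using yi unfolding has_RL_deriv_def h_def[abs_def] by simp
  qed
  have "has_Caputo_deriv \<alpha> T (\<lambda>t. L2_inner \<Omega> (u t) v) (L2_inner \<Omega> u0 v) (\<lambda>t. F t v)" if v: "v \<in> V_space \<Omega>" for v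
    unfolding has_Caputo_deriv_def has_initial_value_def
  proof (intro conjI exI)
    show "AE t in lebesgue_on {0<..<T}. L2_inner \<Omega> (u t) v = L2_inner \<Omega> (u t) v" by simp
    show "((\<lambda>t. \<bar>L2_inner \<Omega> (u t) v - L2_inner \<Omega> u0 v\<bar>) \<longlongrightarrow> 0) (at_right 0)"
    proof (rule Lim_null_comparison)
      show "\<forall>\<^sub>F t in at_right 0. norm \<bar>L2_inner \<Omega> (u t) v - L2_inner \<Omega> u0 v\<bar> \<le> norm (cl \<Omega> (u t) - cl \<Omega> (u 0)) * norm (cl \<Omega> v)"
        using eventually_at_right_less[of 0] by eventually_elim (simp add: yle v)
      show "((\<lambda>t. norm (cl \<Omega> (u t) - cl \<Omega> (u 0)) * norm (cl \<Omega> v)) \<longlongrightarrow> 0) (at_right 0)"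
        by (rule tendsto_mult_left_zero[OF iv])
    qed
  qed (rule RL[OF v])
  moreover have "AE t in lebesgue_on {0<..<T}. F t v + \<rho> * V_inner \<Omega> (u t) v = f v" for v by (simp add: F_def)
  ultimately have "weak_solution \<Omega> \<alpha> T \<rho> f u0 u"
    unfolding weak_solution_def has_Caputo_deriv_dual_def using uL init FL RL by blast
  then show ?thesis using \<open>u \<in> C_time T (H_space \<Omega>) (L2_norm \<Omega>)\<close> by blast
qed

end

theorem theorem51:
  fixes \<Omega> :: "(real ^ 2) set" and \<alpha> T \<rho> :: real
    and f :: "(real ^ 2 \<Rightarrow> real ^ 2) \<Rightarrow> real" and u0 :: "real ^ 2 \<Rightarrow> real ^ 2"
  assumes "0 < \<alpha>" and "\<alpha> < 1" and "0 < T" and "0 < \<rho>"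
    and "open \<Omega>" and "connected \<Omega>" and "\<Omega> \<noteq> {}" and "bounded \<Omega>"
    and "f \<in> V_dual \<Omega>" and "u0 \<in> H_space \<Omega>"
  shows "\<exists>u. weak_solution \<Omega> \<alpha> T \<rho> f u0 u \<and>
           (\<forall>w. weak_solution \<Omega> \<alpha> T \<rho> f u0 w \<longrightarrow>
              (AE t in lebesgue_on {0<..<T}. AE x in lebesgue_on \<Omega>. w t x = u t x)) \<and>
           u \<in> C_time T (H_space \<Omega>) (L2_norm \<Omega>)"
proof -
  interpret planar_domain \<Omega> by unfold_locales (fact assms)+
  obtain C where C: "0 < C" "\<And>v. v \<in> V_space \<Omega> \<Longrightarrow> norm (cl \<Omega> v) \<le> C * norm (cl \<Omega> (gradm v))"
    using Poincare by blast
  interpret poincare_domain \<Omega> C by unfold_locales (fact C)+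
  have "u0 \<in> L2 \<Omega>" using assms(10) by (simp add: H_space_def)
  then obtain u where u: "weak_solution \<Omega> \<alpha> T \<rho> f u0 u" "u \<in> C_time T (H_space \<Omega>) (L2_norm \<Omega>)"
    using weak_solution_exists[OF assms(1-4,9)] by blast
  then show ?thesis using weak_solution_unique[OF assms(1-4) u(1)] by blast
qed

end
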